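(* For nonnegative integers $r,s$, the walled Brauer-Clifford superalgebra $\mathsf{BC}_{r,s}$ is isomorphic to the $(r,s)$-bead diagram algebra $\mathsf{BD}_{r,s}$ as associative superalgebras.
   Context: The base field is $\mathbb C$. $\mathsf{BC}_{r,s}$ is the associative superalgebra generated by even elements $s_1,\dots,s_{r-1},s_{r+1},\dots,s_{r+s-1},e_{r,r+1}$ and odd elements $c_1,\dots,c_{r+s}$ with relations (for indices in the allowable range; generators and relations with out-of-range indices are omitted, and $e_{r,r+1}$ is present only if $r,s\ge1$): $s_i^2=1$, $s_is_{i+1}s_i=s_{i+1}s_is_{i+1}$, $s_is_j=s_js_i$ ($|i-j|>1$); $e_{r,r+1}^2=0$, $e_{r,r+1}s_j=s_je_{r,r+1}$ ($j\ne r-1,r+1$), $e_{r,r+1}=e_{r,r+1}s_{r-1}e_{r,r+1}=e_{r,r+1}s_{r+1}e_{r,r+1}$; $s_{r-1}s_{r+1}e_{r,r+1}s_{r+1}s_{r-1}e_{r,r+1}=e_{r,r+1}s_{r-1}s_{r+1}e_{r,r+1}s_{r+1}s_{r-1}$; $c_i^2=-1$ ($1\le i\le r$), $c_i^2=1$ ($r+1\le i\le r+s$), $c_ic_j=-c_jc_i$ ($i\neq j$); $s_ic_is_i=c_{i+1}$, $s_ic_j=c_js_i$ ($j\ne i,i+1$); $c_re_{r,r+1}=c_{r+1}e_{r,r+1}$, $e_{r,r+1}c_r=e_{r,r+1}c_{r+1}$, $e_{r,r+1}c_re_{r,r+1}=0$, $e_{r,r+1}c_j=c_je_{r,r+1}$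 ($j\ne r,r+1$). An $(r,s)$-bead diagram is a graph with a top row and a bottom row of $r+s$ vertices each (labeled $1,\dots,r+s$ from left to right), a vertical wall separating the first $r$ vertices from the last $s$ in each row, such that: each vertex is connected by a strand to exactly one other vertex; a strand joining the top row with the bottom row (vertical) does not cross the wall; a strand joining two vertices in the same row (horizontal) must cross the wall; each strand may carry finitely many numbered beads, the bead numbers on the whole diagram being exactly $1,2,\dots,m$ for some $m\ge0$, each used once; there are no loops. Beads may slide along their strand but may not jump to another strand or change their order along a strand; diagrams differing only by sliding are the same. Thus a bead diagram is determined by its connections together with, for each strand, the sequence of bead numbers along it. A bead diagram is even (odd) if it has an even (odd) number of beads. $\widetilde{\mathsf{BD}}_{r,s}$ is the superspace with basis the $(r,s)$-bead diagrams. The product $d_1d_2$ of bead diagrams is obtained by placing $d_1$ under $d_2$ and identifying the top vertices of $d_1$ with the bottom vertices of $d_2$; if a loop occurs in the middle, $d_1d_2=0$; otherwise, if $m$ is the largest bead number of $d_1$ (with $m=0$ if $d_1$ has no beads), each bead number $i$ of $d_2$ is changed to $m+i$ and the diagrams are concatenated. This is an associative unital superalgebra. $\mathsf{BD}'_{r,s}$ is its subalgebra generated by the following diagrams: $\mathbf s_i$ ($1\le i\le r-1$ or $r+1\le i\le r+s-1$), without beads, joining top $i$ to bottom $i+1$, top $i+1$ to bottom $i$, and top $k$ to bottom $k$ for all other $k$; $\mathbf e_{r,r+1}$, without beads, joining top $r$ with top $r+1$, bottom $r$ with bottom $r+1$, and top $k$ to bottom $k$ for all other $k$; $\mathbf c_k$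 ($1\le k\le r+s$), all strands joining top $i$ to bottom $i$, with a single bead, numbered $1$, on the $k$th strand. $\mathsf{BD}_{r,s}=\mathsf{BD}'_{r,s}/\mathsf L$, where $\mathsf L$ is the two-sided ideal generated by $\mathbf c_k^2+1$ ($1\le k\le r$), $\mathbf c_l^2-1$ ($r+1\le l\le r+s$), and $\mathbf c_i\mathbf c_j+\mathbf c_j\mathbf c_i$ ($1\le i\ne j\le r+s$). *)

theory Defs
  imports "HOL-Algebra.Algebra" "HOL-Algebra.Algebraic_Closure_Type" Complex_Main
begin

section \<open>Complex associative superalgebras\<close>

abbreviation complex_ring :: "complex ring"
  where "complex_ring \<equiv> ring_of_type_algebra"

record 'a superalgebra = "(complex, 'a) module" +
  even_part :: "'a set"
  odd_part :: "'a set"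

locale superalgebra = module complex_ring A + ring A for A :: "'a superalgebra" (structure) +
  assumes smult_mult_left:
      "\<lbrakk>x \<in> carrier A; y \<in> carrier A\<rbrakk> \<Longrightarrow> (a \<odot> x) \<otimes> y = a \<odot> (x \<otimes> y)"
    and smult_mult_right:
      "\<lbrakk>x \<in> carrier A; y \<in> carrier A\<rbrakk> \<Longrightarrow> x \<otimes> (a \<odot> y) = a \<odot> (x \<otimes> y)"
    and even_submodule: "submodule (even_part A) complex_ring A"
    and odd_submodule: "submodule (odd_part A) complex_ring A"
    and direct_sum:
      "x \<in> carrier A \<Longrightarrow> \<exists>!p. p \<in> even_part A \<times> odd_part A \<and> x = fst p \<oplus> snd p"
    and even_even: "\<lbrakk>x \<in> even_part A; y \<in> even_part A\<rbrakk> \<Longrightarrow> x \<otimes> y \<in> even_part A"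
    and even_odd: "\<lbrakk>x \<in> even_part A; y \<in> odd_part A\<rbrakk> \<Longrightarrow> x \<otimes> y \<in> odd_part A"
    and odd_even: "\<lbrakk>x \<in> odd_part A; y \<in> even_part A\<rbrakk> \<Longrightarrow> x \<otimes> y \<in> odd_part A"
    and odd_odd: "\<lbrakk>x \<in> odd_part A; y \<in> odd_part A\<rbrakk> \<Longrightarrow> x \<otimes> y \<in> even_part A"

definition superalgebra_iso :: "'a superalgebra \<Rightarrow> 'b superalgebra \<Rightarrow> ('a \<Rightarrow> 'b) set" where
  "superalgebra_iso A B =
     {h \<in> ring_iso A B.
        (\<forall>a. \<forall>x \<in> carrier A. h (a \<odot>\<^bsub>A\<^esub> x) = a \<odot>\<^bsub>B\<^esub> h x) \<and>
        h ` even_part A = even_part B \<and> h ` odd_part A = odd_part B}"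

definition superalgebra_isomorphic :: "'a superalgebra \<Rightarrow> 'b superalgebra \<Rightarrow> bool" where
  "superalgebra_isomorphic A B \<longleftrightarrow>
     superalgebra A \<and> superalgebra B \<and> (\<exists>h. h \<in> superalgebra_iso A B)"

text \<open>The unital subalgebra generated by \<open>S\<close>.\<close>

inductive_set subalgebra_generated :: "'a superalgebra \<Rightarrow> 'a set \<Rightarrow> 'a set"
  for A (structure) and S where
  incl: "x \<in> S \<Longrightarrow> x \<in> subalgebra_generated A S"
| zero: "\<zero> \<in> subalgebra_generated A S"
| one: "\<one> \<in> subalgebra_generated A S"
| add: "\<lbrakk>x \<in> subalgebra_generated A S; y \<in> subalgebra_generated A S\<rbrakk>
    \<Longrightarrow> x \<oplus> y \<in> subalgebra_generated A S"
| mult: "\<lbrakk>x \<in> subalgebra_generated A S; y \<in> subalgebra_generated A S\<rbrakk>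
    \<Longrightarrow> x \<otimes> y \<in> subalgebra_generated A S"
| smult: "x \<in> subalgebra_generated A S \<Longrightarrow> a \<odot> x \<in> subalgebra_generated A S"

definition restrict_superalgebra :: "'a superalgebra \<Rightarrow> 'a set \<Rightarrow> 'a superalgebra" where
  "restrict_superalgebra A H =
     A\<lparr>carrier := H, even_part := even_part A \<inter> H, odd_part := odd_part A \<inter> H\<rparr>"

text \<open>Quotient by a two-sided ideal \<open>I\<close>: the quotient ring \<^const>\<open>FactRing\<close> with the induced
  scalar multiplication and grading. Ideals of a unital algebra are closed under scalars, so
  ring ideals are the algebra ideals.\<close>

definition quotient_superalgebra :: "'a superalgebra \<Rightarrow> 'a set \<Rightarrow> 'a set superalgebra" where
  "quotient_superalgebra A I =
     \<lparr>carrier = carrier (A Quot I), monoid.mult = monoid.mult (A Quot I),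
      one = one (A Quot I), ring.zero = ring.zero (A Quot I), add = add (A Quot I),
      module.smult = (\<lambda>a Q. \<Union>x\<in>Q. I +>\<^bsub>A\<^esub> (a \<odot>\<^bsub>A\<^esub> x)),
      even_part = ((+>\<^bsub>A\<^esub>) I) ` even_part A,
      odd_part = ((+>\<^bsub>A\<^esub>) I) ` odd_part A\<rparr>"

text \<open>The superspace with homogeneous basis \<open>B\<close> (finitely supported functions on \<open>B\<close>), with the
  bilinear product extending the partial product \<open>p\<close> of basis elements, where \<open>None\<close> means that
  the product is zero; \<open>u\<close> is the unit, and \<open>par\<close> modulo 2 is the parity of a basis element.\<close>

definition basis_vec :: "'b \<Rightarrow> 'b \<Rightarrow> complex" where
  "basis_vec x = (\<lambda>y. if y = x then 1 else 0)"

definition basis_superalgebra ::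
  "'b set \<Rightarrow> ('b \<Rightarrow> 'b \<Rightarrow> 'b option) \<Rightarrow> 'b \<Rightarrow> ('b \<Rightarrow> nat) \<Rightarrow> ('b \<Rightarrow> complex) superalgebra" where
  "basis_superalgebra B p u par =
     \<lparr>carrier = {f. finite {x. f x \<noteq> 0} \<and> {x. f x \<noteq> 0} \<subseteq> B},
      monoid.mult = (\<lambda>f g z.
        \<Sum>(x, y) \<in> {(x, y). f x \<noteq> 0 \<and> g y \<noteq> 0 \<and> p x y = Some z}. f x * g y),
      one = basis_vec u,
      ring.zero = (\<lambda>_. 0),
      add = (\<lambda>f g x. f x + g x),
      module.smult = (\<lambda>a f x. a * f x),
      even_part = {f. finite {x. f x \<noteq> 0} \<and> {x. f x \<noteq> 0} \<subseteq> {x \<in> B. even (par x)}},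
      odd_part = {f. finite {x. f x \<noteq> 0} \<and> {x. f x \<noteq> 0} \<subseteq> {x \<in> B. odd (par x)}}\<rparr>"

section \<open>The walled Brauer-Clifford superalgebra\<close>

datatype generator = S nat | E | is_C: C nat

definition s_indices :: "nat \<Rightarrow> nat \<Rightarrow> nat set" where
  "s_indices r s = {1..<r} \<union> {r + 1..<r + s}"

definition generators :: "nat \<Rightarrow> nat \<Rightarrow> generator set" where
  "generators r s =
     S ` s_indices r s \<union> (if r \<ge> 1 \<and> s \<ge> 1 then {E} else {}) \<union> C ` {1..r + s}"

definition free_superalgebra :: "nat \<Rightarrow> nat \<Rightarrow> (generator list \<Rightarrow> complex) superalgebra" where
  "free_superalgebra r s =
     basis_superalgebra (lists (generators r s)) (\<lambda>v w. Some (v @ w)) []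
       (\<lambda>w. length (filter is_C w))"

text \<open>A pair \<open>(x, y)\<close> stands for the relation \<open>x = y\<close>. The generator \<open>E\<close> is
  \<open>e\<close> with subscripts \<open>r\<close> and \<open>r + 1\<close>.\<close>

inductive_set BC_relations ::
  "nat \<Rightarrow> nat \<Rightarrow> ((generator list \<Rightarrow> complex) \<times> (generator list \<Rightarrow> complex)) set"
  for r s where
  s_square: "i \<in> s_indices r s \<Longrightarrow>
    (basis_vec [S i, S i], basis_vec []) \<in> BC_relations r s"
| s_braid: "\<lbrakk>i \<in> s_indices r s; i + 1 \<in> s_indices r s\<rbrakk> \<Longrightarrow>
    (basis_vec [S i, S (i + 1), S i], basis_vec [S (i + 1), S i, S (i + 1)]) \<in> BC_relations r s"
| s_commute: "\<lbrakk>i \<in> s_indices r s; j \<in> s_indices r s; \<bar>int i - int j\<bar> > 1\<rbrakk> \<Longrightarrow>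
    (basis_vec [S i, S j], basis_vec [S j, S i]) \<in> BC_relations r s"
| e_square: "\<lbrakk>r \<ge> 1; s \<ge> 1\<rbrakk> \<Longrightarrow>
    (basis_vec [E, E], (\<lambda>_. 0)) \<in> BC_relations r s"
| e_s_commute: "\<lbrakk>r \<ge> 1; s \<ge> 1; j \<in> s_indices r s; j \<noteq> r - 1; j \<noteq> r + 1\<rbrakk> \<Longrightarrow>
    (basis_vec [E, S j], basis_vec [S j, E]) \<in> BC_relations r s"
| e_s_e_left: "\<lbrakk>r \<ge> 2; s \<ge> 1\<rbrakk> \<Longrightarrow>
    (basis_vec [E], basis_vec [E, S (r - 1), E]) \<in> BC_relations r s"
| e_s_e_right: "\<lbrakk>r \<ge> 1; s \<ge> 2\<rbrakk> \<Longrightarrow>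
    (basis_vec [E], basis_vec [E, S (r + 1), E]) \<in> BC_relations r s"
| s_s_e: "\<lbrakk>r \<ge> 2; s \<ge> 2\<rbrakk> \<Longrightarrow>
    (basis_vec [S (r - 1), S (r + 1), E, S (r + 1), S (r - 1), E],
     basis_vec [E, S (r - 1), S (r + 1), E, S (r + 1), S (r - 1)]) \<in> BC_relations r s"
| c_square_left: "i \<in> {1..r} \<Longrightarrow>
    (basis_vec [C i, C i], (\<lambda>w. - basis_vec [] w)) \<in> BC_relations r s"
| c_square_right: "i \<in> {r + 1..r + s} \<Longrightarrow>
    (basis_vec [C i, C i], basis_vec []) \<in> BC_relations r s"
| c_anticommute: "\<lbrakk>i \<in> {1..r + s}; j \<in> {1..r + s}; i \<noteq> j\<rbrakk> \<Longrightarrow>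
    (basis_vec [C i, C j], (\<lambda>w. - basis_vec [C j, C i] w)) \<in> BC_relations r s"
| s_c_s: "i \<in> s_indices r s \<Longrightarrow>
    (basis_vec [S i, C i, S i], basis_vec [C (i + 1)]) \<in> BC_relations r s"
| s_c_commute: "\<lbrakk>i \<in> s_indices r s; j \<in> {1..r + s}; j \<noteq> i; j \<noteq> i + 1\<rbrakk> \<Longrightarrow>
    (basis_vec [S i, C j], basis_vec [C j, S i]) \<in> BC_relations r s"
| c_e: "\<lbrakk>r \<ge> 1; s \<ge> 1\<rbrakk> \<Longrightarrow>
    (basis_vec [C r, E], basis_vec [C (r + 1), E]) \<in> BC_relations r s"
| e_c: "\<lbrakk>r \<ge> 1; s \<ge> 1\<rbrakk> \<Longrightarrow>
    (basis_vec [E, C r], basis_vec [E, C (r + 1)]) \<in> BC_relations r s"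
| e_c_e: "\<lbrakk>r \<ge> 1; s \<ge> 1\<rbrakk> \<Longrightarrow>
    (basis_vec [E, C r, E], (\<lambda>_. 0)) \<in> BC_relations r s"
| e_c_commute: "\<lbrakk>r \<ge> 1; s \<ge> 1; j \<in> {1..r + s}; j \<noteq> r; j \<noteq> r + 1\<rbrakk> \<Longrightarrow>
    (basis_vec [E, C j], basis_vec [C j, E]) \<in> BC_relations r s"

definition BC :: "nat \<Rightarrow> nat \<Rightarrow> (generator list \<Rightarrow> complex) set superalgebra" where
  "BC r s =
     (let F = free_superalgebra r s in
      quotient_superalgebra F (Idl\<^bsub>F\<^esub> {x \<ominus>\<^bsub>F\<^esub> y | x y. (x, y) \<in> BC_relations r s}))"

section \<open>Bead diagrams\<close>

datatype vertex = is_Top: Top (label: nat) | Bot (label: nat)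

definition vertices :: "nat \<Rightarrow> vertex set" where
  "vertices n = Top ` {1..n} \<union> Bot ` {1..n}"

text \<open>A diagram is the set of its oriented strands: \<open>(v, ns, w)\<close> is a strand from \<open>v\<close> to \<open>w\<close> on
  which one meets the beads \<open>ns\<close> in this order when walking from \<open>v\<close> to \<open>w\<close>. Every strand occurs
  with both orientations.\<close>

type_synonym diagram = "(vertex \<times> nat list \<times> vertex) set"

definition bead_numbers :: "diagram \<Rightarrow> nat set" where
  "bead_numbers d = (\<Union>(v, ns, w) \<in> d. set ns)"

definition bead_diagrams :: "nat \<Rightarrow> nat \<Rightarrow> diagram set" where
  "bead_diagrams r s =
     {d. d \<subseteq> vertices (r + s) \<times> UNIV \<times> vertices (r + s) \<and>
         (\<forall>v \<in> vertices (r + s). \<exists>!p. (v, p) \<in> d) \<and>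
         (\<forall>v ns w. (v, ns, w) \<in> d \<longrightarrow>
            v \<noteq> w \<and> (w, rev ns, v) \<in> d \<and> distinct ns \<and>
            (is_Top v \<noteq> is_Top w \<longrightarrow> (label v \<le> r \<longleftrightarrow> label w \<le> r)) \<and>
            (is_Top v = is_Top w \<longrightarrow> (label v \<le> r \<longleftrightarrow> \<not> label w \<le> r))) \<and>
         (\<forall>v ns w v' ns' w'. (v, ns, w) \<in> d \<and> (v', ns', w') \<in> d \<and> set ns \<inter> set ns' \<noteq> {} \<longrightarrow>
            {v, w} = {v', w'}) \<and>
         (\<exists>m. bead_numbers d = {1..m})}"

definition max_bead :: "diagram \<Rightarrow> nat" where
  "max_bead d = Max (insert 0 (bead_numbers d))"

definition shift_beads :: "nat \<Rightarrow> diagram \<Rightarrow> diagram" where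
  "shift_beads m d = (\<lambda>(v, ns, w). (v, map ((+) m) ns, w)) ` d"

text \<open>Walks along strands when \<open>d1\<close> is placed under \<open>d2\<close>. \<open>Inl v\<close> is the vertex \<open>v\<close> of \<open>d1\<close> and
  \<open>Inr v\<close> that of \<open>d2\<close>; \<open>Inl (Top k)\<close> and \<open>Inr (Bot k)\<close> are the two copies of the \<open>k\<close>-th identified
  vertex, and which copy occurs as an endpoint of a walk records whether the strand of the walk at
  that endpoint belongs to \<open>d1\<close> or to \<open>d2\<close>. A walk thus never turns back at an identified
  vertex.\<close>

inductive walk :: "diagram \<Rightarrow> diagram \<Rightarrow> vertex + vertex \<Rightarrow> nat list \<Rightarrow> vertex + vertex \<Rightarrow> bool"
  for d1 d2 where
  lower: "(v, ns, w) \<in> d1 \<Longrightarrow> walk d1 d2 (Inl v) ns (Inl w)"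
| upper: "(v, ns, w) \<in> d2 \<Longrightarrow> walk d1 d2 (Inr v) ns (Inr w)"
| step_up: "\<lbrakk>walk d1 d2 x ns (Inl (Top k)); (Bot k, ms, w) \<in> d2\<rbrakk>
    \<Longrightarrow> walk d1 d2 x (ns @ ms) (Inr w)"
| step_down: "\<lbrakk>walk d1 d2 x ns (Inr (Bot k)); (Top k, ms, w) \<in> d1\<rbrakk>
    \<Longrightarrow> walk d1 d2 x (ns @ ms) (Inl w)"

text \<open>A loop through the \<open>k\<close>-th identified vertex leaves it inside \<open>d1\<close> and returns to it inside
  \<open>d2\<close>.\<close>

definition has_loop :: "diagram \<Rightarrow> diagram \<Rightarrow> bool" where
  "has_loop d1 d2 \<longleftrightarrow> (\<exists>k ns. walk d1 d2 (Inl (Top k)) ns (Inr (Bot k)))"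

fun outer_vertex :: "vertex \<Rightarrow> vertex + vertex" where
  "outer_vertex (Bot k) = Inl (Bot k)"
| "outer_vertex (Top k) = Inr (Top k)"

definition concatenate :: "diagram \<Rightarrow> diagram \<Rightarrow> diagram" where
  "concatenate d1 d2 = {(v, ns, w). walk d1 d2 (outer_vertex v) ns (outer_vertex w)}"

definition diagram_mult :: "diagram \<Rightarrow> diagram \<Rightarrow> diagram option" where
  "diagram_mult d1 d2 =
     (if has_loop d1 d2 then None
      else Some (concatenate d1 (shift_beads (max_bead d1) d2)))"

definition strand :: "vertex \<Rightarrow> nat list \<Rightarrow> vertex \<Rightarrow> diagram" where
  "strand v ns w = {(v, ns, w), (w, rev ns, v)}"

definition id_diagram :: "nat \<Rightarrow> nat \<Rightarrow> diagram" where
  "id_diagram r s = (\<Union>k \<in> {1..r + s}. strand (Top k) [] (Bot k))"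

definition s_diagram :: "nat \<Rightarrow> nat \<Rightarrow> nat \<Rightarrow> diagram" where
  "s_diagram r s i =
     strand (Top i) [] (Bot (i + 1)) \<union> strand (Top (i + 1)) [] (Bot i) \<union>
     (\<Union>k \<in> {1..r + s} - {i, i + 1}. strand (Top k) [] (Bot k))"

definition e_diagram :: "nat \<Rightarrow> nat \<Rightarrow> diagram" where
  "e_diagram r s =
     strand (Top r) [] (Top (r + 1)) \<union> strand (Bot r) [] (Bot (r + 1)) \<union>
     (\<Union>k \<in> {1..r + s} - {r, r + 1}. strand (Top k) [] (Bot k))"

definition c_diagram :: "nat \<Rightarrow> nat \<Rightarrow> nat \<Rightarrow> diagram" where
  "c_diagram r s k =
     strand (Top k) [1] (Bot k) \<union> (\<Union>j \<in> {1..r + s} - {k}. strand (Top j) [] (Bot j))"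

definition BD_tilde :: "nat \<Rightarrow> nat \<Rightarrow> (diagram \<Rightarrow> complex) superalgebra" where
  "BD_tilde r s =
     basis_superalgebra (bead_diagrams r s) diagram_mult (id_diagram r s)
       (\<lambda>d. card (bead_numbers d))"

definition BD_generators :: "nat \<Rightarrow> nat \<Rightarrow> diagram set" where
  "BD_generators r s =
     s_diagram r s ` s_indices r s \<union> (if r \<ge> 1 \<and> s \<ge> 1 then {e_diagram r s} else {}) \<union>
     c_diagram r s ` {1..r + s}"

definition BD' :: "nat \<Rightarrow> nat \<Rightarrow> (diagram \<Rightarrow> complex) superalgebra" where
  "BD' r s =
     restrict_superalgebra (BD_tilde r s)
       (subalgebra_generated (BD_tilde r s) (basis_vec ` BD_generators r s))"

definition BD_ideal :: "nat \<Rightarrow> nat \<Rightarrow> (diagram \<Rightarrow> complex) set" where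
  "BD_ideal r s =
     (let A = BD' r s; c = (\<lambda>k. basis_vec (c_diagram r s k)) in
      Idl\<^bsub>A\<^esub>
        ({c k \<otimes>\<^bsub>A\<^esub> c k \<oplus>\<^bsub>A\<^esub> \<one>\<^bsub>A\<^esub> | k. k \<in> {1..r}} \<union>
         {c l \<otimes>\<^bsub>A\<^esub> c l \<ominus>\<^bsub>A\<^esub> \<one>\<^bsub>A\<^esub> | l. l \<in> {r + 1..r + s}} \<union>
         {c i \<otimes>\<^bsub>A\<^esub> c j \<oplus>\<^bsub>A\<^esub> c j \<otimes>\<^bsub>A\<^esub> c i | i j.
            i \<in> {1..r + s} \<and> j \<in> {1..r + s} \<and> i \<noteq> j}))"

definition BD :: "nat \<Rightarrow> nat \<Rightarrow> (diagram \<Rightarrow> complex) set superalgebra" where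
  "BD r s = quotient_superalgebra (BD' r s) (BD_ideal r s)"

end

theory Submission
  imports Defs
begin

text \<open>
  Both algebras are quotients of the free superalgebra on words in the generators. Sending a word to
  the product of the diagrams of its letters, or to zero when a loop appears, defines a homomorphism
  \<open>draw\<close> from the free superalgebra onto \<open>BD'\<close>: the subalgebra generated by the generator diagrams
  has the diagrams of words as a basis (\<open>BD'_eq\<close>). The relations of \<open>BC\<close> in which no sign and no
  square of an odd generator occurs hold for diagrams, and \<open>draw\<close> maps the relators of the
  remaining, Clifford, relations exactly to the generators of the ideal \<open>L\<close>. So the two quotients
  agree as soon as the kernel of \<open>draw\<close> lies in the ideal of relations. This amounts to two facts
  about words: words with the same diagram are equal in \<open>BC\<close> (\<open>val_cong\<close>), and a word whose
  multiplication meets a loop is zero in \<open>BC\<close> (\<open>val_zero\<close>).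

  Signs obstruct a direct rewriting argument, because the order in which beads of different strands
  are listed matters. They disappear when every occurrence of an odd generator carries its own
  colour: on \<open>BC\<close> tensored with an exterior algebra with generators \<open>\<xi>\<^sub>b\<close>, the operators \<open>c\<^sub>k \<otimes> \<xi>\<^sub>b\<close>
  with different \<open>k\<close> commute. This gives a representation of a monoid with zero, \<open>bead_monoid\<close>, whose
  relations involve no signs, and the value of a word in \<open>BC\<close> can be recovered from the action of
  its coloured version on the unit (\<open>apply_word\<close>).

  In the bead monoid every word has a normal form: a product of arcs at the bottom, a bead word on
  each strand, and a permutation at the top (\<open>word_form\<close>). The Coxeter presentation of the symmetric
  groups gives the permutation part, and the conjugates of \<open>e\<close> under it are the caps. The diagram,
  regarded as a map that sends a vertex to the other end of its strand together with the beads on the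
  way, determines the normal form up to moving beads along arcs and up to permuting arcs, and both
  changes are absorbed by the arcs (\<open>form_unique\<close>). Here the key identity is that two disjoint caps
  absorb the permutation that exchanges them (\<open>cap_cap_swap\<close>).

  It remains to see that a diagram of a word, built up one letter after the other, is the product of
  diagrams that is defined by walks. For a single letter this is a direct computation
  (\<open>concatenate_generator\<close>); for words it follows from the associativity of gluing
  (\<open>concatenate_assoc\<close>), which holds since eliminating two families of glued vertices one after the
  other amounts to eliminating them together (\<open>path_eliminate\<close>).
\<close>

section \<open>Coxeter presentation of the symmetric groups on both sides of the wall\<close>

abbreviation adj :: "nat \<Rightarrow> nat \<Rightarrow> nat" where
  "adj i \<equiv> Transposition.transpose i (i + 1)"

definition perm_word :: "nat list \<Rightarrow> nat \<Rightarrow> nat" where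
  "perm_word u = foldr (\<lambda>i. (\<circ>) (adj i)) u id"

lemma perm_word_Nil [simp]: "perm_word [] = id"
  and perm_word_Cons [simp]: "perm_word (i # u) = adj i \<circ> perm_word u"
  by (simp_all add: perm_word_def)

lemma perm_word_append [simp]: "perm_word (u @ v) = perm_word u \<circ> perm_word v"
  by (induction u) (auto simp: o_assoc)

lemma perm_word_rev: "perm_word u \<circ> perm_word (rev u) = id" "perm_word (rev u) \<circ> perm_word u = id"
proof (induction u)
  case (Cons i u)
  have "adj i (perm_word u (perm_word (rev u) (adj i x))) = x" for x
    using fun_cong[OF Cons(1), of "adj i x"] by simp
  moreover have "perm_word (rev u) (adj i (adj i (perm_word u x))) = x" for x
    using fun_cong[OF Cons(2), of x] by simp
  ultimately show "perm_word (i # u) \<circ> perm_word (rev (i # u)) = id"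
      "perm_word (rev (i # u)) \<circ> perm_word (i # u) = id"
    by (auto simp: fun_eq_iff)
qed auto

lemma bij_perm_word: "bij (perm_word u)"
  using perm_word_rev[of u] o_bij by blast

lemma perm_word_fixes: "x \<notin> set u \<Longrightarrow> x \<notin> Suc ` set u \<Longrightarrow> perm_word u x = x"
proof (induction u)
  case (Cons i u)
  then have "x \<noteq> i" "x \<noteq> i + 1" by auto
  then show ?case using Cons by (simp add: Transposition.transpose_def)
qed simp

text \<open>The descending word \<open>s\<^bsub>m-1\<^esub> \<dots> s\<^bsub>k\<^esub>\<close> is the minimal representative of the coset of permutations
  that send \<open>k\<close> to \<open>m\<close>.\<close>

lemma perm_word_descending:
  "k \<le> m \<Longrightarrow> perm_word (rev [k..<m]) x = (if x = k then m else if k < x \<and> x \<le> m then x - 1 else x)"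
proof (induction m arbitrary: x)
  case (Suc m)
  show ?case
  proof (cases "k \<le> m")
    case True
    then show ?thesis using Suc.IH[OF True, of x]
      by (auto simp: Transposition.transpose_def)
  next
    case False
    then show ?thesis using Suc.prems by (auto simp: le_Suc_eq)
  qed
qed auto

text \<open>The relations of the generators without signs. The element \<open>gm k b\<close> is a bead of colour \<open>b\<close> on the
  strand \<open>k\<close>. Beads on different strands commute, and nothing is said about beads on the same strand:
  their order is part of a diagram. The last assumption says that a closed loop is zero whatever
  beads it carries.\<close>

locale bead_monoid =
  fixes r s :: nat
    and sg :: "nat \<Rightarrow> 'm :: {monoid_mult, mult_zero}"
    and ee :: 'm
    and gm :: "nat \<Rightarrow> nat \<Rightarrow> 'm"
  assumes sg_square: "i \<in> s_indices r s \<Longrightarrow> sg i * sg i = 1"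
    and sg_braid: "i \<in> s_indices r s \<Longrightarrow> i + 1 \<in> s_indices r s \<Longrightarrow>
          sg i * sg (i + 1) * sg i = sg (i + 1) * sg i * sg (i + 1)"
    and sg_commute: "i \<in> s_indices r s \<Longrightarrow> j \<in> s_indices r s \<Longrightarrow> i + 1 < j \<Longrightarrow>
          sg i * sg j = sg j * sg i"
    and ee_sg: "1 \<le> r \<Longrightarrow> 1 \<le> s \<Longrightarrow> j \<in> s_indices r s \<Longrightarrow> j \<noteq> r - 1 \<Longrightarrow> j \<noteq> r + 1 \<Longrightarrow>
          ee * sg j = sg j * ee"
    and ee_sg_ee_left: "2 \<le> r \<Longrightarrow> 1 \<le> s \<Longrightarrow> ee * sg (r - 1) * ee = ee"
    and ee_sg_ee_right: "1 \<le> r \<Longrightarrow> 2 \<le> s \<Longrightarrow> ee * sg (r + 1) * ee = ee"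
    and sg_sg_ee: "2 \<le> r \<Longrightarrow> 2 \<le> s \<Longrightarrow>
          sg (r - 1) * sg (r + 1) * ee * sg (r + 1) * sg (r - 1) * ee =
          ee * sg (r - 1) * sg (r + 1) * ee * sg (r + 1) * sg (r - 1)"
    and gm_commute: "i \<in> {1..r + s} \<Longrightarrow> j \<in> {1..r + s} \<Longrightarrow> i \<noteq> j \<Longrightarrow>
          gm i b * gm j b' = gm j b' * gm i b"
    and sg_gm_sg: "i \<in> s_indices r s \<Longrightarrow> sg i * gm i b * sg i = gm (i + 1) b"
    and sg_gm_commute: "i \<in> s_indices r s \<Longrightarrow> j \<in> {1..r + s} \<Longrightarrow> j \<noteq> i \<Longrightarrow> j \<noteq> i + 1 \<Longrightarrow>
          sg i * gm j b = gm j b * sg i"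
    and gm_ee: "1 \<le> r \<Longrightarrow> 1 \<le> s \<Longrightarrow> gm r b * ee = gm (r + 1) b * ee"
    and ee_gm: "1 \<le> r \<Longrightarrow> 1 \<le> s \<Longrightarrow> ee * gm r b = ee * gm (r + 1) b"
    and ee_gm_commute: "1 \<le> r \<Longrightarrow> 1 \<le> s \<Longrightarrow> j \<in> {1..r + s} \<Longrightarrow> j \<noteq> r \<Longrightarrow> j \<noteq> r + 1 \<Longrightarrow>
          ee * gm j b = gm j b * ee"
    and ee_beads_ee: "1 \<le> r \<Longrightarrow> 1 \<le> s \<Longrightarrow> ee * prod_list (map (gm r) bs) * ee = 0"
begin

definition sgs :: "nat list \<Rightarrow> 'm" where
  "sgs u = prod_list (map sg u)"

lemma sgs_Nil [simp]: "sgs [] = 1"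
  and sgs_Cons [simp]: "sgs (i # u) = sg i * sgs u"
  and sgs_append [simp]: "sgs (u @ v) = sgs u * sgs v"
  by (simp_all add: sgs_def)

lemma sgs_commute_sg:
  assumes "i \<in> s_indices r s" "set u \<subseteq> s_indices r s" "\<forall>j \<in> set u. j + 1 < i \<or> i + 1 < j"
  shows "sgs u * sg i = sg i * sgs u"
  using assms(2,3)
proof (induction u)
  case (Cons j u)
  have "sg j * sg i = sg i * sg j"
    using Cons.prems assms(1) sg_commute[of i j] sg_commute[of j i] by auto
  then show ?case using Cons by simp (metis mult.assoc)
qed simp

text \<open>A letter to the right of a descending word either lengthens it, shortens it, or passes through it
  with its index unchanged or lowered by one (by the braid relation).\<close>

lemma descending_snoc:
  assumes k: "k \<le> m" "{k..<m} \<subseteq> s_indices r s" and i: "i \<in> s_indices r s" "i < m"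
  obtains u' k' where "set u' \<subseteq> {j \<in> s_indices r s. j + 1 < m}" "k' \<le> m"
    "{k'..<m} \<subseteq> s_indices r s"
    "sgs (rev [k..<m] @ [i]) = sgs (u' @ rev [k'..<m])"
    "perm_word (rev [k..<m] @ [i]) = perm_word (u' @ rev [k'..<m])"
proof -
  consider "i + 1 < k" | "i + 1 = k" | "i = k" | "k < i" by linarith
  then show ?thesis
  proof cases
    case 1
    have "sgs (rev [k..<m] @ [i]) = sgs ([i] @ rev [k..<m])"
      using sgs_commute_sg[of i "rev [k..<m]"] i k 1 by fastforce
    moreover have "perm_word (rev [k..<m] @ [i]) = perm_word ([i] @ rev [k..<m])"
      using 1 k by (auto simp: fun_eq_iff perm_word_descending Transposition.transpose_def)
    ultimately show ?thesis using 1 k i by (intro that[of "[i]" k]) auto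
  next
    case 2
    then have e: "rev [k..<m] @ [i] = rev [i..<m]" using k by (simp add: upt_conv_Cons)
    have "{i..<m} \<subseteq> s_indices r s" using 2 i k by (auto simp: subset_iff) (metis Suc_leI le_neq_implies_less Suc_eq_plus1)
    then show ?thesis using 2 e i by (intro that[of "[]" i]) auto
  next
    case 3
    then have e: "rev [k..<m] = rev [k+1..<m] @ [i]" using i by (simp add: upt_conv_Cons)
    have "sgs (rev [k..<m] @ [i]) = sgs (rev [k+1..<m])"
      unfolding e using sg_square[OF i(1)] by (simp add: mult.assoc)
    moreover have "perm_word (rev [k..<m] @ [i]) = perm_word (rev [k+1..<m])"
      unfolding e by (auto simp: fun_eq_iff)
    ultimately show ?thesis using 3 k i by (intro that[of "[]" "k+1"]) auto
  next
    case 4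
    then obtain j where j: "i = j + 1" "k \<le> j" by (metis Suc_eq_plus1 less_iff_Suc_add le_add1 add_Suc_right)
    have "[k..<m] = [k..<j] @ [j..<m]" using j i upt_add_eq_append[of k j "m - j"] by auto
    also have "[j..<m] = j # (j+1) # [j+2..<m]" using j i by (simp add: upt_conv_Cons)
    finally have e: "rev [k..<m] = rev [j+2..<m] @ [j+1,j] @ rev [k..<j]" by simp
    have jJ: "j \<in> s_indices r s" "j + 1 \<in> s_indices r s" using j k i by auto
    have c1: "sgs (rev [k..<j]) * sg (j + 1) = sg (j+1) * sgs (rev [k..<j])"
      by (rule sgs_commute_sg) (use jJ k i j in auto)
    have c2: "sgs (rev [j+2..<m]) * sg j = sg j * sgs (rev [j+2..<m])"
      by (rule sgs_commute_sg) (use jJ k i j in auto)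
    have "sgs (rev [k..<m] @ [i]) = sgs (rev [j+2..<m]) * (sg (j+1) * sg j * (sgs (rev [k..<j]) * sg (j + 1)))"
      unfolding e by (simp add: j mult.assoc)
    also have "\<dots> = sgs (rev [j+2..<m]) * (sg (j+1) * sg j * sg (j + 1)) * sgs (rev [k..<j])"
      unfolding c1 by (simp add: mult.assoc)
    also have "\<dots> = (sgs (rev [j+2..<m]) * sg j) * sg (j+1) * sg j * sgs (rev [k..<j])"
      unfolding sg_braid[OF jJ, symmetric] by (simp add: mult.assoc)
    also have "\<dots> = sgs ([j] @ rev [k..<m])" unfolding c2 e by (simp add: mult.assoc)
    finally have "sgs (rev [k..<m] @ [i]) = sgs ([j] @ rev [k..<m])" .
    moreover have "perm_word (rev [k..<m] @ [i]) = perm_word ([j] @ rev [k..<m])"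
      using 4 j k i by (auto simp: fun_eq_iff perm_word_descending Transposition.transpose_def)
    ultimately show ?thesis using 4 j k i jJ by (intro that[of "[j]" k]) auto
  qed
qed

lemma word_decomposition:
  assumes "set u \<subseteq> {j \<in> s_indices r s. j < m}"
  shows "\<exists>u' k. set u' \<subseteq> {j \<in> s_indices r s. j + 1 < m} \<and> k \<le> m \<and> {k..<m} \<subseteq> s_indices r s \<and>
    sgs u = sgs (u' @ rev [k..<m]) \<and> perm_word u = perm_word (u' @ rev [k..<m])"
  using assms
proof (induction u rule: rev_induct)
  case Nil
  then show ?case by (intro exI[of _ "[]"] exI[of _ m]) auto
next
  case (snoc i u)
  then obtain u' k where k: "set u' \<subseteq> {j \<in> s_indices r s. j + 1 < m}" "k \<le> m" "{k..<m} \<subseteq> s_indices r s"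
    "sgs u = sgs (u' @ rev [k..<m])" "perm_word u = perm_word (u' @ rev [k..<m])"
    by (metis (no_types, lifting) set_append Un_subset_iff)
  obtain v k' where k': "set v \<subseteq> {j \<in> s_indices r s. j + 1 < m}" "k' \<le> m"
    "{k'..<m} \<subseteq> s_indices r s"
    "sgs (rev [k..<m] @ [i]) = sgs (v @ rev [k'..<m])"
    "perm_word (rev [k..<m] @ [i]) = perm_word (v @ rev [k'..<m])"
    using descending_snoc[OF k(2,3), of i] snoc.prems by auto
  have "sgs (u @ [i]) = sgs u' * sgs (rev [k..<m] @ [i])" by (simp add: k mult.assoc)
  also have "\<dots> = sgs u' * sgs (v @ rev [k'..<m])" by (simp only: k'(4))
  finally have 1: "sgs (u @ [i]) = sgs ((u' @ v) @ rev [k'..<m])" by (simp only: sgs_append mult.assoc)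
  have "perm_word (u @ [i]) = perm_word u' \<circ> perm_word (rev [k..<m] @ [i])"
    by (simp only: k perm_word_append o_assoc)
  also have "\<dots> = perm_word u' \<circ> perm_word (v @ rev [k'..<m])" by (simp only: k'(5))
  finally have 2: "perm_word (u @ [i]) = perm_word ((u' @ v) @ rev [k'..<m])"
    by (simp only: perm_word_append o_assoc)
  show ?case by (intro exI[of _ "u' @ v"] exI[of _ k'] conjI 1 2) (use k k' in auto)
qed

text \<open>The Coxeter presentation of \<open>S\<^sub>r \<times> S\<^sub>s\<close>: the largest point \<open>m\<close> that can move is the image of some \<open>k\<close>,
  and the coset decomposition by \<open>k\<close> reduces to words that fix \<open>m\<close>.\<close>

lemma sgs_cong_bounded:
  "set u \<subseteq> {j \<in> s_indices r s. j < m} \<Longrightarrow> set v \<subseteq> {j \<in> s_indices r s. j < m} \<Longrightarrow>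
    perm_word u = perm_word v \<Longrightarrow> sgs u = sgs v"
proof (induction m arbitrary: u v)
  case (Suc m)
  obtain u' k where k: "set u' \<subseteq> {j \<in> s_indices r s. j + 1 < Suc m}" "k \<le> Suc m"
    "sgs u = sgs (u' @ rev [k..<Suc m])" "perm_word u = perm_word (u' @ rev [k..<Suc m])"
    using word_decomposition[OF Suc.prems(1)] by metis
  obtain v' l where l: "set v' \<subseteq> {j \<in> s_indices r s. j + 1 < Suc m}" "l \<le> Suc m"
    "sgs v = sgs (v' @ rev [l..<Suc m])" "perm_word v = perm_word (v' @ rev [l..<Suc m])"
    using word_decomposition[OF Suc.prems(2)] by metis
  have "perm_word u' (Suc m) = Suc m" "perm_word v' (Suc m) = Suc m"
    using k l by (auto intro!: perm_word_fixes)
  then have "perm_word u k = Suc m" "perm_word v l = Suc m" using k l by (simp_all add: perm_word_descending del: upt_Suc)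
  then have kl: "k = l" using Suc.prems(3) bij_perm_word[of v] by (metis bij_pointE)
  have "perm_word u' \<circ> (perm_word (rev [k..<Suc m]) \<circ> perm_word (rev (rev [k..<Suc m]))) =
        perm_word v' \<circ> (perm_word (rev [k..<Suc m]) \<circ> perm_word (rev (rev [k..<Suc m])))"
    using Suc.prems(3) kl unfolding k l perm_word_append by (simp only: o_assoc)
  then have "perm_word u' = perm_word v'" unfolding perm_word_rev by simp
  then have "sgs u' = sgs v'" using k l by (intro Suc.IH) auto
  then show ?case using k l kl by simp
qed auto

theorem sgs_cong:
  assumes "set u \<subseteq> s_indices r s" "set v \<subseteq> s_indices r s" "perm_word u = perm_word v"
  shows "sgs u = sgs v"
proof (rule sgs_cong_bounded[where m = "r + s"])
  show "set u \<subseteq> {j \<in> s_indices r s. j < r + s}" "set v \<subseteq> {j \<in> s_indices r s. j < r + s}"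
    using assms by (auto simp: s_indices_def)
qed fact

text \<open>The coset decomposition again, now for a permutation that fixes \<open>r\<close> and \<open>r + 1\<close>: the descending part
  then cannot touch these two points. The letters that remain are those that commute with \<open>ee\<close>.\<close>

lemma stabilizer_word:
  assumes "set u \<subseteq> {j \<in> s_indices r s. j < m}" "perm_word u r = r" "perm_word u (r + 1) = r + 1"
  shows "\<exists>u'. set u' \<subseteq> s_indices r s - {r - 1, r + 1} \<and> sgs u' = sgs u"
  using assms
proof (induction m arbitrary: u)
  case 0
  then show ?case by (intro exI[of _ "[]"]) auto
next
  case (Suc m)
  obtain u' k where k: "set u' \<subseteq> {j \<in> s_indices r s. j + 1 < Suc m}" "k \<le> Suc m"
    "{k..<Suc m} \<subseteq> s_indices r s"
    "sgs u = sgs (u' @ rev [k..<Suc m])" "perm_word u = perm_word (u' @ rev [k..<Suc m])"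
    using word_decomposition[OF Suc.prems(1)] by metis
  have m: "perm_word u' (Suc m) = Suc m" using k by (auto intro!: perm_word_fixes)
  then have km: "perm_word u k = Suc m" using k by (simp add: perm_word_descending del: upt_Suc)
  have "r \<notin> {k..<Suc m}" using k(3) by (auto simp: s_indices_def)
  then have "k = Suc m \<or> Suc m \<le> r \<or> r < k" by auto
  moreover have "k = Suc m" if "Suc m = r"
    using that km Suc.prems bij_perm_word[of u] by (metis bij_pointE)
  moreover have "k \<noteq> r + 1" if "Suc m > r + 1"
    using that km Suc.prems by auto
  ultimately have "k = Suc m \<or> Suc m < r \<or> r + 1 < k" using k(2) by linarith
  then have sub: "{k..<Suc m} \<inter> {r - 1, r, r + 1} = {}" by auto
  have fixed: "perm_word (rev [k..<Suc m]) x = x" if "x \<in> {r, r+1}" for x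
    using that \<open>k = Suc m \<or> Suc m < r \<or> r + 1 < k\<close> k(2)
    by (auto simp: perm_word_descending simp del: upt_Suc)
  then have "perm_word u' r = r" "perm_word u' (r + 1) = r + 1"
    using Suc.prems(2,3) unfolding k(5) by auto
  then obtain u'' where "set u'' \<subseteq> s_indices r s - {r - 1, r + 1}" "sgs u'' = sgs u'"
    using Suc.IH[of u'] k by auto
  then show ?case using k(3,4) sub by (intro exI[of _ "u'' @ rev [k..<Suc m]"]) auto
qed

end

section \<open>Permutations, beads and caps in a bead monoid\<close>

text \<open>These two rules move an element through a product one factor at a time, where each factor may change
  it.\<close>

lemma intertwine_left:
  fixes a b :: "'m :: semigroup_mult"
  assumes "a * x = x' * a" "b * x' = x'' * b" shows "b * a * x = x'' * (b * a)"
proof -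
  have "b * a * x = b * x' * a" by (simp only: mult.assoc assms(1))
  then show ?thesis by (simp only: assms(2) mult.assoc)
qed

lemma intertwine_right:
  fixes a b :: "'m :: semigroup_mult"
  assumes "x * a = a' * x" "x * b = b' * x" shows "x * (a * b) = a' * b' * x"
proof -
  have "x * (a * b) = a' * (x * b)" by (simp only: assms(1) flip: mult.assoc)
  then show ?thesis by (simp only: assms(2) mult.assoc)
qed

lemma prod_list_cong_mset:
  fixes f :: "'a \<Rightarrow> 'm :: monoid_mult"
  assumes "mset xs = mset ys" "\<And>x y. x \<in> set xs \<Longrightarrow> y \<in> set xs \<Longrightarrow> f x * f y = f y * f x"
  shows "prod_list (map f xs) = prod_list (map f ys)"
  using assms
proof (induction xs arbitrary: ys)
  case (Cons x xs)
  note comm = Cons.prems(2)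
  obtain as bs where ys: "ys = as @ x # bs"
    by (metis Cons.prems(1) list.set_intros(1) set_mset_mset split_list)
  have xs: "mset xs = mset (as @ bs)" using Cons.prems(1) ys by simp
  have sub: "set (as @ bs) \<subseteq> set (x # xs)" using mset_eq_setD[OF xs] by auto
  have "set cs \<subseteq> set (x # xs) \<Longrightarrow> f x * prod_list (map f cs) = prod_list (map f cs) * f x" for cs
  proof (induction cs)
    case (Cons c cs)
    then have "f x * f c = f c * f x" using comm by simp
    then show ?case using Cons by (simp add: intertwine_right)
  qed simp
  from this[of as] sub have 1: "f x * prod_list (map f as) = prod_list (map f as) * f x" by simp
  have "prod_list (map f xs) = prod_list (map f (as @ bs))"
    using Cons.prems by (intro Cons.IH xs) auto
  then have "prod_list (map f (x # xs)) = f x * prod_list (map f as) * prod_list (map f bs)"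
    by (simp add: mult.assoc)
  then show ?case unfolding ys 1 by (simp add: mult.assoc)
qed simp

context bead_monoid
begin

text \<open>The group \<open>S\<^sub>r \<times> S\<^sub>s\<close> as a set of permutations, and its image in the monoid. The choice of the word in
  \<open>T\<close> does not matter by \<open>sgs_cong\<close>.\<close>

definition Sym :: "(nat \<Rightarrow> nat) set" where
  "Sym = perm_word ` {u. set u \<subseteq> s_indices r s}"

definition T :: "(nat \<Rightarrow> nat) \<Rightarrow> 'm" where
  "T \<sigma> = sgs (SOME u. set u \<subseteq> s_indices r s \<and> perm_word u = \<sigma>)"

lemma T_perm_word: "set u \<subseteq> s_indices r s \<Longrightarrow> T (perm_word u) = sgs u"
  unfolding T_def by (rule someI2[of _ u]) (auto intro: sgs_cong)

lemma Sym_id [simp]: "id \<in> Sym" and T_id [simp]: "T id = 1"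
  using T_perm_word[of "[]"] by (auto simp: Sym_def intro: image_eqI[of _ _ "[]"])

lemma Sym_adj: "i \<in> s_indices r s \<Longrightarrow> adj i \<in> Sym"
  and T_adj: "i \<in> s_indices r s \<Longrightarrow> T (adj i) = sg i"
  using T_perm_word[of "[i]"] by (auto simp: Sym_def intro!: image_eqI[of _ _ "[i]"])

lemma Sym_comp [intro, simp]:
  assumes "\<sigma> \<in> Sym" "\<tau> \<in> Sym" shows "\<sigma> \<circ> \<tau> \<in> Sym"
proof -
  obtain u v where "set (u @ v) \<subseteq> s_indices r s" "\<sigma> = perm_word u" "\<tau> = perm_word v"
    using assms by (auto simp: Sym_def)
  then show ?thesis unfolding Sym_def by (intro image_eqI[of _ _ "u @ v"]) auto
qed

lemma T_comp:
  assumes "\<sigma> \<in> Sym" "\<tau> \<in> Sym" shows "T (\<sigma> \<circ> \<tau>) = T \<sigma> * T \<tau>"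
proof -
  obtain u v where u: "set u \<subseteq> s_indices r s" "\<sigma> = perm_word u"
    and v: "set v \<subseteq> s_indices r s" "\<tau> = perm_word v"
    using assms by (auto simp: Sym_def)
  then show ?thesis using T_perm_word[of u] T_perm_word[of v] T_perm_word[of "u @ v"] by simp
qed

lemma Sym_bij: "\<sigma> \<in> Sym \<Longrightarrow> bij \<sigma>"
  by (auto simp: Sym_def bij_perm_word)

lemma Sym_inv [intro, simp]: "\<sigma> \<in> Sym \<Longrightarrow> inv_into UNIV \<sigma> \<in> Sym"
proof -
  assume "\<sigma> \<in> Sym"
  then obtain u where u: "set u \<subseteq> s_indices r s" "\<sigma> = perm_word u" by (auto simp: Sym_def)
  have "inv_into UNIV \<sigma> = perm_word (rev u)" unfolding u by (rule inv_unique_comp) (rule perm_word_rev)+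
  then show ?thesis unfolding Sym_def using u by (intro image_eqI[of _ _ "rev u"]) auto
qed

lemma T_inv:
  assumes "\<sigma> \<in> Sym" shows "T \<sigma> * T (inv_into UNIV \<sigma>) = 1" "T (inv_into UNIV \<sigma>) * T \<sigma> = 1"
proof -
  have b: "bij \<sigma>" by (rule Sym_bij[OF assms])
  have "\<sigma> \<circ> inv_into UNIV \<sigma> = id" "inv_into UNIV \<sigma> \<circ> \<sigma> = id"
    using b by (auto simp: fun_eq_iff bij_is_surj surj_f_inv_f bij_is_inj)
  then show "T \<sigma> * T (inv_into UNIV \<sigma>) = 1" "T (inv_into UNIV \<sigma>) * T \<sigma> = 1"
    using T_comp assms by (metis Sym_inv T_id)+
qed

lemma T_cancel:
  assumes "\<sigma> \<in> Sym" "x * T \<sigma> = y * T \<sigma>" shows "x = y"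
proof -
  have "x * (T \<sigma> * T (inv_into UNIV \<sigma>)) = y * (T \<sigma> * T (inv_into UNIV \<sigma>))"
    using assms(2) by (simp flip: mult.assoc)
  then show ?thesis using T_inv[OF assms(1)] by simp
qed

lemma Sym_inv_simps [simp]:
  assumes "\<sigma> \<in> Sym" shows "\<sigma> (inv_into UNIV \<sigma> x) = x" "inv_into UNIV \<sigma> (\<sigma> x) = x"
  using Sym_bij[OF assms] by (auto simp: bij_is_surj surj_f_inv_f bij_is_inj)

lemma Sym_eq_iff: "\<sigma> \<in> Sym \<Longrightarrow> \<sigma> x = \<sigma> y \<longleftrightarrow> x = y"
  using Sym_bij by (metis bij_pointE)

lemma Sym_side: "\<sigma> \<in> Sym \<Longrightarrow> \<sigma> x \<le> r \<longleftrightarrow> x \<le> r"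
proof -
  have "set u \<subseteq> s_indices r s \<Longrightarrow> perm_word u x \<le> r \<longleftrightarrow> x \<le> r" for u
  proof (induction u)
    case (Cons i u)
    then have "adj i y \<le> r \<longleftrightarrow> y \<le> r" for y
      by (auto simp: Transposition.transpose_def s_indices_def)
    then show ?case using Cons by simp
  qed simp
  then show "\<sigma> \<in> Sym \<Longrightarrow> \<sigma> x \<le> r \<longleftrightarrow> x \<le> r" by (auto simp: Sym_def)
qed

lemma Sym_bounds: "\<sigma> \<in> Sym \<Longrightarrow> \<sigma> x \<in> {1..r+s} \<longleftrightarrow> x \<in> {1..r+s}"
proof -
  have "set u \<subseteq> s_indices r s \<Longrightarrow> perm_word u x \<in> {1..r+s} \<longleftrightarrow> x \<in> {1..r+s}" for u
  proof (induction u)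
    case (Cons i u)
    then have "adj i y \<in> {1..r+s} \<longleftrightarrow> y \<in> {1..r+s}" for y
      by (auto simp: Transposition.transpose_def s_indices_def)
    then show ?case using Cons by simp
  qed simp
  then show "\<sigma> \<in> Sym \<Longrightarrow> ?thesis" by (auto simp: Sym_def)
qed

lemma Sym_transpose:
  assumes "a \<in> {1..r+s}" "b \<in> {1..r+s}" "a \<le> r \<longleftrightarrow> b \<le> r"
  shows "Transposition.transpose a b \<in> Sym"
proof -
  have "Transposition.transpose a (a + d) \<in> Sym"
    if "1 \<le> a" "a + d \<le> r + s" "a \<le> r \<longleftrightarrow> a + d \<le> r" for a d
    using that
  proof (induction d)
    case (Suc d)
    then have i: "a + d \<in> s_indices r s" by (auto simp: s_indices_def)
    show ?case
    proof (cases "d = 0")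
      case True
      then show ?thesis using Sym_adj[OF i] by simp
    next
      case False
      then have "Transposition.transpose a (a + Suc d) =
          adj (a + d) \<circ> Transposition.transpose a (a + d) \<circ> adj (a + d)"
        by (auto simp: fun_eq_iff Transposition.transpose_def)
      moreover have "Transposition.transpose a (a + d) \<in> Sym" using Suc by auto
      ultimately show ?thesis using Sym_adj[OF i] by (simp only: Sym_comp)
    qed
  qed (simp flip: id_def)
  from this[of a "b - a"] this[of b "a - b"] show ?thesis
    using assms by (cases "a \<le> b") (auto simp: transpose_commute)
qed

text \<open>Two strands on one side can be moved to any two positions on that side. The other side stays fixed, so
  that moves on both sides can be combined.\<close>

lemma Sym_move2:
  assumes "{y, y', z, z'} \<subseteq> {1..r+s}" "y \<noteq> y'" "z \<noteq> z'"
    "y \<le> r \<longleftrightarrow> z \<le> r" "y' \<le> r \<longleftrightarrow> z' \<le> r" "y \<le> r \<longleftrightarrow> y' \<le> r"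
  shows "\<exists>\<sigma> \<in> Sym. \<sigma> y = z \<and> \<sigma> y' = z' \<and> (\<forall>k. (k \<le> r) \<noteq> (y \<le> r) \<longrightarrow> \<sigma> k = k)"
proof -
  define w where "w = Transposition.transpose y z y'"
  have w: "w \<in> {1..r+s}" "w \<le> r \<longleftrightarrow> y \<le> r" "w \<noteq> z"
    using assms by (auto simp: w_def Transposition.transpose_def)
  let ?\<sigma> = "Transposition.transpose w z' \<circ> Transposition.transpose y z"
  have "?\<sigma> \<in> Sym" using w assms by (intro Sym_comp Sym_transpose) auto
  moreover have "?\<sigma> y = z" using w assms by simp
  moreover have "?\<sigma> y' = z'" by (simp flip: w_def)
  moreover have "?\<sigma> k = k" if "(k \<le> r) \<noteq> (y \<le> r)" for k
  proof -
    have "k \<noteq> w" "k \<noteq> z'" "k \<noteq> y" "k \<noteq> z" using that w assms by auto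
    then show ?thesis by simp
  qed
  ultimately show ?thesis by blast
qed

lemma T_transpose:
  assumes "\<sigma> \<in> Sym" "a \<in> {1..r+s}" "b \<in> {1..r+s}" "a \<le> r \<longleftrightarrow> b \<le> r"
  shows "T \<sigma> * T (Transposition.transpose a b) = T (Transposition.transpose (\<sigma> a) (\<sigma> b)) * T \<sigma>"
proof -
  have "\<sigma> \<circ> Transposition.transpose a b = Transposition.transpose (\<sigma> a) (\<sigma> b) \<circ> \<sigma>"
    using assms(1) by (auto simp: fun_eq_iff Transposition.transpose_def Sym_eq_iff)
  moreover have "Transposition.transpose a b \<in> Sym" "Transposition.transpose (\<sigma> a) (\<sigma> b) \<in> Sym"
    using assms Sym_side[OF assms(1)] Sym_bounds[OF assms(1)] by (auto intro!: Sym_transpose)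
  ultimately show ?thesis using assms(1) by (metis T_comp)
qed

lemma T_transpose_square:
  assumes "a \<in> {1..r+s}" "b \<in> {1..r+s}" "a \<le> r \<longleftrightarrow> b \<le> r"
  shows "T (Transposition.transpose a b) * T (Transposition.transpose a b) = 1"
  using T_comp[OF Sym_transpose[OF assms] Sym_transpose[OF assms]] by simp

lemma T_gm: "\<sigma> \<in> Sym \<Longrightarrow> k \<in> {1..r+s} \<Longrightarrow> T \<sigma> * gm k b = gm (\<sigma> k) b * T \<sigma>"
proof -
  assume k: "k \<in> {1..r+s}"
  have sgi: "sg i * gm k b = gm (adj i k) b * sg i" if "i \<in> s_indices r s" "k \<in> {1..r+s}" for i k
  proof -
    have 1: "sg i * gm i b = gm (i + 1) b * sg i"
      using sg_gm_sg[OF that(1), of b] sg_square[OF that(1)] by (metis mult.assoc mult.right_neutral)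
    have "sg i * gm (i + 1) b = gm i b * sg i"
      using sg_gm_sg[OF that(1), of b] sg_square[OF that(1)] by (metis mult.assoc mult.left_neutral)
    then show ?thesis using 1 sg_gm_commute[OF that] by (auto simp: Transposition.transpose_def)
  qed
  have "set u \<subseteq> s_indices r s \<Longrightarrow> sgs u * gm k b = gm (perm_word u k) b * sgs u" for u
  proof (induction u)
    case (Cons i u)
    then have "perm_word u \<in> Sym" by (auto simp: Sym_def)
    then have "perm_word u k \<in> {1..r+s}" using k Sym_bounds by auto
    then have "sg i * gm (perm_word u k) b = gm (perm_word (i # u) k) b * sg i"
      using sgi Cons by auto
    then show ?case using Cons by (simp add: intertwine_left)
  qed simp
  then show "\<sigma> \<in> Sym \<Longrightarrow> ?thesis" by (auto simp: Sym_def T_perm_word)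
qed

lemma T_gm_assoc: "\<sigma> \<in> Sym \<Longrightarrow> k \<in> {1..r+s} \<Longrightarrow> T \<sigma> * (gm k b * z) = gm (\<sigma> k) b * (T \<sigma> * z)"
  by (simp add: T_gm flip: mult.assoc)

definition gam :: "nat \<Rightarrow> nat list \<Rightarrow> 'm" where
  "gam k bs = prod_list (map (gm k) bs)"

lemma gam_Nil [simp]: "gam k [] = 1"
  and gam_Cons: "gam k (b # bs) = gm k b * gam k bs"
  and gam_append: "gam k (bs @ cs) = gam k bs * gam k cs"
  by (simp_all add: gam_def)

lemma T_gam:
  assumes "\<sigma> \<in> Sym" "k \<in> {1..r+s}" shows "T \<sigma> * gam k bs = gam (\<sigma> k) bs * T \<sigma>"
  by (induction bs) (simp_all add: gam_Cons T_gm[OF assms] intertwine_right)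

lemma gm_gam_commute:
  assumes "k \<in> {1..r+s}" "l \<in> {1..r+s}" "k \<noteq> l"
  shows "gm k b * gam l bs = gam l bs * gm k b"
  by (induction bs) (simp_all add: gam_Cons gm_commute[OF assms] intertwine_right)

lemma gam_commute:
  assumes "k \<in> {1..r+s}" "l \<in> {1..r+s}" "k \<noteq> l"
  shows "gam k bs * gam l cs = gam l cs * gam k bs"
  by (induction bs) (simp_all add: gam_Cons gm_gam_commute[OF assms] intertwine_left)

definition opp :: "nat \<Rightarrow> nat \<Rightarrow> bool" where
  "opp x y \<longleftrightarrow> x \<in> {1..r+s} \<and> y \<in> {1..r+s} \<and> (x \<le> r \<longleftrightarrow> \<not> y \<le> r)"

text \<open>The conjugate of \<open>ee\<close> that joins the strands \<open>x\<close> and \<open>y\<close>, on opposite sides of the wall and in either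
  order. Its independence of the chosen permutation is \<open>cap_eq\<close>.\<close>

definition cap :: "nat \<Rightarrow> nat \<Rightarrow> 'm" where
  "cap x y = (let \<sigma> = (SOME \<sigma>. \<sigma> \<in> Sym \<and> {\<sigma> r, \<sigma> (r + 1)} = {x, y}) in T \<sigma> * ee * T (inv_into UNIV \<sigma>))"

lemma opp_commute: "opp x y \<longleftrightarrow> opp y x"
  by (auto simp: opp_def)

lemma opp_bounds: "opp x y \<Longrightarrow> 1 \<le> r \<and> 1 \<le> s \<and> x \<in> {1..r+s} \<and> y \<in> {1..r+s} \<and> x \<noteq> y"
  by (auto simp: opp_def)

lemma opp_Sym: "\<sigma> \<in> Sym \<Longrightarrow> opp (\<sigma> x) (\<sigma> y) \<longleftrightarrow> opp x y"
  unfolding opp_def using Sym_side Sym_bounds by blast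

lemma cap_commute: "cap x y = cap y x"
  by (simp add: cap_def insert_commute)

text \<open>A permutation fixing \<open>r\<close> and \<open>r + 1\<close> is a product of generators commuting with \<open>e\<close>.\<close>

lemma T_ee_commute:
  assumes "1 \<le> r" "1 \<le> s" "\<sigma> \<in> Sym" "\<sigma> r = r" "\<sigma> (r + 1) = r + 1"
  shows "T \<sigma> * ee = ee * T \<sigma>"
proof -
  obtain u where u: "set u \<subseteq> s_indices r s" "perm_word u = \<sigma>" using assms by (auto simp: Sym_def)
  then have "set u \<subseteq> {j \<in> s_indices r s. j < r + s}" by (auto simp: s_indices_def)
  then obtain v where v: "set v \<subseteq> s_indices r s - {r - 1, r + 1}" "sgs v = sgs u"
    using stabilizer_word[of u "r + s"] assms u by auto
  have "sgs v * ee = ee * sgs v" using v(1)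
  proof (induction v)
    case (Cons j v)
    then have "sg j * ee = ee * sg j" using ee_sg[of j] assms by auto
    then show ?case using Cons by (simp add: intertwine_left)
  qed simp
  then show ?thesis using v u T_perm_word[of u] by simp
qed

lemma cap_eq:
  assumes "1 \<le> r" "1 \<le> s" "\<sigma> \<in> Sym"
  shows "cap (\<sigma> r) (\<sigma> (r + 1)) = T \<sigma> * ee * T (inv_into UNIV \<sigma>)"
  unfolding cap_def Let_def
proof (rule someI2[of _ \<sigma>])
  fix \<tau> assume \<tau>: "\<tau> \<in> Sym \<and> {\<tau> r, \<tau> (r + 1)} = {\<sigma> r, \<sigma> (r + 1)}"
  have side: "\<tau> r \<le> r" "\<not> \<tau> (r + 1) \<le> r" "\<sigma> r \<le> r" "\<not> \<sigma> (r + 1) \<le> r"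
    using \<tau> assms by (auto simp: Sym_side)
  then have eq: "\<tau> r = \<sigma> r" "\<tau> (r + 1) = \<sigma> (r + 1)" using \<tau> by (metis doubleton_eq_iff)+
  let ?\<rho> = "inv_into UNIV \<sigma> \<circ> \<tau>"
  have \<rho>: "?\<rho> \<in> Sym" using \<tau> assms by auto
  have "?\<rho> r = r" "?\<rho> (r + 1) = r + 1" using eq assms by auto
  then have "T ?\<rho> * ee = ee * T ?\<rho>" using T_ee_commute[of ?\<rho>] \<rho> assms by simp
  moreover have "T \<tau> = T \<sigma> * T ?\<rho>"
  proof -
    have "\<sigma> \<circ> ?\<rho> = \<tau>" using assms(3) by (simp add: fun_eq_iff)
    then show ?thesis using T_comp[OF assms(3) \<rho>] by simp
  qed
  ultimately have "T \<tau> * ee * T (inv_into UNIV \<tau>) = T \<sigma> * ee * (T ?\<rho> * T (inv_into UNIV \<tau>))"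
    by (simp add: mult.assoc)
  also have "T ?\<rho> * T (inv_into UNIV \<tau>) = T (inv_into UNIV \<sigma>)"
    using T_comp[of "inv_into UNIV \<sigma>" \<tau>] T_inv[of \<tau>] \<tau> assms by (simp add: mult.assoc)
  finally show "T \<tau> * ee * T (inv_into UNIV \<tau>) = T \<sigma> * ee * T (inv_into UNIV \<sigma>)" .
qed (use assms in auto)

lemma opp_obtain:
  assumes "opp x y"
  obtains \<sigma> where "\<sigma> \<in> Sym" "{\<sigma> r, \<sigma> (r + 1)} = {x, y}"
proof -
  have *: "\<exists>\<sigma>. \<sigma> \<in> Sym \<and> \<sigma> r = x \<and> \<sigma> (r + 1) = y" if "opp x y" "x \<le> r" for x y
  proof -
    let ?\<sigma> = "Transposition.transpose r x \<circ> Transposition.transpose (r + 1) y"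
    have "?\<sigma> \<in> Sym" using that by (intro Sym_comp Sym_transpose) (auto simp: opp_def)
    moreover have "?\<sigma> r = x" "?\<sigma> (r + 1) = y"
      using that by (auto simp: opp_def Transposition.transpose_def)
    ultimately show ?thesis by blast
  qed
  show thesis
  proof (cases "x \<le> r")
    case True
    then show ?thesis using *[of x y] assms that by auto
  next
    case False
    then have "opp y x" "y \<le> r" using assms by (auto simp: opp_def)
    then show ?thesis using *[of y x] that by (metis insert_commute)
  qed
qed

lemma T_cap:
  assumes "\<sigma> \<in> Sym" "opp x y"
  shows "T \<sigma> * cap x y = cap (\<sigma> x) (\<sigma> y) * T \<sigma>"
proof -
  have rs: "1 \<le> r" "1 \<le> s" using opp_bounds[OF assms(2)] by auto
  obtain \<tau> where \<tau>: "\<tau> \<in> Sym" "{\<tau> r, \<tau> (r + 1)} = {x, y}" using assms opp_obtain by metis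
  then have xy: "cap x y = cap (\<tau> r) (\<tau> (r + 1))"
    "cap (\<sigma> x) (\<sigma> y) = cap ((\<sigma> \<circ> \<tau>) r) ((\<sigma> \<circ> \<tau>) (r + 1))"
    by (auto simp: doubleton_eq_iff cap_commute)
  have "inv_into UNIV (\<sigma> \<circ> \<tau>) = inv_into UNIV \<tau> \<circ> inv_into UNIV \<sigma>" using assms \<tau> by (simp add: o_inv_distrib Sym_bij)
  then have "T (inv_into UNIV (\<sigma> \<circ> \<tau>)) * T \<sigma> = T (inv_into UNIV \<tau>)"
    using T_comp[of "inv_into UNIV \<tau>" "inv_into UNIV \<sigma>"] T_inv[of \<sigma>] assms \<tau> by (simp add: mult.assoc)
  moreover have "cap (\<sigma> x) (\<sigma> y) = T (\<sigma> \<circ> \<tau>) * ee * T (inv_into UNIV (\<sigma> \<circ> \<tau>))"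
    using cap_eq[OF rs, of "\<sigma> \<circ> \<tau>"] xy assms \<tau> by simp
  moreover have "cap x y = T \<tau> * ee * T (inv_into UNIV \<tau>)" using cap_eq[OF rs, of \<tau>] xy \<tau> by simp
  ultimately show ?thesis using assms \<tau> by (simp add: T_comp mult.assoc)
qed

lemma T_cap_assoc: "\<sigma> \<in> Sym \<Longrightarrow> opp x y \<Longrightarrow> T \<sigma> * (cap x y * z) = cap (\<sigma> x) (\<sigma> y) * (T \<sigma> * z)"
  by (simp add: T_cap flip: mult.assoc)

lemma cap_base: "1 \<le> r \<Longrightarrow> 1 \<le> s \<Longrightarrow> cap r (r + 1) = ee"
  using cap_eq[of id] by simp

lemma gm_cap:
  assumes "opp x y" shows "gm x b * cap x y = gm y b * cap x y"
proof -
  have rs: "1 \<le> r" "1 \<le> s" "opp r (r + 1)" using opp_bounds[OF assms] by (auto simp: opp_def)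
  obtain \<sigma> where \<sigma>: "\<sigma> \<in> Sym" "{\<sigma> r, \<sigma> (r + 1)} = {x, y}" using assms opp_obtain by metis
  have "gm (\<sigma> r) b * cap (\<sigma> r) (\<sigma> (r + 1)) * T \<sigma> = T \<sigma> * (gm r b * cap r (r + 1))"
    using \<sigma>(1) rs by (simp add: mult.assoc T_gm T_cap T_gm_assoc T_cap_assoc)
  also have "\<dots> = T \<sigma> * (gm (r + 1) b * cap r (r + 1))" using gm_ee rs cap_base by simp
  also have "\<dots> = gm (\<sigma> (r + 1)) b * cap (\<sigma> r) (\<sigma> (r + 1)) * T \<sigma>"
    using \<sigma>(1) rs by (simp add: mult.assoc T_gm T_cap T_gm_assoc T_cap_assoc)
  finally have "gm (\<sigma> r) b * cap (\<sigma> r) (\<sigma> (r + 1)) = gm (\<sigma> (r + 1)) b * cap (\<sigma> r) (\<sigma> (r + 1))"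
    using T_cancel[OF \<sigma>(1)] by blast
  then show ?thesis using \<sigma>(2) by (auto simp: doubleton_eq_iff cap_commute)
qed

lemma cap_gm:
  assumes "opp x y" shows "cap x y * gm x b = cap x y * gm y b"
proof -
  have rs: "1 \<le> r" "1 \<le> s" "opp r (r + 1)" using opp_bounds[OF assms] by (auto simp: opp_def)
  obtain \<sigma> where \<sigma>: "\<sigma> \<in> Sym" "{\<sigma> r, \<sigma> (r + 1)} = {x, y}" using assms opp_obtain by metis
  have "cap (\<sigma> r) (\<sigma> (r + 1)) * gm (\<sigma> r) b * T \<sigma> = T \<sigma> * (cap r (r + 1) * gm r b)"
    using \<sigma>(1) rs by (simp add: mult.assoc T_gm T_cap T_gm_assoc T_cap_assoc)
  also have "\<dots> = T \<sigma> * (cap r (r + 1) * gm (r + 1) b)" using ee_gm rs cap_base by simp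
  also have "\<dots> = cap (\<sigma> r) (\<sigma> (r + 1)) * gm (\<sigma> (r + 1)) b * T \<sigma>"
    using \<sigma>(1) rs by (simp add: mult.assoc T_gm T_cap T_gm_assoc T_cap_assoc)
  finally have "cap (\<sigma> r) (\<sigma> (r + 1)) * gm (\<sigma> r) b = cap (\<sigma> r) (\<sigma> (r + 1)) * gm (\<sigma> (r + 1)) b"
    using T_cancel[OF \<sigma>(1)] by blast
  then show ?thesis using \<sigma>(2) by (auto simp: doubleton_eq_iff cap_commute)
qed

end

section \<open>Products of caps and beads\<close>

context bead_monoid
begin

text \<open>Two caps that share the strand \<open>x\<close> can be moved next to the wall. There \<open>y\<close> and \<open>y'\<close> are exchanged by
  one of the two letters adjacent to the wall, and the defining relations apply.\<close>

lemma opp_move: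
  assumes "opp x y" "opp x y'" "y \<noteq> y'"
  obtains \<sigma> x0 y0 y0' where "\<sigma> \<in> Sym" "\<sigma> x0 = x" "\<sigma> y0 = y" "\<sigma> y0' = y'"
    "{x0, y0} = {r, r + 1}" "adj (min y0 y0') y0 = y0'" "min y0 y0' \<in> s_indices r s"
    "min y0 y0' = (if y \<le> r then r - 1 else r + 1)" "y \<le> r \<Longrightarrow> 2 \<le> r" "\<not> y \<le> r \<Longrightarrow> 2 \<le> s"
proof (cases "y \<le> r")
  case True
  then have b: "1 \<le> y" "1 \<le> y'" "y' \<le> r" "\<not> x \<le> r" "x \<le> r + s" using assms by (auto simp: opp_def)
  then have r2: "2 \<le> r" using True assms(3) by auto
  then have q: "r \<noteq> r - 1" "1 \<le> r - 1" "r - 1 \<le> r + s" by auto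
  obtain \<tau> where \<tau>: "\<tau> \<in> Sym" "\<tau> r = y" "\<tau> (r - 1) = y'" "\<forall>k. (k \<le> r) \<noteq> (r \<le> r) \<longrightarrow> \<tau> k = k"
    using Sym_move2[of r "r - 1" y y'] True b q assms(3) by auto
  let ?\<sigma> = "Transposition.transpose (r + 1) x \<circ> \<tau>"
  show thesis
  proof (rule that[of ?\<sigma> "r + 1" r "r - 1"])
    show "?\<sigma> \<in> Sym" using b by (intro Sym_comp \<tau> Sym_transpose) auto
    show "?\<sigma> (r + 1) = x" using \<tau> by simp
    show "?\<sigma> r = y" "?\<sigma> (r - 1) = y'" using \<tau> b True by (auto simp: Transposition.transpose_def)
    show "min r (r - 1) \<in> s_indices r s" using r2 by (auto simp: s_indices_def)
  qed (use r2 True in \<open>auto simp: min_def Transposition.transpose_def\<close>)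
next
  case False
  then have b: "1 \<le> x" "x \<le> r" "\<not> y' \<le> r" "y' \<le> r + s" "y \<le> r + s" using assms by (auto simp: opp_def)
  then have s2: "2 \<le> s" using False assms(3) by auto
  obtain \<tau> where \<tau>: "\<tau> \<in> Sym" "\<tau> (r + 1) = y" "\<tau> (r + 2) = y'" "\<forall>k. (k \<le> r) \<noteq> (r + 1 \<le> r) \<longrightarrow> \<tau> k = k"
    using Sym_move2[of "r + 1" "r + 2" y y'] False b s2 assms(3) by auto
  let ?\<sigma> = "Transposition.transpose r x \<circ> \<tau>"
  show thesis
  proof (rule that[of ?\<sigma> r "r + 1" "r + 2"])
    show "?\<sigma> \<in> Sym" using b by (intro Sym_comp \<tau> Sym_transpose) auto
    show "?\<sigma> r = x" using \<tau> by simp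
    show "?\<sigma> (r + 1) = y" "?\<sigma> (r + 2) = y'" using \<tau> b False by (auto simp: Transposition.transpose_def)
    show "min (r + 1) (r + 2) \<in> s_indices r s" using s2 by (auto simp: s_indices_def)
  qed (use s2 False in \<open>auto simp: min_def Transposition.transpose_def\<close>)
qed

text \<open>In the standard position this is \<open>e (s e s) = e s\<close>, a consequence of \<open>e s e = e\<close>.\<close>

lemma cap_cap_share:
  assumes "opp x y" "opp x y'" "y \<noteq> y'"
  shows "cap x y * cap x y' = cap x y * T (Transposition.transpose y y')"
proof -
  obtain \<sigma> x0 y0 y0' where \<sigma>: "\<sigma> \<in> Sym" "\<sigma> x0 = x" "\<sigma> y0 = y" "\<sigma> y0' = y'"
    "{x0, y0} = {r, r + 1}" "adj (min y0 y0') y0 = y0'" "min y0 y0' \<in> s_indices r s"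
    "min y0 y0' = (if y \<le> r then r - 1 else r + 1)" "y \<le> r \<Longrightarrow> 2 \<le> r" "\<not> y \<le> r \<Longrightarrow> 2 \<le> s"
    using opp_move[OF assms] by metis
  have rs: "1 \<le> r" "1 \<le> s" using opp_bounds[OF assms(1)] by auto
  have o: "opp x0 y0" "opp x0 y0'" "y0 \<noteq> y0'"
    using assms \<sigma>(1-4) opp_Sym[OF \<sigma>(1)] by metis+
  let ?i = "min y0 y0'"
  have tr: "Transposition.transpose y0 y0' = adj ?i"
    using \<sigma>(6) o(3) by (auto simp: min_def Transposition.transpose_def fun_eq_iff split: if_splits)
  have c: "cap x0 y0 = ee" using \<sigma>(5) cap_base[OF rs] by (auto simp: doubleton_eq_iff cap_commute)
  have e: "ee * sg ?i * ee = ee" using \<sigma>(8-10) ee_sg_ee_left ee_sg_ee_right rs by (cases "y \<le> r") auto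
  have "x0 \<noteq> y0'" using o by (auto simp: opp_def)
  then have x0: "adj ?i x0 = x0" using tr[symmetric] o by (auto simp: opp_def)
  have "cap x0 y0' = cap (adj ?i x0) (adj ?i y0)" using x0 \<sigma>(6) by simp
  then have "cap x0 y0' * sg ?i = sg ?i * ee"
    using T_cap[OF Sym_adj[OF \<sigma>(7)] o(1)] T_adj[OF \<sigma>(7)] c by simp
  then have "cap x0 y0' = sg ?i * ee * sg ?i"
    using sg_square[OF \<sigma>(7)] by (metis mult.assoc mult.right_neutral)
  then have base: "cap x0 y0 * cap x0 y0' = cap x0 y0 * T (Transposition.transpose y0 y0')"
    using c e tr T_adj[OF \<sigma>(7)] by (simp flip: mult.assoc)
  have "cap x y * cap x y' * T \<sigma> = T \<sigma> * (cap x0 y0 * cap x0 y0')"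
    using \<sigma>(1-4) o by (auto simp: T_cap T_cap_assoc mult.assoc)
  also have "\<dots> = cap x y * (T \<sigma> * T (Transposition.transpose y0 y0'))"
    using \<sigma>(1-4) o by (auto simp: base T_cap_assoc)
  also have "T \<sigma> * T (Transposition.transpose y0 y0') = T (Transposition.transpose y y') * T \<sigma>"
    using T_transpose[OF \<sigma>(1), of y0 y0'] \<sigma>(3,4) o unfolding opp_def by blast
  finally have "cap x y * cap x y' * T \<sigma> = cap x y * T (Transposition.transpose y y') * T \<sigma>"
    by (simp add: mult.assoc)
  then show ?thesis using T_cancel[OF \<sigma>(1)] by blast
qed

text \<open>In the standard position this is the relation \<open>sg_sg_ee\<close> between \<open>e\<close> and its conjugate one step
  further away from the wall.\<close>

lemma cap_cap_commute:
  assumes "opp x y" "opp x' y'" "{x, y} \<inter> {x', y'} = {}"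
  shows "cap x y * cap x' y' = cap x' y' * cap x y"
proof -
  have *: "cap x y * cap x' y' = cap x' y' * cap x y"
    if "opp x y" "opp x' y'" "x \<noteq> x'" "y \<noteq> y'" "x \<le> r" "x' \<le> r" for x y x' y'
  proof -
    note h = that
    have b: "1 \<le> x" "1 \<le> x'" "y \<le> r + s" "y' \<le> r + s" "\<not> y \<le> r" "\<not> y' \<le> r"
      using that by (auto simp: opp_def)
    then have rs: "2 \<le> r" "2 \<le> s" using that by auto
    then have q: "r \<noteq> r - 1" "1 \<le> r - 1" "r - 1 \<le> r + s" by auto
    obtain \<tau> where \<tau>: "\<tau> \<in> Sym" "\<tau> r = x" "\<tau> (r - 1) = x'" "\<forall>k. (k \<le> r) \<noteq> (r \<le> r) \<longrightarrow> \<tau> k = k"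
      using Sym_move2[of r "r - 1" x x'] h b q by auto
    obtain \<rho> where \<rho>: "\<rho> \<in> Sym" "\<rho> (r + 1) = y" "\<rho> (r + 2) = y'"
      "\<forall>k. (k \<le> r) \<noteq> (r + 1 \<le> r) \<longrightarrow> \<rho> k = k"
      using Sym_move2[of "r + 1" "r + 2" y y'] h b rs by auto
    let ?\<sigma> = "\<tau> \<circ> \<rho>"
    have \<sigma>: "?\<sigma> \<in> Sym" "?\<sigma> r = x" "?\<sigma> (r - 1) = x'" "?\<sigma> (r + 1) = y" "?\<sigma> (r + 2) = y'"
      using \<tau> \<rho> that b by auto
    have J: "r - 1 \<in> s_indices r s" "r + 1 \<in> s_indices r s" using rs by (auto simp: s_indices_def)
    let ?\<pi> = "adj (r - 1) \<circ> adj (r + 1)"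
    have "inv_into UNIV ?\<pi> = adj (r + 1) \<circ> adj (r - 1)"
      by (rule inv_unique_comp) (auto simp: fun_eq_iff)
    moreover have "?\<pi> r = r - 1" "?\<pi> (r + 1) = r + 2"
      using rs by (auto simp: Transposition.transpose_def)
    ultimately have "cap (r - 1) (r + 2) = sg (r - 1) * sg (r + 1) * ee * (sg (r + 1) * sg (r - 1))"
      using cap_eq[of ?\<pi>] rs Sym_adj[OF J(1)] Sym_adj[OF J(2)] T_adj[OF J(1)] T_adj[OF J(2)]
      by (simp add: T_comp del: comp_apply o_apply)
    then have base: "cap r (r + 1) * cap (r - 1) (r + 2) = cap (r - 1) (r + 2) * cap r (r + 1)"
      using sg_sg_ee[OF rs] cap_base rs by (simp add: mult.assoc)
    have o: "opp r (r + 1)" "opp (r - 1) (r + 2)" using rs by (auto simp: opp_def)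
    have "cap x y * cap x' y' * T ?\<sigma> = T ?\<sigma> * (cap r (r + 1) * cap (r - 1) (r + 2))"
      using T_cap_assoc[OF \<sigma>(1) o(1)] T_cap[OF \<sigma>(1) o(2)] unfolding \<sigma>(2-5) by (simp add: mult.assoc)
    also have "\<dots> = T ?\<sigma> * (cap (r - 1) (r + 2) * cap r (r + 1))" by (simp only: base)
    also have "\<dots> = cap x' y' * cap x y * T ?\<sigma>"
      using T_cap_assoc[OF \<sigma>(1) o(2)] T_cap[OF \<sigma>(1) o(1)] unfolding \<sigma>(2-5) by (simp add: mult.assoc)
    finally show ?thesis using T_cancel[OF \<sigma>(1)] by blast
  qed
  have o: "opp y x" "opp y' x'" "x \<le> r \<longleftrightarrow> \<not> y \<le> r" "x' \<le> r \<longleftrightarrow> \<not> y' \<le> r"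
    using assms by (auto simp: opp_commute opp_def)
  show ?thesis using *[of x y x' y'] *[of y x x' y'] *[of x y y' x'] *[of y x y' x'] assms o
    by (cases "x \<le> r"; cases "x' \<le> r") (auto simp: cap_commute)
qed

text \<open>Two disjoint caps absorb the permutation that exchanges them: both arms of the exchange are
  obtained by multiplying with the same mixed cap.\<close>

lemma cap_cap_swap:
  assumes "opp x y" "opp x' y'" "x \<noteq> x'" "y \<noteq> y'" "x \<le> r \<longleftrightarrow> x' \<le> r"
  shows "cap x y * cap x' y' * T (Transposition.transpose x x' \<circ> Transposition.transpose y y') =
    cap x y * cap x' y'"
proof -
  let ?a = "cap x y" and ?b = "cap x' y'" and ?m = "cap x y'"
  let ?tx = "T (Transposition.transpose x x')" and ?ty = "T (Transposition.transpose y y')"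
  have o: "opp x y'" "opp y' x'" "opp y' x" using assms by (auto simp: opp_def)
  have S: "Transposition.transpose x x' \<in> Sym" "Transposition.transpose y y' \<in> Sym"
    using assms by (auto intro!: Sym_transpose simp: opp_def)
  have comm: "?a * ?b = ?b * ?a" using assms by (intro cap_cap_commute) (auto simp: opp_def)
  have 1: "?a * ?m = ?a * ?ty" by (rule cap_cap_share[OF assms(1) o(1) assms(4)])
  have 2: "?b * ?m = ?b * ?tx" using cap_cap_share[OF o(2,3)] assms(3)
    by (simp add: cap_commute transpose_commute)
  have "?a * ?b * ?tx = ?a * (?b * ?m)" by (simp only: 2 mult.assoc)
  also have "\<dots> = ?b * (?a * ?m)" using comm by (simp flip: mult.assoc)
  also have "\<dots> = ?a * ?b * ?ty" unfolding 1 comm by (simp only: mult.assoc)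
  finally have "?a * ?b * ?tx * ?ty = ?a * ?b * (?ty * ?ty)" by (simp add: mult.assoc)
  also have "?ty * ?ty = 1" using assms by (intro T_transpose_square) (auto simp: opp_def)
  finally show ?thesis using S by (simp add: T_comp mult.assoc)
qed

lemma cap_gm_commute:
  assumes "opp x y" "k \<in> {1..r+s}" "k \<noteq> x" "k \<noteq> y"
  shows "cap x y * gm k b = gm k b * cap x y"
proof -
  have rs: "1 \<le> r" "1 \<le> s" "opp r (r + 1)" using opp_bounds[OF assms(1)] by (auto simp: opp_def)
  obtain \<sigma> where \<sigma>: "\<sigma> \<in> Sym" "{\<sigma> r, \<sigma> (r + 1)} = {x, y}" using opp_obtain[OF assms(1)] by metis
  let ?l = "inv_into UNIV \<sigma> k"
  have l: "?l \<in> {1..r+s}" using Sym_bounds[of "inv_into UNIV \<sigma>" k] \<sigma>(1) assms(2) by blast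
  have k: "\<sigma> ?l = k" using \<sigma>(1) by simp
  then have ne: "?l \<noteq> r" "?l \<noteq> r + 1" using assms \<sigma>(2) by (auto simp: doubleton_eq_iff)
  have c: "cap (\<sigma> r) (\<sigma> (r + 1)) = cap x y" using \<sigma>(2) by (auto simp: doubleton_eq_iff cap_commute)
  have "cap x y * gm k b * T \<sigma> = T \<sigma> * (cap r (r + 1) * gm ?l b)"
    using T_cap_assoc[OF \<sigma>(1) rs(3)] T_gm[OF \<sigma>(1) l] by (simp only: c k mult.assoc)
  also have "cap r (r + 1) * gm ?l b = gm ?l b * cap r (r + 1)"
    using ee_gm_commute rs l ne cap_base by simp
  also have "T \<sigma> * (gm ?l b * cap r (r + 1)) = gm k b * cap x y * T \<sigma>"
    using T_cap[OF \<sigma>(1) rs(3)] T_gm_assoc[OF \<sigma>(1) l] by (simp only: c k mult.assoc)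
  finally show ?thesis using T_cancel[OF \<sigma>(1)] by blast
qed

lemma cap_gam_commute:
  assumes "opp x y" "k \<in> {1..r+s}" "k \<noteq> x" "k \<noteq> y"
  shows "cap x y * gam k bs = gam k bs * cap x y"
  by (induction bs) (simp_all add: gam_Cons cap_gm_commute[OF assms] intertwine_right)

text \<open>Beads slide over a cap, where they are met in the opposite order.\<close>

lemma gam_cap:
  assumes "opp x y" shows "gam x bs * cap x y = gam y (rev bs) * cap x y"
proof (induction bs)
  case (Cons b bs)
  have xy: "x \<in> {1..r+s}" "y \<in> {1..r+s}" "x \<noteq> y" using opp_bounds[OF assms] by auto
  have "gam x (b # bs) * cap x y = gm x b * gam y (rev bs) * cap x y"
    using Cons by (simp add: gam_Cons mult.assoc)
  also have "gm x b * gam y (rev bs) = gam y (rev bs) * gm x b" by (rule gm_gam_commute[OF xy])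
  also have "\<dots> * cap x y = gam y (rev bs) * (gm y b * cap x y)"
    using gm_cap[OF assms] by (simp add: mult.assoc)
  finally show ?case by (simp add: gam_append gam_Cons mult.assoc)
qed simp

lemma cap_gam:
  assumes "opp x y" shows "cap x y * gam x bs = cap x y * gam y (rev bs)"
proof (induction bs)
  case (Cons b bs)
  have xy: "y \<in> {1..r+s}" "x \<in> {1..r+s}" "y \<noteq> x" using opp_bounds[OF assms] by auto
  have "cap x y * gam x (b # bs) = cap x y * (gm y b * gam x bs)"
    using cap_gm[OF assms] by (simp add: gam_Cons flip: mult.assoc)
  also have "\<dots> = cap x y * gam x bs * gm y b"
    unfolding gm_gam_commute[OF xy] by (simp add: mult.assoc)
  finally show ?case unfolding Cons by (simp add: gam_append gam_Cons mult.assoc)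
qed simp

lemma cap_gam_cap:
  assumes "opp x y" shows "cap x y * gam x bs * cap x y = 0"
proof -
  have rs: "1 \<le> r" "1 \<le> s" "opp r (r + 1)" using opp_bounds[OF assms] by (auto simp: opp_def)
  obtain \<sigma> where \<sigma>: "\<sigma> \<in> Sym" "{\<sigma> r, \<sigma> (r + 1)} = {x, y}" using opp_obtain[OF assms(1)] by metis
  have c: "cap (\<sigma> r) (\<sigma> (r + 1)) = cap x y" using \<sigma>(2) by (auto simp: doubleton_eq_iff cap_commute)
  have r: "r \<in> {1..r+s}" using rs by simp
  have 0: "cap x y * gam (\<sigma> r) bs * cap x y = 0" for bs
  proof -
    have "cap x y * gam (\<sigma> r) bs * cap x y * T \<sigma> = T \<sigma> * (cap r (r+1) * gam r bs * cap r (r+1))"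
      using T_cap[OF \<sigma>(1) rs(3)] T_gam[OF \<sigma>(1) r] by (simp only: c intertwine_right)
    also have "\<dots> = 0 * T \<sigma>" using ee_beads_ee[OF rs(1,2)] cap_base[OF rs(1,2)] by (simp add: gam_def)
    finally show ?thesis using T_cancel[OF \<sigma>(1)] by blast
  qed
  show ?thesis
  proof (cases "\<sigma> r = x")
    case True
    then show ?thesis using 0 by simp
  next
    case False
    then have "\<sigma> r = y" using \<sigma>(2) by (auto simp: doubleton_eq_iff)
    then show ?thesis using 0[of "rev bs"] cap_gam[OF assms] by simp
  qed
qed

definition beads :: "nat list \<Rightarrow> (nat \<Rightarrow> nat list) \<Rightarrow> 'm" where
  "beads ks \<alpha> = prod_list (map (\<lambda>k. gam k (\<alpha> k)) ks)"

lemma beads_Nil [simp]: "beads [] \<alpha> = 1"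
  and beads_Cons [simp]: "beads (k # ks) \<alpha> = gam k (\<alpha> k) * beads ks \<alpha>"
  by (simp_all add: beads_def)

lemma beads_cong: "(\<And>k. k \<in> set ks \<Longrightarrow> \<alpha> k = \<beta> k) \<Longrightarrow> beads ks \<alpha> = beads ks \<beta>"
  by (induction ks) auto

lemma beads_cong_mset:
  assumes "mset ks = mset ls" "set ks \<subseteq> {1..r+s}" shows "beads ks \<alpha> = beads ls \<alpha>"
  unfolding beads_def
proof (rule prod_list_cong_mset[OF assms(1)])
  fix x y assume "x \<in> set ks" "y \<in> set ks"
  then show "gam x (\<alpha> x) * gam y (\<alpha> y) = gam y (\<alpha> y) * gam x (\<alpha> x)"
    using assms(2) gam_commute[of x y] by (cases "x = y") (simp, blast)
qed

lemma gam_beads_commute: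
  "set ks \<subseteq> {1..r+s} \<Longrightarrow> k \<in> {1..r+s} \<Longrightarrow> k \<notin> set ks \<Longrightarrow> gam k bs * beads ks \<alpha> = beads ks \<alpha> * gam k bs"
proof (induction ks)
  case (Cons l ks)
  then have "gam k bs * gam l (\<alpha> l) = gam l (\<alpha> l) * gam k bs" by (intro gam_commute) auto
  then show ?case using Cons by (simp add: intertwine_right)
qed simp

definition strands :: "nat list" where
  "strands = [1..<r+s+1]"

lemma set_strands [simp]: "set strands = {1..r+s}" and distinct_strands: "distinct strands"
  by (auto simp: strands_def)

text \<open>Bead words on all strands at once. Beads of different strands commute, so the order of the strands in
  the product does not matter.\<close>

definition Gam :: "(nat \<Rightarrow> nat list) \<Rightarrow> 'm" where
  "Gam \<alpha> = beads strands \<alpha>"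

lemma Gam_Nil: "Gam (\<lambda>_. []) = 1"
proof -
  have "beads ks (\<lambda>_. []) = 1" for ks by (induction ks) auto
  then show ?thesis by (simp add: Gam_def)
qed

lemma Gam_split:
  assumes "k \<in> {1..r+s}"
  obtains ks where "\<And>\<alpha>. Gam \<alpha> = gam k (\<alpha> k) * beads ks \<alpha>" "set ks \<subseteq> {1..r+s}" "k \<notin> set ks"
proof
  let ?ks = "remove1 k strands"
  have k: "k \<in> set strands" using assms by auto
  then have "mset strands = mset (k # ?ks)" by (metis mset.simps(2) perm_remove)
  then show "Gam \<alpha> = gam k (\<alpha> k) * beads ?ks \<alpha>" for \<alpha>
    unfolding Gam_def using beads_cong_mset[of "strands" "k # ?ks" \<alpha>] by auto
  show "set ?ks \<subseteq> {1..r+s}" "k \<notin> set ?ks" using distinct_strands set_remove1_subset[of k strands] by auto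
qed

lemma gam_Gam:
  assumes "k \<in> {1..r+s}" shows "gam k bs * Gam \<alpha> = Gam (\<alpha>(k := bs @ \<alpha> k))"
proof -
  obtain ks where ks: "\<And>\<alpha>. Gam \<alpha> = gam k (\<alpha> k) * beads ks \<alpha>" "set ks \<subseteq> {1..r+s}" "k \<notin> set ks"
    using Gam_split[OF assms] by blast
  have "beads ks (\<alpha>(k := bs @ \<alpha> k)) = beads ks \<alpha>" using ks by (intro beads_cong) auto
  then show ?thesis using ks(1) by (simp add: gam_append mult.assoc)
qed

lemma Gam_gam:
  assumes "k \<in> {1..r+s}" shows "Gam \<alpha> * gam k bs = Gam (\<alpha>(k := \<alpha> k @ bs))"
proof -
  obtain ks where ks: "\<And>\<alpha>. Gam \<alpha> = gam k (\<alpha> k) * beads ks \<alpha>" "set ks \<subseteq> {1..r+s}" "k \<notin> set ks"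
    using Gam_split[OF assms] by blast
  have "beads ks (\<alpha>(k := \<alpha> k @ bs)) = beads ks \<alpha>" using ks by (intro beads_cong) auto
  then show ?thesis using ks(1) gam_beads_commute[OF ks(2) assms ks(3)]
    by (simp add: gam_append mult.assoc)
qed

lemma T_Gam:
  assumes "\<sigma> \<in> Sym" shows "T \<sigma> * Gam \<alpha> = Gam (\<alpha> \<circ> inv_into UNIV \<sigma>) * T \<sigma>"
proof -
  have *: "T \<sigma> * beads ks \<alpha> = beads (map \<sigma> ks) (\<alpha> \<circ> inv_into UNIV \<sigma>) * T \<sigma>"
    if "set ks \<subseteq> {1..r+s}" for ks
    using that
  proof (induction ks)
    case (Cons k ks)
    then have "T \<sigma> * gam k (\<alpha> k) = gam (\<sigma> k) (\<alpha> k) * T \<sigma>" using T_gam[OF assms] by simp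
    then show ?case using Cons assms by (simp add: intertwine_right)
  qed simp
  have inj: "inj_on \<sigma> A" for A using Sym_bij[OF assms] by (metis bij_betw_def inj_on_subset subset_UNIV)
  have "\<sigma> ` {1..r+s} \<subseteq> {1..r+s}" using Sym_bounds[OF assms] by blast
  then have "\<sigma> ` {1..r+s} = {1..r+s}" by (intro endo_inj_surj inj) auto
  then have s: "set (map \<sigma> strands) = set strands" by simp
  have "distinct (map \<sigma> strands)" using inj distinct_strands by (simp add: distinct_map)
  then have "mset (map \<sigma> strands) = mset strands"
    using set_eq_iff_mset_eq_distinct distinct_strands s by blast
  then have "beads (map \<sigma> strands) \<beta> = Gam \<beta>" for \<beta>
    unfolding Gam_def by (intro beads_cong_mset)
      (use s in auto)
  then show ?thesis using *[of "strands"] unfolding Gam_def by auto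
qed

lemma Gam_cap_commute:
  assumes "opp x y" "\<alpha> x = []" "\<alpha> y = []" shows "Gam \<alpha> * cap x y = cap x y * Gam \<alpha>"
proof -
  have "set ks \<subseteq> {1..r+s} \<Longrightarrow> cap x y * beads ks \<alpha> = beads ks \<alpha> * cap x y" for ks
  proof (induction ks)
    case (Cons k ks)
    then have "cap x y * gam k (\<alpha> k) = gam k (\<alpha> k) * cap x y"
      using cap_gam_commute[OF assms(1), of k] assms by (cases "k = x \<or> k = y") auto
    then show ?case using Cons by (simp add: intertwine_right)
  qed simp
  from this[of "strands"] show ?thesis by (auto simp: Gam_def)
qed

end

section \<open>Strand maps, words and arcs\<close>

text \<open>A diagram as a function: a vertex is sent to the beads met when walking along its strand and to the
  other end of the strand. Functions are easier to update than sets of oriented strands.\<close>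

type_synonym strand_map = "vertex \<Rightarrow> nat list \<times> vertex"

fun flip_row :: "vertex \<Rightarrow> vertex" where
  "flip_row (Top k) = Bot k"
| "flip_row (Bot k) = Top k"

definition id_map :: strand_map where
  "id_map v = ([], flip_row v)"

fun map_top :: "(nat \<Rightarrow> nat) \<Rightarrow> vertex \<Rightarrow> vertex" where
  "map_top \<sigma> (Top k) = Top (\<sigma> k)"
| "map_top \<sigma> (Bot k) = Bot k"

text \<open>The next three functions put a generator on top of a diagram: a crossing of the strands \<open>i\<close> and
  \<open>i + 1\<close>, a bead \<open>b\<close> on the strand \<open>k\<close>, and a cap that connects the strands at \<open>x\<close> and \<open>y\<close> with each
  other, above which a new strand joins \<open>x\<close> and \<open>y\<close>. When \<open>x\<close> and \<open>y\<close> are already joined, the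
  cap would close a loop.\<close>

definition swap_map :: "nat \<Rightarrow> strand_map \<Rightarrow> strand_map" where
  "swap_map i f v = (let (ns, w) = f (map_top (adj i) v) in (ns, map_top (adj i) w))"

definition bead_map :: "nat \<Rightarrow> nat \<Rightarrow> strand_map \<Rightarrow> strand_map" where
  "bead_map k b f v = (let (ns, w) = f v in
     ((if v = Top k then [b] else []) @ ns @ (if w = Top k then [b] else []), w))"

definition join_map :: "vertex \<Rightarrow> vertex \<Rightarrow> strand_map \<Rightarrow> strand_map" where
  "join_map x y f v =
     (if v = x then ([], y) else if v = y then ([], x)
      else let (ns, w) = f v in
        if w = x then (ns @ fst (f y), snd (f y))
        else if w = y then (ns @ fst (f x), snd (f x))
        else (ns, w))"

lemma join_map_commute: "x \<noteq> y \<Longrightarrow> join_map x y f = join_map y x f"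
  by (auto simp: join_map_def fun_eq_iff split: prod.split)

text \<open>The parameter \<open>m\<close> is the number of beads that are already present.\<close>

fun act :: "nat \<Rightarrow> nat \<Rightarrow> generator \<Rightarrow> strand_map \<Rightarrow> strand_map option" where
  "act r m (S i) f = Some (swap_map i f)"
| "act r m E f = (if snd (f (Top r)) = Top (r + 1) then None
     else Some (join_map (Top r) (Top (r + 1)) f))"
| "act r m (C k) f = Some (bead_map k (Suc m) f)"

definition count_C :: "generator list \<Rightarrow> nat" where
  "count_C w = length (filter is_C w)"

lemma count_C_simps [simp]: "count_C [] = 0" "count_C (g # w) = (if is_C g then Suc (count_C w) else count_C w)"
  "count_C (v @ w) = count_C v + count_C w"
  by (simp_all add: count_C_def)

fun act_word :: "nat \<Rightarrow> nat \<Rightarrow> generator list \<Rightarrow> strand_map \<Rightarrow> strand_map option" where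
  "act_word r m [] f = Some f"
| "act_word r m (g # w) f = Option.bind (act r m g f) (act_word r (m + count_C [g]) w)"

lemma act_word_append:
  "act_word r m (v @ w) f = Option.bind (act_word r m v f) (act_word r (m + count_C v) w)"
  by (induction v arbitrary: m f) (auto split: bind_split)

context bead_monoid
begin

text \<open>The coloured version of a word: the \<open>i\<close>-th odd letter gets the colour \<open>i\<close>, which is also the number of
  the bead that it produces in the diagram.\<close>

fun letter :: "nat \<Rightarrow> generator \<Rightarrow> 'm" where
  "letter m (S i) = sg i"
| "letter m E = ee"
| "letter m (C k) = gm k (Suc m)"

fun word :: "nat \<Rightarrow> generator list \<Rightarrow> 'm" where
  "word m [] = 1"
| "word m (g # w) = letter m g * word (m + count_C [g]) w"

lemma word_append: "word m (v @ w) = word m v * word (m + count_C v) w"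
  by (induction v arbitrary: m) (auto simp: mult.assoc)

text \<open>A triple \<open>(x, bs, y)\<close> is an arc at the bottom from \<open>x\<close> to \<open>y\<close> with beads \<open>bs\<close>. Arcs are listed with
  their left end first, and \<open>link\<close> reads them in both directions.\<close>

definition arc :: "nat \<times> nat list \<times> nat \<Rightarrow> 'm" where
  "arc = (\<lambda>(x, bs, y). gam x bs * cap x y)"

definition arcs :: "(nat \<times> nat list \<times> nat) list \<Rightarrow> 'm" where
  "arcs ps = prod_list (map arc ps)"

definition arcs_ok :: "(nat \<times> nat list \<times> nat) list \<Rightarrow> bool" where
  "arcs_ok ps \<longleftrightarrow> distinct ps \<and> (\<forall>(x, bs, y) \<in> set ps. opp x y \<and> x \<le> r) \<and>
     (\<forall>(x, bs, y) \<in> set ps. \<forall>(x', bs', y') \<in> set ps. x = x' \<or> y = y' \<longrightarrow> (x, bs, y) = (x', bs', y'))"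

definition link :: "(nat \<times> nat list \<times> nat) list \<Rightarrow> nat \<Rightarrow> nat list \<Rightarrow> nat \<Rightarrow> bool" where
  "link ps x bs y \<longleftrightarrow> (x, bs, y) \<in> set ps \<or> (y, rev bs, x) \<in> set ps"

definition unlinked :: "(nat \<times> nat list \<times> nat) list \<Rightarrow> nat \<Rightarrow> bool" where
  "unlinked ps x \<longleftrightarrow> (\<forall>bs y. \<not> link ps x bs y)"

lemma link_sym: "link ps x bs y \<Longrightarrow> link ps y (rev bs) x"
  by (auto simp: link_def)

lemma arcs_ok_unique:
  assumes "arcs_ok ps" "(x, bs, y) \<in> set ps" "(x', bs', y') \<in> set ps" "x = x' \<or> y = y'"
  shows "x = x' \<and> bs = bs' \<and> y = y'"
proof -
  have "\<forall>(x, bs, y) \<in> set ps. \<forall>(x', bs', y') \<in> set ps. x = x' \<or> y = y' \<longrightarrow> (x, bs, y) = (x', bs', y')"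
    using assms(1) by (simp add: arcs_ok_def)
  from bspec[OF bspec[OF this assms(2), simplified] assms(3)] show ?thesis using assms(4) by auto
qed

lemma arcs_ok_opp: "arcs_ok ps \<Longrightarrow> (x, bs, y) \<in> set ps \<Longrightarrow> opp x y \<and> x \<le> r \<and> \<not> y \<le> r"
  by (auto simp: arcs_ok_def opp_def)

lemma link_opp: "arcs_ok ps \<Longrightarrow> link ps x bs y \<Longrightarrow> opp x y"
  unfolding link_def using arcs_ok_opp opp_commute by blast

lemma link_unique:
  assumes "arcs_ok ps" "link ps x bs y" "link ps x bs' y'" shows "bs = bs' \<and> y = y'"
proof -
  have "x \<le> r \<Longrightarrow> (x, cs, z) \<in> set ps" "\<not> x \<le> r \<Longrightarrow> (z, rev cs, x) \<in> set ps" if "link ps x cs z" for cs z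
    using that arcs_ok_opp[OF assms(1)] unfolding link_def by blast+
  from this[OF assms(2)] this[OF assms(3)] show ?thesis
    using arcs_ok_unique[OF assms(1)] rev_is_rev_conv[of bs bs'] by (cases "x \<le> r") blast+
qed

lemma arc_commute:
  assumes "opp x y" "opp x' y'" "{x, y} \<inter> {x', y'} = {}"
  shows "arc (x, bs, y) * arc (x', bs', y') = arc (x', bs', y') * arc (x, bs, y)"
proof -
  have b: "x \<in> {1..r+s}" "x' \<in> {1..r+s}" using assms by (auto simp: opp_def)
  have ne: "x \<noteq> x'" "x \<noteq> y'" "x' \<noteq> x" "x' \<noteq> y" using assms(3) by auto
  have 1: "arc (x, bs, y) * gam x' bs' = gam x' bs' * arc (x, bs, y)"
    unfolding arc_def prod.case
    by (rule intertwine_left[OF cap_gam_commute[OF assms(1) b(2) ne(3,4)] gam_commute[OF b ne(1)]])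
  have 2: "arc (x, bs, y) * cap x' y' = cap x' y' * arc (x, bs, y)"
    unfolding arc_def prod.case
    by (rule intertwine_left[OF cap_cap_commute[OF assms] cap_gam_commute[OF assms(2) b(1) ne(1,2), symmetric]])
  from intertwine_right[OF 1 2] show ?thesis by (simp add: arc_def)
qed

lemma arc_swap: "opp x y \<Longrightarrow> arc (x, bs, y) = arc (y, rev bs, x)"
  using gam_cap[of x y bs] by (simp add: arc_def cap_commute)

lemma arcs_cong_mset:
  assumes "arcs_ok ps" "mset ps = mset qs" shows "arcs ps = arcs qs"
  unfolding arcs_def
proof (rule prod_list_cong_mset[OF assms(2)])
  fix p q assume p: "p \<in> set ps" and q: "q \<in> set ps"
  obtain x bs y x' bs' y' where eq: "p = (x, bs, y)" "q = (x', bs', y')" by (metis prod_cases3)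
  have o: "opp x y" "x \<le> r" "\<not> y \<le> r" "opp x' y'" "x' \<le> r" "\<not> y' \<le> r"
    using arcs_ok_opp[OF assms(1)] p q eq by blast+
  show "arc p * arc q = arc q * arc p"
  proof (cases "p = q")
    case False
    then have "x \<noteq> x'" "y \<noteq> y'" using arcs_ok_unique[OF assms(1)] p q eq by blast+
    then have "{x, y} \<inter> {x', y'} = {}" using o by auto
    then show ?thesis using arc_commute o eq by blast
  qed simp
qed

text \<open>Arcs with different ends commute, so any arc can be moved to the right end of the product. What is
  true to the right of a cap is therefore true to the right of the arcs.\<close>

lemma arcs_absorb:
  assumes "arcs_ok ps" "link ps x bs y" "cap x y * u = cap x y * v"
  shows "arcs ps * u = arcs ps * v"
proof -
  obtain p where p: "p \<in> set ps" "arc p = gam x bs * cap x y"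
    using assms(2) arc_swap[OF link_opp[OF assms(1,2)], of bs] by (force simp: link_def arc_def)
  have "mset ps = mset (remove1 p ps @ [p])" using p by simp
  from arcs_cong_mset[OF assms(1) this] have "arcs ps = arcs (remove1 p ps) * gam x bs * cap x y"
    using p by (simp add: arcs_def mult.assoc)
  then show ?thesis using assms(3) by (simp add: mult.assoc)
qed

lemma arcs_absorb2:
  assumes "arcs_ok ps" "(x, bs, y) \<in> set ps" "(x', bs', y') \<in> set ps" "x \<noteq> x'"
    "cap x y * cap x' y' * u = cap x y * cap x' y' * v"
  shows "arcs ps * u = arcs ps * v"
proof -
  let ?p = "(x, bs, y)" and ?q = "(x', bs', y')"
  let ?qs = "remove1 ?q (remove1 ?p ps)"
  have "opp x y" "opp x' y'" "x' \<le> r" "\<not> y \<le> r"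
    using arcs_ok_opp[OF assms(1)] assms(2-3) by blast+
  then have o: "opp x y" "opp x' y'" "x' \<in> {1..r+s}" "x' \<noteq> y" "x' \<noteq> x"
    using assms(4) opp_bounds by auto
  have q: "?q \<in> set (remove1 ?p ps)" using assms by (simp add: in_set_remove1)
  have "mset ps = mset (?p # remove1 ?p ps)" using perm_remove[OF assms(2)] by simp
  also have "\<dots> = mset (?p # ?q # ?qs)" using perm_remove[OF q] by simp
  finally have "mset ps = mset (?qs @ [?p, ?q])" by simp
  from arcs_cong_mset[OF assms(1) this]
  have "arcs ps = arcs ?qs * gam x bs * (cap x y * gam x' bs') * cap x' y'"
    by (simp add: arcs_def arc_def mult.assoc)
  then have "arcs ps = arcs ?qs * gam x bs * gam x' bs' * (cap x y * cap x' y')"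
    unfolding cap_gam_commute[OF o(1,3,5,4)] by (simp add: mult.assoc)
  then show ?thesis using assms(5) by (simp add: mult.assoc)
qed

text \<open>To the right of an arc all beads of its two strands can be collected on one of them. Hence only the
  combined bead word of the two strands matters, which is the next lemma.\<close>

lemma arcs_Gam_merge:
  assumes "arcs_ok ps" "link ps x bs y"
  shows "arcs ps * Gam \<alpha> = arcs ps * Gam (\<alpha>(x := [], y := rev (\<alpha> x) @ \<alpha> y))"
proof (rule arcs_absorb[OF assms])
  have o: "opp x y" by (rule link_opp[OF assms])
  then have xy: "x \<in> {1..r+s}" "y \<in> {1..r+s}" "x \<noteq> y" using opp_bounds by blast+
  have "Gam \<alpha> = gam x (\<alpha> x) * Gam (\<alpha>(x := []))" using gam_Gam[OF xy(1)] by simp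
  then have "cap x y * Gam \<alpha> = cap x y * gam y (rev (\<alpha> x)) * Gam (\<alpha>(x := []))"
    using cap_gam[OF o] by (simp flip: mult.assoc)
  then show "cap x y * Gam \<alpha> = cap x y * Gam (\<alpha>(x := [], y := rev (\<alpha> x) @ \<alpha> y))"
    using gam_Gam[OF xy(2)] xy(3) by (simp add: mult.assoc)
qed

lemma arcs_Gam_cong:
  assumes "arcs_ok ps" "set qs \<subseteq> set ps" "distinct qs"
    "\<forall>(x, bs, y) \<in> set qs. rev (\<alpha> x) @ \<alpha> y = rev (\<beta> x) @ \<beta> y"
    "\<forall>k. k \<notin> fst ` set qs \<and> k \<notin> (snd \<circ> snd) ` set qs \<longrightarrow> \<alpha> k = \<beta> k"
  shows "arcs ps * Gam \<alpha> = arcs ps * Gam \<beta>"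
  using assms(2-)
proof (induction qs arbitrary: \<alpha> \<beta>)
  case Nil
  then have "\<alpha> = \<beta>" by auto
  then show ?case by simp
next
  case (Cons p qs)
  obtain x bs y where p: "p = (x, bs, y)" by (metis prod_cases3)
  let ?m = "\<lambda>\<alpha>. \<alpha>(x := [], y := rev (\<alpha> x) @ \<alpha> y)"
  have l: "link ps x bs y" "(x, bs, y) \<in> set ps" using Cons.prems p by (auto simp: link_def)
  have sides: "x \<le> r" "\<not> y \<le> r" using arcs_ok_opp[OF assms(1) l(2)] by auto
  have dis: "x \<noteq> x' \<and> y \<noteq> y' \<and> x' \<noteq> y \<and> x \<noteq> y'" if "(x', bs', y') \<in> set qs" for x' bs' y'
  proof -
    have m: "(x', bs', y') \<in> set ps" using that Cons.prems by auto
    have "(x, bs, y) \<noteq> (x', bs', y')" using that Cons.prems p by auto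
    then have "x \<noteq> x'" "y \<noteq> y'" using arcs_ok_unique[OF assms(1) l(2) m] by blast+
    moreover have "x' \<le> r" "\<not> y' \<le> r" using arcs_ok_opp[OF assms(1) m] by blast+
    ultimately show ?thesis using sides by blast
  qed
  have e: "rev (\<alpha> x) @ \<alpha> y = rev (\<beta> x) @ \<beta> y" using Cons.prems(3) p by simp
  have "arcs ps * Gam (?m \<alpha>) = arcs ps * Gam (?m \<beta>)"
  proof (rule Cons.IH)
    show "\<forall>(x', bs', y') \<in> set qs. rev (?m \<alpha> x') @ ?m \<alpha> y' = rev (?m \<beta> x') @ ?m \<beta> y'"
    proof clarify
      fix x' bs' y' assume q: "(x', bs', y') \<in> set qs"
      then have "rev (\<alpha> x') @ \<alpha> y' = rev (\<beta> x') @ \<beta> y'" using Cons.prems(3) by fastforce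
      then show "rev (?m \<alpha> x') @ ?m \<alpha> y' = rev (?m \<beta> x') @ ?m \<beta> y'" using dis[OF q] by auto
    qed
    show "\<forall>k. k \<notin> fst ` set qs \<and> k \<notin> (snd \<circ> snd) ` set qs \<longrightarrow> ?m \<alpha> k = ?m \<beta> k"
      using Cons.prems(4) e by (auto simp: p)
  qed (use Cons.prems in auto)
  then show ?case using arcs_Gam_merge[OF assms(1) l(1)] by metis
qed

text \<open>A permutation of the arcs, which may ignore their beads, is a product of exchanges of two arcs. These
  are absorbed by \<open>cap_cap_swap\<close>. The induction is on the number of arcs that move.\<close>

lemma arcs_T_absorb:
  assumes "arcs_ok ps" "\<sigma> \<in> Sym" "\<And>x bs y. (x, bs, y) \<in> set ps \<Longrightarrow> \<exists>bs'. (\<sigma> x, bs', \<sigma> y) \<in> set ps"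
    "\<And>k. k \<notin> fst ` set ps \<Longrightarrow> k \<notin> (snd \<circ> snd) ` set ps \<Longrightarrow> \<sigma> k = k"
  shows "arcs ps * T \<sigma> = arcs ps"
  using assms(2-)
proof (induction "card {x \<in> fst ` set ps. \<sigma> x \<noteq> x}" arbitrary: \<sigma> rule: less_induct)
  case less
  note uniq = arcs_ok_unique[OF assms(1)]
  show ?case
  proof (cases "\<exists>x \<in> fst ` set ps. \<sigma> x \<noteq> x")
    case False
    have "\<sigma> k = k" for k
    proof -
      consider "k \<in> fst ` set ps" | "k \<in> (snd \<circ> snd) ` set ps"
        | "k \<notin> fst ` set ps" "k \<notin> (snd \<circ> snd) ` set ps" by blast
      then show ?thesis
      proof cases
        case 2
        then obtain x bs where p: "(x, bs, k) \<in> set ps" by force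
        then have "\<sigma> x = x" using False by force
        then obtain bs' where "(x, bs', \<sigma> k) \<in> set ps" using less.prems(2)[OF p] by auto
        then show ?thesis using uniq[OF p] by metis
      qed (use False less.prems in auto)
    qed
    then have "\<sigma> = id" by auto
    then show ?thesis by simp
  next
    case True
    then obtain x bs y where p: "(x, bs, y) \<in> set ps" "\<sigma> x \<noteq> x" by force
    then obtain bs' where q: "(\<sigma> x, bs', \<sigma> y) \<in> set ps" using less.prems(2) by blast
    have o: "opp x y" "opp (\<sigma> x) (\<sigma> y)" "x \<le> r" "\<sigma> x \<le> r" "\<not> y \<le> r" "\<not> \<sigma> y \<le> r"
      using arcs_ok_opp[OF assms(1)] p q by blast+
    have yy: "\<sigma> y \<noteq> y" using uniq[OF p(1) q] p(2) by auto
    \<comment> \<open>Exchanging the arc at \<open>x\<close> with its image puts one more arc in its place.\<close>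
    let ?\<tau> = "Transposition.transpose x (\<sigma> x) \<circ> Transposition.transpose y (\<sigma> y)"
    have \<tau>: "?\<tau> \<in> Sym" using o by (intro Sym_comp Sym_transpose) (auto simp: opp_def)
    have inv: "?\<tau> \<circ> (?\<tau> \<circ> \<sigma>) = \<sigma>"
      using o by (auto simp: fun_eq_iff Transposition.transpose_def)
    have inj: "\<sigma> a = \<sigma> b \<longleftrightarrow> a = b" for a b using less.prems(1) by (rule Sym_eq_iff)
    have left: "?\<tau> k = (if k = x then \<sigma> x else if k = \<sigma> x then x else k)" if "k \<le> r" for k
      using that o by (auto simp: Transposition.transpose_def)
    have right: "?\<tau> k = (if k = y then \<sigma> y else if k = \<sigma> y then y else k)" if "\<not> k \<le> r" for k
      using that o by (auto simp: Transposition.transpose_def)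
    have "{z \<in> fst ` set ps. (?\<tau> \<circ> \<sigma>) z \<noteq> z} \<subset> {z \<in> fst ` set ps. \<sigma> z \<noteq> z}"
    proof
      show "{z \<in> fst ` set ps. (?\<tau> \<circ> \<sigma>) z \<noteq> z} \<subseteq> {z \<in> fst ` set ps. \<sigma> z \<noteq> z}"
      proof (rule subsetI, rule CollectI, rule conjI)
        fix z assume z: "z \<in> {z \<in> fst ` set ps. (?\<tau> \<circ> \<sigma>) z \<noteq> z}"
        then show "z \<in> fst ` set ps" by blast
        then have zr: "z \<le> r" using arcs_ok_opp[OF assms(1)] by force
        show "\<sigma> z \<noteq> z"
        proof
          assume e: "\<sigma> z = z"
          then have "?\<tau> z \<noteq> z" using z by simp
          then have "z = x \<or> z = \<sigma> x" using left[OF zr] by presburger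
          then show False using e inj[of x z] p(2) by auto
        qed
      qed
      have "(?\<tau> \<circ> \<sigma>) x = x" using left[of "\<sigma> x"] o p by simp
      moreover have "x \<in> fst ` set ps" using p by force
      ultimately show "{z \<in> fst ` set ps. (?\<tau> \<circ> \<sigma>) z \<noteq> z} \<noteq> {z \<in> fst ` set ps. \<sigma> z \<noteq> z}"
        using p by blast
    qed
    then have "card {z \<in> fst ` set ps. (?\<tau> \<circ> \<sigma>) z \<noteq> z} < card {z \<in> fst ` set ps. \<sigma> z \<noteq> z}"
      by (intro psubset_card_mono) auto
    then have "arcs ps * T (?\<tau> \<circ> \<sigma>) = arcs ps"
    proof (rule less.hyps)
      fix z bs'' w assume z: "(z, bs'', w) \<in> set ps"
      then obtain cs where c: "(\<sigma> z, cs, \<sigma> w) \<in> set ps" using less.prems(2) by blast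
      have cr: "\<sigma> z \<le> r" "\<not> \<sigma> w \<le> r" using arcs_ok_opp[OF assms(1) c] by auto
      consider "\<sigma> z = x" "\<sigma> w = y" | "\<sigma> z = \<sigma> x" "\<sigma> w = \<sigma> y"
        | "\<sigma> z \<noteq> x" "\<sigma> z \<noteq> \<sigma> x" "\<sigma> w \<noteq> y" "\<sigma> w \<noteq> \<sigma> y"
        using uniq[OF c p(1)] uniq[OF c q] by blast
      then show "\<exists>bs'. ((?\<tau> \<circ> \<sigma>) z, bs', (?\<tau> \<circ> \<sigma>) w) \<in> set ps"
      proof cases
        case 1
        then have "(?\<tau> \<circ> \<sigma>) z = \<sigma> x" "(?\<tau> \<circ> \<sigma>) w = \<sigma> y" using left[of x] right[of y] o by simp_all
        then show ?thesis using q by metis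
      next
        case 2
        then have "(?\<tau> \<circ> \<sigma>) z = x" "(?\<tau> \<circ> \<sigma>) w = y" using left[of "\<sigma> x"] right[of "\<sigma> y"] o p(2) yy by simp_all
        then show ?thesis using p(1) by metis
      next
        case 3
        then have "(?\<tau> \<circ> \<sigma>) z = \<sigma> z" "(?\<tau> \<circ> \<sigma>) w = \<sigma> w" using left[OF cr(1)] right[OF cr(2)] by simp_all
        then show ?thesis using c by metis
      qed
    next
      fix k assume k: "k \<notin> fst ` set ps" "k \<notin> (snd \<circ> snd) ` set ps"
      have "x \<in> fst ` set ps" "\<sigma> x \<in> fst ` set ps" using image_eqI[OF _ p(1), of _ fst] image_eqI[OF _ q, of _ fst] by auto
      moreover have "y \<in> (snd \<circ> snd) ` set ps" "\<sigma> y \<in> (snd \<circ> snd) ` set ps"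
        using image_eqI[OF _ p(1), of _ "snd \<circ> snd"] image_eqI[OF _ q, of _ "snd \<circ> snd"] by auto
      ultimately have "\<sigma> k = k" "k \<noteq> x" "k \<noteq> \<sigma> x" "k \<noteq> y" "k \<noteq> \<sigma> y" using less.prems(3) k by blast+
      then show "(?\<tau> \<circ> \<sigma>) k = k" by simp
    next
      show "?\<tau> \<circ> \<sigma> \<in> Sym" by (rule Sym_comp[OF \<tau> less.prems(1)])
    qed
    moreover have "arcs ps * T ?\<tau> = arcs ps"
      using arcs_absorb2[OF assms(1) p(1) q, of "T ?\<tau>" 1] cap_cap_swap[of x y "\<sigma> x" "\<sigma> y"] o p yy by simp
    moreover have "T \<sigma> = T ?\<tau> * T (?\<tau> \<circ> \<sigma>)"
      using T_comp[OF \<tau> Sym_comp[OF \<tau> less.prems(1)]] unfolding inv .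
    ultimately show ?thesis by (simp flip: mult.assoc)
  qed
qed

end

section \<open>Normal forms of words\<close>

context bead_monoid
begin

text \<open>The strand map \<open>f\<close> is the diagram with the arcs \<open>ps\<close> at the bottom, the beads \<open>\<alpha> k\<close> on the strand \<open>k\<close>
  in the middle, and the permutation \<open>\<sigma>\<close> at the top, where the top vertex \<open>a\<close> continues the strand
  \<open>\<sigma> a\<close>. Each arc is a cap and a cup, so it also joins two strands from above. The beads of an arc sit
  on its bottom part, and beads on the upper part are those of \<open>\<alpha>\<close>.\<close>

definition describes :: "strand_map \<Rightarrow> (nat \<times> nat list \<times> nat) list \<Rightarrow> (nat \<Rightarrow> nat list) \<Rightarrow> (nat \<Rightarrow> nat) \<Rightarrow> bool" where
  "describes f ps \<alpha> \<sigma> \<longleftrightarrow> \<sigma> \<in> Sym \<and> arcs_ok ps \<and>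
     (\<forall>x bs y. link ps x bs y \<longrightarrow> f (Bot x) = (bs, Bot y)) \<and>
     (\<forall>a bs b. link ps (\<sigma> a) bs (\<sigma> b) \<longrightarrow> f (Top a) = (rev (\<alpha> (\<sigma> a)) @ \<alpha> (\<sigma> b), Top b)) \<and>
     (\<forall>a \<in> {1..r+s}. unlinked ps (\<sigma> a) \<longrightarrow>
        f (Top a) = (rev (\<alpha> (\<sigma> a)), Bot (\<sigma> a)) \<and> f (Bot (\<sigma> a)) = (\<alpha> (\<sigma> a), Top a))"

definition form :: "(nat \<times> nat list \<times> nat) list \<Rightarrow> (nat \<Rightarrow> nat list) \<Rightarrow> (nat \<Rightarrow> nat) \<Rightarrow> 'm" where
  "form ps \<alpha> \<sigma> = arcs ps * Gam \<alpha> * T \<sigma>"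

lemma describes_id: "describes id_map [] (\<lambda>_. []) id"
  by (auto simp: describes_def id_map_def arcs_ok_def link_def)

lemma form_id: "form [] (\<lambda>_. []) id = 1"
  by (simp add: form_def arcs_def Gam_Nil)

lemma swap_step:
  assumes "describes f ps \<alpha> \<sigma>" "i \<in> s_indices r s"
  shows "describes (swap_map i f) ps \<alpha> (\<sigma> \<circ> adj i)" "form ps \<alpha> \<sigma> * sg i = form ps \<alpha> (\<sigma> \<circ> adj i)"
proof -
  have S: "\<sigma> \<in> Sym" using assms(1) by (simp add: describes_def)
  have rng: "adj i a \<in> {1..r+s} \<longleftrightarrow> a \<in> {1..r+s}" for a using Sym_bounds[OF Sym_adj[OF assms(2)]] .
  have 1: "f (Top (adj i a)) = (rev (\<alpha> (\<sigma> (adj i a))) @ \<alpha> (\<sigma> (adj i b)), Top (adj i b))"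
    if "link ps (\<sigma> (adj i a)) bs (\<sigma> (adj i b))" for a bs b
    using that assms(1) by (simp add: describes_def)
  have 2: "f (Top (adj i a)) = (rev (\<alpha> (\<sigma> (adj i a))), Bot (\<sigma> (adj i a)))"
     "f (Bot (\<sigma> (adj i a))) = (\<alpha> (\<sigma> (adj i a)), Top (adj i a))"
    if "unlinked ps (\<sigma> (adj i a))" "a \<in> {1..r+s}" for a
    using that assms(1) rng[of a] unfolding describes_def by blast+
  show "describes (swap_map i f) ps \<alpha> (\<sigma> \<circ> adj i)"
    unfolding describes_def
  proof (intro conjI allI impI ballI)
    show "\<sigma> \<circ> adj i \<in> Sym" using S Sym_adj[OF assms(2)] by (rule Sym_comp)
    show "arcs_ok ps" using assms(1) by (simp add: describes_def)
  next
    fix x bs y assume "link ps x bs y"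
    then have "f (Bot x) = (bs, Bot y)" using assms(1) by (simp add: describes_def)
    then show "swap_map i f (Bot x) = (bs, Bot y)" by (simp add: swap_map_def)
  next
    fix a bs b assume "link ps ((\<sigma> \<circ> adj i) a) bs ((\<sigma> \<circ> adj i) b)"
    then show "swap_map i f (Top a) = (rev (\<alpha> ((\<sigma> \<circ> adj i) a)) @ \<alpha> ((\<sigma> \<circ> adj i) b), Top b)"
      using 1[of a bs b] by (simp add: swap_map_def)
  next
    fix a assume "a \<in> {1..r+s}" "unlinked ps ((\<sigma> \<circ> adj i) a)"
    then show "swap_map i f (Top a) = (rev (\<alpha> ((\<sigma> \<circ> adj i) a)), Bot ((\<sigma> \<circ> adj i) a))"
      "swap_map i f (Bot ((\<sigma> \<circ> adj i) a)) = (\<alpha> ((\<sigma> \<circ> adj i) a), Top a)"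
      using 2[of a] by (simp_all add: swap_map_def)
  qed
  show "form ps \<alpha> \<sigma> * sg i = form ps \<alpha> (\<sigma> \<circ> adj i)"
    using T_comp[OF S Sym_adj[OF assms(2)]] T_adj[OF assms(2)] by (simp add: form_def mult.assoc)
qed

lemma bead_step:
  assumes "describes f ps \<alpha> \<sigma>" "k \<in> {1..r+s}"
  shows "describes (bead_map k b f) ps (\<alpha>(\<sigma> k := \<alpha> (\<sigma> k) @ [b])) \<sigma>"
    "form ps \<alpha> \<sigma> * gm k b = form ps (\<alpha>(\<sigma> k := \<alpha> (\<sigma> k) @ [b])) \<sigma>"
proof -
  have S: "\<sigma> \<in> Sym" and ok: "arcs_ok ps" using assms(1) by (auto simp: describes_def)
  have inj: "\<sigma> a = \<sigma> b \<longleftrightarrow> a = b" for a b by (rule Sym_eq_iff[OF S])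
  let ?\<beta> = "\<alpha>(\<sigma> k := \<alpha> (\<sigma> k) @ [b])"
  show "describes (bead_map k b f) ps ?\<beta> \<sigma>"
    unfolding describes_def
  proof (intro conjI allI impI ballI S ok)
    fix x bs y assume "link ps x bs y"
    then have "f (Bot x) = (bs, Bot y)" using assms(1) by (simp add: describes_def)
    then show "bead_map k b f (Bot x) = (bs, Bot y)" by (simp add: bead_map_def)
  next
    fix a bs c assume l: "link ps (\<sigma> a) bs (\<sigma> c)"
    then have f: "f (Top a) = (rev (\<alpha> (\<sigma> a)) @ \<alpha> (\<sigma> c), Top c)" using assms(1) by (simp add: describes_def)
    have "\<sigma> a \<noteq> \<sigma> c" using opp_bounds[OF link_opp[OF ok l]] by simp
    then show "bead_map k b f (Top a) = (rev (?\<beta> (\<sigma> a)) @ ?\<beta> (\<sigma> c), Top c)"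
      using f by (auto simp: bead_map_def inj)
  next
    fix a assume "a \<in> {1..r+s}" "unlinked ps (\<sigma> a)"
    then have f: "f (Top a) = (rev (\<alpha> (\<sigma> a)), Bot (\<sigma> a))" "f (Bot (\<sigma> a)) = (\<alpha> (\<sigma> a), Top a)"
      using assms(1) by (simp_all add: describes_def)
    then show "bead_map k b f (Top a) = (rev (?\<beta> (\<sigma> a)), Bot (\<sigma> a))"
      "bead_map k b f (Bot (\<sigma> a)) = (?\<beta> (\<sigma> a), Top a)"
      by (auto simp: bead_map_def inj)
  qed
  have "Gam \<alpha> * gm (\<sigma> k) b = Gam ?\<beta>" using Gam_gam[of "\<sigma> k" \<alpha> "[b]"] Sym_bounds[OF S] assms(2)
    by (simp only: gam_Cons gam_Nil mult_1_right)
  then show "form ps \<alpha> \<sigma> * gm k b = form ps ?\<beta> \<sigma>"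
    using T_gm[OF S assms(2)] by (simp add: form_def mult.assoc) (simp flip: mult.assoc)
qed

text \<open>The new cap is pulled down through the permutation and the beads of the other strands, and stops at
  the beads of its own strands.\<close>

lemma form_ee:
  assumes "1 \<le> r" "1 \<le> s" "\<sigma> \<in> Sym" "{a, b} = {r, r + 1}"
  shows "opp (\<sigma> a) (\<sigma> b)"
    "form ps \<alpha> \<sigma> * ee = arcs ps * (gam (\<sigma> a) (\<alpha> (\<sigma> a)) * gam (\<sigma> b) (\<alpha> (\<sigma> b)) * cap (\<sigma> a) (\<sigma> b) *
      (Gam (\<alpha>(\<sigma> a := [], \<sigma> b := [])) * T \<sigma>))"
proof -
  let ?x = "\<sigma> a" and ?y = "\<sigma> b"
  have o: "opp a b" using assms by (auto simp: opp_def doubleton_eq_iff)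
  have e: "cap a b = ee" using cap_base[OF assms(1,2)] assms(4) by (auto simp: doubleton_eq_iff cap_commute)
  show o': "opp ?x ?y" using o opp_Sym[OF assms(3)] by simp
  then have xy: "?x \<in> {1..r+s}" "?y \<in> {1..r+s}" "?x \<noteq> ?y" using opp_bounds by blast+
  let ?\<alpha> = "\<alpha>(?x := [], ?y := [])"
  have "?\<alpha>(?y := \<alpha> ?y) = \<alpha>(?x := [])" using xy(3) by (auto simp: fun_eq_iff)
  then have "gam ?y (\<alpha> ?y) * Gam ?\<alpha> = Gam (\<alpha>(?x := []))"
    using gam_Gam[OF xy(2), of "\<alpha> ?y" ?\<alpha>] by simp
  moreover have "gam ?x (\<alpha> ?x) * Gam (\<alpha>(?x := [])) = Gam \<alpha>" using gam_Gam[OF xy(1), of "\<alpha> ?x" "\<alpha>(?x := [])"] by simp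
  ultimately have "Gam \<alpha> = gam ?x (\<alpha> ?x) * gam ?y (\<alpha> ?y) * Gam ?\<alpha>" by (simp add: mult.assoc)
  moreover have "T \<sigma> * ee = cap ?x ?y * T \<sigma>" using T_cap[OF assms(3) o] unfolding e .
  moreover have "Gam ?\<alpha> * cap ?x ?y = cap ?x ?y * Gam ?\<alpha>" using xy by (intro Gam_cap_commute[OF o']) auto
  ultimately show "form ps \<alpha> \<sigma> * ee = arcs ps * (gam ?x (\<alpha> ?x) * gam ?y (\<alpha> ?y) * cap ?x ?y *
      (Gam ?\<alpha> * T \<sigma>))"
    by (simp add: form_def mult.assoc) (simp flip: mult.assoc)
qed

text \<open>The new cap meets an arc with the same two ends, so a loop is closed.\<close>

lemma loop_step:
  assumes "1 \<le> r" "1 \<le> s" "describes f ps \<alpha> \<sigma>" "snd (f (Top r)) = Top (r + 1)"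
  shows "form ps \<alpha> \<sigma> * ee = 0"
proof -
  have S: "\<sigma> \<in> Sym" and ok: "arcs_ok ps" using assms(3) by (auto simp: describes_def)
  let ?x = "\<sigma> r" and ?y = "\<sigma> (r + 1)"
  have r: "r \<in> {1..r+s}" using assms by auto
  have "\<not> unlinked ps ?x" using assms(3,4) r unfolding describes_def by force
  then obtain bs y where l: "link ps ?x bs y" unfolding unlinked_def by blast
  then have "link ps (\<sigma> r) bs (\<sigma> (inv_into UNIV \<sigma> y))" using S by simp
  then have "f (Top r) = (rev (\<alpha> ?x) @ \<alpha> y, Top (inv_into UNIV \<sigma> y))"
    using assms(3) S unfolding describes_def by (metis Sym_inv_simps(1))
  then have "y = ?y" using assms(4) S by (metis Sym_inv_simps(1) snd_conv vertex.inject(1))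
  then have l: "link ps ?x bs ?y" using l by simp
  have o: "opp ?x ?y" by (rule link_opp[OF ok l])
  have "cap ?x ?y * (gam ?x (\<alpha> ?x) * gam ?y (\<alpha> ?y) * cap ?x ?y) =
    cap ?x ?y * gam ?x (\<alpha> ?x) * (gam ?x (rev (\<alpha> ?y)) * cap ?x ?y)"
    using gam_cap[of ?y ?x "\<alpha> ?y"] o opp_commute cap_commute by (simp add: mult.assoc)
  also have "\<dots> = cap ?x ?y * gam ?x (\<alpha> ?x @ rev (\<alpha> ?y)) * cap ?x ?y"
    by (simp add: gam_append mult.assoc)
  also have "\<dots> = 0" by (rule cap_gam_cap[OF o])
  finally have z: "cap ?x ?y * (gam ?x (\<alpha> ?x) * gam ?y (\<alpha> ?y) * cap ?x ?y * (Gam (\<alpha>(?x := [], ?y := [])) * T \<sigma>)) =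
    cap ?x ?y * 0"
    by (simp flip: mult.assoc)
  show ?thesis using arcs_absorb[OF ok l z] form_ee(2)[OF assms(1,2) S refl] by simp
qed

text \<open>The cap just added meets a bottom arc at \<open>x\<close>: the arc turns it into a transposition.\<close>

lemma link_join_step:
  assumes "1 \<le> r" "1 \<le> s" "describes f ps \<alpha> \<sigma>" "{a, b} = {r, r + 1}" "a \<noteq> b"
    "link ps (\<sigma> a) bs (\<sigma> c)" "c \<noteq> b"
  defines "\<tau> \<equiv> Transposition.transpose (\<sigma> c) (\<sigma> b) \<circ> \<sigma>"
    and "\<beta> \<equiv> \<alpha>(\<sigma> a := [], \<sigma> c := [], \<sigma> b := \<alpha> (\<sigma> b) @ rev (\<alpha> (\<sigma> a)) @ \<alpha> (\<sigma> c))"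
  shows "describes (join_map (Top a) (Top b) f) ps \<beta> \<tau>" "form ps \<alpha> \<sigma> * ee = form ps \<beta> \<tau>"
proof -
  have S: "\<sigma> \<in> Sym" and ok: "arcs_ok ps" using assms(3) by (auto simp: describes_def)
  let ?x = "\<sigma> a" and ?y = "\<sigma> b" and ?z = "\<sigma> c"
  let ?t = "Transposition.transpose ?z ?y"
  have inj: "\<sigma> a = \<sigma> b \<longleftrightarrow> a = b" for a b by (rule Sym_eq_iff[OF S])
  have oy: "opp ?x ?y" by (rule form_ee(1)[OF assms(1,2) S assms(4)])
  have oz: "opp ?x ?z" by (rule link_opp[OF ok assms(6)])
  have ne: "?x \<noteq> ?y" "?x \<noteq> ?z" "?z \<noteq> ?y" "a \<noteq> c" using assms(5,7) opp_bounds[OF oz] inj by auto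
  have b: "?x \<in> {1..r+s}" "?y \<in> {1..r+s}" "?z \<in> {1..r+s}" "?y \<le> r \<longleftrightarrow> ?z \<le> r"
    using oy oz unfolding opp_def by blast+
  have t: "?t \<in> Sym" using b by (intro Sym_transpose) auto
  have tinv: "inv_into UNIV ?t = ?t" by (rule inv_unique_comp) (auto simp: fun_eq_iff)
  let ?\<alpha> = "\<alpha>(?x := [], ?y := [])"
  let ?a = "\<alpha> ?x" and ?b = "\<alpha> ?y"
  have "cap ?x ?z * (gam ?x ?a * gam ?y ?b * cap ?x ?y) = gam ?y ?b * (cap ?x ?z * (gam ?x ?a * cap ?x ?y))"
  proof -
    have "gam ?x ?a * gam ?y ?b = gam ?y ?b * gam ?x ?a" using b ne by (intro gam_commute) auto
    moreover have "cap ?x ?z * gam ?y ?b = gam ?y ?b * cap ?x ?z" using b ne by (intro cap_gam_commute oz) auto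
    ultimately show ?thesis by (simp add: mult.assoc) (simp flip: mult.assoc)
  qed
  also have "cap ?x ?z * (gam ?x ?a * cap ?x ?y) = cap ?x ?z * (cap ?x ?y * gam ?z (rev ?a))"
  proof -
    have "cap ?x ?y * gam ?z (rev ?a) = gam ?z (rev ?a) * cap ?x ?y"
      using b ne by (intro cap_gam_commute oy) auto
    moreover have "cap ?x ?z * (gam ?x ?a * cap ?x ?y) = cap ?x ?z * (gam ?z (rev ?a) * cap ?x ?y)"
      using cap_gam[OF oz, of ?a] by (simp flip: mult.assoc)
    ultimately show ?thesis by simp
  qed
  also have "\<dots> = cap ?x ?z * (T ?t * gam ?z (rev ?a))"
    using cap_cap_share[OF oz oy ne(3)] by (simp flip: mult.assoc)
  also have "T ?t * gam ?z (rev ?a) = gam ?y (rev ?a) * T ?t" using T_gam[OF t b(3)] by simp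
  also have "gam ?y ?b * (cap ?x ?z * (gam ?y (rev ?a) * T ?t)) = cap ?x ?z * (gam ?y (?b @ rev ?a) * T ?t)"
  proof -
    have "cap ?x ?z * gam ?y ?b = gam ?y ?b * cap ?x ?z" using b ne by (intro cap_gam_commute oz) auto
    then show ?thesis by (simp add: gam_append flip: mult.assoc)
  qed
  finally have "cap ?x ?z * (gam ?x ?a * gam ?y ?b * cap ?x ?y * (Gam ?\<alpha> * T \<sigma>)) =
    cap ?x ?z * (gam ?y (?b @ rev ?a) * (T ?t * Gam ?\<alpha>) * T \<sigma>)" by (simp flip: mult.assoc)
  also have "gam ?y (?b @ rev ?a) * (T ?t * Gam ?\<alpha>) * T \<sigma> = gam ?y (?b @ rev ?a) * Gam (?\<alpha> \<circ> ?t) * T \<tau>"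
    unfolding T_Gam[OF t] tinv \<tau>_def T_comp[OF t S] by (simp add: mult.assoc)
  also have "gam ?y (?b @ rev ?a) * Gam (?\<alpha> \<circ> ?t) = Gam \<beta>"
  proof -
    have "(?\<alpha> \<circ> ?t)(?y := (?b @ rev ?a) @ (?\<alpha> \<circ> ?t) ?y) = \<beta>"
      using ne by (auto simp: \<beta>_def fun_eq_iff Transposition.transpose_def)
    then show ?thesis using gam_Gam[OF b(2)] by metis
  qed
  finally have "arcs ps * (gam ?x ?a * gam ?y ?b * cap ?x ?y * (Gam ?\<alpha> * T \<sigma>)) = arcs ps * (Gam \<beta> * T \<tau>)"
    by (rule arcs_absorb[OF ok assms(6)])
  then show "form ps \<alpha> \<sigma> * ee = form ps \<beta> \<tau>"
    using form_ee(2)[OF assms(1,2) S assms(4)] by (simp add: form_def mult.assoc)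

  let ?j = "join_map (Top a) (Top b) f"
  have lk: "f (Top p) = (rev (\<alpha> (\<sigma> p)) @ \<alpha> (\<sigma> q), Top q)" if "link ps (\<sigma> p) cs (\<sigma> q)" for p cs q
    using assms(3) that by (simp add: describes_def)
  have ul: "f (Top p) = (rev (\<alpha> (\<sigma> p)), Bot (\<sigma> p))" "f (Bot (\<sigma> p)) = (\<alpha> (\<sigma> p), Top p)"
    if "p \<in> {1..r+s}" "unlinked ps (\<sigma> p)" for p
    using assms(3) that by (simp_all add: describes_def)
  have fa: "f (Top a) = (rev ?a @ \<alpha> ?z, Top c)" by (rule lk[OF assms(6)])
  have fc: "f (Top c) = (rev (\<alpha> ?z) @ ?a, Top a)" by (rule lk[OF link_sym[OF assms(6)]])
  have \<tau>: "\<tau> p = (if p = c then ?y else if p = b then ?z else \<sigma> p)" for p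
    using assms(7) by (auto simp: \<tau>_def Transposition.transpose_def inj)
  have u: "link ps ?x cs w \<Longrightarrow> w = ?z" "link ps ?z cs w \<Longrightarrow> w = ?x"
    "link ps w cs ?x \<Longrightarrow> w = ?z" "link ps w cs ?z \<Longrightarrow> w = ?x" for cs w
    using link_unique[OF ok assms(6)] link_unique[OF ok link_sym[OF assms(6)]] link_sym[of ps w cs] by blast+
  show "describes ?j ps \<beta> \<tau>"
    unfolding describes_def
  proof (intro conjI allI impI ballI)
    show "\<tau> \<in> Sym" unfolding \<tau>_def by (rule Sym_comp[OF t S])
    show "arcs_ok ps" by fact
  next
    fix x cs y assume "link ps x cs y"
    then have "f (Bot x) = (cs, Bot y)" using assms(3) by (simp add: describes_def)
    then show "?j (Bot x) = (cs, Bot y)" by (simp add: join_map_def)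
  next
    fix p cs q assume l: "link ps (\<tau> p) cs (\<tau> q)"
    have "\<tau> p \<noteq> \<tau> q" using opp_bounds[OF link_opp[OF ok l]] by simp
    then have pq: "p \<noteq> q" by auto
    consider "p = a" | "p = b" | "p = c" | "q = c" "p \<notin> {a, b, c}" | "p \<notin> {a, b, c}" "q \<noteq> c" by blast
    then show "?j (Top p) = (rev (\<beta> (\<tau> p)) @ \<beta> (\<tau> q), Top q)"
    proof cases
      case 1
      then have "link ps ?x cs (\<tau> q)" using l \<tau>[of p] assms(5) ne(4) by simp
      then have "\<tau> q = ?z" by (rule u(1))
      then have "q = b" using ne inj by (auto simp: \<tau> split: if_splits)
      then show ?thesis using 1 ne assms(5,7) by (simp add: join_map_def \<tau> \<beta>_def)
    next
      case 2
      then have "link ps ?z cs (\<tau> q)" using l \<tau>[of p] assms(7) by simp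
      then have "\<tau> q = ?x" by (rule u(2))
      then have "q = a" using ne inj by (auto simp: \<tau> split: if_splits)
      then show ?thesis using 2 ne assms(5,7) by (simp add: join_map_def \<tau> \<beta>_def)
    next
      case 3
      then have "link ps ?y cs (\<tau> q)" using l \<tau>[of p] by simp
      then have q: "\<tau> q \<noteq> ?x" "\<tau> q \<noteq> ?z" using u(3)[of ?y cs] u(4)[of ?y cs] ne by auto
      then have q': "q \<noteq> a" "q \<noteq> b" "\<tau> q = \<sigma> q" using 3 pq ne assms(5) \<tau> by auto
      then have "f (Top b) = (rev ?b @ \<alpha> (\<sigma> q), Top q)" using lk \<open>link ps ?y cs (\<tau> q)\<close> by metis
      then show ?thesis using 3 ne assms(5,7) q q' pq fc \<open>\<tau> p \<noteq> \<tau> q\<close> by (simp add: join_map_def \<tau> \<beta>_def)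
    next
      case 4
      then have p: "\<tau> p = \<sigma> p" "\<tau> q = ?y" using \<tau> by auto
      then have "f (Top p) = (rev (\<alpha> (\<sigma> p)) @ ?b, Top b)" using lk l by metis
      then show ?thesis using 4 ne assms(5,7) p fa by (simp add: join_map_def \<beta>_def inj)
    next
      case 5
      then have p: "\<tau> p = \<sigma> p" using \<tau> by auto
      have "q \<noteq> b"
      proof
        assume "q = b"
        then have "link ps (\<sigma> p) cs ?z" using l p \<tau>[of q] assms(7) by simp
        then have "\<sigma> p = ?x" by (rule u(4))
        then show False using 5 inj by simp
      qed
      moreover have "q \<noteq> a"
      proof
        assume "q = a"
        then have "link ps (\<sigma> p) cs ?x" using l p \<tau>[of q] ne(4) assms(5) by simp
        then have "\<sigma> p = ?z" by (rule u(3))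
        then show False using 5 inj by simp
      qed
      moreover have "\<tau> q = \<sigma> q" using 5 \<open>q \<noteq> b\<close> \<tau> by auto
      ultimately show ?thesis using 5 p lk l by (simp add: join_map_def \<beta>_def inj)
    qed
  next
    fix p assume p: "p \<in> {1..r+s}" "unlinked ps (\<tau> p)"
    have "p \<noteq> a" "p \<noteq> b" using p assms(6,7) link_sym[OF assms(6)] ne assms(5) \<tau> by (auto simp: unlinked_def)
    then have "?j (Top p) = (rev (\<beta> (\<tau> p)), Bot (\<tau> p)) \<and> ?j (Bot (\<tau> p)) = (\<beta> (\<tau> p), Top p)"
    proof (cases "p = c")
      case True
      then have "unlinked ps ?y" using p \<tau> by simp
      moreover have "b \<in> {1..r+s}" using b(2) Sym_bounds[OF S] by blast
      ultimately have "f (Top b) = (rev ?b, Bot ?y)" "f (Bot ?y) = (?b, Top b)" using ul by auto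
      then show ?thesis using True ne assms(5,7) fa fc \<tau> by (simp add: join_map_def \<beta>_def)
    next
      case False
      then have "\<tau> p = \<sigma> p" using \<open>p \<noteq> b\<close> \<tau> by simp
      then show ?thesis using ul[of p] p False \<open>p \<noteq> a\<close> \<open>p \<noteq> b\<close> by (simp add: join_map_def \<beta>_def inj)
    qed
    then show "?j (Top p) = (rev (\<beta> (\<tau> p)), Bot (\<tau> p))" "?j (Bot (\<tau> p)) = (\<beta> (\<tau> p), Top p)" by auto
  qed
qed

text \<open>The strands of the new cap end at the bottom, so the cap is a new arc that carries their beads.\<close>

lemma free_join_step:
  assumes "1 \<le> r" "1 \<le> s" "describes f ps \<alpha> \<sigma>" "unlinked ps (\<sigma> r)" "unlinked ps (\<sigma> (r + 1))"
  defines "p \<equiv> (\<sigma> r, \<alpha> (\<sigma> r) @ rev (\<alpha> (\<sigma> (r + 1))), \<sigma> (r + 1))"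
    and "\<beta> \<equiv> \<alpha>(\<sigma> r := [], \<sigma> (r + 1) := [])"
  shows "describes (join_map (Top r) (Top (r + 1)) f) (ps @ [p]) \<beta> \<sigma>"
    "form ps \<alpha> \<sigma> * ee = form (ps @ [p]) \<beta> \<sigma>"
proof -
  have S: "\<sigma> \<in> Sym" and ok: "arcs_ok ps" using assms(3) by (auto simp: describes_def)
  let ?x = "\<sigma> r" and ?y = "\<sigma> (r + 1)"
  have inj: "\<sigma> a = \<sigma> b \<longleftrightarrow> a = b" for a b by (rule Sym_eq_iff[OF S])
  have o: "opp ?x ?y" by (rule form_ee(1)[OF assms(1,2) S refl])
  have "gam ?y (\<alpha> ?y) * cap ?x ?y = gam ?x (rev (\<alpha> ?y)) * cap ?x ?y"
    using gam_cap[of ?y ?x] o opp_commute cap_commute by simp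
  then have "arc p = gam ?x (\<alpha> ?x) * gam ?y (\<alpha> ?y) * cap ?x ?y"
    by (simp add: p_def arc_def gam_append mult.assoc)
  then have "arcs (ps @ [p]) = arcs ps * (gam ?x (\<alpha> ?x) * gam ?y (\<alpha> ?y) * cap ?x ?y)"
    by (simp add: arcs_def)
  then show "form ps \<alpha> \<sigma> * ee = form (ps @ [p]) \<beta> \<sigma>"
    using form_ee(2)[OF assms(1,2) S refl] by (simp add: form_def \<beta>_def mult.assoc)

  let ?j = "join_map (Top r) (Top (r + 1)) f"
  have side: "?x \<le> r" "\<not> ?y \<le> r" using Sym_side[OF S] by auto
  have lnk: "link (ps @ [p]) u cs v \<longleftrightarrow> link ps u cs v \<or> (u, cs, v) = p \<or> (v, rev cs, u) = p" for u cs v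
    by (auto simp: link_def)
  have ns: "(?x, cs, v) \<notin> set ps" "(v, cs, ?x) \<notin> set ps" "(?y, cs, v) \<notin> set ps" "(v, cs, ?y) \<notin> set ps" for cs v
    using assms(4,5) unfolding unlinked_def link_def by (metis rev_rev_ident)+
  have nl: "\<not> link ps ?x cs v" "\<not> link ps v cs ?x" "\<not> link ps ?y cs v" "\<not> link ps v cs ?y" for cs v
    using ns by (auto simp: link_def)
  have rng: "r \<in> {1..r+s}" "r + 1 \<in> {1..r+s}" using assms by auto
  have ul: "f (Top p) = (rev (\<alpha> (\<sigma> p)), Bot (\<sigma> p))" "f (Bot (\<sigma> p)) = (\<alpha> (\<sigma> p), Top p)"
    if "p \<in> {1..r+s}" "unlinked ps (\<sigma> p)" for p
    using assms(3) that by (simp_all add: describes_def)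
  note fx = ul[OF rng(1) assms(4)] and fy = ul[OF rng(2) assms(5)]
  show "describes ?j (ps @ [p]) \<beta> \<sigma>"
    unfolding describes_def
  proof (intro conjI allI impI ballI S)
    have "distinct (ps @ [p])" using ok ns by (auto simp: arcs_ok_def p_def)
    moreover have "\<forall>(x, bs, y) \<in> set (ps @ [p]). opp x y \<and> x \<le> r"
      using ok o side by (auto simp: arcs_ok_def p_def)
    moreover have uniq: "(x, bs, y) = (x', bs', y')"
      if m: "(x, bs, y) \<in> set (ps @ [p])" "(x', bs', y') \<in> set (ps @ [p])" and e: "x = x' \<or> y = y'"
      for x bs y x' bs' y'
    proof -
      consider "(x, bs, y) \<in> set ps" "(x', bs', y') \<in> set ps" | "(x, bs, y) = p" "(x', bs', y') = p"
        | "(x, bs, y) \<in> set ps" "(x', bs', y') = p" | "(x, bs, y) = p" "(x', bs', y') \<in> set ps"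
        using m by auto
      then show ?thesis
      proof cases
        case 1
        then show ?thesis using arcs_ok_unique[OF ok] e by blast
      qed (use e ns p_def in auto)
    qed
    moreover have "case q of (x, bs, y) \<Rightarrow> case q' of (x', bs', y') \<Rightarrow> x = x' \<or> y = y' \<longrightarrow> (x, bs, y) = (x', bs', y')"
      if "q \<in> set (ps @ [p])" "q' \<in> set (ps @ [p])" for q q'
      using uniq that by (cases q, cases q') blast
    ultimately show "arcs_ok (ps @ [p])" by (simp only: arcs_ok_def) blast
  next
    fix u cs v assume l: "link (ps @ [p]) u cs v"
    consider "link ps u cs v" | "u = ?x" "v = ?y" "cs = \<alpha> ?x @ rev (\<alpha> ?y)"
      | "u = ?y" "v = ?x" "cs = \<alpha> ?y @ rev (\<alpha> ?x)"
      using l[unfolded lnk] unfolding p_def by (auto simp: rev_swap)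
    then show "?j (Bot u) = (cs, Bot v)"
    proof cases
      case 1
      then have "f (Bot u) = (cs, Bot v)" using assms(3) by (simp add: describes_def)
      then show ?thesis by (simp add: join_map_def)
    qed (use fx fy in \<open>simp_all add: join_map_def\<close>)
  next
    fix c cs d assume l: "link (ps @ [p]) (\<sigma> c) cs (\<sigma> d)"
    consider "link ps (\<sigma> c) cs (\<sigma> d)" | "c = r" "d = r + 1" | "c = r + 1" "d = r"
      using l[unfolded lnk] unfolding p_def by (auto simp: inj)
    then show "?j (Top c) = (rev (\<beta> (\<sigma> c)) @ \<beta> (\<sigma> d), Top d)"
    proof cases
      case 1
      then have f: "f (Top c) = (rev (\<alpha> (\<sigma> c)) @ \<alpha> (\<sigma> d), Top d)" using assms(3) by (simp add: describes_def)
      have "c \<noteq> r" "c \<noteq> r + 1" "d \<noteq> r" "d \<noteq> r + 1" using 1 nl by auto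
      then show ?thesis using f by (simp add: join_map_def \<beta>_def inj)
    qed (simp_all add: join_map_def \<beta>_def)
  next
    fix c assume c: "c \<in> {1..r+s}" "unlinked (ps @ [p]) (\<sigma> c)"
    have "c \<noteq> r" "c \<noteq> r + 1" using c(2)[unfolded unlinked_def lnk] unfolding p_def by (auto simp: rev_swap)
    moreover have "unlinked ps (\<sigma> c)" using c(2) by (simp add: unlinked_def lnk)
    ultimately show "?j (Top c) = (rev (\<beta> (\<sigma> c)), Bot (\<sigma> c))" "?j (Bot (\<sigma> c)) = (\<beta> (\<sigma> c), Top c)"
      using ul[OF c(1)] by (simp_all add: join_map_def \<beta>_def inj)
  qed
qed

end

section \<open>The diagram of a word determines the word\<close>

context bead_monoid
begin

lemma describes_unlinked:
  assumes "describes f ps \<alpha> \<sigma>" "\<sigma> a = k" "unlinked ps k" "k \<in> {1..r+s}"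
  shows "f (Top a) = (rev (\<alpha> k), Bot k)" "f (Bot k) = (\<alpha> k, Top a)"
proof -
  have S: "\<sigma> \<in> Sym" using assms(1) by (simp add: describes_def)
  have "a \<in> {1..r+s}" using assms(2,4) Sym_bounds[OF S, of a] by simp
  then show "f (Top a) = (rev (\<alpha> k), Bot k)" "f (Bot k) = (\<alpha> k, Top a)"
    using assms(1-3) by (auto simp: describes_def)
qed

lemma describes_link:
  assumes "describes f ps \<alpha> \<sigma>" "link ps x bs y" "\<sigma> a = x" "\<sigma> b = y"
  shows "f (Top a) = (rev (\<alpha> x) @ \<alpha> y, Top b)"
  using assms by (auto simp: describes_def)

text \<open>The permutations of two descriptions of the same strand map differ by a permutation of the arcs,
  which the arcs absorb.\<close>

lemma form_unique:
  assumes "describes f ps \<alpha> \<sigma>" "describes g qs \<beta> \<tau>" "\<And>v. v \<in> vertices (r + s) \<Longrightarrow> f v = g v"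
  shows "form ps \<alpha> \<sigma> = form qs \<beta> \<tau>"
proof -
  have S: "\<sigma> \<in> Sym" "\<tau> \<in> Sym" and ok: "arcs_ok ps" "arcs_ok qs"
    using assms by (auto simp: describes_def)
  have vB: "f (Bot k) = g (Bot k)" and vT: "f (Top k) = g (Top k)" if "k \<in> {1..r+s}" for k
    using that assms(3) by (auto simp: vertices_def)
  have rngS: "\<sigma> k \<in> {1..r+s} \<longleftrightarrow> k \<in> {1..r+s}" and rngT: "\<tau> k \<in> {1..r+s} \<longleftrightarrow> k \<in> {1..r+s}" for k
    by (rule Sym_bounds[OF S(1)], rule Sym_bounds[OF S(2)])
  have unl: "link qs x bs y \<longleftrightarrow> x \<in> {1..r+s} \<and> h (Bot x) = (bs, Bot y)"
    if d: "describes h qs \<beta> \<tau>" for h qs \<beta> \<tau> x bs y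
  proof
    assume l: "link qs x bs y"
    have "arcs_ok qs" using d by (simp add: describes_def)
    then have "x \<in> {1..r+s}" using opp_bounds[OF link_opp[OF _ l]] by blast
    then show "x \<in> {1..r+s} \<and> h (Bot x) = (bs, Bot y)" using l d by (simp add: describes_def)
  next
    assume h: "x \<in> {1..r+s} \<and> h (Bot x) = (bs, Bot y)"
    have T: "\<tau> \<in> Sym" using d by (simp add: describes_def)
    let ?a = "inv_into UNIV \<tau> x"
    have a: "\<tau> ?a = x" using T by simp
    then have ra: "?a \<in> {1..r+s}" using h Sym_bounds[OF T, of ?a] by simp
    show "link qs x bs y"
    proof (cases "unlinked qs x")
      case True
      then have "h (Bot x) = (\<beta> x, Top ?a)" using describes_unlinked(2)[OF d a] h by blast
      then show ?thesis using h by simp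
    next
      case False
      then obtain cs z where l: "link qs x cs z" by (auto simp: unlinked_def)
      then have "h (Bot x) = (cs, Bot z)" using d by (simp add: describes_def)
      then show ?thesis using h l by simp
    qed
  qed
  have links: "link ps x bs y \<longleftrightarrow> link qs x bs y" for x bs y
    unfolding unl[OF assms(1)] unl[OF assms(2)] using vB by auto
  have mem: "(x, bs, y) \<in> set ps \<longleftrightarrow> x \<le> r \<and> link ps x bs y" if "arcs_ok ps" for ps x bs y
    using arcs_ok_opp[OF that] by (auto simp: link_def)
  have "(x, bs, y) \<in> set ps \<longleftrightarrow> (x, bs, y) \<in> set qs" for x bs y
    using links by (simp add: mem[OF ok(1)] mem[OF ok(2)])
  then have sets: "set ps = set qs" by auto
  moreover have "distinct ps" "distinct qs" using ok by (auto simp: arcs_ok_def)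
  ultimately have "mset ps = mset qs" using set_eq_iff_mset_eq_distinct by blast
  then have arcs: "arcs qs = arcs ps" using arcs_cong_mset[OF ok(1)] by simp

  \<comment> \<open>\<open>\<pi>\<close> fixes the strands without arcs and permutes the arcs, but it need not respect their beads.\<close>
  let ?\<pi> = "\<tau> \<circ> inv_into UNIV \<sigma>"
  have P: "?\<pi> \<in> Sym" using S by (intro Sym_comp Sym_inv)
  have \<tau>: "\<tau> = ?\<pi> \<circ> \<sigma>" using S by (simp add: fun_eq_iff)
  have ends: "k \<in> fst ` set ps \<or> k \<in> (snd \<circ> snd) ` set ps \<longleftrightarrow> \<not> unlinked ps k" for k

  proof
    assume "k \<in> fst ` set ps \<or> k \<in> (snd \<circ> snd) ` set ps"
    then obtain x bs y where m: "(x, bs, y) \<in> set ps" "k = x \<or> k = y" by auto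
    then have "link ps x bs y" "link ps y (rev bs) x" by (auto simp: link_def)
    then show "\<not> unlinked ps k" using m(2) unfolding unlinked_def by blast
  next
    assume "\<not> unlinked ps k"
    then obtain bs y where "(k, bs, y) \<in> set ps \<or> (y, rev bs, k) \<in> set ps"
      unfolding unlinked_def link_def by blast
    then show "k \<in> fst ` set ps \<or> k \<in> (snd \<circ> snd) ` set ps"
      using image_eqI[of k fst "(k, bs, y)"] image_eqI[of k "snd \<circ> snd" "(y, rev bs, k)"] by auto
  qed
  have ulS: "f (Bot k) = (\<alpha> k, Top (inv_into UNIV \<sigma> k))"
    if "unlinked ps k" "k \<in> {1..r+s}" for k
    by (rule describes_unlinked(2)[OF assms(1) _ that]) (simp add: S)
  have unlinked_iff: "unlinked qs k \<longleftrightarrow> unlinked ps k" for k using links by (simp add: unlinked_def)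
  have ulT: "g (Bot k) = (\<beta> k, Top (inv_into UNIV \<tau> k))"
    if "unlinked ps k" "k \<in> {1..r+s}" for k
    by (rule describes_unlinked(2)[OF assms(2)]) (use that S unlinked_iff in auto)
  have fixed: "?\<pi> k = k \<and> \<alpha> k = \<beta> k" if "unlinked ps k" "k \<in> {1..r+s}" for k
  proof -
    have e: "(\<alpha> k, Top (inv_into UNIV \<sigma> k)) = (\<beta> k, Top (inv_into UNIV \<tau> k))"
      using ulS[OF that] ulT[OF that] vB[OF that(2)] by simp
    then have "inv_into UNIV \<sigma> k = inv_into UNIV \<tau> k" by simp
    then have "?\<pi> k = k" using S by simp
    then show ?thesis using e by simp
  qed
  \<comment> \<open>The two descriptions link the same top vertices, with the same combined beads.\<close>
  have linked: "link ps (?\<pi> x) bs (?\<pi> y) \<and> rev (\<alpha> x) @ \<alpha> y = rev (\<beta> (?\<pi> x)) @ \<beta> (?\<pi> y)"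
    if l: "link ps x cs y" and bs: "bs = fst (g (Bot (?\<pi> x)))" for x cs y bs
  proof -
    let ?a = "inv_into UNIV \<sigma> x" and ?b = "inv_into UNIV \<sigma> y"
    have ab: "\<sigma> ?a = x" "\<sigma> ?b = y" using S by simp_all
    have x: "x \<in> {1..r+s}" using opp_bounds[OF link_opp[OF ok(1) l]] by blast
    then have a: "?a \<in> {1..r+s}" using rngS[of ?a] ab by simp
    have fa: "f (Top ?a) = (rev (\<alpha> x) @ \<alpha> y, Top ?b)" by (rule describes_link[OF assms(1) l ab])
    have "\<not> unlinked qs (\<tau> ?a)"
    proof
      assume "unlinked qs (\<tau> ?a)"
      then have "g (Top ?a) = (rev (\<beta> (\<tau> ?a)), Bot (\<tau> ?a))" using assms(2) a by (simp add: describes_def)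
      then show False using fa vT[OF a] by simp
    qed
    then obtain ds z where dz: "link qs (\<tau> ?a) ds z" by (auto simp: unlinked_def)
    let ?c = "inv_into UNIV \<tau> z"
    have c: "\<tau> ?c = z" using S by simp
    then have "g (Top ?a) = (rev (\<beta> (\<tau> ?a)) @ \<beta> z, Top ?c)" by (rule describes_link[OF assms(2) dz refl])
    then have eq: "rev (\<alpha> x) @ \<alpha> y = rev (\<beta> (\<tau> ?a)) @ \<beta> z" "?c = ?b" using fa vT[OF a] by auto
    then have z: "z = ?\<pi> y" using c by simp
    have "g (Bot (\<tau> ?a)) = (ds, Bot z)" using assms(2) dz by (simp add: describes_def)
    then have "bs = ds" using bs by simp
    then show ?thesis using dz links eq z by simp
  qed
  have "arcs ps * T ?\<pi> = arcs ps"
  proof (rule arcs_T_absorb[OF ok(1) P])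
    fix x bs y assume m: "(x, bs, y) \<in> set ps"
    then have "link ps x bs y" by (simp add: link_def)
    then have "link ps (?\<pi> x) (fst (g (Bot (?\<pi> x)))) (?\<pi> y)" using linked by blast
    moreover have "?\<pi> x \<le> r" using Sym_side[OF P] arcs_ok_opp[OF ok(1) m] by blast
    ultimately show "\<exists>bs'. (?\<pi> x, bs', ?\<pi> y) \<in> set ps" using mem[OF ok(1)] by blast
  next
    fix k assume "k \<notin> fst ` set ps" "k \<notin> (snd \<circ> snd) ` set ps"
    then have u: "unlinked ps k" using ends by blast
    show "?\<pi> k = k"
    proof (cases "k \<in> {1..r+s}")
      case False
      have out: "perm_word u k = k" if "set u \<subseteq> s_indices r s" for u
        by (rule perm_word_fixes) (use that False in \<open>auto simp: s_indices_def\<close>)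
      then have "\<sigma> k = k" "\<tau> k = k" using S by (auto simp: Sym_def)
      then show ?thesis using S Sym_inv_simps(2)[OF S(1), of k] by simp
    qed (use fixed u in blast)
  qed
  moreover have "Gam \<beta> * T ?\<pi> = T ?\<pi> * Gam (\<beta> \<circ> ?\<pi>)"
  proof -
    have "(\<beta> \<circ> ?\<pi>) \<circ> inv_into UNIV ?\<pi> = \<beta>" unfolding fun_eq_iff comp_apply[of \<beta>] comp_apply[of "\<beta> \<circ> ?\<pi>"]
      using Sym_inv_simps(1)[OF P] by simp
    then show ?thesis using T_Gam[OF P, of "\<beta> \<circ> ?\<pi>"] by simp
  qed
  ultimately have "arcs ps * Gam \<beta> * T ?\<pi> = arcs ps * Gam (\<beta> \<circ> ?\<pi>)"
    by (simp add: mult.assoc) (simp flip: mult.assoc)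
  \<comment> \<open>\<open>Gam\<close> ignores the values outside the range of strands, where \<open>\<alpha>\<close> and \<open>\<beta>\<close> may differ.\<close>
  also have "\<dots> = arcs ps * Gam (\<lambda>k. if k \<in> {1..r+s} then (\<beta> \<circ> ?\<pi>) k else \<alpha> k)"
    unfolding Gam_def by (auto intro!: arg_cong[of _ _ "\<lambda>x. _ * x"] beads_cong)
  also have "\<dots> = arcs ps * Gam \<alpha>"
  proof (rule arcs_Gam_cong[OF ok(1) subset_refl])
    show "distinct ps" using ok by (simp add: arcs_ok_def)
    show "\<forall>(x, bs, y) \<in> set ps.
      rev (if x \<in> {1..r+s} then (\<beta> \<circ> ?\<pi>) x else \<alpha> x) @ (if y \<in> {1..r+s} then (\<beta> \<circ> ?\<pi>) y else \<alpha> y) = rev (\<alpha> x) @ \<alpha> y"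
    proof clarify
      fix x bs y assume m: "(x, bs, y) \<in> set ps"
      then have "link ps x bs y" by (simp add: link_def)
      then have "rev (\<alpha> x) @ \<alpha> y = rev (\<beta> (?\<pi> x)) @ \<beta> (?\<pi> y)" using linked by blast
      moreover have "x \<in> {1..r+s}" "y \<in> {1..r+s}" using arcs_ok_opp[OF ok(1) m] opp_bounds by blast+
      ultimately show "rev (if x \<in> {1..r+s} then (\<beta> \<circ> ?\<pi>) x else \<alpha> x) @
        (if y \<in> {1..r+s} then (\<beta> \<circ> ?\<pi>) y else \<alpha> y) = rev (\<alpha> x) @ \<alpha> y" by simp
    qed
    show "\<forall>k. k \<notin> fst ` set ps \<and> k \<notin> (snd \<circ> snd) ` set ps \<longrightarrow>
      (if k \<in> {1..r+s} then (\<beta> \<circ> ?\<pi>) k else \<alpha> k) = \<alpha> k"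
    proof (intro allI impI)
      fix k assume "k \<notin> fst ` set ps \<and> k \<notin> (snd \<circ> snd) ` set ps"
      then have "unlinked ps k" using ends by blast
      then show "(if k \<in> {1..r+s} then (\<beta> \<circ> ?\<pi>) k else \<alpha> k) = \<alpha> k"
        using fixed[of k] by simp
    qed
  qed
  finally have "arcs ps * Gam \<beta> * T ?\<pi> = arcs ps * Gam \<alpha>" .
  then have "arcs ps * Gam \<beta> * (T ?\<pi> * T \<sigma>) = form ps \<alpha> \<sigma>" by (simp add: form_def flip: mult.assoc)
  then show ?thesis using T_comp[OF P S(1)] \<tau> arcs by (simp add: form_def)
qed

text \<open>The letters of a word are put on top of the normal form one by one. A letter \<open>e\<close> closes a loop, is
  absorbed into an arc at one of its two strands, or becomes a new arc.\<close>

lemma word_form: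
  assumes "set w \<subseteq> generators r s"
  shows "case act_word r 0 w id_map of None \<Rightarrow> word 0 w = 0
    | Some f \<Rightarrow> \<exists>ps \<alpha> \<sigma>. describes f ps \<alpha> \<sigma> \<and> word 0 w = form ps \<alpha> \<sigma>"
  using assms
proof (induction w rule: rev_induct)
  case Nil
  show ?case using describes_id form_id by force
next
  case (snoc g w)
  have w: "word 0 (w @ [g]) = word 0 w * letter (count_C w) g" by (simp add: word_append)
  show ?case
  proof (cases "act_word r 0 w id_map")
    case None
    then have "word 0 w = 0" using snoc by simp
    then show ?thesis using None w by (simp add: act_word_append)
  next
    case (Some f)
    then obtain ps \<alpha> \<sigma> where d: "describes f ps \<alpha> \<sigma>" "word 0 w = form ps \<alpha> \<sigma>"
      using snoc by auto
    have S: "\<sigma> \<in> Sym" using d by (simp add: describes_def)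
    have a: "act_word r 0 (w @ [g]) id_map = act r (count_C w) g f"
      using Some by (simp add: act_word_append split: bind_split)
    show ?thesis
    proof (cases g)
      case (S i)
      then have i: "i \<in> s_indices r s" using snoc.prems by (auto simp: generators_def split: if_splits)
      then show ?thesis using swap_step[OF d(1) i] S w a d(2) by auto
    next
      case (C k)
      then have "k \<in> {1..r+s}" using snoc.prems by (auto simp: generators_def split: if_splits)
      then show ?thesis using bead_step[OF d(1), of k "Suc (count_C w)"] C w a d(2) by auto
    next
      case E
      then have rs: "1 \<le> r" "1 \<le> s" using snoc.prems by (auto simp: generators_def split: if_splits)
      show ?thesis
      proof (cases "snd (f (Top r)) = Top (r + 1)")
        case True
        then show ?thesis using loop_step[OF rs d(1) True] E w a d(2) by simp
      next
        case False
        have ne: "\<not> link ps (\<sigma> r) bs (\<sigma> (r + 1))" for bs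
        proof
          assume "link ps (\<sigma> r) bs (\<sigma> (r + 1))"
          then have "snd (f (Top r)) = Top (r + 1)" using describes_link[OF d(1) _ refl refl] by simp
          then show False using False by simp
        qed
        have "\<exists>ps' \<alpha>' \<sigma>'. describes (join_map (Top r) (Top (r + 1)) f) ps' \<alpha>' \<sigma>' \<and> form ps \<alpha> \<sigma> * ee = form ps' \<alpha>' \<sigma>'"
        proof -
          consider "unlinked ps (\<sigma> r)" "unlinked ps (\<sigma> (r + 1))"
            | bs y where "link ps (\<sigma> r) bs y" | bs y where "link ps (\<sigma> (r + 1)) bs y"
            by (auto simp: unlinked_def)
          then show ?thesis
          proof cases
            case 1
            then show ?thesis using free_join_step[OF rs d(1)] by blast
          next
            case 2
            then have l: "link ps (\<sigma> r) bs (\<sigma> (inv_into UNIV \<sigma> y))" using S by simp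
            then have "inv_into UNIV \<sigma> y \<noteq> r + 1" using ne by metis
            from link_join_step[OF rs d(1) refl _ l this] show ?thesis by auto
          next
            case 3
            then have l: "link ps (\<sigma> (r + 1)) bs (\<sigma> (inv_into UNIV \<sigma> y))" using S by simp
            then have "inv_into UNIV \<sigma> y \<noteq> r" using ne link_sym by metis
            from link_join_step[OF rs d(1) insert_commute _ l this] show ?thesis
              using join_map_commute[of "Top r" "Top (r + 1)" f] by auto
          qed
        qed
        then show ?thesis using E w a d(2) False by auto
      qed
    qed
  qed
qed

theorem word_cong:
  assumes "set v \<subseteq> generators r s" "set w \<subseteq> generators r s"
    "act_word r 0 v id_map = Some f" "act_word r 0 w id_map = Some g"
    "\<And>u. u \<in> vertices (r + s) \<Longrightarrow> f u = g u"
  shows "word 0 v = word 0 w"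
  using word_form[OF assms(1)] word_form[OF assms(2)] assms(3,4) form_unique[OF _ _ assms(5)] by fastforce

theorem word_zero:
  assumes "set w \<subseteq> generators r s" "act_word r 0 w id_map = None"
  shows "word 0 w = 0"
  using word_form[OF assms(1)] assms(2) by simp

end

section \<open>Gluing diagrams along walks\<close>

text \<open>Walks in a graph with labelled edges \<open>D\<close>, in which two successive edges are joined by a pair in \<open>J\<close>.
  This general form of \<open>walk\<close> treats any number of stacked diagrams alike.\<close>

inductive path :: "('n \<times> 'l list \<times> 'n) set \<Rightarrow> ('n \<times> 'n) set \<Rightarrow> 'n \<Rightarrow> 'l list \<Rightarrow> 'n \<Rightarrow> bool"
  for D J where
  edge: "(x, ns, y) \<in> D \<Longrightarrow> path D J x ns y"
| step: "(x, ns, y) \<in> D \<Longrightarrow> (y, z) \<in> J \<Longrightarrow> path D J z ms w \<Longrightarrow> path D J x (ns @ ms) w"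

lemma path_trans: "path D J x ns y \<Longrightarrow> (y, z) \<in> J \<Longrightarrow> path D J z ms w \<Longrightarrow> path D J x (ns @ ms) w"
  by (induction rule: path.induct) (auto intro: path.intros)

lemma path_mono: "path D J x ns y \<Longrightarrow> D \<subseteq> D' \<Longrightarrow> J \<subseteq> J' \<Longrightarrow> path D' J' x ns y"
  by (induction rule: path.induct) (auto intro: path.intros)

lemma path_rev:
  assumes "\<And>x ns y. (x, ns, y) \<in> D \<Longrightarrow> (y, rev ns, x) \<in> D" "sym J"
  shows "path D J x ns y \<Longrightarrow> path D J y (rev ns) x"
proof (induction rule: path.induct)
  case (step x ns y z ms w)
  then show ?case using path_trans[OF step.IH, of y "rev ns" x] assms(1) symD[OF assms(2)]
    by (auto intro: path.edge)
qed (auto intro: path.edge assms(1))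

lemma path_relabel:
  assumes "\<And>x ns y. (x, ns, y) \<in> D \<Longrightarrow> \<exists>ms. (x, ms, y) \<in> D'"
  shows "path D J x ns y \<Longrightarrow> \<exists>ms. path D' J x ms y"
proof (induction rule: path.induct)
  case (edge x ns y)
  then show ?case using assms by (meson path.edge)
next
  case (step x ns y z ms w)
  then show ?case using assms by (meson path.step)
qed

lemma path_map_labels:
  "path ((\<lambda>(x, ns, y). (x, map h ns, y)) ` D) J x ns y \<longleftrightarrow> (\<exists>ms. ns = map h ms \<and> path D J x ms y)"
proof
  show "path ((\<lambda>(x, ns, y). (x, map h ns, y)) ` D) J x ns y \<Longrightarrow> \<exists>ms. ns = map h ms \<and> path D J x ms y"
  proof (induction rule: path.induct)
    case (edge x ns y)
    then show ?case by (auto intro: path.edge)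
  next
    case (step x ns y z ms w)
    then obtain ls ks where "ns = map h ls" "(x, ls, y) \<in> D" "ms = map h ks" "path D J z ks w" by auto
    then show ?case using step(2) by (intro exI[of _ "ls @ ks"]) (auto intro: path.step)
  qed
  have "path D J x ms y \<Longrightarrow> path ((\<lambda>(x, ns, y). (x, map h ns, y)) ` D) J x (map h ms) y" for ms
    by (induction rule: path.induct) (force intro: path.edge path.step)+
  then show "\<exists>ms. ns = map h ms \<and> path D J x ms y \<Longrightarrow> path ((\<lambda>(x, ns, y). (x, map h ns, y)) ` D) J x ns y"
    by auto
qed

lemma path_deterministic:
  assumes D: "\<And>x ns y ns' y'. (x, ns, y) \<in> D \<Longrightarrow> (x, ns', y') \<in> D \<Longrightarrow> ns = ns' \<and> y = y'"
    and J: "single_valued J"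
    and "path D J x ns y" "path D J x ms z" "y \<notin> Domain J" "z \<notin> Domain J"
  shows "ns = ms \<and> y = z"
  using assms(3-)
proof (induction arbitrary: ms rule: path.induct)
  case (edge x ns y)
  from edge(2) show ?case
  proof cases
    case edge
    then show ?thesis using D \<open>(x, ns, y) \<in> D\<close> by blast
  next
    case (step ns' y')
    then show ?thesis using D[OF \<open>(x, ns, y) \<in> D\<close>] edge(3) by blast
  qed
next
  case (step x ns y y' ns' w)
  note st = step
  from step(5) show ?case
  proof cases
    case edge
    then show ?thesis using D[OF step(1) edge] step(2,7) by blast
  next
    case (step ls u u' ks)
    then have "ns = ls" "y = u" using D \<open>(x, ns, y) \<in> D\<close> by blast+
    moreover have "y' = u'" using J \<open>(y, y') \<in> J\<close> step(3) \<open>y = u\<close> by (auto dest: single_valuedD)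
    ultimately show ?thesis using step st(4)[of ks] st(6,7) by auto
  qed
qed

text \<open>A walk that leaves the glued vertices for good cannot start on a loop, since the loop would be
  the only continuation.\<close>

lemma path_exit_no_loop:
  assumes D: "\<And>x ns y ns' y'. (x, ns, y) \<in> D \<Longrightarrow> (x, ns', y') \<in> D \<Longrightarrow> ns = ns' \<and> y = y'"
    and J: "single_valued J"
    and "path D J x ms z" "z \<notin> Domain J" "path D J x ns y" "(y, x) \<in> J"
  shows False
  using assms(3-)
proof (induction arbitrary: ns y rule: path.induct)
  case (edge x ms z)
  note ed = edge
  from edge(3) show ?case
  proof cases
    case edge
    then show ?thesis using D \<open>(x, ms, z) \<in> D\<close> \<open>(y, x) \<in> J\<close> \<open>z \<notin> Domain J\<close> by blast
  next
    case (step ns y' z ms)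
    then show ?thesis using D[OF ed(1)] ed(2) by blast
  qed
next
  case (step x ms u u' ks z)
  note st = step
  from step(6) show ?case
  proof cases
    case edge
    then have "y = u" using D[OF st(1) edge] by simp
    then have "x = u'" using J st(2,7) by (auto dest: single_valuedD)
    then show ?thesis using st(4)[OF st(5), of ns y] st(6,7) by simp
  next
    case (step ns1 w w' ns2)
    then have w: "w = u" "ns1 = ms" using D[OF st(1) step(2)] by auto
    then have "w' = u'" using J step(3) st(2) by (auto dest: single_valuedD)
    then have "path D J u' (ns2 @ ms) u" using path_trans[OF step(4) st(7) path.edge[OF st(1)]] by simp
    then show ?thesis using st(4)[OF st(5)] st(2) by blast
  qed
qed

definition loop :: "('n \<times> 'l list \<times> 'n) set \<Rightarrow> ('n \<times> 'n) set \<Rightarrow> bool" where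
  "loop D J \<longleftrightarrow> (\<exists>x ns y. path D J x ns y \<and> (y, x) \<in> J)"

text \<open>A walk through glued vertices becomes a single edge between two of the remaining vertices.\<close>

definition eliminate :: "('n \<times> 'l list \<times> 'n) set \<Rightarrow> ('n \<times> 'n) set \<Rightarrow> ('n \<times> 'l list \<times> 'n) set" where
  "eliminate D J = {(x, ns, y). path D J x ns y \<and> x \<notin> Domain J \<and> y \<notin> Domain J}"

text \<open>Gluing in two stages: a walk through \<open>J \<union> K\<close> is cut at its passages through \<open>K\<close>.\<close>

lemma path_cut:
  assumes "path D (J \<union> K) x ns y"
  shows "path D J x ns y \<or> (\<exists>z z' ks ls. ns = ks @ ls \<and> path D J x ks z \<and> (z, z') \<in> K \<and> path D (J \<union> K) z' ls y)"
  using assms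
proof (induction rule: path.induct)
  case (edge x ns y)
  then show ?case by (auto intro: path.edge)
next
  case (step x ns y z ms w)
  show ?case
  proof (cases "(y, z) \<in> J")
    case True
    from step.IH show ?thesis
    proof (elim disjE exE conjE)
      fix u u' ks ls assume "ms = ks @ ls" "path D J z ks u" "(u, u') \<in> K" "path D (J \<union> K) u' ls w"
      then show ?thesis using path.step[OF step(1) True, of ks u] by (metis append.assoc)
    qed (use path.step[OF step(1) True] in blast)
  next
    case False
    then show ?thesis using step by (blast intro: path.edge)
  qed
qed

text \<open>Gluing first along \<open>J\<close> and then along \<open>K\<close> is gluing along both.\<close>

lemma path_eliminate:
  assumes K: "Domain K \<inter> Domain J = {}" "Range K \<inter> Domain J = {}"
    and xy: "x \<notin> Domain J" "y \<notin> Domain J"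
  shows "path (eliminate D J) K x ns y \<longleftrightarrow> path D (J \<union> K) x ns y"
proof
  show "path (eliminate D J) K x ns y \<Longrightarrow> path D (J \<union> K) x ns y"
  proof (induction rule: path.induct)
    case (edge x ns y)
    then show ?case by (auto simp: eliminate_def intro: path_mono)
  next
    case (step x ns y z ms w)
    then have "path D (J \<union> K) x ns y" by (auto simp: eliminate_def intro: path_mono)
    then show ?case using step by (auto intro: path_trans)
  qed
  have "path D (J \<union> K) x ns y \<Longrightarrow> y \<notin> Domain J \<Longrightarrow>
    path D J x ns y \<or> (\<exists>z z' ks ls. ns = ks @ ls \<and> path D J x ks z \<and> (z, z') \<in> K \<and> path (eliminate D J) K z' ls y)"
  proof (induction rule: path.induct)
    case (edge x ns y)
    then show ?case by (auto intro: path.edge)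
  next
    case (step x ns y z ms w)
    from step.IH[OF step.prems] consider "path D J z ms w"
      | u u' ks ls where "ms = ks @ ls" "path D J z ks u" "(u, u') \<in> K" "path (eliminate D J) K u' ls w" by blast
    note IH = this
    show ?case
    proof (cases "(y, z) \<in> J")
      case True
      from IH show ?thesis
      proof cases
        case 1
        then show ?thesis using path.step[OF step(1) True] by blast
      next
        case 2
        then show ?thesis using path.step[OF step(1) True, of ks u] by (metis append.assoc)
      qed
    next
      case False
      then have yz: "(y, z) \<in> K" using step by blast
      then have z: "z \<notin> Domain J" using K by blast
      from IH have "path (eliminate D J) K z ms w"
      proof cases
        case 1
        then show ?thesis using z step.prems by (auto simp: eliminate_def intro: path.edge)
      next
        case 2
        then have "u \<notin> Domain J" using K by blast
        then have "(z, ks, u) \<in> eliminate D J" using z 2 by (auto simp: eliminate_def)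
        then show ?thesis using 2 by (auto intro: path.step)
      qed
      then show ?thesis using yz step by (blast intro: path.edge)
    qed
  qed
  moreover assume "path D (J \<union> K) x ns y"
  ultimately consider "path D J x ns y"
      | u u' ks ls where "ns = ks @ ls" "path D J x ks u" "(u, u') \<in> K" "path (eliminate D J) K u' ls y"
    using xy by blast
  then show "path (eliminate D J) K x ns y"
  proof cases
    case 1
    then show ?thesis using xy by (auto simp: eliminate_def intro: path.edge)
  next
    case 2
    then have "(x, ks, u) \<in> eliminate D J" using xy K by (auto simp: eliminate_def)
    then show ?thesis using 2 by (auto intro: path.step)
  qed
qed

lemma loop_eliminate:
  assumes K: "Domain K \<inter> Domain J = {}" "Range K \<inter> Domain J = {}"
  shows "loop D (J \<union> K) \<longleftrightarrow> loop D J \<or> loop (eliminate D J) K"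
proof
  assume "loop D J \<or> loop (eliminate D J) K"
  then show "loop D (J \<union> K)"
  proof
    assume "loop D J"
    then show ?thesis unfolding loop_def by (meson UnI1 path_mono subset_refl sup_ge1)
  next
    assume "loop (eliminate D J) K"
    then obtain x ns y where "path (eliminate D J) K x ns y" "(y, x) \<in> K" by (auto simp: loop_def)
    moreover from this have "x \<notin> Domain J" "y \<notin> Domain J" using K by blast+
    ultimately show ?thesis using path_eliminate[OF K] unfolding loop_def by blast
  qed
next
  assume "loop D (J \<union> K)"
  then obtain x ns y where p: "path D (J \<union> K) x ns y" "(y, x) \<in> J \<union> K" by (auto simp: loop_def)
  have *: "loop (eliminate D J) K" if "path D (J \<union> K) x ns y" "(y, x) \<in> K" for x ns y
  proof -
    have "x \<notin> Domain J" "y \<notin> Domain J" using that K by blast+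
    then have "path (eliminate D J) K x ns y" using path_eliminate[OF K] that(1) by blast
    then show ?thesis using that(2) by (auto simp: loop_def)
  qed
  show "loop D J \<or> loop (eliminate D J) K"
  proof (cases "(y, x) \<in> K")
    case True
    then show ?thesis using * p by blast
  next
    case False
    then have yx: "(y, x) \<in> J" using p by blast
    from path_cut[OF p(1)] show ?thesis
    proof (elim disjE exE conjE)
      assume "path D J x ns y"
      then show ?thesis using yx by (auto simp: loop_def)
    next
      fix z z' ks ls assume c: "path D J x ks z" "(z, z') \<in> K" "path D (J \<union> K) z' ls y"
      have "path D (J \<union> K) x ks z" using c(1) by (auto intro: path_mono)
      then have "path D (J \<union> K) z' (ls @ ks) z" using path_trans[OF c(3) p(2)] by blast
      then show ?thesis using * c(2) by blast
    qed
  qed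
qed

text \<open>A diagram is placed in a larger graph by an injection of its vertices. The top row of one layer is
  glued to the bottom row of the next.\<close>

definition layer :: "('v \<Rightarrow> 'n) \<Rightarrow> ('v \<times> 'l list \<times> 'v) set \<Rightarrow> ('n \<times> 'l list \<times> 'n) set" where
  "layer h d = (\<lambda>(v, ns, w). (h v, ns, h w)) ` d"

definition glue :: "(vertex \<Rightarrow> 'n) \<Rightarrow> (vertex \<Rightarrow> 'n) \<Rightarrow> ('n \<times> 'n) set" where
  "glue f g = range (\<lambda>k. (f (Top k), g (Bot k))) \<union> range (\<lambda>k. (g (Bot k), f (Top k)))"

lemma mem_layer: "(x, ns, y) \<in> layer h d \<longleftrightarrow> (\<exists>v w. x = h v \<and> y = h w \<and> (v, ns, w) \<in> d)"
  by (auto simp: layer_def intro: rev_image_eqI)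

lemma layer_layer: "layer h (layer f d) = layer (h \<circ> f) d"
  by (force simp: layer_def)

lemma layer_Un: "layer h (d \<union> d') = layer h d \<union> layer h d'"
  by (simp add: layer_def image_Un)

lemma map_glue: "map_prod h h ` glue f g = glue (h \<circ> f) (h \<circ> g)"
  by (auto simp: glue_def image_Un image_image)

lemma sym_glue: "sym (glue f g)"
  by (auto simp: glue_def sym_def)

lemma single_valued_glue: "inj f \<Longrightarrow> inj g \<Longrightarrow> range f \<inter> range g = {} \<Longrightarrow> single_valued (glue f g)"
  by (force simp: glue_def single_valued_def dest: injD)

lemma path_rename:
  assumes "inj h"
  shows "path (layer h D) (map_prod h h ` J) (h x) ns (h y) \<longleftrightarrow> path D J x ns y"
proof
  have "path (layer h D) (map_prod h h ` J) u ns v \<Longrightarrow> \<forall>x. u = h x \<longrightarrow> (\<exists>y. v = h y \<and> path D J x ns y)" for u v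
  proof (induction rule: path.induct)
    case (edge x ns y)
    then show ?case using injD[OF assms] by (auto simp: layer_def intro: path.edge)
  next
    case (step x ns y z ms w)
    show ?case
    proof (intro allI impI)
      fix x' assume "x = h x'"
      then obtain y' where y': "y = h y'" "(x', ns, y') \<in> D" using step(1) injD[OF assms] by (auto simp: layer_def)
      then obtain z' where z': "z = h z'" "(y', z') \<in> J" using step(2) injD[OF assms] by auto
      then show "\<exists>y. w = h y \<and> path D J x' (ns @ ms) y" using step.IH y' by (blast intro: path.step)
    qed
  qed
  then show "path (layer h D) (map_prod h h ` J) (h x) ns (h y) \<Longrightarrow> path D J x ns y"
    using injD[OF assms] by blast
  have *: "(a, ns, b) \<in> D \<Longrightarrow> (h a, ns, h b) \<in> layer h D" for a ns b by (force simp: layer_def)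
  show "path D J x ns y \<Longrightarrow> path (layer h D) (map_prod h h ` J) (h x) ns (h y)"
    by (induction rule: path.induct) (force intro: path.edge path.step *)+
qed

lemma walk_trans:
  assumes "walk d1 d2 z ms w"
  shows "walk d1 d2 x ns y \<Longrightarrow> (y, z) \<in> glue Inl Inr \<Longrightarrow> walk d1 d2 x (ns @ ms) w"
  using assms
proof (induction rule: walk.induct)
  case (lower v ns w)
  then show ?case by (auto simp: glue_def intro: walk.step_down)
next
  case (upper v ns w)
  then show ?case by (auto simp: glue_def intro: walk.step_up)
next
  case (step_up x ns k ms w)
  then show ?case using walk.step_up[of d1 d2 _ _ k ms w] by (metis append.assoc)
next
  case (step_down x ns k ms w)
  then show ?case using walk.step_down[of d1 d2 _ _ k ms w] by (metis append.assoc)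
qed

abbreviation stack :: "diagram \<Rightarrow> diagram \<Rightarrow> ((vertex + vertex) \<times> nat list \<times> (vertex + vertex)) set" where
  "stack d1 d2 \<equiv> layer Inl d1 \<union> layer Inr d2"

lemma walk_iff_path: "walk d1 d2 x ns y \<longleftrightarrow> path (stack d1 d2) (glue Inl Inr) x ns y"
proof
  have mem: "(v, ns, w) \<in> d1 \<Longrightarrow> (Inl v, ns, Inl w) \<in> stack d1 d2"
    "(v, ns, w) \<in> d2 \<Longrightarrow> (Inr v, ns, Inr w) \<in> stack d1 d2" for v ns w
    by (force simp: layer_def)+
  have g: "(Inl (Top k), Inr (Bot k)) \<in> glue Inl Inr" "(Inr (Bot k), Inl (Top k)) \<in> glue Inl Inr" for k
    by (auto simp: glue_def)
  show "walk d1 d2 x ns y \<Longrightarrow> path (stack d1 d2) (glue Inl Inr) x ns y"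
  proof (induction rule: walk.induct)
    case (step_up x ns k ms w)
    then show ?case using path_trans[OF step_up.IH g(1) path.edge[OF mem(2)]] by simp
  next
    case (step_down x ns k ms w)
    then show ?case using path_trans[OF step_down.IH g(2) path.edge[OF mem(1)]] by simp
  qed (rule path.edge, erule mem)+
  show "path (stack d1 d2) (glue Inl Inr) x ns y \<Longrightarrow> walk d1 d2 x ns y"
  proof (induction rule: path.induct)
    case (edge x ns y)
    then show ?case by (auto simp: layer_def intro: walk.intros)
  next
    case (step x ns y z ms w)
    then have "walk d1 d2 x ns y" by (auto simp: layer_def intro: walk.intros)
    then show ?case using walk_trans step by blast
  qed
qed

lemma Domain_glue: "Domain (glue f g) = range (\<lambda>k. f (Top k)) \<union> range (\<lambda>k. g (Bot k))"
  by (auto simp: glue_def Domain_Un_eq)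

lemma outer_not_glued: "outer_vertex v \<notin> Domain (glue Inl Inr)"
  by (cases v) (auto simp: Domain_glue)

lemma not_glued_outer: "x \<notin> Domain (glue Inl Inr) \<Longrightarrow> \<exists>v. x = outer_vertex v"
proof -
  assume x: "x \<notin> Domain (glue Inl Inr)"
  consider k where "x = Inl (Top k)" | k where "x = Inl (Bot k)" | k where "x = Inr (Top k)" | k where "x = Inr (Bot k)"
    by (metis obj_sumE vertex.exhaust)
  then show ?thesis
  proof cases
    case 2
    then show ?thesis by (intro exI[of _ "Bot _"]) simp
  next
    case 3
    then show ?thesis by (intro exI[of _ "Top _"]) simp
  qed (use x in \<open>auto simp: Domain_glue\<close>)
qed

definition reversible :: "diagram \<Rightarrow> bool" where
  "reversible d \<longleftrightarrow> (\<forall>v ns w. (v, ns, w) \<in> d \<longrightarrow> (w, rev ns, v) \<in> d)"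

text \<open>The loops in the definition of \<open>has_loop\<close> start inside the lower diagram. A loop that starts inside
  the upper one can be reversed.\<close>

lemma has_loop_iff:
  assumes "reversible d1" "reversible d2"
  shows "has_loop d1 d2 \<longleftrightarrow> loop (stack d1 d2) (glue Inl Inr)"
proof
  show "has_loop d1 d2 \<Longrightarrow> loop (stack d1 d2) (glue Inl Inr)"
    unfolding has_loop_def loop_def walk_iff_path by (force simp: glue_def)
  assume "loop (stack d1 d2) (glue Inl Inr)"
  then obtain x ns y where p: "path (stack d1 d2) (glue Inl Inr) x ns y" "(y, x) \<in> glue Inl Inr"
    by (auto simp: loop_def)
  have "(x, ns, y) \<in> stack d1 d2 \<Longrightarrow> (y, rev ns, x) \<in> stack d1 d2" for x ns y
    using assms by (auto simp: mem_layer reversible_def)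
  from path_rev[OF this sym_glue p(1)] p show "has_loop d1 d2"
    unfolding has_loop_def walk_iff_path by (auto simp: glue_def)
qed

lemma inj_case_sum:
  assumes "inj f" "inj g" "range f \<inter> range g = {}" shows "inj (case_sum f g)"
proof (rule injI)
  fix x y assume "case_sum f g x = case_sum f g y"
  then show "x = y" using assms(3) injD[OF assms(1)] injD[OF assms(2)] by (cases x; cases y; force)
qed

text \<open>A third layer that is not glued is never entered.\<close>

lemma path_two_layers:
  fixes e1 e2 e3 :: "vertex \<Rightarrow> 'n"
  assumes inj: "inj e1" "inj e2"
    and disj: "range e1 \<inter> range e2 = {}" "range e1 \<inter> range e3 = {}" "range e2 \<inter> range e3 = {}"
  defines "h \<equiv> case_sum e1 e2"
  shows "path (layer e1 a \<union> layer e2 b \<union> layer e3 c) (glue e1 e2) (h x) ns (h y) \<longleftrightarrow>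
    path (stack a b) (glue Inl Inr) x ns y"
proof -
  let ?D = "layer e1 a \<union> layer e2 b" and ?J = "glue e1 e2"
  have h: "inj h" unfolding h_def by (rule inj_case_sum[OF inj disj(1)])
  have comp: "h \<circ> Inl = e1" "h \<circ> Inr = e2" by (auto simp: h_def)
  have J: "?J = map_prod h h ` glue Inl Inr" by (simp add: map_glue comp)
  have D: "?D = layer h (stack a b)" by (simp add: layer_Un layer_layer comp)
  have three: "e3 v \<notin> range h" for v using disj by (force simp: h_def split: sum.splits)
  have "path (?D \<union> layer e3 c) ?J x ns y \<Longrightarrow> x \<in> range h \<longrightarrow> path ?D ?J x ns y" for x ns y
  proof (induction rule: path.induct)
    case (edge x ns y)
    then have "(x, ns, y) \<in> ?D" if "x \<in> range h" using that three unfolding Un_iff mem_layer by blast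
    then show ?case by (blast intro: path.edge)
  next
    case (step x ns y z ms w)
    have "z \<in> range h" using step(2) unfolding J by auto
    moreover have "(x, ns, y) \<in> ?D" if "x \<in> range h"
      using step(1) that three unfolding Un_iff mem_layer by blast
    ultimately show ?case using step by (blast intro: path.step)
  qed
  then have "path (?D \<union> layer e3 c) ?J (h x) ns (h y) \<longleftrightarrow> path ?D ?J (h x) ns (h y)"
    by (blast intro: path_mono)
  then show ?thesis unfolding D J path_rename[OF h] .
qed

text \<open>Contracting two of three layers leaves their composite and the third one. The composite is placed by
  \<open>o'\<close>, which takes its bottom row from the lower and its top row from the upper layer.\<close>

lemma eliminate_layers:
  fixes e1 e2 e3 o' :: "vertex \<Rightarrow> 'n"
  assumes inj: "inj e1" "inj e2"
    and disj: "range e1 \<inter> range e2 = {}" "range e1 \<inter> range e3 = {}" "range e2 \<inter> range e3 = {}"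
    and o: "\<And>k. o' (Bot k) = e1 (Bot k)" "\<And>k. o' (Top k) = e2 (Top k)"
  shows "eliminate (layer e1 a \<union> layer e2 b \<union> layer e3 c) (glue e1 e2) = layer o' (concatenate a b) \<union> layer e3 c"
proof -
  let ?h = "case_sum e1 e2"
  let ?D = "layer e1 a \<union> layer e2 b \<union> layer e3 c" and ?J = "glue e1 e2"
  note two = path_two_layers[OF inj disj]
  have h: "inj ?h" by (rule inj_case_sum[OF inj disj(1)])
  have J: "?J = map_prod ?h ?h ` glue Inl Inr" by (simp add: map_glue comp_def)
  have o': "?h (outer_vertex v) = o' v" for v using o by (cases v) auto
  have glued: "?h x \<in> Domain ?J \<longleftrightarrow> x \<in> Domain (glue Inl Inr)" for x
    unfolding J using injD[OF h] by force
  have three: "e3 v \<notin> Domain ?J" "e3 v \<notin> range ?h" for v using disj by (force simp: glue_def split: sum.splits)+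
  have "path ?D ?J x ns y \<and> x \<notin> Domain ?J \<and> y \<notin> Domain ?J \<longleftrightarrow>
    (x, ns, y) \<in> layer o' (concatenate a b) \<union> layer e3 c" for x ns y
  proof
    assume p: "path ?D ?J x ns y \<and> x \<notin> Domain ?J \<and> y \<notin> Domain ?J"
    show "(x, ns, y) \<in> layer o' (concatenate a b) \<union> layer e3 c"
    proof (cases "x \<in> range ?h")
      case True
      have "path ?D ?J x ns y \<Longrightarrow> x \<in> range ?h \<longrightarrow> y \<in> range ?h" for x ns y
      proof (induction rule: path.induct)
        case (edge x ns y)
        have "e1 u \<in> range ?h" "e2 u \<in> range ?h" for u using range_eqI[of _ ?h "Inl u"] range_eqI[of _ ?h "Inr u"] by auto
        then show ?case using edge three(2) unfolding Un_iff mem_layer by (elim disjE exE conjE) simp_all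
      next
        case (step x ns y z ms w)
        then show ?case unfolding J by auto
      qed
      then obtain x' y' where xy: "x = ?h x'" "y = ?h y'" using True p by blast
      then obtain v w where vw: "x' = outer_vertex v" "y' = outer_vertex w"
        using p glued not_glued_outer by metis
      have "(v, ns, w) \<in> concatenate a b" using p two xy vw by (simp add: concatenate_def walk_iff_path)
      moreover have "x = o' v" "y = o' w" using xy vw o' by auto
      ultimately show ?thesis by (force simp: layer_def)
    next
      case False
      have "e1 u \<in> range ?h" "e2 u \<in> range ?h" for u using range_eqI[of _ ?h "Inl u"] range_eqI[of _ ?h "Inr u"] by auto
      then have ed: "(x, ns', y') \<in> layer e3 c" if "(x, ns', y') \<in> ?D" for ns' y'
        using that False by (auto simp: layer_def)
      from p have "path ?D ?J x ns y" by blast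
      then show ?thesis
      proof cases
        case edge
        then show ?thesis using ed by blast
      next
        case (step ns y z ms)
        then show ?thesis using ed[OF step(2)] three by (auto simp: layer_def)
      qed
    qed
  next
    assume m: "(x, ns, y) \<in> layer o' (concatenate a b) \<union> layer e3 c"
    show "path ?D ?J x ns y \<and> x \<notin> Domain ?J \<and> y \<notin> Domain ?J"
    proof (cases "(x, ns, y) \<in> layer e3 c")
      case True
      then have "path ?D ?J x ns y" by (blast intro: path.edge)
      then show ?thesis using True three by (auto simp: mem_layer)
    next
      case False
      then obtain v w where vw: "x = o' v" "y = o' w" "(v, ns, w) \<in> concatenate a b" using m by (auto simp: layer_def)
      then have "path ?D ?J x ns y" using two[of a b c "outer_vertex v" ns "outer_vertex w"]
        by (simp add: concatenate_def walk_iff_path o')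
      moreover have "x \<notin> Domain ?J" "y \<notin> Domain ?J"
        using glued[of "outer_vertex v"] glued[of "outer_vertex w"] outer_not_glued vw o' by metis+
      ultimately show ?thesis by blast
    qed
  qed
  then show ?thesis unfolding eliminate_def by auto
qed

lemma loop_rename:
  assumes "inj h" shows "loop (layer h D) (map_prod h h ` J) \<longleftrightarrow> loop D J"
proof
  assume "loop (layer h D) (map_prod h h ` J)"
  then obtain x ns y where "path (layer h D) (map_prod h h ` J) x ns y" "(y, x) \<in> map_prod h h ` J"
    by (auto simp: loop_def)
  then show "loop D J" using path_rename[OF assms] unfolding loop_def by fastforce
next
  assume "loop D J"
  then obtain x ns y where "path D J x ns y" "(y, x) \<in> J" by (auto simp: loop_def)
  then have "path (layer h D) (map_prod h h ` J) (h x) ns (h y)" "(h y, h x) \<in> map_prod h h ` J"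
    using path_rename[OF assms] by force+
  then show "loop (layer h D) (map_prod h h ` J)"
    unfolding loop_def by (intro exI[of _ "h x"] exI[of _ ns] exI[of _ "h y"] conjI)
qed

text \<open>Three diagrams on top of each other, of which \<open>a\<close> and \<open>b\<close> are glued first. The injection \<open>h\<close>
  places the composite and \<open>c\<close>, in the appropriate order, in the three layers.\<close>

lemma concatenate_in_layers:
  fixes e1 e2 e3 o' :: "vertex \<Rightarrow> 'n"
  assumes inj: "inj e1" "inj e2" "inj e3"
    and disj: "range e1 \<inter> range e2 = {}" "range e1 \<inter> range e3 = {}" "range e2 \<inter> range e3 = {}"
    and o: "\<And>k. o' (Bot k) = e1 (Bot k)" "\<And>k. o' (Top k) = e2 (Top k)"
    and h: "inj h" "layer h (stack p q) = layer o' (concatenate a b) \<union> layer e3 c"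
      "\<And>v. h (outer_vertex v) \<notin> Domain (glue e1 e2)"
    and K: "map_prod h h ` glue Inl Inr \<in> {glue e2 e3, glue e3 e1}"
  defines "D \<equiv> \<lambda>a b c. layer e1 a \<union> layer e2 b \<union> layer e3 c" and "J \<equiv> glue e1 e2 \<union> map_prod h h ` glue Inl Inr"
  shows "(v, ns, w) \<in> concatenate p q \<longleftrightarrow> path (D a b c) J (h (outer_vertex v)) ns (h (outer_vertex w))"
    "loop (stack a b) (glue Inl Inr) \<or> loop (stack p q) (glue Inl Inr) \<longleftrightarrow> loop (D a b c) J"
proof -
  let ?K = "map_prod h h ` glue Inl Inr"
  have e: "eliminate (D a b c) (glue e1 e2) = layer h (stack p q)"
    unfolding D_def h(2) by (rule eliminate_layers[OF inj(1,2) disj o])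
  have ne: "e1 u \<noteq> e2 v" "e2 v \<noteq> e1 u" "e1 u \<noteq> e3 v" "e3 v \<noteq> e1 u" "e2 u \<noteq> e3 v" "e3 v \<noteq> e2 u" for u v
    using disj by blast+
  have "Domain (glue e2 e3) \<inter> Domain (glue e1 e2) = {}" "Range (glue e2 e3) \<inter> Domain (glue e1 e2) = {}"
    "Domain (glue e3 e1) \<inter> Domain (glue e1 e2) = {}" "Range (glue e3 e1) \<inter> Domain (glue e1 e2) = {}"
    using ne by (auto simp: glue_def inj_eq inj)
  then have KJ: "Domain ?K \<inter> Domain (glue e1 e2) = {}" "Range ?K \<inter> Domain (glue e1 e2) = {}"
    using K by (elim insertE emptyE; simp only:)+
  have "(v, ns, w) \<in> concatenate p q \<longleftrightarrow> path (layer h (stack p q)) ?K (h (outer_vertex v)) ns (h (outer_vertex w))"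
    unfolding path_rename[OF h(1)] by (simp add: concatenate_def walk_iff_path)
  also have "\<dots> \<longleftrightarrow> path (D a b c) J (h (outer_vertex v)) ns (h (outer_vertex w))"
    unfolding e[symmetric] J_def by (rule path_eliminate[OF KJ h(3) h(3)])
  finally show "(v, ns, w) \<in> concatenate p q \<longleftrightarrow> path (D a b c) J (h (outer_vertex v)) ns (h (outer_vertex w))" .
  have "loop (D a b c) (glue e1 e2) \<longleftrightarrow> loop (stack a b) (glue Inl Inr)"
  proof -
    let ?i = "case_sum e1 e2"
    have i: "inj ?i" by (rule inj_case_sum[OF inj(1,2) disj(1)])
    have Ji: "glue e1 e2 = map_prod ?i ?i ` glue Inl Inr" by (simp add: map_glue comp_def)
    note two = path_two_layers[OF inj(1,2) disj, of a b c]
    show ?thesis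
    proof
      assume "loop (D a b c) (glue e1 e2)"
      then obtain x ns y where l: "path (D a b c) (glue e1 e2) x ns y" "(y, x) \<in> glue e1 e2" by (auto simp: loop_def)
      then obtain x' y' where xy: "x = ?i x'" "y = ?i y'" "(y', x') \<in> glue Inl Inr" unfolding Ji by auto
      then show "loop (stack a b) (glue Inl Inr)" using l(1) two unfolding D_def loop_def by blast
    next
      assume "loop (stack a b) (glue Inl Inr)"
      then obtain x ns y where l: "path (stack a b) (glue Inl Inr) x ns y" "(y, x) \<in> glue Inl Inr" by (auto simp: loop_def)
      then have "path (D a b c) (glue e1 e2) (?i x) ns (?i y)" using two unfolding D_def by blast
      moreover have "(?i y, ?i x) \<in> glue e1 e2" unfolding Ji using l(2) by force
      ultimately show "loop (D a b c) (glue e1 e2)" unfolding loop_def by blast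
    qed
  qed
  moreover have "loop (layer h (stack p q)) ?K \<longleftrightarrow> loop (stack p q) (glue Inl Inr)" by (rule loop_rename[OF h(1)])
  ultimately show "loop (stack a b) (glue Inl Inr) \<or> loop (stack p q) (glue Inl Inr) \<longleftrightarrow> loop (D a b c) J"
    using loop_eliminate[OF KJ, of "D a b c"] unfolding J_def e by simp
qed

lemma reversible_concatenate:
  assumes "reversible a" "reversible b" shows "reversible (concatenate a b)"
proof -
  have "(x, ns, y) \<in> stack a b \<Longrightarrow> (y, rev ns, x) \<in> stack a b" for x ns y
    using assms by (auto simp: mem_layer reversible_def)
  from path_rev[OF this sym_glue] show ?thesis
    unfolding reversible_def concatenate_def walk_iff_path by simp
qed

text \<open>Both sides describe the walks in the stack of all three diagrams. The pairs \<open>(1, v)\<close>, \<open>(2, v)\<close> and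
  \<open>(3, v)\<close> serve as the vertices of the three layers.\<close>

theorem concatenate_assoc:
  assumes "reversible a" "reversible b" "reversible c"
  shows "concatenate (concatenate a b) c = concatenate a (concatenate b c)"
    "has_loop a b \<or> has_loop (concatenate a b) c \<longleftrightarrow> has_loop b c \<or> has_loop a (concatenate b c)"
proof -
  define e :: "nat \<Rightarrow> vertex \<Rightarrow> nat \<times> vertex" where "e = Pair"
  have inj: "inj (e i)" for i by (auto simp: e_def inj_def)
  have disj: "i \<noteq> j \<Longrightarrow> range (e i) \<inter> range (e j) = {}" for i j by (auto simp: e_def)
  define o1 where "o1 = (\<lambda>v. e (if is_Top v then 2 else 1) v)"
  define o2 where "o2 = (\<lambda>v. e (if is_Top v then 3 else 2) v)"
  let ?h1 = "case_sum o1 (e 3)" and ?h2 = "case_sum (e 1) o2"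
  have h: "inj ?h1" "inj ?h2" by (auto simp: inj_def o1_def o2_def e_def split: sum.splits if_splits)
  have comp: "?h1 \<circ> Inl = o1" "?h1 \<circ> Inr = e 3" "?h2 \<circ> Inl = e 1" "?h2 \<circ> Inr = o2" by auto
  have K: "map_prod ?h1 ?h1 ` glue Inl Inr = glue (e 2) (e 3)" "map_prod ?h2 ?h2 ` glue Inl Inr = glue (e 1) (e 2)"
    unfolding map_glue comp by (simp_all add: glue_def o1_def o2_def)
  have out: "?h1 (outer_vertex v) = ?h2 (outer_vertex v)" for v by (cases v) (auto simp: o1_def o2_def)
  have o12: "o1 (Bot k) = e 1 (Bot k)" "o1 (Top k) = e 2 (Top k)" "o2 (Bot k) = e 2 (Bot k)" "o2 (Top k) = e 3 (Top k)" for k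
    by (simp_all add: o1_def o2_def)
  have L: "layer ?h1 (stack (concatenate a b) c) = layer o1 (concatenate a b) \<union> layer (e 3) c"
    "layer ?h2 (stack a (concatenate b c)) = layer o2 (concatenate b c) \<union> layer (e 1) a"
    by (simp only: layer_Un layer_layer comp, simp only: layer_Un layer_layer comp Un_commute)
  have ng: "?h1 (outer_vertex v) \<notin> Domain (glue (e 1) (e 2))" "?h2 (outer_vertex v) \<notin> Domain (glue (e 2) (e 3))" for v
    by (cases v; auto simp: o1_def o2_def glue_def e_def)+
  note lhs = concatenate_in_layers[OF inj inj inj disj disj disj o12(1,2) h(1) L(1) ng(1), unfolded K]
  note rhs = concatenate_in_layers[OF inj inj inj disj disj disj o12(3,4) h(2) L(2) ng(2), unfolded K]
  have D: "layer (e 2) b \<union> layer (e 3) c \<union> layer (e 1) a = layer (e 1) a \<union> layer (e 2) b \<union> layer (e 3) c"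
    and J: "glue (e 2) (e 3) \<union> glue (e 1) (e 2) = glue (e 1) (e 2) \<union> glue (e 2) (e 3)" by auto
  have "(v, ns, w) \<in> concatenate (concatenate a b) c \<longleftrightarrow> (v, ns, w) \<in> concatenate a (concatenate b c)" for v ns w
    using lhs(1) rhs(1) unfolding D J out by simp
  then show "concatenate (concatenate a b) c = concatenate a (concatenate b c)" by auto
  show "has_loop a b \<or> has_loop (concatenate a b) c \<longleftrightarrow> has_loop b c \<or> has_loop a (concatenate b c)"
    using lhs(2) rhs(2) assms reversible_concatenate unfolding D J by (simp add: has_loop_iff)
qed

section \<open>Strand maps as bead diagrams\<close>

definition graph :: "nat \<Rightarrow> strand_map \<Rightarrow> diagram" where
  "graph n f = (\<lambda>v. (v, f v)) ` vertices n"

lemma mem_graph: "(v, ns, w) \<in> graph n f \<longleftrightarrow> v \<in> vertices n \<and> f v = (ns, w)"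
  by (auto simp: graph_def)

lemma graph_eq_iff: "graph n f = graph n g \<longleftrightarrow> (\<forall>v \<in> vertices n. f v = g v)"
  by (auto simp: graph_def)

lemma vertices_simps [simp]: "Top k \<in> vertices n \<longleftrightarrow> k \<in> {1..n}" "Bot k \<in> vertices n \<longleftrightarrow> k \<in> {1..n}"
  by (auto simp: vertices_def)

text \<open>The wall condition says that strands join vertices of different colours.\<close>

definition colour :: "nat \<Rightarrow> vertex \<Rightarrow> bool" where
  "colour r v \<longleftrightarrow> (is_Top v \<longleftrightarrow> label v \<le> r)"

lemma colour_simps [simp]: "colour r (Top k) \<longleftrightarrow> k \<le> r" "colour r (Bot k) \<longleftrightarrow> \<not> k \<le> r"
  by (auto simp: colour_def)

definition matching :: "nat \<Rightarrow> nat \<Rightarrow> strand_map \<Rightarrow> bool" where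
  "matching r s f \<longleftrightarrow> (\<forall>v ns w. v \<in> vertices (r + s) \<and> f v = (ns, w) \<longrightarrow>
     w \<in> vertices (r + s) \<and> w \<noteq> v \<and> f w = (rev ns, v) \<and> (colour r v \<longleftrightarrow> \<not> colour r w))"

definition numbered :: "nat \<Rightarrow> nat \<Rightarrow> strand_map \<Rightarrow> bool" where
  "numbered n m f \<longleftrightarrow> (\<forall>v \<in> vertices n. distinct (fst (f v))) \<and>
     (\<forall>v \<in> vertices n. \<forall>v' \<in> vertices n. \<forall>b. b \<in> set (fst (f v)) \<and> b \<in> set (fst (f v')) \<longrightarrow>
        v' = v \<or> v' = snd (f v)) \<and>
     (\<Union>v \<in> vertices n. set (fst (f v))) = {1..m}"

definition valid :: "nat \<Rightarrow> nat \<Rightarrow> nat \<Rightarrow> strand_map \<Rightarrow> bool" where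
  "valid r s m f \<longleftrightarrow> matching r s f \<and> numbered (r + s) m f"

lemma matchingD:
  assumes "matching r s f" "v \<in> vertices (r + s)" "f v = (ns, w)"
  shows "w \<in> vertices (r + s)" "w \<noteq> v" "f w = (rev ns, v)" "colour r v \<longleftrightarrow> \<not> colour r w"
  using assms unfolding matching_def by blast+

lemma bead_numbers_graph: "bead_numbers (graph n f) = (\<Union>v \<in> vertices n. set (fst (f v)))"
  unfolding bead_numbers_def graph_def by (force split: prod.splits)

lemma valid_beads:
  assumes "valid r s m f"
  shows "bead_numbers (graph (r + s) f) = {1..m}" "max_bead (graph (r + s) f) = m"
proof -
  show 1: "bead_numbers (graph (r + s) f) = {1..m}"
    using assms by (simp add: valid_def numbered_def bead_numbers_graph)
  show "max_bead (graph (r + s) f) = m" unfolding max_bead_def 1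
    by (rule Max_eqI) (auto simp: Suc_le_eq)
qed

lemma graph_bead_diagram:
  assumes "valid r s m f" shows "graph (r + s) f \<in> bead_diagrams r s"
proof -
  have m: "matching r s f" and n: "numbered (r + s) m f" using assms by (auto simp: valid_def)
  have strand: "v \<noteq> w \<and> (w, rev ns, v) \<in> graph (r + s) f \<and> distinct ns \<and>
      (is_Top v \<noteq> is_Top w \<longrightarrow> (label v \<le> r \<longleftrightarrow> label w \<le> r)) \<and>
      (is_Top v = is_Top w \<longrightarrow> (label v \<le> r \<longleftrightarrow> \<not> label w \<le> r))"
    if "(v, ns, w) \<in> graph (r + s) f" for v ns w
  proof -
    have v: "v \<in> vertices (r + s)" "f v = (ns, w)" using that by (auto simp: mem_graph)
    note md = matchingD[OF m v]
    have "distinct ns" using n v unfolding numbered_def by force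
    then show ?thesis using md by (auto simp: mem_graph colour_def)
  qed
  have "{v, w} = {v', w'}"
    if "(v, ns, w) \<in> graph (r + s) f \<and> (v', ns', w') \<in> graph (r + s) f \<and> set ns \<inter> set ns' \<noteq> {}"
    for v ns w v' ns' w'
  proof -
    have v: "v \<in> vertices (r + s)" "f v = (ns, w)" "v' \<in> vertices (r + s)" "f v' = (ns', w')"
      and "\<exists>b. b \<in> set ns \<and> b \<in> set ns'"
      using that by (auto simp: mem_graph)
    then obtain b where "b \<in> set (fst (f v))" "b \<in> set (fst (f v'))" by auto
    then have "v' = v \<or> v' = w" using n v unfolding numbered_def by (metis snd_conv)
    then show ?thesis using v matchingD(3)[OF m v(1,2)] by auto
  qed
  moreover have "\<exists>m. bead_numbers (graph (r + s) f) = {1..m}" using valid_beads[OF assms] by blast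
  moreover have "\<exists>!p. (v, p) \<in> graph (r + s) f" if "v \<in> vertices (r + s)" for v
    using that by (intro ex1I[of _ "f v"]) (auto simp: graph_def)
  moreover have "graph (r + s) f \<subseteq> vertices (r + s) \<times> UNIV \<times> vertices (r + s)"
    using matchingD(1)[OF m] by (auto simp: mem_graph)
  ultimately show ?thesis unfolding bead_diagrams_def using strand by blast
qed

lemma reversible_graph: "matching r s f \<Longrightarrow> reversible (graph (r + s) f)"
  unfolding reversible_def mem_graph using matchingD by blast

lemma valid_id: "valid r s 0 id_map"
proof -
  have "flip_row v \<in> vertices n \<longleftrightarrow> v \<in> vertices n" "flip_row v \<noteq> v" "flip_row (flip_row v) = v"
    "colour r (flip_row v) \<longleftrightarrow> \<not> colour r v" for v n
    by (cases v; simp)+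
  then show ?thesis by (auto simp: valid_def matching_def numbered_def id_map_def)
qed

lemma matching_swap:
  assumes "matching r s f" "i \<in> s_indices r s" shows "matching r s (swap_map i f)"
proof -
  let ?t = "map_top (adj i)"
  have t: "?t (?t v) = v" "colour r (?t v) \<longleftrightarrow> colour r v" "?t v \<in> vertices (r + s) \<longleftrightarrow> v \<in> vertices (r + s)" for v
    using assms(2) by (cases v; auto simp: Transposition.transpose_def s_indices_def)+
  have "w \<in> vertices (r + s) \<and> w \<noteq> v \<and> swap_map i f w = (rev ns, v) \<and> (colour r v \<longleftrightarrow> \<not> colour r w)"
    if v: "v \<in> vertices (r + s)" "swap_map i f v = (ns, w)" for v ns w
  proof -
    have f: "f (?t v) = (ns, ?t w)" using v(2) t by (auto simp: swap_map_def split: prod.splits)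
    show ?thesis using matchingD[OF assms(1) _ f] v(1) t by (auto simp: swap_map_def)
  qed
  then show ?thesis unfolding matching_def by blast
qed

lemma valid_swap:
  assumes "valid r s m f" "i \<in> s_indices r s" shows "valid r s m (swap_map i f)"
proof -
  let ?t = "map_top (adj i)"
  have t: "?t (?t v) = v" "?t v \<in> vertices (r + s) \<longleftrightarrow> v \<in> vertices (r + s)" for v
    using assms(2) by (cases v; auto simp: Transposition.transpose_def s_indices_def)+
  have n: "numbered (r + s) m f" using assms by (auto simp: valid_def)
  have f: "fst (swap_map i f v) = fst (f (?t v))" "snd (swap_map i f v) = ?t (snd (f (?t v)))" for v
    by (simp_all add: swap_map_def split: prod.split)
  have im: "?t ` vertices (r + s) = vertices (r + s)"
  proof
    show "vertices (r + s) \<subseteq> ?t ` vertices (r + s)" using t by (metis image_eqI subsetI)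
  qed (use t in blast)
  have "(\<Union>v \<in> vertices (r + s). set (fst (f (?t v)))) = (\<Union>v \<in> ?t ` vertices (r + s). set (fst (f v)))" by simp
  also have "\<dots> = {1..m}" using n unfolding im by (simp only: numbered_def)
  finally have "(\<Union>v \<in> vertices (r + s). set (fst (f (?t v)))) = {1..m}" .
  moreover have "v' = v \<or> v' = ?t (snd (f (?t v)))" if "v \<in> vertices (r + s)" "v' \<in> vertices (r + s)"
    "b \<in> set (fst (f (?t v)))" "b \<in> set (fst (f (?t v')))" for v v' b
  proof -
    have "?t v' = ?t v \<or> ?t v' = snd (f (?t v))" using n that t unfolding numbered_def by blast
    then show ?thesis using t by metis
  qed
  moreover have "distinct (fst (f (?t v)))" if "v \<in> vertices (r + s)" for v
    using n that t unfolding numbered_def by blast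
  ultimately have "numbered (r + s) m (swap_map i f)" unfolding numbered_def f by blast
  then show ?thesis using assms matching_swap by (simp add: valid_def)
qed

lemma matching_bead:
  assumes "matching r s f" shows "matching r s (bead_map k b f)"
proof -
  have "w \<in> vertices (r + s) \<and> w \<noteq> v \<and> bead_map k b f w = (rev ns, v) \<and> (colour r v \<longleftrightarrow> \<not> colour r w)"
    if v: "v \<in> vertices (r + s)" "bead_map k b f v = (ns, w)" for v ns w
  proof -
    obtain ms where f: "f v = (ms, w)" "ns = (if v = Top k then [b] else []) @ ms @ (if w = Top k then [b] else [])"
      using v(2) by (auto simp: bead_map_def split: prod.splits)
    show ?thesis using matchingD[OF assms v(1) f(1)] f(2) by (auto simp: bead_map_def)
  qed
  then show ?thesis unfolding matching_def by blast
qed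

lemma valid_bead:
  assumes "valid r s m f" "k \<in> {1..r+s}" shows "valid r s (Suc m) (bead_map k (Suc m) f)"
proof -
  have m: "matching r s f" and n: "numbered (r + s) m f" using assms by (auto simp: valid_def)
  have sub: "set (fst (f v)) \<subseteq> {1..m}" if "v \<in> vertices (r + s)" for v
    using n that unfolding numbered_def by blast
  have new: "Suc m \<notin> set (fst (f v))" if "v \<in> vertices (r + s)" for v using sub[OF that] by auto
  let ?x = "Top k"
  have x: "?x \<in> vertices (r + s)" using assms by simp
  let ?y = "snd (f ?x)"
  have fx: "f ?x = (fst (f ?x), ?y)" by simp
  note y = matchingD[OF m x fx]
  have yy: "snd (f v) = ?x \<longleftrightarrow> v = ?y" if "v \<in> vertices (r + s)" for v
    using matchingD(3)[OF m that, of "fst (f v)" "snd (f v)"] y(3) by auto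
  have f: "set (fst (bead_map k (Suc m) f v)) = set (fst (f v)) \<union> (if v = ?x \<or> v = ?y then {Suc m} else {})"
    "snd (bead_map k (Suc m) f v) = snd (f v)"
    "distinct (fst (bead_map k (Suc m) f v))" if "v \<in> vertices (r + s)" for v
  proof -
    have d: "distinct (fst (f v))" using n that unfolding numbered_def by blast
    have e: "bead_map k (Suc m) f v = ((if v = ?x then [Suc m] else []) @ fst (f v) @ (if v = ?y then [Suc m] else []), snd (f v))"
      using yy[OF that] by (cases "f v") (simp add: bead_map_def)
    show "set (fst (bead_map k (Suc m) f v)) = set (fst (f v)) \<union> (if v = ?x \<or> v = ?y then {Suc m} else {})"
      "snd (bead_map k (Suc m) f v) = snd (f v)" unfolding e by auto
    show "distinct (fst (bead_map k (Suc m) f v))" unfolding e using d new[OF that] y(2) by auto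
  qed
  have "numbered (r + s) (Suc m) (bead_map k (Suc m) f)"
    unfolding numbered_def
  proof (intro conjI ballI allI impI)
    fix v v' b assume v: "v \<in> vertices (r + s)" "v' \<in> vertices (r + s)"
      and b: "b \<in> set (fst (bead_map k (Suc m) f v)) \<and> b \<in> set (fst (bead_map k (Suc m) f v'))"
    show "v' = v \<or> v' = snd (bead_map k (Suc m) f v)"
    proof (cases "b = Suc m")
      case True
      then have "v = ?x \<or> v = ?y" "v' = ?x \<or> v' = ?y" using b v f new by (auto split: if_splits)
      then show ?thesis using f(2)[OF v(1)] y(3) by auto
    next
      case False
      then have "b \<in> set (fst (f v))" "b \<in> set (fst (f v'))" using b v f by (auto split: if_splits)
      then show ?thesis using n v f(2)[OF v(1)] unfolding numbered_def by metis
    qed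
  next
    have "(\<Union>v \<in> vertices (r + s). set (fst (bead_map k (Suc m) f v))) =
      (\<Union>v \<in> vertices (r + s). set (fst (f v))) \<union> {Suc m}" using f(1) x y(1) by (auto split: if_splits)
    also have "\<dots> = {1..Suc m}" using n by (auto simp: numbered_def)
    finally show "(\<Union>v \<in> vertices (r + s). set (fst (bead_map k (Suc m) f v))) = {1..Suc m}" .
  qed (use f in auto)
  then show ?thesis using matching_bead[OF m] by (simp add: valid_def)
qed

text \<open>The partners \<open>p\<close>, \<open>q\<close> of the two joined vertices become partners of each other.\<close>

lemma join_cases:
  assumes "matching r s f" "x \<in> vertices (r + s)" "y \<in> vertices (r + s)" "x \<noteq> y" "snd (f x) \<noteq> y"
  obtains p q ns ms where "f x = (ns, p)" "f y = (ms, q)" "f p = (rev ns, x)" "f q = (rev ms, y)"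
    "p \<in> vertices (r + s)" "q \<in> vertices (r + s)" "distinct [x, y, p, q]"
    "join_map x y f x = ([], y)" "join_map x y f y = ([], x)"
    "join_map x y f p = (rev ns @ ms, q)" "join_map x y f q = (rev ms @ ns, p)"
    "\<And>v. v \<in> vertices (r + s) \<Longrightarrow> v \<notin> {x, y, p, q} \<Longrightarrow> join_map x y f v = f v \<and> snd (f v) \<notin> {x, y, p, q}"
proof -
  obtain ns p ms q where f: "f x = (ns, p)" "f y = (ms, q)" by (metis surj_pair)
  note p = matchingD[OF assms(1,2) f(1)] and q = matchingD[OF assms(1,3) f(2)]
  have ne: "p \<noteq> y" "q \<noteq> x" "p \<noteq> q" using assms(4,5) f p q by auto
  have other: "snd (f v) \<notin> {x, y, p, q}" if v: "v \<in> vertices (r + s)" "v \<notin> {x, y, p, q}" for v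
    using matchingD(3)[OF assms(1) v(1), of "fst (f v)" "snd (f v)"] v(2) f p(3) q(3) by auto
  show thesis
  proof (rule that[OF f p(3) q(3) p(1) q(1)])
    show "join_map x y f v = f v \<and> snd (f v) \<notin> {x, y, p, q}"
      if "v \<in> vertices (r + s)" "v \<notin> {x, y, p, q}" for v
      using other[OF that] that by (auto simp: join_map_def split: prod.split)
  qed (use f p q ne assms in \<open>auto simp: join_map_def\<close>)
qed

lemma matching_join:
  assumes "matching r s f" "x \<in> vertices (r + s)" "y \<in> vertices (r + s)" "x \<noteq> y" "snd (f x) \<noteq> y"
    "colour r x \<longleftrightarrow> \<not> colour r y"
  shows "matching r s (join_map x y f)"
proof -
  obtain p q ns ms where j: "f x = (ns, p)" "f y = (ms, q)" "f p = (rev ns, x)" "f q = (rev ms, y)"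
    "p \<in> vertices (r + s)" "q \<in> vertices (r + s)" "distinct [x, y, p, q]"
    "join_map x y f x = ([], y)" "join_map x y f y = ([], x)"
    "join_map x y f p = (rev ns @ ms, q)" "join_map x y f q = (rev ms @ ns, p)"
    "\<And>v. v \<in> vertices (r + s) \<Longrightarrow> v \<notin> {x, y, p, q} \<Longrightarrow> join_map x y f v = f v \<and> snd (f v) \<notin> {x, y, p, q}"
    using join_cases[OF assms(1-5)] by metis
  have c: "colour r x \<longleftrightarrow> \<not> colour r p" "colour r y \<longleftrightarrow> \<not> colour r q"
    using matchingD(4)[OF assms(1,2) j(1)] matchingD(4)[OF assms(1,3) j(2)] by auto
  have "w \<in> vertices (r + s) \<and> w \<noteq> v \<and> join_map x y f w = (rev ls, v) \<and> (colour r v \<longleftrightarrow> \<not> colour r w)"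
    if v: "v \<in> vertices (r + s)" "join_map x y f v = (ls, w)" for v ls w
  proof (cases "v \<in> {x, y, p, q}")
    case True
    then show ?thesis using v(2) j(5-11) assms(2,3,6) c by auto
  next
    case False
    then have f: "f v = (ls, w)" "snd (f v) \<notin> {x, y, p, q}" using j(12)[OF v(1)] v(2) by auto
    then have "w \<notin> {x, y, p, q}" by simp
    then show ?thesis using matchingD[OF assms(1) v(1) f(1)] j(12)[of w] by auto
  qed
  then show ?thesis unfolding matching_def by blast
qed

lemma valid_join:
  assumes "valid r s m f" "x \<in> vertices (r + s)" "y \<in> vertices (r + s)" "x \<noteq> y" "snd (f x) \<noteq> y"
    "colour r x \<longleftrightarrow> \<not> colour r y"
  shows "valid r s m (join_map x y f)"
proof -
  have m: "matching r s f" and n: "numbered (r + s) m f" using assms by (auto simp: valid_def)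
  obtain p q ns ms where j: "f x = (ns, p)" "f y = (ms, q)" "f p = (rev ns, x)" "f q = (rev ms, y)"
    "p \<in> vertices (r + s)" "q \<in> vertices (r + s)" "distinct [x, y, p, q]"
    "join_map x y f x = ([], y)" "join_map x y f y = ([], x)"
    "join_map x y f p = (rev ns @ ms, q)" "join_map x y f q = (rev ms @ ns, p)"
    "\<And>v. v \<in> vertices (r + s) \<Longrightarrow> v \<notin> {x, y, p, q} \<Longrightarrow> join_map x y f v = f v \<and> snd (f v) \<notin> {x, y, p, q}"
    using join_cases[OF m assms(2-5)] by metis
  let ?j = "join_map x y f" and ?V = "vertices (r + s)"
  have share: "v' = v \<or> v' = snd (f v)" if "v \<in> ?V" "v' \<in> ?V" "b \<in> set (fst (f v))" "b \<in> set (fst (f v'))" for v v' b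
    using n that unfolding numbered_def by blast
  have d: "distinct (fst (f v))" if "v \<in> ?V" for v using n that unfolding numbered_def by blast
  have disj: "set ns \<inter> set ms = {}" using share[OF assms(2,3)] j(1,2,7) by auto
  have dn: "distinct ns" "distinct ms" using d[OF assms(2)] d[OF assms(3)] j by auto
  have old: "v \<in> ?V \<Longrightarrow> v \<notin> {x, y, p, q} \<Longrightarrow> fst (?j v) = fst (f v) \<and> (\<forall>b \<in> set (fst (f v)). b \<notin> set ns \<and> b \<notin> set ms)" for v
    using j(12)[of v] share[OF assms(2), of v] share[OF assms(3), of v] j(1,2) by auto
  have "numbered (r + s) m ?j"
    unfolding numbered_def
  proof (intro conjI ballI allI impI)
    fix v assume v: "v \<in> ?V"
    show "distinct (fst (?j v))"
      using j(7-11) dn disj d[OF v] j(12)[OF v] by (cases "v \<in> {x, y, p, q}") auto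
  next
    fix v v' b assume v: "v \<in> ?V" "v' \<in> ?V" and b: "b \<in> set (fst (?j v)) \<and> b \<in> set (fst (?j v'))"
    show "v' = v \<or> v' = snd (?j v)"
    proof (cases "v \<in> {x, y, p, q}"; cases "v' \<in> {x, y, p, q}")
      assume "v \<in> {x, y, p, q}" "v' \<in> {x, y, p, q}"
      then show ?thesis using b j(8-11) by auto
    next
      assume "v \<in> {x, y, p, q}" "v' \<notin> {x, y, p, q}"
      then show ?thesis using b j(8-11) old[OF v(2)] by auto
    next
      assume "v \<notin> {x, y, p, q}" "v' \<in> {x, y, p, q}"
      then show ?thesis using b j(8-11) old[OF v(1)] by auto
    next
      assume "v \<notin> {x, y, p, q}" "v' \<notin> {x, y, p, q}"
      then show ?thesis using b j(12)[OF v(1)] j(12)[OF v(2)] share[OF v] by auto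
    qed
  next
    let ?O = "?V - {x, y, p, q}"
    have V: "?V = ?O \<union> {x, y, p, q}" using assms(2,3) j(5,6) by auto
    have "(\<Union>v \<in> ?O. set (fst (?j v))) = (\<Union>v \<in> ?O. set (fst (f v)))" using old by auto
    moreover have "(\<Union>v \<in> {x, y, p, q}. set (fst (?j v))) = (\<Union>v \<in> {x, y, p, q}. set (fst (f v)))"
      using j(1-4,8-11) by auto
    ultimately have "(\<Union>v \<in> ?V. set (fst (?j v))) = (\<Union>v \<in> ?V. set (fst (f v)))"
      by (subst (1 2) V) (simp only: UN_Un)
    then show "(\<Union>v \<in> ?V. set (fst (?j v))) = {1..m}" using n by (simp add: numbered_def)
  qed
  then show ?thesis using matching_join[OF m assms(2-6)] by (simp add: valid_def)
qed

lemma valid_act: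
  assumes "valid r s m f" "g \<in> generators r s" "act r m g f = Some f'"
  shows "valid r s (m + count_C [g]) f'"
proof (cases g)
  case (S i)
  then have "i \<in> s_indices r s" using assms(2) by (auto simp: generators_def split: if_splits)
  then show ?thesis using valid_swap assms S by auto
next
  case E
  then have "1 \<le> r" "1 \<le> s" using assms(2) by (auto simp: generators_def split: if_splits)
  then show ?thesis using valid_join[OF assms(1), of "Top r" "Top (r + 1)"] assms(3) E by (auto split: if_splits)
next
  case (C k)
  then have "k \<in> {1..r+s}" using assms(2) by (auto simp: generators_def split: if_splits)
  then show ?thesis using valid_bead assms C by auto
qed

lemma valid_act_word:
  "valid r s m f \<Longrightarrow> set w \<subseteq> generators r s \<Longrightarrow> act_word r m w f = Some f' \<Longrightarrow> valid r s (m + count_C w) f'"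
proof (induction w arbitrary: m f)
  case (Cons g w)
  then obtain f1 where "act r m g f = Some f1" "act_word r (m + count_C [g]) w f1 = Some f'"
    by (auto split: bind_splits)
  then show ?case using Cons.IH[of "m + count_C [g]" f1] valid_act[of r s m f g f1] Cons.prems
    by (auto split: if_splits)
qed auto

section \<open>Products with generator diagrams\<close>

text \<open>A walk that has arrived at \<open>y\<close> can be completed to one that ends at \<open>z\<close>, outside the glued row.\<close>

definition continues where
  "continues D J y ms z \<longleftrightarrow> z \<notin> Domain J \<and> (y \<notin> Domain J \<and> ms = [] \<and> z = y \<or> (\<exists>y'. (y, y') \<in> J \<and> path D J y' ms z))"

lemma edge_continues: "(x, ns, y) \<in> D \<Longrightarrow> continues D J y ms z \<Longrightarrow> path D J x (ns @ ms) z"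
  unfolding continues_def by (auto intro: path.edge path.step)

lemma continuesI: "(y, y') \<in> J \<Longrightarrow> path D J y' ms z \<Longrightarrow> z \<notin> Domain J \<Longrightarrow> continues D J y ms z"
  unfolding continues_def by blast

text \<open>A walk between outer vertices is determined by its start. So it suffices to exhibit, for every
  outer vertex, the walk to the other end of its strand.\<close>

lemma concatenate_graphs:
  assumes f': "\<And>v. v \<in> vertices n \<Longrightarrow>
      path (stack (graph n f) (graph n g)) (glue Inl Inr) (outer_vertex v) (fst (f' v)) (outer_vertex (snd (f' v)))"
    and exits: "\<And>k. k \<in> {1..n} \<Longrightarrow>
      \<exists>ns z. path (stack (graph n f) (graph n g)) (glue Inl Inr) (Inl (Top k)) ns z \<and> z \<notin> Domain (glue Inl Inr)"
  shows "\<not> has_loop (graph n f) (graph n g)" "concatenate (graph n f) (graph n g) = graph n f'"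
proof -
  let ?D = "stack (graph n f) (graph n g)" and ?J = "glue Inl Inr :: ((vertex + vertex) \<times> (vertex + vertex)) set"
  have D: "(x, ns, y) \<in> ?D \<Longrightarrow> (x, ns', y') \<in> ?D \<Longrightarrow> ns = ns' \<and> y = y'" for x ns y ns' y'
    by (auto simp: mem_layer mem_graph)
  have J: "single_valued ?J" by (rule single_valued_glue) auto
  have start: "path ?D ?J x ns y \<Longrightarrow> \<exists>v \<in> vertices n. x = Inl v \<or> x = Inr v" for x ns y
    by (induction rule: path.induct) (auto simp: mem_layer mem_graph)
  show "\<not> has_loop (graph n f) (graph n g)"
  proof
    assume "has_loop (graph n f) (graph n g)"
    then obtain k ns where l: "path ?D ?J (Inl (Top k)) ns (Inr (Bot k))"
      by (auto simp: has_loop_def walk_iff_path)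
    then have "k \<in> {1..n}" using start[OF l] by auto
    then obtain ms z where "path ?D ?J (Inl (Top k)) ms z" "z \<notin> Domain ?J" using exits by blast
    from path_exit_no_loop[OF D J this l] show False by (auto simp: glue_def)
  qed
  have "(v, ns, w) \<in> concatenate (graph n f) (graph n g) \<longleftrightarrow> v \<in> vertices n \<and> f' v = (ns, w)" for v ns w
  proof
    assume "(v, ns, w) \<in> concatenate (graph n f) (graph n g)"
    then have p: "path ?D ?J (outer_vertex v) ns (outer_vertex w)" by (simp add: concatenate_def walk_iff_path)
    have v: "v \<in> vertices n" using start[OF p] by (cases v) auto
    have "ns = fst (f' v) \<and> outer_vertex w = outer_vertex (snd (f' v))"
      by (rule path_deterministic[OF D J p f'[OF v]]) (auto simp: outer_not_glued)
    then show "v \<in> vertices n \<and> f' v = (ns, w)" using v by (cases w; cases "snd (f' v)") (auto simp: prod_eq_iff)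
  next
    assume "v \<in> vertices n \<and> f' v = (ns, w)"
    then show "(v, ns, w) \<in> concatenate (graph n f) (graph n g)"
      using f'[of v] by (simp add: concatenate_def walk_iff_path)
  qed
  then show "concatenate (graph n f) (graph n g) = graph n f'" by (auto simp: mem_graph)
qed

text \<open>The upper diagram has only vertical strands, from bottom \<open>k\<close> to top \<open>\<rho> k\<close> with beads \<open>\<beta> k\<close>. This covers
  all generators except \<open>e\<close>.\<close>

lemma concatenate_vertical:
  assumes f: "matching r s f"
    and g: "\<And>k. k \<in> {1..r+s} \<Longrightarrow> \<rho> k \<in> {1..r+s} \<and> g (Bot k) = (\<beta> k, Top (\<rho> k)) \<and> g (Top (\<rho> k)) = (rev (\<beta> k), Bot k)"
    and surj: "\<And>k. k \<in> {1..r+s} \<Longrightarrow> \<exists>l \<in> {1..r+s}. k = \<rho> l"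
    and f'_bot: "\<And>k. k \<in> {1..r+s} \<Longrightarrow> f' (Bot k) = (let (ns, w) = f (Bot k) in
        case w of Bot l \<Rightarrow> (ns, Bot l) | Top l \<Rightarrow> (ns @ \<beta> l, Top (\<rho> l)))"
    and f'_top: "\<And>k. k \<in> {1..r+s} \<Longrightarrow> f' (Top (\<rho> k)) = (let (ns, w) = f (Top k) in
        case w of Bot l \<Rightarrow> (rev (\<beta> k) @ ns, Bot l) | Top l \<Rightarrow> (rev (\<beta> k) @ ns @ \<beta> l, Top (\<rho> l)))"
  shows "\<not> has_loop (graph (r + s) f) (graph (r + s) g)"
    "concatenate (graph (r + s) f) (graph (r + s) g) = graph (r + s) f'"
proof -
  let ?D = "stack (graph (r + s) f) (graph (r + s) g)"
  let ?J = "glue Inl Inr :: ((vertex + vertex) \<times> (vertex + vertex)) set"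
  let ?up = "\<lambda>w. case w of Bot l \<Rightarrow> ([], Bot l) | Top l \<Rightarrow> (\<beta> l, Top (\<rho> l))"
  have edge: "v \<in> vertices (r + s) \<Longrightarrow> f v = (ns, w) \<Longrightarrow> (Inl v, ns, Inl w) \<in> ?D"
    "v \<in> vertices (r + s) \<Longrightarrow> g v = (ns, w) \<Longrightarrow> (Inr v, ns, Inr w) \<in> ?D" for v ns w
    by (auto simp: mem_layer mem_graph)
  have up: "continues ?D ?J (Inl w) (fst (?up w)) (outer_vertex (snd (?up w)))" if "w \<in> vertices (r + s)" for w
  proof (cases w)
    case (Top l)
    then have "path ?D ?J (Inr (Bot l)) (\<beta> l) (Inr (Top (\<rho> l)))" using that g edge by (intro path.edge) auto
    then show ?thesis using Top by (intro continuesI[of _ "Inr (Bot l)"]) (auto simp: glue_def)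
  next
    case (Bot l)
    then show ?thesis by (auto simp: continues_def glue_def)
  qed
  have low: "path ?D ?J (Inl v) (fst (f v) @ fst (?up (snd (f v)))) (outer_vertex (snd (?up (snd (f v)))))"
    if "v \<in> vertices (r + s)" for v
  proof (rule edge_continues)
    show "(Inl v, fst (f v), Inl (snd (f v))) \<in> ?D" using edge(1) that by simp
    show "continues ?D ?J (Inl (snd (f v))) (fst (?up (snd (f v)))) (outer_vertex (snd (?up (snd (f v)))))"
      using matchingD(1)[OF f that] by (intro up) (metis prod.collapse)
  qed
  have main: "path ?D ?J (outer_vertex v) (fst (f' v)) (outer_vertex (snd (f' v)))" if "v \<in> vertices (r + s)" for v
  proof (cases v)
    case (Bot k)
    then show ?thesis using low[OF that] f'_bot[of k] that by (auto split: prod.splits vertex.splits)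
  next
    case (Top k')
    then have "k' \<in> {1..r+s}" using that by simp
    then obtain k where k: "k \<in> {1..r+s}" "k' = \<rho> k" using surj by blast
    let ?u = "?up (snd (f (Top k)))"
    have "(Inr (Top k'), rev (\<beta> k), Inr (Bot k)) \<in> ?D" using edge(2) that Top k g by auto
    moreover have "continues ?D ?J (Inr (Bot k)) (fst (f (Top k)) @ fst ?u) (outer_vertex (snd ?u))"
      by (rule continuesI[OF _ low[of "Top k"] outer_not_glued]) (use k in \<open>auto simp: glue_def\<close>)
    ultimately have "path ?D ?J (Inr (Top k')) (rev (\<beta> k) @ fst (f (Top k)) @ fst ?u) (outer_vertex (snd ?u))"
      by (rule edge_continues)
    then show ?thesis using f'_top[OF k(1)] k Top by (auto split: prod.splits vertex.splits)
  qed
  have ex: "\<exists>ns z. path ?D ?J (Inl (Top k)) ns z \<and> z \<notin> Domain ?J" if "k \<in> {1..r+s}" for k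
    using low[of "Top k"] that outer_not_glued by auto
  show "\<not> has_loop (graph (r + s) f) (graph (r + s) g)"
    "concatenate (graph (r + s) f) (graph (r + s) g) = graph (r + s) f'"
    using concatenate_graphs[OF main ex] by blast+
qed

fun generator_map :: "nat \<Rightarrow> generator \<Rightarrow> nat \<Rightarrow> strand_map" where
  "generator_map r (S i) b = swap_map i id_map"
| "generator_map r E b = join_map (Top r) (Top (r + 1)) id_map"
| "generator_map r (C k) b = bead_map k b id_map"

lemma concatenate_id:
  assumes "matching r s f"
  shows "\<not> has_loop (graph (r + s) f) (graph (r + s) id_map)"
    "concatenate (graph (r + s) f) (graph (r + s) id_map) = graph (r + s) f"
  by (rule concatenate_vertical[OF assms, where \<rho> = id and \<beta> = "\<lambda>_. []"];
    auto simp: id_map_def split: prod.splits vertex.splits)+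

lemma concatenate_swap:
  assumes "matching r s f" "i \<in> s_indices r s"
  shows "\<not> has_loop (graph (r + s) f) (graph (r + s) (swap_map i id_map))"
    "concatenate (graph (r + s) f) (graph (r + s) (swap_map i id_map)) = graph (r + s) (swap_map i f)"
proof -
  have a: "adj i k \<in> {1..r+s} \<longleftrightarrow> k \<in> {1..r+s}" for k
    using assms(2) by (auto simp: s_indices_def Transposition.transpose_def)
  have b: "\<exists>l \<in> {1..r+s}. k = adj i l" if "k \<in> {1..r+s}" for k
    using that a by (intro bexI[of _ "adj i k"]) auto
  have g: "adj i k \<in> {1..r+s} \<and> swap_map i id_map (Bot k) = ([], Top (adj i k)) \<and>
      swap_map i id_map (Top (adj i k)) = (rev [], Bot k)" if "k \<in> {1..r+s}" for k
    using that a[of k] by (simp only: swap_map_def id_map_def map_top.simps flip_row.simps transpose_involutory Let_def prod.case rev.simps)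
  have f1: "swap_map i f (Bot k) = (let (ns, w) = f (Bot k) in
      case w of Bot l \<Rightarrow> (ns, Bot l) | Top l \<Rightarrow> (ns @ [], Top (adj i l)))" for k
  proof -
    obtain ns w where "f (Bot k) = (ns, w)" by fastforce
    then show ?thesis by (cases w) (simp_all add: swap_map_def)
  qed
  have f2: "swap_map i f (Top (adj i k)) = (let (ns, w) = f (Top k) in
      case w of Bot l \<Rightarrow> (rev [] @ ns, Bot l) | Top l \<Rightarrow> (rev [] @ ns @ [], Top (adj i l)))" for k
  proof -
    obtain ns w where "f (Top k) = (ns, w)" by fastforce
    then show ?thesis by (cases w) (simp_all add: swap_map_def)
  qed
  show "\<not> has_loop (graph (r + s) f) (graph (r + s) (swap_map i id_map))"
    "concatenate (graph (r + s) f) (graph (r + s) (swap_map i id_map)) = graph (r + s) (swap_map i f)"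
    by (rule concatenate_vertical[OF assms(1) g b f1 f2]; assumption)+
qed

lemma concatenate_bead:
  assumes "matching r s f"
  shows "\<not> has_loop (graph (r + s) f) (graph (r + s) (bead_map k b id_map))"
    "concatenate (graph (r + s) f) (graph (r + s) (bead_map k b id_map)) = graph (r + s) (bead_map k b f)"
proof -
  let ?b = "\<lambda>l. if l = k then [b] else []"
  have g: "id l \<in> {1..r+s} \<and> bead_map k b id_map (Bot l) = (?b l, Top (id l)) \<and>
      bead_map k b id_map (Top (id l)) = (rev (?b l), Bot l)" if "l \<in> {1..r+s}" for l
    using that by (simp add: bead_map_def id_map_def)
  have f1: "bead_map k b f (Bot j) = (let (ns, w) = f (Bot j) in
      case w of Bot l \<Rightarrow> (ns, Bot l) | Top l \<Rightarrow> (ns @ ?b l, Top (id l)))" for j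
  proof -
    obtain ns w where "f (Bot j) = (ns, w)" by fastforce
    then show ?thesis by (cases w) (simp_all add: bead_map_def)
  qed
  have f2: "bead_map k b f (Top (id j)) = (let (ns, w) = f (Top j) in
      case w of Bot l \<Rightarrow> (rev (?b j) @ ns, Bot l) | Top l \<Rightarrow> (rev (?b j) @ ns @ ?b l, Top (id l)))" for j
  proof -
    obtain ns w where "f (Top j) = (ns, w)" by fastforce
    then show ?thesis by (cases w) (simp_all add: bead_map_def)
  qed
  have s: "\<exists>l \<in> {1..r+s}. j = id l" if "j \<in> {1..r+s}" for j using that by simp
  show "\<not> has_loop (graph (r + s) f) (graph (r + s) (bead_map k b id_map))"
    "concatenate (graph (r + s) f) (graph (r + s) (bead_map k b id_map)) = graph (r + s) (bead_map k b f)"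
    by (rule concatenate_vertical[OF assms g s f1 f2]; assumption)+
qed

text \<open>If no loop arises, a walk passes the strand between the bottom vertices \<open>r\<close> and \<open>r + 1\<close> of the upper
  diagram at most once. So it runs along at most two strands of the lower diagram.\<close>

lemma concatenate_join:
  assumes f: "matching r s f" and rs: "1 \<le> r" "1 \<le> s"
  defines "e \<equiv> join_map (Top r) (Top (r + 1)) id_map"
  shows "has_loop (graph (r + s) f) (graph (r + s) e) \<longleftrightarrow> snd (f (Top r)) = Top (r + 1)"
    "snd (f (Top r)) \<noteq> Top (r + 1) \<Longrightarrow>
      concatenate (graph (r + s) f) (graph (r + s) e) = graph (r + s) (join_map (Top r) (Top (r + 1)) f)"
proof -
  let ?D = "stack (graph (r + s) f) (graph (r + s) e)"
  let ?J = "glue Inl Inr :: ((vertex + vertex) \<times> (vertex + vertex)) set"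
  let ?x = "Top r" and ?y = "Top (r + 1)"
  have xy: "?x \<in> vertices (r + s)" "?y \<in> vertices (r + s)" "?x \<noteq> ?y" using rs by auto
  have edge: "v \<in> vertices (r + s) \<Longrightarrow> f v = (ns, w) \<Longrightarrow> (Inl v, ns, Inl w) \<in> ?D"
    "v \<in> vertices (r + s) \<Longrightarrow> e v = (ns, w) \<Longrightarrow> (Inr v, ns, Inr w) \<in> ?D" for v ns w
    by (auto simp: mem_layer mem_graph)
  have e: "e ?x = ([], ?y)" "e ?y = ([], ?x)" "e (Bot r) = ([], Bot (r + 1))" "e (Bot (r + 1)) = ([], Bot r)"
    "k \<noteq> r \<Longrightarrow> k \<noteq> r + 1 \<Longrightarrow> e (Top k) = ([], Bot k) \<and> e (Bot k) = ([], Top k)" for k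
    by (auto simp: e_def join_map_def id_map_def)
  have J: "(Inl (Top k), Inr (Bot k)) \<in> ?J" "(Inr (Bot k), Inl (Top k)) \<in> ?J" for k by (auto simp: glue_def)
  have loop: "has_loop (graph (r + s) f) (graph (r + s) e)" if l: "snd (f ?x) = ?y"
  proof -
    obtain ns where fx: "f ?x = (ns, ?y)" using l by (metis prod.collapse)
    have "path ?D ?J (Inr (Bot r)) [] (Inr (Bot (r + 1)))" using edge(2) e rs by (intro path.edge) auto
    then have "path ?D ?J (Inl ?y) (rev ns @ []) (Inr (Bot (r + 1)))"
      using matchingD(3)[OF f xy(1) fx] xy by (intro path.step[OF edge(1) J(1)]) auto
    then show ?thesis unfolding has_loop_def walk_iff_path by blast
  qed
  have *: "\<not> has_loop (graph (r + s) f) (graph (r + s) e) \<and>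
    concatenate (graph (r + s) f) (graph (r + s) e) = graph (r + s) (join_map ?x ?y f)" if nl: "snd (f ?x) \<noteq> ?y"
  proof -
    have c0: "continues ?D ?J (Inl w) [] (outer_vertex w)" if "w \<in> vertices (r + s)" "w \<noteq> ?x" "w \<noteq> ?y" for w
    proof (cases w)
      case (Top l)
      then have "path ?D ?J (Inr (Bot l)) [] (Inr (Top l))" using that edge(2) e(5)[of l] by (intro path.edge) auto
      then show ?thesis using Top by (intro continuesI[of _ "Inr (Bot l)"]) (auto simp: glue_def)
    next
      case (Bot l)
      then show ?thesis by (auto simp: continues_def glue_def)
    qed
    have nl': "snd (f ?y) \<noteq> ?x" using nl matchingD(3)[OF f xy(2), of "fst (f ?y)" ?x] by (metis prod.collapse snd_conv)
    have partner: "snd (f v) \<in> vertices (r + s)" "snd (f v) \<noteq> v" if "v \<in> vertices (r + s)" for v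
      using matchingD(1,2)[OF f that] by (metis prod.collapse)+
    have direct: "path ?D ?J (Inl v) (fst (f v)) (outer_vertex (snd (f v)))"
      if "v \<in> vertices (r + s)" "snd (f v) \<noteq> ?x" "snd (f v) \<noteq> ?y" for v
      using edge_continues[OF edge(1)[OF that(1)] c0[of "snd (f v)"]] that partner[OF that(1)]
      by (metis append_Nil2 prod.collapse)
    have cross: "continues ?D ?J (Inl u) (fst (f u')) (outer_vertex (snd (f u')))"
      if "(u, u') = (?x, ?y) \<or> (u, u') = (?y, ?x)" for u u'
    proof -
      let ?b = "flip_row u" and ?b' = "flip_row u'"
      have u': "u' \<in> vertices (r + s)" "snd (f u') \<noteq> ?x" "snd (f u') \<noteq> ?y"
        using that xy nl nl' partner(2)[OF xy(1)] partner(2)[OF xy(2)] by auto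
      have "continues ?D ?J (Inr ?b') (fst (f u')) (outer_vertex (snd (f u')))"
        by (rule continuesI[OF _ direct[OF u'] outer_not_glued]) (use that J in auto)
      moreover have "(Inr ?b, [], Inr ?b') \<in> ?D" using that e rs by (intro edge(2)) auto
      ultimately have "path ?D ?J (Inr ?b) ([] @ fst (f u')) (outer_vertex (snd (f u')))" by (rule edge_continues[rotated])
      then have "path ?D ?J (Inr ?b) (fst (f u')) (outer_vertex (snd (f u')))" by simp
      then show ?thesis by (rule continuesI[OF _ _ outer_not_glued, rotated]) (use that J in auto)
    qed
    let ?j = "\<lambda>v. if snd (f v) = ?x then (fst (f v) @ fst (f ?y), snd (f ?y))
      else if snd (f v) = ?y then (fst (f v) @ fst (f ?x), snd (f ?x)) else f v"
    have low: "path ?D ?J (Inl v) (fst (?j v)) (outer_vertex (snd (?j v)))" if v: "v \<in> vertices (r + s)" for v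
    proof -
      have fv: "(Inl v, fst (f v), Inl (snd (f v))) \<in> ?D" using edge(1) v by simp
      consider "snd (f v) = ?x" | "snd (f v) = ?y" | "snd (f v) \<noteq> ?x" "snd (f v) \<noteq> ?y" by blast
      then show ?thesis
      proof cases
        case 1
        then show ?thesis using edge_continues[OF fv] cross[of ?x ?y] by simp
      next
        case 2
        then show ?thesis using edge_continues[OF fv] cross[of ?y ?x] xy(3) by simp
      next
        case 3
        then show ?thesis using direct[OF v] by simp
      qed
    qed
    have jm: "join_map ?x ?y f v = ?j v" if "v \<noteq> ?x" "v \<noteq> ?y" for v
      using that by (simp add: join_map_def split: prod.split)
    have main: "path ?D ?J (outer_vertex v) (fst (join_map ?x ?y f v)) (outer_vertex (snd (join_map ?x ?y f v)))"
      if v: "v \<in> vertices (r + s)" for v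
    proof (cases "v = ?x \<or> v = ?y")
      case True
      then show ?thesis
      proof
        assume "v = ?x"
        then show ?thesis using path.edge[OF edge(2)[OF xy(1) e(1)]] by (simp add: join_map_def)
      next
        assume "v = ?y"
        then show ?thesis using path.edge[OF edge(2)[OF xy(2) e(2)]] by (simp add: join_map_def)
      qed
    next
      case False
      then have jv: "join_map ?x ?y f v = ?j v" using jm by blast
      show ?thesis
      proof (cases v)
        case (Bot k)
        then show ?thesis using low[OF v] unfolding jv by simp
      next
        case (Top k)
        then have "(Inr v, [], Inr (Bot k)) \<in> ?D" using e(5)[of k] False v by (intro edge(2)) auto
        moreover have "continues ?D ?J (Inr (Bot k)) (fst (?j v)) (outer_vertex (snd (?j v)))"
          by (rule continuesI[OF _ low[OF v] outer_not_glued]) (use Top J in auto)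
        ultimately have "path ?D ?J (Inr v) ([] @ fst (?j v)) (outer_vertex (snd (?j v)))" by (rule edge_continues)
        then show ?thesis using Top unfolding jv by simp
      qed
    qed
    have ex: "\<exists>ns z. path ?D ?J (Inl (Top k)) ns z \<and> z \<notin> Domain ?J" if "k \<in> {1..r+s}" for k
      using low[of "Top k"] that outer_not_glued by (auto simp del: split_paired_Ex)
    show ?thesis using concatenate_graphs[OF main ex] by blast
  qed
  show "has_loop (graph (r + s) f) (graph (r + s) e) \<longleftrightarrow> snd (f (Top r)) = Top (r + 1)"
    using loop * by blast
  show "snd (f (Top r)) \<noteq> Top (r + 1) \<Longrightarrow>
      concatenate (graph (r + s) f) (graph (r + s) e) = graph (r + s) (join_map (Top r) (Top (r + 1)) f)"
    using * by blast
qed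

lemma concatenate_generator:
  assumes f: "matching r s f" and g: "g \<in> generators r s"
  shows "has_loop (graph (r + s) f) (graph (r + s) (generator_map r g b)) \<longleftrightarrow> act r m g f = None"
    "act r m g f = Some f' \<Longrightarrow>
      concatenate (graph (r + s) f) (graph (r + s) (generator_map r g (Suc m))) = graph (r + s) f'"
proof -
  have "(has_loop (graph (r + s) f) (graph (r + s) (generator_map r g b)) \<longleftrightarrow> act r m g f = None) \<and>
    (act r m g f = Some f' \<longrightarrow>
      concatenate (graph (r + s) f) (graph (r + s) (generator_map r g (Suc m))) = graph (r + s) f')"
  proof (cases g)
    case (S i)
    then have "i \<in> s_indices r s" using g by (auto simp: generators_def split: if_splits)
    then show ?thesis using concatenate_swap[OF f] S by auto
  next
    case E
    then have "1 \<le> r" "1 \<le> s" using g by (auto simp: generators_def split: if_splits)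
    then show ?thesis using concatenate_join[OF f] E by auto
  next
    case (C k)
    then show ?thesis using concatenate_bead[OF f] by auto
  qed
  then show "has_loop (graph (r + s) f) (graph (r + s) (generator_map r g b)) \<longleftrightarrow> act r m g f = None"
    "act r m g f = Some f' \<Longrightarrow>
      concatenate (graph (r + s) f) (graph (r + s) (generator_map r g (Suc m))) = graph (r + s) f'" by auto
qed

section \<open>Diagrams of words\<close>

lemma shift_concatenate:
  "shift_beads m (concatenate a b) = concatenate (shift_beads m a) (shift_beads m b)"
proof -
  have s: "stack (shift_beads m a) (shift_beads m b) = (\<lambda>(x, ns, y). (x, map ((+) m) ns, y)) ` stack a b"
    unfolding shift_beads_def layer_def by (auto simp: image_Un image_image split_beta)
  have "(v, ns, w) \<in> shift_beads m (concatenate a b) \<longleftrightarrow>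
    (v, ns, w) \<in> concatenate (shift_beads m a) (shift_beads m b)" for v ns w
  proof -
    have "(v, ns, w) \<in> shift_beads m (concatenate a b) \<longleftrightarrow> (\<exists>ms. ns = map ((+) m) ms \<and> (v, ms, w) \<in> concatenate a b)"
      by (auto simp: shift_beads_def intro: rev_image_eqI)
    then show ?thesis by (simp add: concatenate_def walk_iff_path s path_map_labels)
  qed
  then show ?thesis by auto
qed

lemma has_loop_shift: "has_loop (shift_beads m a) (shift_beads l b) \<longleftrightarrow> has_loop a b"
proof -
  have 1: "(x, ns, y) \<in> stack (shift_beads m a) (shift_beads l b) \<Longrightarrow> \<exists>ms. (x, ms, y) \<in> stack a b" for x ns y
    by (auto simp: mem_layer shift_beads_def)
  have 2: "(x, ns, y) \<in> stack a b \<Longrightarrow> \<exists>ms. (x, ms, y) \<in> stack (shift_beads m a) (shift_beads l b)" for x ns y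
    unfolding Un_iff mem_layer shift_beads_def by (force intro: rev_image_eqI)
  let ?J = "glue Inl Inr"
  have "\<exists>ms. path (stack a b) ?J x ms y" if "path (stack (shift_beads m a) (shift_beads l b)) ?J x ns y" for x ns y
    by (rule path_relabel[OF _ that]) (rule 1)
  moreover have "\<exists>ms. path (stack (shift_beads m a) (shift_beads l b)) ?J x ms y"
    if "path (stack a b) ?J x ns y" for x ns y
    by (rule path_relabel[OF _ that]) (rule 2)
  ultimately have "(\<exists>ns. path (stack (shift_beads m a) (shift_beads l b)) ?J x ns y) \<longleftrightarrow>
    (\<exists>ns. path (stack a b) ?J x ns y)" for x y by meson
  then show ?thesis unfolding has_loop_def walk_iff_path by simp
qed

lemma shift_beads_0 [simp]: "shift_beads 0 a = a"
proof -
  have "map ((+) (0 :: nat)) = id" by (simp add: fun_eq_iff map_idI)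
  then show ?thesis by (simp add: shift_beads_def)
qed

lemma has_loop_shift_right: "has_loop a (shift_beads l b) \<longleftrightarrow> has_loop a b"
  using has_loop_shift[of 0 a l b] by simp

lemma reversible_shift: "reversible a \<Longrightarrow> reversible (shift_beads m a)"
  unfolding reversible_def shift_beads_def by (force simp: rev_map)

lemma shift_graph: "shift_beads m (graph n f) = graph n (\<lambda>v. (map ((+) m) (fst (f v)), snd (f v)))"
  by (auto simp: shift_beads_def graph_def image_image split_beta)

lemma shift_generator: "shift_beads m (graph n (generator_map r g b)) = graph n (generator_map r g (m + b))"
proof -
  have "(map ((+) m) (fst (generator_map r g b v)), snd (generator_map r g b v)) = generator_map r g (m + b) v" for v
    by (cases g) (auto simp: swap_map_def bead_map_def join_map_def id_map_def)
  then show ?thesis unfolding shift_graph by simp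
qed

lemma matching_generator:
  assumes "g \<in> generators r s" shows "matching r s (generator_map r g b)"
proof -
  have m: "matching r s id_map" using valid_id by (simp add: valid_def)
  show ?thesis
  proof (cases g)
    case (S i)
    then show ?thesis using assms matching_swap[OF m] by (auto simp: generators_def split: if_splits)
  next
    case E
    then have "1 \<le> r" "1 \<le> s" using assms by (auto simp: generators_def split: if_splits)
    then show ?thesis using matching_join[OF m, of "Top r" "Top (r + 1)"] E by (auto simp: id_map_def)
  next
    case (C k)
    then show ?thesis using matching_bead[OF m] by simp
  qed
qed

text \<open>Multiplying by the diagram of a word is the same as letting its letters act one by one. The
  induction appends a letter: the last letter acts on the product by \<open>concatenate_generator\<close>, and the
  associativity of gluing moves it inside. Both sides vanish for the same words, since the loops
  correspond as well.\<close>

theorem diagram_mult_word: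
  assumes f: "valid r s m f" and w: "set w \<subseteq> generators r s"
  shows "Option.bind (act_word r 0 w id_map) (\<lambda>g. diagram_mult (graph (r + s) f) (graph (r + s) g)) =
    map_option (graph (r + s)) (act_word r m w f)"
  using w
proof (induction w rule: rev_induct)
  case Nil
  have "matching r s f" using f by (simp add: valid_def)
  moreover have "shift_beads m (graph (r + s) id_map) = graph (r + s) id_map"
    unfolding shift_graph graph_eq_iff by (simp add: id_map_def)
  ultimately show ?case using concatenate_id[of r s f] valid_beads(2)[OF f] by (simp add: diagram_mult_def)
next
  case (snoc g w)
  let ?gr = "graph (r + s)" and ?c = "count_C w"
  let ?A = "act_word r 0 w id_map" and ?B = "act_word r m w f"
  have g: "g \<in> generators r s" and w: "set w \<subseteq> generators r s" using snoc.prems by auto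
  have IH: "Option.bind ?A (\<lambda>g. diagram_mult (?gr f) (?gr g)) = map_option ?gr ?B" by (rule snoc.IH[OF w])
  have A': "act_word r 0 (w @ [g]) id_map = Option.bind ?A (act r ?c g)"
    and B': "act_word r m (w @ [g]) f = Option.bind ?B (act r (m + ?c) g)"
    by (auto simp: act_word_append split: bind_splits)
  show ?case
  proof (cases ?A)
    case None
    then have "?B = None" using IH by simp
    then show ?thesis unfolding A' B' using None by simp
  next
    case (Some h)
    have vh: "valid r s ?c h" using valid_act_word[OF valid_id w Some] by simp
    have mf: "matching r s f" and mh: "matching r s h" using f vh by (auto simp: valid_def)
    let ?G = "\<lambda>b. ?gr (generator_map r g b)"
    have rev: "reversible (?gr f)" "reversible (shift_beads m (?gr h))" "reversible (?G b)" for b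
      using mf mh matching_generator[OF g] by (auto intro: reversible_graph reversible_shift)
    let ?h = "shift_beads m (?gr h)" and ?g = "?G (Suc (m + ?c))"
    have sg: "?g = shift_beads m (?G (Suc ?c))" by (simp add: shift_generator)
    have loop_hg: "has_loop ?h ?g \<longleftrightarrow> act r ?c g h = None"
      unfolding sg has_loop_shift by (rule concatenate_generator(1)[OF mh g])
    have assoc: "concatenate (concatenate (?gr f) ?h) ?g = concatenate (?gr f) (concatenate ?h ?g)"
      "has_loop (?gr f) ?h \<or> has_loop (concatenate (?gr f) ?h) ?g \<longleftrightarrow>
        has_loop ?h ?g \<or> has_loop (?gr f) (concatenate ?h ?g)"
      by (rule concatenate_assoc[OF rev])+
    have mx: "max_bead (?gr f) = m" by (rule valid_beads(2)[OF f])
    have hB: "map_option ?gr ?B = (if has_loop (?gr f) ?h then None else Some (concatenate (?gr f) ?h))"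
    proof -
      have "diagram_mult (?gr f) (?gr h) = map_option ?gr ?B" using IH Some by simp
      then show ?thesis unfolding diagram_mult_def mx has_loop_shift_right by simp
    qed
    have hh: "concatenate ?h ?g = shift_beads m (?gr h')" if "act r ?c g h = Some h'" for h'
      unfolding sg shift_concatenate[symmetric] using concatenate_generator(2)[OF mh g that] by simp
    show ?thesis
    proof (cases "act r ?c g h")
      case None
      then have "has_loop (?gr f) ?h \<or> has_loop (concatenate (?gr f) ?h) ?g" using assoc(2) loop_hg by blast
      moreover have "act r (m + ?c) g h' = None" if "?B = Some h'" "has_loop (concatenate (?gr f) ?h) ?g" for h'
      proof -
        have "?gr h' = concatenate (?gr f) ?h" using hB that by (auto split: if_splits)
        moreover have "matching r s h'" using valid_act_word[OF f w that(1)] by (simp add: valid_def)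
        ultimately show ?thesis using concatenate_generator(1)[of r s h' g] g that(2) by metis
      qed
      ultimately have "Option.bind ?B (act r (m + ?c) g) = None"
        using hB by (cases ?B) (auto split: if_splits)
      then show ?thesis unfolding A' B' using Some None by simp
    next
      case (Some h')
      have lhs: "Option.bind (act_word r 0 (w @ [g]) id_map) (\<lambda>g. diagram_mult (?gr f) (?gr g)) =
        (if has_loop (?gr f) (concatenate ?h ?g) then None else Some (concatenate (?gr f) (concatenate ?h ?g)))"
        unfolding A' using Some \<open>?A = Some h\<close> mx hh[OF Some] by (simp add: diagram_mult_def has_loop_shift_right)
      have loops: "has_loop (?gr f) (concatenate ?h ?g) \<longleftrightarrow> has_loop (?gr f) ?h \<or> has_loop (concatenate (?gr f) ?h) ?g"
        using assoc(2) loop_hg Some by simp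
      have "map_option ?gr (Option.bind ?B (act r (m + ?c) g)) =
        (if has_loop (?gr f) (concatenate ?h ?g) then None else Some (concatenate (?gr f) (concatenate ?h ?g)))"
      proof (cases ?B)
        case None
        then have "has_loop (?gr f) ?h" using hB by (auto split: if_splits)
        then show ?thesis using None loops by simp
      next
        case (Some k)
        then have k: "\<not> has_loop (?gr f) ?h" "?gr k = concatenate (?gr f) ?h" using hB by (auto split: if_splits)
        have mk: "matching r s k" using valid_act_word[OF f w Some] by (simp add: valid_def)
        note cg = concatenate_generator[OF mk g, unfolded k(2)]
        show ?thesis using cg(1)[of "Suc (m + ?c)" "m + ?c"] cg(2)[of "m + ?c"] loops k(1) Some assoc(1)
          by (cases "act r (m + ?c) g k") auto
      qed
      then show ?thesis unfolding lhs B' by simp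
    qed
  qed
qed

lemma graph_id: "graph (r + s) id_map = id_diagram r s"
  unfolding graph_def id_diagram_def strand_def vertices_def id_map_def by auto

lemma graph_generator:
  "i \<in> s_indices r s \<Longrightarrow> graph (r + s) (generator_map r (S i) b) = s_diagram r s i"
  "1 \<le> r \<Longrightarrow> 1 \<le> s \<Longrightarrow> graph (r + s) (generator_map r E b) = e_diagram r s"
  "k \<in> {1..r+s} \<Longrightarrow> graph (r + s) (generator_map r (C k) 1) = c_diagram r s k"
proof -
  have eqI: "graph (r + s) f = d" if "\<And>v ns w. (v, ns, w) \<in> d \<Longrightarrow> v \<in> vertices (r + s) \<and> f v = (ns, w)"
    "\<And>v. v \<in> vertices (r + s) \<Longrightarrow> (v, f v) \<in> d" for f d
    using that by (force simp: graph_def)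
  show "i \<in> s_indices r s \<Longrightarrow> graph (r + s) (generator_map r (S i) b) = s_diagram r s i"
  proof (rule eqI)
    fix v ns w assume "i \<in> s_indices r s" "(v, ns, w) \<in> s_diagram r s i"
    then show "v \<in> vertices (r + s) \<and> generator_map r (S i) b v = (ns, w)"
      by (auto simp: s_diagram_def strand_def swap_map_def id_map_def s_indices_def Transposition.transpose_def)
  next
    fix v assume "i \<in> s_indices r s" "v \<in> vertices (r + s)"
    then show "(v, generator_map r (S i) b v) \<in> s_diagram r s i"
      by (cases v) (auto simp: s_diagram_def strand_def swap_map_def id_map_def s_indices_def Transposition.transpose_def)
  qed
  show "1 \<le> r \<Longrightarrow> 1 \<le> s \<Longrightarrow> graph (r + s) (generator_map r E b) = e_diagram r s"
  proof (rule eqI)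
    fix v ns w assume "1 \<le> r" "1 \<le> s" "(v, ns, w) \<in> e_diagram r s"
    then show "v \<in> vertices (r + s) \<and> generator_map r E b v = (ns, w)"
      by (auto simp: e_diagram_def strand_def join_map_def id_map_def)
  next
    fix v assume "1 \<le> r" "1 \<le> s" "v \<in> vertices (r + s)"
    then show "(v, generator_map r E b v) \<in> e_diagram r s"
      by (cases v) (auto simp: e_diagram_def strand_def join_map_def id_map_def)
  qed
  show "k \<in> {1..r+s} \<Longrightarrow> graph (r + s) (generator_map r (C k) 1) = c_diagram r s k"
  proof (rule eqI)
    fix v ns w assume "k \<in> {1..r+s}" "(v, ns, w) \<in> c_diagram r s k"
    then show "v \<in> vertices (r + s) \<and> generator_map r (C k) 1 v = (ns, w)"
      by (auto simp: c_diagram_def strand_def bead_map_def id_map_def)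
  next
    fix v assume "k \<in> {1..r+s}" "v \<in> vertices (r + s)"
    then show "(v, generator_map r (C k) 1 v) \<in> c_diagram r s k"
      by (cases v) (auto simp: c_diagram_def strand_def bead_map_def id_map_def)
  qed
qed

definition word_diagram :: "nat \<Rightarrow> nat \<Rightarrow> generator list \<Rightarrow> diagram option" where
  "word_diagram r s w = map_option (graph (r + s)) (act_word r 0 w id_map)"

lemma word_diagram_append:
  assumes "set v \<subseteq> generators r s" "set w \<subseteq> generators r s"
  shows "word_diagram r s (v @ w) = Option.bind (word_diagram r s v) (\<lambda>d. Option.bind (word_diagram r s w) (diagram_mult d))"
proof (cases "act_word r 0 v id_map")
  case (Some f)
  have "valid r s (count_C v) f" using valid_act_word[OF valid_id assms(1) Some] by simp
  from diagram_mult_word[OF this assms(2)] show ?thesis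
    using Some by (simp add: word_diagram_def act_word_append map_option_case split: bind_splits option.splits)
qed (simp add: word_diagram_def act_word_append)

lemma word_diagram_Nil: "word_diagram r s [] = Some (id_diagram r s)"
  by (simp add: word_diagram_def graph_id)

lemma word_diagram_generator:
  "i \<in> s_indices r s \<Longrightarrow> word_diagram r s [S i] = Some (s_diagram r s i)"
  "1 \<le> r \<Longrightarrow> 1 \<le> s \<Longrightarrow> word_diagram r s [E] = Some (e_diagram r s)"
  "k \<in> {1..r+s} \<Longrightarrow> word_diagram r s [C k] = Some (c_diagram r s k)"
  using graph_generator(1)[of i r s 1] graph_generator(2)[of r s 1] graph_generator(3)[of k r s]
  by (simp_all add: word_diagram_def id_map_def[of "Top r"])

lemma word_diagram_bead_diagram:
  assumes "set w \<subseteq> generators r s" "word_diagram r s w = Some d"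
  shows "d \<in> bead_diagrams r s" "card (bead_numbers d) = count_C w"
proof -
  obtain f where f: "act_word r 0 w id_map = Some f" "d = graph (r + s) f"
    using assms(2) by (auto simp: word_diagram_def)
  have "valid r s (count_C w) f" using valid_act_word[OF valid_id assms(1) f(1)] by simp
  then show "d \<in> bead_diagrams r s" "card (bead_numbers d) = count_C w"
    using graph_bead_diagram valid_beads(1) f(2) by auto
qed

section \<open>Relations between diagrams of words\<close>

lemma word_diagram_cong:
  assumes "\<And>x. rel_option (\<lambda>f g. f x = g x) (act_word r 0 v id_map) (act_word r 0 w id_map)"
  shows "word_diagram r s v = word_diagram r s w"
proof -
  have "act_word r 0 v id_map = act_word r 0 w id_map"
    using assms by (cases "act_word r 0 v id_map"; cases "act_word r 0 w id_map") (auto simp: fun_eq_iff)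
  then show ?thesis by (simp add: word_diagram_def)
qed

lemmas strand_map_defs = swap_map_def bead_map_def join_map_def id_map_def Transposition.transpose_def

lemma word_diagram_symmetric_relations:
  shows "word_diagram r s [S i, S i] = word_diagram r s []"
    "word_diagram r s [S i, S (i + 1), S i] = word_diagram r s [S (i + 1), S i, S (i + 1)]"
    "i + 1 < j \<or> j + 1 < i \<Longrightarrow> word_diagram r s [S i, S j] = word_diagram r s [S j, S i]"
proof -
  show "word_diagram r s [S i, S i] = word_diagram r s []"
    by (rule word_diagram_cong, case_tac x) (auto simp: swap_map_def id_map_def)
  show "word_diagram r s [S i, S (i + 1), S i] = word_diagram r s [S (i + 1), S i, S (i + 1)]"
    by (rule word_diagram_cong, case_tac x) (auto simp: strand_map_defs)
  show "i + 1 < j \<or> j + 1 < i \<Longrightarrow> word_diagram r s [S i, S j] = word_diagram r s [S j, S i]"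
    by (rule word_diagram_cong, case_tac x) (auto simp: strand_map_defs)
qed

lemma word_diagram_bead_relations:
  shows "word_diagram r s [S i, C i, S i] = word_diagram r s [C (i + 1)]"
    "j \<noteq> i \<Longrightarrow> j \<noteq> i + 1 \<Longrightarrow> word_diagram r s [S i, C j] = word_diagram r s [C j, S i]"
proof -
  show "word_diagram r s [S i, C i, S i] = word_diagram r s [C (i + 1)]"
    by (rule word_diagram_cong, case_tac x) (auto simp: strand_map_defs)
  show "j \<noteq> i \<Longrightarrow> j \<noteq> i + 1 \<Longrightarrow> word_diagram r s [S i, C j] = word_diagram r s [C j, S i]"
    by (rule word_diagram_cong, case_tac x) (auto simp: strand_map_defs)
qed

lemma word_diagram_cap_relations:
  shows "word_diagram r s [E, E] = None"
    "word_diagram r s [E, C r, E] = None"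
    "word_diagram r s [C r, E] = word_diagram r s [C (r + 1), E]"
    "word_diagram r s [E, C r] = word_diagram r s [E, C (r + 1)]"
    "j \<noteq> r \<Longrightarrow> j \<noteq> r + 1 \<Longrightarrow> word_diagram r s [E, C j] = word_diagram r s [C j, E]"
proof -
  show "word_diagram r s [E, E] = None" "word_diagram r s [E, C r, E] = None"
    by (simp_all add: word_diagram_def strand_map_defs)
  show "word_diagram r s [C r, E] = word_diagram r s [C (r + 1), E]"
    by (rule word_diagram_cong, case_tac x) (auto simp: strand_map_defs)
  show "word_diagram r s [E, C r] = word_diagram r s [E, C (r + 1)]"
    by (rule word_diagram_cong, case_tac x) (auto simp: strand_map_defs)
  show "j \<noteq> r \<Longrightarrow> j \<noteq> r + 1 \<Longrightarrow> word_diagram r s [E, C j] = word_diagram r s [C j, E]"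
    by (rule word_diagram_cong, case_tac x) (auto simp: strand_map_defs)
qed

lemma word_diagram_cap_swap_relations:
  shows "j \<in> s_indices r s \<Longrightarrow> j \<noteq> r - 1 \<Longrightarrow> j \<noteq> r + 1 \<Longrightarrow> word_diagram r s [E, S j] = word_diagram r s [S j, E]"
    "2 \<le> r \<Longrightarrow> word_diagram r s [E, S (r - 1), E] = word_diagram r s [E]"
    "word_diagram r s [E, S (r + 1), E] = word_diagram r s [E]"
    "2 \<le> r \<Longrightarrow> word_diagram r s [S (r - 1), S (r + 1), E, S (r + 1), S (r - 1), E] =
      word_diagram r s [E, S (r - 1), S (r + 1), E, S (r + 1), S (r - 1)]"
proof -
  show "j \<in> s_indices r s \<Longrightarrow> j \<noteq> r - 1 \<Longrightarrow> j \<noteq> r + 1 \<Longrightarrow> word_diagram r s [E, S j] = word_diagram r s [S j, E]"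
  proof -
    assume "j \<in> s_indices r s" "j \<noteq> r - 1" "j \<noteq> r + 1"
    then have "j \<noteq> r" "Suc j \<noteq> r" "j \<noteq> Suc r" by (auto simp: s_indices_def)
    then show ?thesis by (intro word_diagram_cong, case_tac x) (auto simp: strand_map_defs)
  qed
  show "word_diagram r s [E, S (r + 1), E] = word_diagram r s [E]"
    by (rule word_diagram_cong, case_tac x) (auto simp: strand_map_defs)
  assume "2 \<le> r"
  then obtain q where q: "r = Suc (Suc q)" by (metis Suc_le_D numeral_2_eq_2 Suc_le_mono)
  show "word_diagram r s [E, S (r - 1), E] = word_diagram r s [E]"
    unfolding q by (rule word_diagram_cong, case_tac x) (auto simp: strand_map_defs)
  show "word_diagram r s [S (r - 1), S (r + 1), E, S (r + 1), S (r - 1), E] =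
      word_diagram r s [E, S (r - 1), S (r + 1), E, S (r + 1), S (r - 1)]"
    unfolding q by (rule word_diagram_cong, case_tac x) (auto simp: strand_map_defs)
qed

section \<open>Words in a ring with Brauer-Clifford relations\<close>

text \<open>The composition of partial maps is a monoid with zero. Their elements can be specified state by state,
  which for linear maps would require a basis.\<close>

typedef 'a partial_map = "UNIV :: ('a \<Rightarrow> 'a option) set" morphisms apply_partial Partial_Map ..

setup_lifting type_definition_partial_map

instantiation partial_map :: (type) "{monoid_mult, mult_zero}"
begin

lift_definition times_partial_map :: "'a partial_map \<Rightarrow> 'a partial_map \<Rightarrow> 'a partial_map"
  is "\<lambda>f g x. Option.bind (g x) f" .

lift_definition one_partial_map :: "'a partial_map" is Some .

lift_definition zero_partial_map :: "'a partial_map" is "\<lambda>_. None" .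

instance
proof
  fix f g h :: "'a partial_map"
  show "f * g * h = f * (g * h)" by transfer (auto simp: fun_eq_iff split: bind_splits)
  show "1 * f = f" by transfer (auto simp: fun_eq_iff)
  show "f * 1 = f" by transfer (auto simp: fun_eq_iff)
  show "0 * f = 0" by transfer (auto simp: fun_eq_iff split: bind_splits)
  show "f * 0 = 0" by transfer (auto simp: fun_eq_iff)
qed

end

lemma apply_times [simp]: "apply_partial (f * g) x = Option.bind (apply_partial g x) (apply_partial f)"
  by transfer simp

lemma apply_one [simp]: "apply_partial 1 x = Some x"
  by transfer simp

lemma apply_zero [simp]: "apply_partial 0 x = None"
  by transfer simp

lemma apply_Partial_Map [simp]: "apply_partial (Partial_Map f) x = f x"
  by (simp add: Partial_Map_inverse)

lemma partial_map_eqI: "(\<And>x. apply_partial f x = apply_partial g x) \<Longrightarrow> f = g"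
  by (metis apply_partial_inverse ext)

text \<open>A ring with elements that satisfy the defining relations of \<open>BC\<close>. It will be the quotient of the free
  superalgebra by these relations.\<close>

locale brauer_clifford_ring = ring R for R (structure) +
  fixes r s :: nat and sR :: "nat \<Rightarrow> 'a" and eR :: 'a and cR :: "nat \<Rightarrow> 'a"
  assumes s_closed [simp, intro]: "i \<in> s_indices r s \<Longrightarrow> sR i \<in> carrier R"
    and e_closed [simp, intro]: "1 \<le> r \<Longrightarrow> 1 \<le> s \<Longrightarrow> eR \<in> carrier R"
    and c_closed [simp, intro]: "k \<in> {1..r+s} \<Longrightarrow> cR k \<in> carrier R"
    and s_square: "i \<in> s_indices r s \<Longrightarrow> sR i \<otimes> sR i = \<one>"
    and s_braid: "i \<in> s_indices r s \<Longrightarrow> i + 1 \<in> s_indices r s \<Longrightarrow>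
          sR i \<otimes> sR (i + 1) \<otimes> sR i = sR (i + 1) \<otimes> sR i \<otimes> sR (i + 1)"
    and s_commute: "i \<in> s_indices r s \<Longrightarrow> j \<in> s_indices r s \<Longrightarrow> i + 1 < j \<Longrightarrow>
          sR i \<otimes> sR j = sR j \<otimes> sR i"
    and e_square: "1 \<le> r \<Longrightarrow> 1 \<le> s \<Longrightarrow> eR \<otimes> eR = \<zero>"
    and e_s_commute: "1 \<le> r \<Longrightarrow> 1 \<le> s \<Longrightarrow> j \<in> s_indices r s \<Longrightarrow> j \<noteq> r - 1 \<Longrightarrow> j \<noteq> r + 1 \<Longrightarrow>
          eR \<otimes> sR j = sR j \<otimes> eR"
    and e_s_e_left: "2 \<le> r \<Longrightarrow> 1 \<le> s \<Longrightarrow> eR \<otimes> sR (r - 1) \<otimes> eR = eR"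
    and e_s_e_right: "1 \<le> r \<Longrightarrow> 2 \<le> s \<Longrightarrow> eR \<otimes> sR (r + 1) \<otimes> eR = eR"
    and s_s_e: "2 \<le> r \<Longrightarrow> 2 \<le> s \<Longrightarrow>
          sR (r - 1) \<otimes> sR (r + 1) \<otimes> eR \<otimes> sR (r + 1) \<otimes> sR (r - 1) \<otimes> eR =
          eR \<otimes> sR (r - 1) \<otimes> sR (r + 1) \<otimes> eR \<otimes> sR (r + 1) \<otimes> sR (r - 1)"
    and c_square: "k \<in> {1..r+s} \<Longrightarrow> cR k \<otimes> cR k = (if k \<le> r then \<ominus> \<one> else \<one>)"
    and c_anticommute: "i \<in> {1..r+s} \<Longrightarrow> j \<in> {1..r+s} \<Longrightarrow> i \<noteq> j \<Longrightarrow> cR i \<otimes> cR j = \<ominus> (cR j \<otimes> cR i)"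
    and s_c_s: "i \<in> s_indices r s \<Longrightarrow> sR i \<otimes> cR i \<otimes> sR i = cR (i + 1)"
    and s_c_commute: "i \<in> s_indices r s \<Longrightarrow> j \<in> {1..r+s} \<Longrightarrow> j \<noteq> i \<Longrightarrow> j \<noteq> i + 1 \<Longrightarrow>
          sR i \<otimes> cR j = cR j \<otimes> sR i"
    and c_e: "1 \<le> r \<Longrightarrow> 1 \<le> s \<Longrightarrow> cR r \<otimes> eR = cR (r + 1) \<otimes> eR"
    and e_c: "1 \<le> r \<Longrightarrow> 1 \<le> s \<Longrightarrow> eR \<otimes> cR r = eR \<otimes> cR (r + 1)"
    and e_c_e: "1 \<le> r \<Longrightarrow> 1 \<le> s \<Longrightarrow> eR \<otimes> cR r \<otimes> eR = \<zero>"
    and e_c_commute: "1 \<le> r \<Longrightarrow> 1 \<le> s \<Longrightarrow> j \<in> {1..r+s} \<Longrightarrow> j \<noteq> r \<Longrightarrow> j \<noteq> r + 1 \<Longrightarrow>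
          eR \<otimes> cR j = cR j \<otimes> eR"
begin

text \<open>A state \<open>(B, x)\<close> stands for \<open>x \<otimes> \<xi>\<^sub>B\<close>, where \<open>\<xi>\<^sub>B\<close> is the product of the \<open>\<xi>\<^sub>b\<close> with \<open>b \<in> B\<close> in increasing
  order in the exterior algebra. The other states only exist for typing reasons; the operators below
  are extended to them in such a way that the relations remain true.\<close>

definition proper :: "nat set \<times> 'a \<Rightarrow> bool" where
  "proper = (\<lambda>(B, x). finite B \<and> x \<in> carrier R \<and> x \<noteq> \<zero>)"

text \<open>The sign of \<open>\<xi>\<^sub>b \<xi>\<^sub>B = \<plusminus> \<xi>\<^bsub>B \<union> {b}\<^esub>\<close>.\<close>

definition signed :: "nat \<Rightarrow> nat set \<Rightarrow> 'a \<Rightarrow> 'a" where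
  "signed b B y = (if even (card {b' \<in> B. b' < b}) then y else \<ominus> y)"

definition swap_op :: "nat \<Rightarrow> (nat set \<times> 'a) partial_map" where
  "swap_op i = Partial_Map (\<lambda>(B, x). if proper (B, x) then Some (B, sR i \<otimes> x) else Some (B, x))"

definition cap_op :: "(nat set \<times> 'a) partial_map" where
  "cap_op = Partial_Map (\<lambda>(B, x). if proper (B, x) \<and> eR \<otimes> x \<noteq> \<zero> then Some (B, eR \<otimes> x) else None)"

definition bead_op :: "nat \<Rightarrow> nat \<Rightarrow> (nat set \<times> 'a) partial_map" where
  "bead_op k b = Partial_Map (\<lambda>(B, x). if proper (B, x)
     then if b \<in> B then None else Some (insert b B, signed b B (cR k \<otimes> x))
     else Some (B, x))"

lemma unit_mult_zero_iff:
  assumes "u \<in> carrier R" "v \<in> carrier R" "x \<in> carrier R" "v \<otimes> u = \<one> \<or> v \<otimes> u = \<ominus> \<one>"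
  shows "u \<otimes> x = \<zero> \<longleftrightarrow> x = \<zero>"
proof
  assume "u \<otimes> x = \<zero>"
  then have "(v \<otimes> u) \<otimes> x = \<zero>" using assms by (simp add: m_assoc)
  then show "x = \<zero>" using assms by (auto simp: l_minus)
qed (use assms in simp)

lemma s_mult_zero_iff: "i \<in> s_indices r s \<Longrightarrow> x \<in> carrier R \<Longrightarrow> sR i \<otimes> x = \<zero> \<longleftrightarrow> x = \<zero>"
  using unit_mult_zero_iff[of "sR i" "sR i" x] s_square by auto

lemma c_mult_zero_iff: "k \<in> {1..r+s} \<Longrightarrow> x \<in> carrier R \<Longrightarrow> cR k \<otimes> x = \<zero> \<longleftrightarrow> x = \<zero>"
  using unit_mult_zero_iff[of "cR k" "cR k" x] c_square by auto

lemma signed_closed [simp]: "y \<in> carrier R \<Longrightarrow> signed b B y \<in> carrier R"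
  by (simp add: signed_def)

lemma signed_zero_iff: "y \<in> carrier R \<Longrightarrow> signed b B y = \<zero> \<longleftrightarrow> y = \<zero>"
  by (auto simp: signed_def)

lemma mult_signed: "u \<in> carrier R \<Longrightarrow> y \<in> carrier R \<Longrightarrow> u \<otimes> signed b B y = signed b B (u \<otimes> y)"
  by (simp add: signed_def r_minus)

lemma proper_simps [simp]:
  "proper (B, x) \<longleftrightarrow> finite B \<and> x \<in> carrier R \<and> x \<noteq> \<zero>"
  by (simp add: proper_def)

lemma proper_step:
  "i \<in> s_indices r s \<Longrightarrow> proper (B, x) \<Longrightarrow> proper (B, sR i \<otimes> x)"
  "k \<in> {1..r+s} \<Longrightarrow> proper (B, x) \<Longrightarrow> proper (insert b B, signed b B (cR k \<otimes> x))"
  using s_mult_zero_iff c_mult_zero_iff by (auto simp: signed_zero_iff)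

lemma swap_op_apply:
  "apply_partial (swap_op i) (B, x) = (if proper (B, x) then Some (B, sR i \<otimes> x) else Some (B, x))"
  by (simp add: swap_op_def)

lemma cap_op_apply:
  "apply_partial cap_op (B, x) = (if proper (B, x) \<and> eR \<otimes> x \<noteq> \<zero> then Some (B, eR \<otimes> x) else None)"
  by (simp add: cap_op_def)

lemma bead_op_apply:
  "apply_partial (bead_op k b) (B, x) = (if proper (B, x)
     then if b \<in> B then None else Some (insert b B, signed b B (cR k \<otimes> x)) else Some (B, x))"
  by (simp add: bead_op_def)

text \<open>Of two distinct beads, exactly one sees the other when it is inserted second.\<close>

lemma signed_signed_commute:
  assumes "finite B" "b \<notin> B" "b' \<notin> B" "b \<noteq> b'" "y \<in> carrier R"
  shows "signed b (insert b' B) (signed b' B y) = \<ominus> signed b' (insert b B) (signed b B y)"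
proof -
  have *: "even (card {a \<in> insert c B. a < b}) \<longleftrightarrow> (even (card {a \<in> B. a < b}) \<longleftrightarrow> \<not> c < b)"
    if "c \<notin> B" for b c
  proof (cases "c < b")
    case True
    then have "{a \<in> insert c B. a < b} = insert c {a \<in> B. a < b}" by auto
    then show ?thesis using True assms(1) that by simp
  next
    case False
    then have "{a \<in> insert c B. a < b} = {a \<in> B. a < b}" by auto
    then show ?thesis using False by simp
  qed
  have "b < b' \<longleftrightarrow> \<not> b' < b" using assms(4) by auto
  then show ?thesis unfolding signed_def *[OF assms(2)] *[OF assms(3)] using assms(5) by auto
qed

lemma bead_op_commute:
  assumes "i \<in> {1..r+s}" "j \<in> {1..r+s}" "i \<noteq> j"
  shows "bead_op i b * bead_op j b' = bead_op j b' * bead_op i b"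
proof (rule partial_map_eqI)
  fix p :: "nat set \<times> 'a"
  obtain B x where p: "p = (B, x)" by fastforce
  show "apply_partial (bead_op i b * bead_op j b') p = apply_partial (bead_op j b' * bead_op i b) p"
  proof (cases "proper (B, x)")
    case True
    then have x: "x \<in> carrier R" "finite B" by auto
    note P = proper_step(2)[OF assms(1) True] proper_step(2)[OF assms(2) True]
    have c: "cR i \<in> carrier R" "cR j \<in> carrier R" using assms by auto
    have "cR i \<otimes> (cR j \<otimes> x) = \<ominus> (cR j \<otimes> (cR i \<otimes> x))"
      using c_anticommute[OF assms] c x by (simp add: l_minus flip: m_assoc)
    then have "signed b (insert b' B) (cR i \<otimes> signed b' B (cR j \<otimes> x)) =
        signed b' (insert b B) (cR j \<otimes> signed b B (cR i \<otimes> x))" if "b \<notin> B" "b' \<notin> B" "b \<noteq> b'"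
      using signed_signed_commute[OF x(2) that] c x
      by (simp add: mult_signed) (simp add: signed_def)
    then show ?thesis using True P by (auto simp: p bead_op_apply insert_commute simp del: proper_simps)
  qed (auto simp: p bead_op_apply simp del: proper_simps)
qed

text \<open>Beads on the strand \<open>r\<close> multiply by a power of \<open>c\<^sub>r\<close>, which is \<open>1\<close> or \<open>c\<^sub>r\<close> up to sign. So \<open>e\<close> followed
  by beads and \<open>e\<close> reduces to \<open>e e = 0\<close> and \<open>e c e = 0\<close>.\<close>

lemma beads_then_cap:
  assumes "1 \<le> r" "1 \<le> s" "y \<in> carrier R" "finite B" "y \<noteq> \<zero>"
    "apply_partial (prod_list (map (bead_op r) bs)) (B, y) = Some (B', y')"
  shows "finite B' \<and> y' \<in> {y, \<ominus> y, cR r \<otimes> y, \<ominus> (cR r \<otimes> y)} \<and> y' \<noteq> \<zero>"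
  using assms(6)
proof (induction bs arbitrary: B' y')
  case (Cons b bs)
  then obtain B1 y1 where 1: "apply_partial (prod_list (map (bead_op r) bs)) (B, y) = Some (B1, y1)"
    "apply_partial (bead_op r b) (B1, y1) = Some (B', y')" by (auto split: bind_splits)
  have IH: "finite B1" "y1 \<in> {y, \<ominus> y, cR r \<otimes> y, \<ominus> (cR r \<otimes> y)}" "y1 \<noteq> \<zero>" using Cons.IH[OF 1(1)] by auto
  have c: "cR r \<in> carrier R" "r \<in> {1..r+s}" using assms by auto
  have y1: "y1 \<in> carrier R" using IH(2) assms(3) c by auto
  have cc: "cR r \<otimes> (cR r \<otimes> y) = \<ominus> y" using c_square[of r] assms c by (simp add: l_minus flip: m_assoc)
  have "B' = insert b B1" "y' = signed b B1 (cR r \<otimes> y1)" using 1(2) y1 IH by (auto simp: bead_op_apply split: if_splits)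
  then show ?case using IH assms(3) c cc y1 c_mult_zero_iff[OF c(2) y1]
    by (auto simp: signed_def r_minus)
qed (use assms in auto)

text \<open>The operators satisfy the relations without signs, since the sign from the exterior algebra cancels
  that of the anticommuting \<open>c\<^sub>k\<close>.\<close>

sublocale op: bead_monoid r s swap_op cap_op bead_op
proof
  fix i assume i: "i \<in> s_indices r s"
  have c: "sR i \<in> carrier R" using i by simp
  show "swap_op i * swap_op i = 1"
  proof (rule partial_map_eqI)
    fix p :: "nat set \<times> 'a"
    obtain B x where p: "p = (B, x)" by fastforce
    have "sR i \<otimes> (sR i \<otimes> x) = x" if "x \<in> carrier R" using that s_square[OF i] c by (simp flip: m_assoc)
    then show "apply_partial (swap_op i * swap_op i) p = apply_partial 1 p"
      using proper_step(1)[OF i, of B x] by (auto simp: p swap_op_apply)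
  qed
  show "swap_op i * bead_op i b * swap_op i = bead_op (i + 1) b" for b
  proof (rule partial_map_eqI)
    fix p :: "nat set \<times> 'a"
    obtain B x where p: "p = (B, x)" by fastforce
    have k: "i \<in> {1..r+s}" using i by (auto simp: s_indices_def)
    have "sR i \<otimes> (cR i \<otimes> (sR i \<otimes> x)) = cR (i + 1) \<otimes> x" if "x \<in> carrier R"
      using that s_c_s[OF i] c c_closed[OF k] by (simp flip: m_assoc)
    then show "apply_partial (swap_op i * bead_op i b * swap_op i) p = apply_partial (bead_op (i + 1) b) p"
      using proper_step(1)[OF i, of B x] proper_step(2)[OF k, of B "sR i \<otimes> x" b] c_closed[OF k] c
      by (auto simp: p swap_op_apply bead_op_apply mult_signed)
  qed
  show "swap_op i * bead_op j b = bead_op j b * swap_op i"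
    if j: "j \<in> {1..r+s}" "j \<noteq> i" "j \<noteq> i + 1" for j b
  proof (rule partial_map_eqI)
    fix p :: "nat set \<times> 'a"
    obtain B x where p: "p = (B, x)" by fastforce
    have "sR i \<otimes> (cR j \<otimes> x) = cR j \<otimes> (sR i \<otimes> x)" if "x \<in> carrier R"
      using that s_c_commute[OF i j] c c_closed[OF j(1)] by (simp flip: m_assoc)
    then show "apply_partial (swap_op i * bead_op j b) p = apply_partial (bead_op j b * swap_op i) p"
      using proper_step(1)[OF i, of B x] proper_step(2)[OF j(1), of B x b] c_closed[OF j(1)] c
      by (auto simp: p swap_op_apply bead_op_apply mult_signed simp del: atLeastAtMost_iff)
  qed
  show "swap_op i * swap_op j = swap_op j * swap_op i" if j: "j \<in> s_indices r s" "i + 1 < j" for j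
  proof (rule partial_map_eqI)
    fix p :: "nat set \<times> 'a"
    obtain B x where p: "p = (B, x)" by fastforce
    have "sR i \<otimes> (sR j \<otimes> x) = sR j \<otimes> (sR i \<otimes> x)" if "x \<in> carrier R"
      using that s_commute[OF i j] c s_closed[OF j(1)] by (simp flip: m_assoc)
    then show "apply_partial (swap_op i * swap_op j) p = apply_partial (swap_op j * swap_op i) p"
      using proper_step(1)[OF i, of B x] proper_step(1)[OF j(1), of B x] by (auto simp: p swap_op_apply)
  qed
  show "swap_op i * swap_op (i + 1) * swap_op i = swap_op (i + 1) * swap_op i * swap_op (i + 1)"
    if j: "i + 1 \<in> s_indices r s"
  proof (rule partial_map_eqI)
    fix p :: "nat set \<times> 'a"
    obtain B x where p: "p = (B, x)" by fastforce
    have "sR i \<otimes> (sR (i + 1) \<otimes> (sR i \<otimes> x)) = sR (i + 1) \<otimes> (sR i \<otimes> (sR (i + 1) \<otimes> x))" if "x \<in> carrier R"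
      using that s_braid[OF i j] c s_closed[OF j] by (simp flip: m_assoc)
    then show "apply_partial (swap_op i * swap_op (i + 1) * swap_op i) p =
        apply_partial (swap_op (i + 1) * swap_op i * swap_op (i + 1)) p"
      using proper_step(1)[OF i, of B x] proper_step(1)[OF j, of B x]
        proper_step(1)[OF i, of B "sR (i + 1) \<otimes> x"] proper_step(1)[OF j, of B "sR i \<otimes> x"]
      by (auto simp: p swap_op_apply)
  qed
next
  fix i j b b' assume "i \<in> {1..r+s}" "j \<in> {1..r+s}" "i \<noteq> j"
  then show "bead_op i b * bead_op j b' = bead_op j b' * bead_op i b" by (rule bead_op_commute)
next
  assume rs: "1 \<le> r" "1 \<le> s"
  then have e: "eR \<in> carrier R" and k: "r \<in> {1..r+s}" "r + 1 \<in> {1..r+s}" by auto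
  show "cap_op * swap_op j = swap_op j * cap_op" if j: "j \<in> s_indices r s" "j \<noteq> r - 1" "j \<noteq> r + 1" for j
  proof (rule partial_map_eqI)
    fix p :: "nat set \<times> 'a"
    obtain B x where p: "p = (B, x)" by fastforce
    have "eR \<otimes> (sR j \<otimes> x) = sR j \<otimes> (eR \<otimes> x)" if "x \<in> carrier R"
      using that e_s_commute[OF rs j] e s_closed[OF j(1)] by (simp flip: m_assoc)
    then show "apply_partial (cap_op * swap_op j) p = apply_partial (swap_op j * cap_op) p"
      using proper_step(1)[OF j(1), of B x] e s_mult_zero_iff[OF j(1), of "eR \<otimes> x"]
      by (auto simp: p swap_op_apply cap_op_apply)
  qed
  show "bead_op r b * cap_op = bead_op (r + 1) b * cap_op" for b
  proof (rule partial_map_eqI)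
    fix p :: "nat set \<times> 'a"
    obtain B x where p: "p = (B, x)" by fastforce
    have "cR r \<otimes> (eR \<otimes> x) = cR (r + 1) \<otimes> (eR \<otimes> x)" if "x \<in> carrier R"
      using that c_e[OF rs] e c_closed[OF k(1)] c_closed[OF k(2)] by (simp flip: m_assoc)
    then show "apply_partial (bead_op r b * cap_op) p = apply_partial (bead_op (r + 1) b * cap_op) p"
      using e by (auto simp: p bead_op_apply cap_op_apply)
  qed
  show "cap_op * bead_op r b = cap_op * bead_op (r + 1) b" for b
  proof (rule partial_map_eqI)
    fix p :: "nat set \<times> 'a"
    obtain B x where p: "p = (B, x)" by fastforce
    have "eR \<otimes> (cR r \<otimes> x) = eR \<otimes> (cR (r + 1) \<otimes> x)" if "x \<in> carrier R"
      using that e_c[OF rs] e c_closed[OF k(1)] c_closed[OF k(2)] by (simp flip: m_assoc)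
    then show "apply_partial (cap_op * bead_op r b) p = apply_partial (cap_op * bead_op (r + 1) b) p"
      using e proper_step(2)[OF k(1), of B x b] proper_step(2)[OF k(2), of B x b] c_closed[OF k(1)] c_closed[OF k(2)]
      by (auto simp: p bead_op_apply cap_op_apply mult_signed)
  qed
  show "cap_op * bead_op j b = bead_op j b * cap_op" if j: "j \<in> {1..r+s}" "j \<noteq> r" "j \<noteq> r + 1" for j b
  proof (rule partial_map_eqI)
    fix p :: "nat set \<times> 'a"
    obtain B x where p: "p = (B, x)" by fastforce
    have "eR \<otimes> (cR j \<otimes> x) = cR j \<otimes> (eR \<otimes> x)" if "x \<in> carrier R"
      using that e_c_commute[OF rs j] e c_closed[OF j(1)] by (simp flip: m_assoc)
    then show "apply_partial (cap_op * bead_op j b) p = apply_partial (bead_op j b * cap_op) p"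
      using e proper_step(2)[OF j(1), of B x b] c_closed[OF j(1)] c_mult_zero_iff[OF j(1), of "eR \<otimes> x"]
      by (auto simp: p bead_op_apply cap_op_apply mult_signed signed_zero_iff simp del: atLeastAtMost_iff)
  qed
  show "cap_op * prod_list (map (bead_op r) bs) * cap_op = 0" for bs
  proof (rule partial_map_eqI)
    fix p :: "nat set \<times> 'a"
    obtain B x where p: "p = (B, x)" by fastforce
    show "apply_partial (cap_op * prod_list (map (bead_op r) bs) * cap_op) p = apply_partial 0 p"
    proof (cases "proper (B, x) \<and> eR \<otimes> x \<noteq> \<zero>")
      case True
      then have x: "x \<in> carrier R" "finite B" by auto
      let ?y = "eR \<otimes> x"
      have z: "eR \<otimes> ?y = \<zero>" "eR \<otimes> (cR r \<otimes> ?y) = \<zero>"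
        using e_square[OF rs] e_c_e[OF rs] x e c_closed[OF k(1)] by (simp_all flip: m_assoc)
      have "apply_partial cap_op (B', y') = None"
        if "apply_partial (prod_list (map (bead_op r) bs)) (B, ?y) = Some (B', y')" for B' y'
      proof -
        have "y' \<in> {?y, \<ominus> ?y, cR r \<otimes> ?y, \<ominus> (cR r \<otimes> ?y)}"
          using beads_then_cap[OF rs _ x(2) _ that] True e by simp
        then have "eR \<otimes> y' = \<zero>" using z x e c_closed[OF k(1)] by (auto simp: r_minus)
        then show ?thesis by (simp add: cap_op_apply)
      qed
      then show ?thesis using True by (auto simp: p cap_op_apply mult.assoc split: bind_splits)
    qed (auto simp: p cap_op_apply)
  qed
next
  assume rs: "2 \<le> r" "1 \<le> s"
  then have e: "eR \<in> carrier R" and i: "r - 1 \<in> s_indices r s" by (auto simp: s_indices_def)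
  show "cap_op * swap_op (r - 1) * cap_op = cap_op"
  proof (rule partial_map_eqI)
    fix p :: "nat set \<times> 'a"
    obtain B x where p: "p = (B, x)" by fastforce
    have "eR \<otimes> (sR (r - 1) \<otimes> (eR \<otimes> x)) = eR \<otimes> x" if "x \<in> carrier R"
      using that e_s_e_left[OF rs] e s_closed[OF i] by (simp flip: m_assoc)
    then show "apply_partial (cap_op * swap_op (r - 1) * cap_op) p = apply_partial cap_op p"
      using e proper_step(1)[OF i, of B "eR \<otimes> x"] by (auto simp: p swap_op_apply cap_op_apply)
  qed
next
  assume rs: "1 \<le> r" "2 \<le> s"
  then have e: "eR \<in> carrier R" and i: "r + 1 \<in> s_indices r s" by (auto simp: s_indices_def)
  show "cap_op * swap_op (r + 1) * cap_op = cap_op"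
  proof (rule partial_map_eqI)
    fix p :: "nat set \<times> 'a"
    obtain B x where p: "p = (B, x)" by fastforce
    have "eR \<otimes> (sR (r + 1) \<otimes> (eR \<otimes> x)) = eR \<otimes> x" if "x \<in> carrier R"
      using that e_s_e_right[OF rs] e s_closed[OF i] by (simp flip: m_assoc)
    then show "apply_partial (cap_op * swap_op (r + 1) * cap_op) p = apply_partial cap_op p"
      using e proper_step(1)[OF i, of B "eR \<otimes> x"] by (auto simp: p swap_op_apply cap_op_apply)
  qed
next
  assume rs: "2 \<le> r" "2 \<le> s"
  then have e: "eR \<in> carrier R" and i: "r - 1 \<in> s_indices r s" and j: "r + 1 \<in> s_indices r s"
    by (auto simp: s_indices_def)
  let ?i = "sR (r - 1)" and ?j = "sR (r + 1)"
  show "swap_op (r - 1) * swap_op (r + 1) * cap_op * swap_op (r + 1) * swap_op (r - 1) * cap_op =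
    cap_op * swap_op (r - 1) * swap_op (r + 1) * cap_op * swap_op (r + 1) * swap_op (r - 1)"
  proof (rule partial_map_eqI)
    fix p :: "nat set \<times> 'a"
    obtain B x where p: "p = (B, x)" by fastforce
    have sw: "apply_partial (swap_op l) (B, y) = (if y = \<zero> then Some (B, y) else Some (B, sR l \<otimes> y))"
      if "finite B" "y \<in> carrier R" for l y using that by (simp add: swap_op_apply)
    have cp: "apply_partial cap_op (B, y) = (if eR \<otimes> y = \<zero> then None else Some (B, eR \<otimes> y))"
      if "finite B" "y \<in> carrier R" for y using that e by (auto simp: cap_op_apply)
    show "apply_partial (swap_op (r - 1) * swap_op (r + 1) * cap_op * swap_op (r + 1) * swap_op (r - 1) * cap_op) p =
      apply_partial (cap_op * swap_op (r - 1) * swap_op (r + 1) * cap_op * swap_op (r + 1) * swap_op (r - 1)) p"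
    proof (cases "proper (B, x)")
      case True
      then have x: "finite B" "x \<in> carrier R" "x \<noteq> \<zero>" by auto
      note zi = s_mult_zero_iff[OF i] and zj = s_mult_zero_iff[OF j]
      have ci: "?i \<in> carrier R" and cj: "?j \<in> carrier R" using i j by auto
      have eq: "?i \<otimes> (?j \<otimes> (eR \<otimes> (?j \<otimes> (?i \<otimes> (eR \<otimes> x))))) = eR \<otimes> (?i \<otimes> (?j \<otimes> (eR \<otimes> (?j \<otimes> (?i \<otimes> x)))))"
        using s_s_e[OF rs] x e ci cj by (simp flip: m_assoc)
      have zero: "eR \<otimes> (?j \<otimes> (?i \<otimes> (eR \<otimes> x))) = \<zero> \<longleftrightarrow> eR \<otimes> (?i \<otimes> (?j \<otimes> (eR \<otimes> (?j \<otimes> (?i \<otimes> x))))) = \<zero>"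
        unfolding eq[symmetric] using zi zj x e ci cj by simp
      have lhs: "apply_partial (swap_op (r - 1) * swap_op (r + 1) * cap_op * swap_op (r + 1) * swap_op (r - 1) * cap_op) (B, x) =
        (if eR \<otimes> (?j \<otimes> (?i \<otimes> (eR \<otimes> x))) = \<zero> then None
         else Some (B, ?i \<otimes> (?j \<otimes> (eR \<otimes> (?j \<otimes> (?i \<otimes> (eR \<otimes> x)))))))"
        using x e ci cj zi zj by (simp add: sw cp)
      have rhs: "apply_partial (cap_op * swap_op (r - 1) * swap_op (r + 1) * cap_op * swap_op (r + 1) * swap_op (r - 1)) (B, x) =
        (if eR \<otimes> (?i \<otimes> (?j \<otimes> (eR \<otimes> (?j \<otimes> (?i \<otimes> x))))) = \<zero> then None
         else Some (B, eR \<otimes> (?i \<otimes> (?j \<otimes> (eR \<otimes> (?j \<otimes> (?i \<otimes> x)))))))"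
        using x e ci cj zi zj by (simp add: sw cp)
      show ?thesis unfolding p lhs rhs using zero eq by simp
    next
      case False
      then have "apply_partial (swap_op l) (B, x) = Some (B, x)" "apply_partial cap_op (B, x) = None" for l
        by (simp_all only: swap_op_apply cap_op_apply simp_thms if_False)
      then show ?thesis unfolding p by simp
    qed
  qed
qed

fun letter_value :: "generator \<Rightarrow> 'a" where
  "letter_value (S i) = sR i"
| "letter_value E = eR"
| "letter_value (C k) = cR k"

fun val :: "generator list \<Rightarrow> 'a" where
  "val [] = \<one>"
| "val (g # w) = letter_value g \<otimes> val w"

lemma letter_closed: "g \<in> generators r s \<Longrightarrow> letter_value g \<in> carrier R"
  by (cases g) (auto simp: generators_def split: if_splits)

lemma val_closed: "set w \<subseteq> generators r s \<Longrightarrow> val w \<in> carrier R"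
  by (induction w) (auto intro: letter_closed)

text \<open>Letters act from the right end of a word, so that every new bead number is smaller than the
  numbers already present and no sign occurs.\<close>

lemma apply_word:
  assumes "\<one> \<noteq> \<zero>" "set w \<subseteq> generators r s"
  shows "apply_partial (op.word m w) ({}, \<one>) =
    (if val w = \<zero> then None else Some ({Suc m..m + count_C w}, val w))"
  using assms(2)
proof (induction w arbitrary: m)
  case Nil
  then show ?case using assms(1) by simp
next
  case (Cons g w)
  let ?B = "{Suc (m + count_C [g])..m + count_C [g] + count_C w}"
  have g: "g \<in> generators r s" and w: "set w \<subseteq> generators r s" using Cons.prems by auto
  note IH = Cons.IH[OF w, of "m + count_C [g]"]
  have v: "val w \<in> carrier R" by (rule val_closed[OF w])
  show ?case
  proof (cases "val w = \<zero>")
    case True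
    then show ?thesis using IH letter_closed[OF g] by simp
  next
    case False
    then have IH: "apply_partial (op.word (m + count_C [g]) w) ({}, \<one>) = Some (?B, val w)" using IH by simp
    have p: "proper (?B, val w)" using False v by simp
    show ?thesis
    proof (cases g)
      case (S i)
      then have i: "i \<in> s_indices r s" using g by (auto simp: generators_def split: if_splits)
      then show ?thesis using IH S p proper_step(1)[OF i p] by (simp add: swap_op_apply)
    next
      case E
      then show ?thesis using IH p by (simp add: cap_op_apply)
    next
      case (C k)
      then have k: "k \<in> {1..r+s}" using g by (auto simp: generators_def split: if_splits)
      have none: "{b' \<in> ?B. b' < Suc m} = {}" "Suc m \<notin> ?B" using C by auto
      have ins: "insert (Suc m) ?B = {Suc m..m + count_C (g # w)}" using C by auto
      have "signed (Suc m) ?B (cR k \<otimes> val w) = cR k \<otimes> val w" unfolding signed_def none by simp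
      moreover have "cR k \<otimes> val w \<noteq> \<zero>" using c_mult_zero_iff[OF k v] False by simp
      ultimately have "apply_partial (bead_op k (Suc m)) (?B, val w) =
          Some ({Suc m..m + count_C (g # w)}, cR k \<otimes> val w)"
        unfolding bead_op_apply ins[symmetric] using p none(2) by (simp only: if_True if_False)
      then show ?thesis using IH C \<open>cR k \<otimes> val w \<noteq> \<zero>\<close> by simp
    qed
  qed
qed

text \<open>The coloured words agree in the bead monoid by \<open>word_cong\<close>, and their action on the unit returns the
  values.\<close>

theorem val_cong:
  assumes "set v \<subseteq> generators r s" "set w \<subseteq> generators r s"
    "word_diagram r s v = Some d" "word_diagram r s w = Some d"
  shows "val v = val w"
proof (cases "\<one> = \<zero>")
  case True
  then have "carrier R = {\<zero>}" by (rule one_zeroD)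
  then show ?thesis using val_closed[OF assms(1)] val_closed[OF assms(2)] by simp
next
  case False
  obtain f g where "act_word r 0 v id_map = Some f" "act_word r 0 w id_map = Some g"
    "graph (r + s) f = graph (r + s) g" using assms(3,4) by (auto simp: word_diagram_def)
  then have "op.word 0 v = op.word 0 w"
    using op.word_cong[OF assms(1,2)] by (simp add: graph_eq_iff)
  then have "(if val v = \<zero> then None else Some ({Suc 0..0 + count_C v}, val v)) =
    (if val w = \<zero> then None else Some ({Suc 0..0 + count_C w}, val w))"
    using apply_word[OF False assms(1), of 0] apply_word[OF False assms(2), of 0] by simp
  then show ?thesis by (auto split: if_splits)
qed

theorem val_zero:
  assumes "set w \<subseteq> generators r s" "word_diagram r s w = None"
  shows "val w = \<zero>"
proof (cases "\<one> = \<zero>")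
  case True
  then have "carrier R = {\<zero>}" by (rule one_zeroD)
  then show ?thesis using val_closed[OF assms(1)] by simp
next
  case False
  have "op.word 0 w = 0" using op.word_zero[OF assms(1)] assms(2) by (auto simp: word_diagram_def)
  then show ?thesis using apply_word[OF False assms(1), of 0] by (simp split: if_splits)
qed

end

section \<open>Superalgebras with a multiplicative basis\<close>

abbreviation supp :: "('b \<Rightarrow> complex) \<Rightarrow> 'b set" where
  "supp f \<equiv> {x. f x \<noteq> 0}"

lemma basis_carrier: "f \<in> carrier (basis_superalgebra B p u par) \<longleftrightarrow> finite (supp f) \<and> supp f \<subseteq> B"
  and basis_even: "f \<in> even_part (basis_superalgebra B p u par) \<longleftrightarrow> finite (supp f) \<and> supp f \<subseteq> {x \<in> B. even (par x)}"
  and basis_odd: "f \<in> odd_part (basis_superalgebra B p u par) \<longleftrightarrow> finite (supp f) \<and> supp f \<subseteq> {x \<in> B. odd (par x)}"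
  and basis_zero [simp]: "\<zero>\<^bsub>basis_superalgebra B p u par\<^esub> = (\<lambda>_. 0)"
  and basis_one [simp]: "\<one>\<^bsub>basis_superalgebra B p u par\<^esub> = basis_vec u"
  and basis_add [simp]: "f \<oplus>\<^bsub>basis_superalgebra B p u par\<^esub> g = (\<lambda>x. f x + g x)"
  and basis_smult [simp]: "a \<odot>\<^bsub>basis_superalgebra B p u par\<^esub> f = (\<lambda>x. a * f x)"
  by (simp_all add: basis_superalgebra_def)

lemma finite_supp_add: "finite (supp f) \<Longrightarrow> finite (supp g) \<Longrightarrow> finite (supp (\<lambda>x. f x + g x))"
  by (rule finite_subset[of _ "supp f \<union> supp g"]) auto

lemma finite_supp_smult: "finite (supp f) \<Longrightarrow> finite (supp (\<lambda>x. a * f x))"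
  by (rule finite_subset[of _ "supp f"]) auto

lemma supp_basis_vec [simp]: "supp (basis_vec x) = {x}"
  by (auto simp: basis_vec_def)

text \<open>The product as a double sum over any finite sets that contain the supports, so that different
  products can be compared over common index sets.\<close>

lemma basis_mult_expand:
  assumes "finite U" "finite Y" "supp f \<subseteq> U" "supp g \<subseteq> Y"
  shows "(f \<otimes>\<^bsub>basis_superalgebra B p u par\<^esub> g) z = (\<Sum>x\<in>U. \<Sum>y\<in>Y. if p x y = Some z then f x * g y else 0)"
proof -
  have "(f \<otimes>\<^bsub>basis_superalgebra B p u par\<^esub> g) z =
    (\<Sum>(x, y) \<in> {(x, y). f x \<noteq> 0 \<and> g y \<noteq> 0 \<and> p x y = Some z}. f x * g y)"
    by (simp add: basis_superalgebra_def)
  also have "\<dots> = (\<Sum>(x, y) \<in> U \<times> Y. if p x y = Some z then f x * g y else 0)"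
    by (rule sum.mono_neutral_cong_left) (use assms in \<open>auto split: if_splits\<close>)
  finally show ?thesis by (simp add: sum.cartesian_product)
qed

lemma supp_basis_mult:
  "supp (f \<otimes>\<^bsub>basis_superalgebra B p u par\<^esub> g) \<subseteq> (\<Union>x \<in> supp f. \<Union>y \<in> supp g. set_option (p x y))"
proof
  fix z assume "z \<in> supp (f \<otimes>\<^bsub>basis_superalgebra B p u par\<^esub> g)"
  then have "(\<Sum>(x, y) \<in> {(x, y). f x \<noteq> 0 \<and> g y \<noteq> 0 \<and> p x y = Some z}. f x * g y) \<noteq> 0"
    by (simp add: basis_superalgebra_def)
  then obtain q where "q \<in> {(x, y). f x \<noteq> 0 \<and> g y \<noteq> 0 \<and> p x y = Some z}" by (meson sum.neutral)
  then show "z \<in> (\<Union>x \<in> supp f. \<Union>y \<in> supp g. set_option (p x y))" by force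
qed

lemma finite_supp_mult:
  "finite (supp f) \<Longrightarrow> finite (supp g) \<Longrightarrow> finite (supp (f \<otimes>\<^bsub>basis_superalgebra B p u par\<^esub> g))"
  by (rule finite_subset[OF supp_basis_mult]) auto

lemma basis_vec_mult:
  "basis_vec x \<otimes>\<^bsub>basis_superalgebra B p u par\<^esub> basis_vec y =
    (case p x y of None \<Rightarrow> (\<lambda>_. 0) | Some z \<Rightarrow> basis_vec z)"
proof
  fix z
  show "(basis_vec x \<otimes>\<^bsub>basis_superalgebra B p u par\<^esub> basis_vec y) z =
    (case p x y of None \<Rightarrow> (\<lambda>_. 0) | Some z \<Rightarrow> basis_vec z) z"
    using basis_mult_expand[of "{x}" "{y}" "basis_vec x" "basis_vec y" B p u par z]
    by (simp add: supp_basis_vec) (auto simp: basis_vec_def split: option.splits)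
qed

text \<open>Associativity of the bilinear product reduces to that of \<open>p\<close>, where an undefined product counts as
  zero, and the grading reduces to the additivity of \<open>par\<close>.\<close>

locale basis_product =
  fixes B :: "'b set" and p :: "'b \<Rightarrow> 'b \<Rightarrow> 'b option" and u :: 'b and par :: "'b \<Rightarrow> nat"
  assumes p_closed: "x \<in> B \<Longrightarrow> y \<in> B \<Longrightarrow> p x y = Some z \<Longrightarrow> z \<in> B"
    and p_assoc: "x \<in> B \<Longrightarrow> y \<in> B \<Longrightarrow> z \<in> B \<Longrightarrow>
          Option.bind (p x y) (\<lambda>t. p t z) = Option.bind (p y z) (p x)"
    and u_in: "u \<in> B"
    and p_left_one: "x \<in> B \<Longrightarrow> p u x = Some x"
    and p_right_one: "x \<in> B \<Longrightarrow> p x u = Some x"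
    and par_mult: "x \<in> B \<Longrightarrow> y \<in> B \<Longrightarrow> p x y = Some z \<Longrightarrow> par z = par x + par y"
    and par_one: "par u = 0"
begin

abbreviation "A \<equiv> basis_superalgebra B p u par"

lemma mult_closed:
  assumes "f \<in> carrier A" "g \<in> carrier A" shows "f \<otimes>\<^bsub>A\<^esub> g \<in> carrier A"
proof -
  have "(\<Union>x \<in> supp f. \<Union>y \<in> supp g. set_option (p x y)) \<subseteq> B"
    using assms by (auto simp: basis_carrier dest: p_closed)
  then show ?thesis using assms finite_supp_mult supp_basis_mult[where f = f and g = g and B = B and p = p and u = u and par = par] by (auto simp: basis_carrier)
qed

lemma mult_assoc:
  assumes "f \<in> carrier A" "g \<in> carrier A" "h \<in> carrier A"
  shows "f \<otimes>\<^bsub>A\<^esub> g \<otimes>\<^bsub>A\<^esub> h = f \<otimes>\<^bsub>A\<^esub> (g \<otimes>\<^bsub>A\<^esub> h)"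
proof
  fix z
  let ?X = "supp f" and ?Y = "supp g" and ?W = "supp h"
  have fin: "finite ?X" "finite ?Y" "finite ?W" and sub: "?X \<subseteq> B" "?Y \<subseteq> B" "?W \<subseteq> B"
    using assms by (auto simp: basis_carrier)
  let ?S = "\<Union>x \<in> ?X. \<Union>y \<in> ?Y. set_option (p x y)" and ?T = "\<Union>y \<in> ?Y. \<Union>w \<in> ?W. set_option (p y w)"
  have fT: "finite ?S" "finite ?T" using fin by auto
  have "(f \<otimes>\<^bsub>A\<^esub> g \<otimes>\<^bsub>A\<^esub> h) z = (\<Sum>t\<in>?S. \<Sum>w\<in>?W. if p t w = Some z then (f \<otimes>\<^bsub>A\<^esub> g) t * h w else 0)"
    by (rule basis_mult_expand[OF fT(1) fin(3) supp_basis_mult order_refl])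
  also have "\<dots> =
    (\<Sum>t\<in>?S. \<Sum>w\<in>?W. if p t w = Some z then (\<Sum>x\<in>?X. \<Sum>y\<in>?Y. if p x y = Some t then f x * g y else 0) * h w else 0)"
    by (simp only: basis_mult_expand[OF fin(1,2) order_refl order_refl])
  also have "\<dots> = (\<Sum>t\<in>?S. \<Sum>w\<in>?W. \<Sum>x\<in>?X. \<Sum>y\<in>?Y.
      if p x y = Some t \<and> p t w = Some z then f x * g y * h w else 0)"
    by (intro sum.cong refl) (auto simp: sum_distrib_right intro!: sum.cong)
  also have "\<dots> = (\<Sum>x\<in>?X. \<Sum>y\<in>?Y. \<Sum>w\<in>?W. \<Sum>t\<in>?S.
      if p x y = Some t \<and> p t w = Some z then f x * g y * h w else 0)"
  proof -
    have "(\<Sum>t\<in>?S. \<Sum>w\<in>?W. \<Sum>x\<in>?X. \<Sum>y\<in>?Y. k x y w t) = (\<Sum>x\<in>?X. \<Sum>y\<in>?Y. \<Sum>w\<in>?W. \<Sum>t\<in>?S. k x y w t)"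
      for k :: "_ \<Rightarrow> _ \<Rightarrow> _ \<Rightarrow> _ \<Rightarrow> complex"
    proof -
      have "(\<Sum>t\<in>?S. \<Sum>w\<in>?W. \<Sum>x\<in>?X. \<Sum>y\<in>?Y. k x y w t) = (\<Sum>w\<in>?W. \<Sum>t\<in>?S. \<Sum>x\<in>?X. \<Sum>y\<in>?Y. k x y w t)"
        by (rule sum.swap)
      also have "\<dots> = (\<Sum>w\<in>?W. \<Sum>x\<in>?X. \<Sum>t\<in>?S. \<Sum>y\<in>?Y. k x y w t)" by (intro sum.cong refl sum.swap)
      also have "\<dots> = (\<Sum>w\<in>?W. \<Sum>x\<in>?X. \<Sum>y\<in>?Y. \<Sum>t\<in>?S. k x y w t)" by (intro sum.cong refl sum.swap)
      also have "\<dots> = (\<Sum>x\<in>?X. \<Sum>w\<in>?W. \<Sum>y\<in>?Y. \<Sum>t\<in>?S. k x y w t)" by (rule sum.swap)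
      also have "\<dots> = (\<Sum>x\<in>?X. \<Sum>y\<in>?Y. \<Sum>w\<in>?W. \<Sum>t\<in>?S. k x y w t)" by (intro sum.cong refl sum.swap)
      finally show ?thesis .
    qed
    then show ?thesis .
  qed
  also have "\<dots> = (\<Sum>x\<in>?X. \<Sum>y\<in>?Y. \<Sum>w\<in>?W. if Option.bind (p x y) (\<lambda>t. p t w) = Some z then f x * g y * h w else 0)"
  proof (intro sum.cong refl)
    fix x y w assume m: "x \<in> ?X" "y \<in> ?Y" "w \<in> ?W"
    show "(\<Sum>t\<in>?S. if p x y = Some t \<and> p t w = Some z then f x * g y * h w else 0) =
      (if Option.bind (p x y) (\<lambda>t. p t w) = Some z then f x * g y * h w else 0)"
    proof (cases "p x y")
      case (Some t0)
      have "t0 \<in> ?S" using m Some by force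
      then have "(\<Sum>t\<in>?S. if t = t0 then (if p t0 w = Some z then f x * g y * h w else 0) else 0) =
        (if p t0 w = Some z then f x * g y * h w else 0)" using fT(1) by (subst sum.delta) auto
      moreover have "(\<Sum>t\<in>?S. if p x y = Some t \<and> p t w = Some z then f x * g y * h w else 0) =
        (\<Sum>t\<in>?S. if t = t0 then (if p t0 w = Some z then f x * g y * h w else 0) else 0)"
        using Some by (intro sum.cong) auto
      ultimately show ?thesis using Some by simp
    qed simp
  qed
  also have "\<dots> = (\<Sum>x\<in>?X. \<Sum>y\<in>?Y. \<Sum>w\<in>?W. if Option.bind (p y w) (p x) = Some z then f x * g y * h w else 0)"
    using p_assoc sub by (intro sum.cong refl) (metis (no_types, lifting) subsetD)
  also have "\<dots> = (\<Sum>x\<in>?X. \<Sum>y\<in>?Y. \<Sum>w\<in>?W. \<Sum>t\<in>?T.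
      if p y w = Some t \<and> p x t = Some z then f x * g y * h w else 0)"
  proof (intro sum.cong refl)
    fix x y w assume m: "x \<in> ?X" "y \<in> ?Y" "w \<in> ?W"
    show "(if Option.bind (p y w) (p x) = Some z then f x * g y * h w else 0) =
      (\<Sum>t\<in>?T. if p y w = Some t \<and> p x t = Some z then f x * g y * h w else 0)"
    proof (cases "p y w")
      case (Some t0)
      have "t0 \<in> ?T" using m Some by force
      then have "(\<Sum>t\<in>?T. if t = t0 then (if p x t0 = Some z then f x * g y * h w else 0) else 0) =
        (if p x t0 = Some z then f x * g y * h w else 0)" using fT(2) by (subst sum.delta) auto
      moreover have "(\<Sum>t\<in>?T. if p y w = Some t \<and> p x t = Some z then f x * g y * h w else 0) =
        (\<Sum>t\<in>?T. if t = t0 then (if p x t0 = Some z then f x * g y * h w else 0) else 0)"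
        using Some by (intro sum.cong) auto
      ultimately show ?thesis using Some by simp
    qed simp
  qed
  also have "\<dots> = (\<Sum>x\<in>?X. \<Sum>t\<in>?T. \<Sum>y\<in>?Y. \<Sum>w\<in>?W.
      if p y w = Some t \<and> p x t = Some z then f x * g y * h w else 0)"
  proof -
    have "(\<Sum>y\<in>?Y. \<Sum>w\<in>?W. \<Sum>t\<in>?T. k y w t) = (\<Sum>t\<in>?T. \<Sum>y\<in>?Y. \<Sum>w\<in>?W. k y w t)"
      for k :: "_ \<Rightarrow> _ \<Rightarrow> _ \<Rightarrow> complex"
    proof -
      have "(\<Sum>y\<in>?Y. \<Sum>w\<in>?W. \<Sum>t\<in>?T. k y w t) = (\<Sum>y\<in>?Y. \<Sum>t\<in>?T. \<Sum>w\<in>?W. k y w t)"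
        by (intro sum.cong refl sum.swap)
      also have "\<dots> = (\<Sum>t\<in>?T. \<Sum>y\<in>?Y. \<Sum>w\<in>?W. k y w t)" by (rule sum.swap)
      finally show ?thesis .
    qed
    then show ?thesis by simp
  qed
  also have "\<dots> = (\<Sum>x\<in>?X. \<Sum>t\<in>?T. if p x t = Some z
      then f x * (\<Sum>y\<in>?Y. \<Sum>w\<in>?W. if p y w = Some t then g y * h w else 0) else 0)"
    by (intro sum.cong refl) (auto simp: sum_distrib_left mult.assoc intro!: sum.cong)
  also have "\<dots> = (\<Sum>x\<in>?X. \<Sum>t\<in>?T. if p x t = Some z then f x * (g \<otimes>\<^bsub>A\<^esub> h) t else 0)"
    by (simp only: basis_mult_expand[OF fin(2,3) order_refl order_refl])
  also have "\<dots> = (f \<otimes>\<^bsub>A\<^esub> (g \<otimes>\<^bsub>A\<^esub> h)) z"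
    by (rule basis_mult_expand[OF fin(1) fT(2) order_refl supp_basis_mult, symmetric])
  finally show "(f \<otimes>\<^bsub>A\<^esub> g \<otimes>\<^bsub>A\<^esub> h) z = (f \<otimes>\<^bsub>A\<^esub> (g \<otimes>\<^bsub>A\<^esub> h)) z" .
qed

lemma ring_A: "ring A"
proof (rule ringI)
  show "abelian_group A"
  proof (rule abelian_groupI)
    fix f assume "f \<in> carrier A"
    then show "\<exists>g \<in> carrier A. g \<oplus>\<^bsub>A\<^esub> f = \<zero>\<^bsub>A\<^esub>"
      by (intro bexI[of _ "\<lambda>x. - f x"]) (auto simp: basis_carrier)
  next
    fix f g assume "f \<in> carrier A" "g \<in> carrier A"
    moreover have "supp (\<lambda>x. f x + g x) \<subseteq> supp f \<union> supp g" by auto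
    ultimately show "f \<oplus>\<^bsub>A\<^esub> g \<in> carrier A" using finite_supp_add[of f g] by (auto simp: basis_carrier)
  qed (auto simp: basis_carrier ac_simps)
  show "monoid A"
  proof (rule monoidI)
    show "\<one>\<^bsub>A\<^esub> \<in> carrier A" by (simp add: basis_carrier u_in)
  next
    fix f assume f: "f \<in> carrier A"
    show "\<one>\<^bsub>A\<^esub> \<otimes>\<^bsub>A\<^esub> f = f"
    proof
      fix z
      have "(\<one>\<^bsub>A\<^esub> \<otimes>\<^bsub>A\<^esub> f) z = (\<Sum>x\<in>{u}. \<Sum>y\<in>supp f. if p x y = Some z then basis_vec u x * f y else 0)"
        unfolding basis_one using f by (intro basis_mult_expand) (auto simp: basis_carrier)
      also have "\<dots> = (\<Sum>y\<in>supp f. if y = z then f z else 0)"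
        using f p_left_one by (auto simp: basis_carrier basis_vec_def subset_iff intro!: sum.cong)
      also have "\<dots> = f z" using f by (auto simp: basis_carrier)
      finally show "(\<one>\<^bsub>A\<^esub> \<otimes>\<^bsub>A\<^esub> f) z = f z" .
    qed
    show "f \<otimes>\<^bsub>A\<^esub> \<one>\<^bsub>A\<^esub> = f"
    proof
      fix z
      have "(f \<otimes>\<^bsub>A\<^esub> \<one>\<^bsub>A\<^esub>) z = (\<Sum>x\<in>supp f. \<Sum>y\<in>{u}. if p x y = Some z then f x * basis_vec u y else 0)"
        unfolding basis_one using f by (intro basis_mult_expand) (auto simp: basis_carrier)
      also have "\<dots> = (\<Sum>x\<in>supp f. if x = z then f z else 0)"
        using f p_right_one by (auto simp: basis_carrier basis_vec_def subset_iff intro!: sum.cong)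
      also have "\<dots> = f z" using f by (auto simp: basis_carrier)
      finally show "(f \<otimes>\<^bsub>A\<^esub> \<one>\<^bsub>A\<^esub>) z = f z" .
    qed
  qed (auto intro: mult_closed mult_assoc)
next
  fix f g h assume c: "f \<in> carrier A" "g \<in> carrier A" "h \<in> carrier A"
  have fin: "finite (supp f \<union> supp g)" "finite (supp h)" using c by (auto simp: basis_carrier)
  have sub: "supp f \<subseteq> supp f \<union> supp g" "supp g \<subseteq> supp f \<union> supp g" "supp (\<lambda>x. f x + g x) \<subseteq> supp f \<union> supp g" by auto
  show "(f \<oplus>\<^bsub>A\<^esub> g) \<otimes>\<^bsub>A\<^esub> h = f \<otimes>\<^bsub>A\<^esub> h \<oplus>\<^bsub>A\<^esub> g \<otimes>\<^bsub>A\<^esub> h"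
    unfolding basis_add
    by (rule ext) (simp only: basis_mult_expand[OF fin sub(1) order_refl] basis_mult_expand[OF fin sub(2) order_refl]
      basis_mult_expand[OF fin sub(3) order_refl] flip: sum.distrib, intro sum.cong refl, simp add: algebra_simps)
  show "h \<otimes>\<^bsub>A\<^esub> (f \<oplus>\<^bsub>A\<^esub> g) = h \<otimes>\<^bsub>A\<^esub> f \<oplus>\<^bsub>A\<^esub> h \<otimes>\<^bsub>A\<^esub> g"
    unfolding basis_add
    by (rule ext) (simp only: basis_mult_expand[OF fin(2,1) order_refl sub(1)] basis_mult_expand[OF fin(2,1) order_refl sub(2)]
      basis_mult_expand[OF fin(2,1) order_refl sub(3)] flip: sum.distrib, intro sum.cong refl, simp add: algebra_simps)
qed

lemma smult_mult:
  assumes "f \<in> carrier A" "g \<in> carrier A"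
  shows "(a \<odot>\<^bsub>A\<^esub> f) \<otimes>\<^bsub>A\<^esub> g = a \<odot>\<^bsub>A\<^esub> (f \<otimes>\<^bsub>A\<^esub> g)" "f \<otimes>\<^bsub>A\<^esub> (a \<odot>\<^bsub>A\<^esub> g) = a \<odot>\<^bsub>A\<^esub> (f \<otimes>\<^bsub>A\<^esub> g)"
proof -
  have fin: "finite (supp f)" "finite (supp g)" using assms by (auto simp: basis_carrier)
  have sub: "supp (\<lambda>x. a * f x) \<subseteq> supp f" "supp (\<lambda>x. a * g x) \<subseteq> supp g" by auto
  show "(a \<odot>\<^bsub>A\<^esub> f) \<otimes>\<^bsub>A\<^esub> g = a \<odot>\<^bsub>A\<^esub> (f \<otimes>\<^bsub>A\<^esub> g)"
    unfolding basis_smult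
    by (rule ext) (simp only: basis_mult_expand[OF fin order_refl order_refl] basis_mult_expand[OF fin sub(1) order_refl]
      sum_distrib_left, intro sum.cong refl, simp)
  show "f \<otimes>\<^bsub>A\<^esub> (a \<odot>\<^bsub>A\<^esub> g) = a \<odot>\<^bsub>A\<^esub> (f \<otimes>\<^bsub>A\<^esub> g)"
    unfolding basis_smult
    by (rule ext) (simp only: basis_mult_expand[OF fin order_refl order_refl] basis_mult_expand[OF fin order_refl sub(2)]
      sum_distrib_left, intro sum.cong refl, simp)
qed

lemma graded_mult:
  assumes "finite (supp f)" "finite (supp g)" "supp f \<subseteq> {x \<in> B. even (par x) = a}" "supp g \<subseteq> {x \<in> B. even (par x) = b}"
  shows "finite (supp (f \<otimes>\<^bsub>A\<^esub> g)) \<and> supp (f \<otimes>\<^bsub>A\<^esub> g) \<subseteq> {x \<in> B. even (par x) = (a = b)}"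
proof -
  have "(\<Union>x \<in> supp f. \<Union>y \<in> supp g. set_option (p x y)) \<subseteq> {x \<in> B. even (par x) = (a = b)}"
  proof (rule subsetI)
    fix z assume "z \<in> (\<Union>x \<in> supp f. \<Union>y \<in> supp g. set_option (p x y))"
    then obtain x y where xyz: "f x \<noteq> 0" "g y \<noteq> 0" "z \<in> set_option (p x y)" by auto
    have "x \<in> B \<and> even (par x) = a" "y \<in> B \<and> even (par y) = b" using assms(3,4) xyz(1,2) by blast+
    then have m: "x \<in> B" "y \<in> B" "even (par x) = a" "even (par y) = b" "p x y = Some z"
      using xyz(3) by simp_all
    show "z \<in> {x \<in> B. even (par x) = (a = b)}" using m(3,4) par_mult[OF m(1,2,5)] p_closed[OF m(1,2,5)] by simp
  qed
  then show ?thesis using order_trans[OF supp_basis_mult] finite_supp_mult[OF assms(1,2)] by simp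
qed

lemma cring_complex: "cring complex_ring"
  by (rule cring_from_type_algebra)

lemma complex_ring_simps [simp]:
  "carrier complex_ring = UNIV" "\<zero>\<^bsub>complex_ring\<^esub> = 0" "\<one>\<^bsub>complex_ring\<^esub> = 1"
  "a \<oplus>\<^bsub>complex_ring\<^esub> b = a + b" "a \<otimes>\<^bsub>complex_ring\<^esub> b = a * b"
  by (simp_all add: ring_of_type_algebra_def)

lemma module_A: "module complex_ring A"
proof (rule moduleI)
  show "cring complex_ring" by (rule cring_complex)
  show "abelian_group A" using ring_A by (rule ring.is_abelian_group)
  fix a f assume "f \<in> carrier A"
  moreover have "supp (\<lambda>x. a * f x) \<subseteq> supp f" by auto
  ultimately show "a \<odot>\<^bsub>A\<^esub> f \<in> carrier A" using finite_supp_smult[of f a] by (auto simp: basis_carrier)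
qed (auto simp: algebra_simps)

lemma a_inv_A: "f \<in> carrier A \<Longrightarrow> \<ominus>\<^bsub>A\<^esub> f = (\<lambda>x. - f x)"
proof -
  assume f: "f \<in> carrier A"
  have "(\<lambda>x. - f x) \<in> carrier A" using f by (simp add: basis_carrier)
  then show ?thesis using ring.ring_simprules(20) abelian_group.minus_equality[OF ring.is_abelian_group[OF ring_A], of "\<lambda>x. - f x" f] f
    by simp
qed

lemma submodule_basis: "submodule {f. finite (supp f) \<and> supp f \<subseteq> {x \<in> B. P x}} complex_ring A"
proof (rule module.submoduleI[OF module_A])
  fix f g assume "f \<in> {f. finite (supp f) \<and> supp f \<subseteq> {x \<in> B. P x}}" "g \<in> {f. finite (supp f) \<and> supp f \<subseteq> {x \<in> B. P x}}"
  moreover have "supp (\<lambda>x. f x + g x) \<subseteq> supp f \<union> supp g" by auto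
  ultimately show "f \<oplus>\<^bsub>A\<^esub> g \<in> {f. finite (supp f) \<and> supp f \<subseteq> {x \<in> B. P x}}"
    using finite_supp_add[of f g] by auto
next
  fix a f assume "f \<in> {f. finite (supp f) \<and> supp f \<subseteq> {x \<in> B. P x}}"
  moreover have "supp (\<lambda>x. a * f x) \<subseteq> supp f" by auto
  ultimately show "a \<odot>\<^bsub>A\<^esub> f \<in> {f. finite (supp f) \<and> supp f \<subseteq> {x \<in> B. P x}}"
    using finite_supp_smult[of f a] by auto
next
  fix f assume f: "f \<in> {f. finite (supp f) \<and> supp f \<subseteq> {x \<in> B. P x}}"
  then have "f \<in> carrier A" by (auto simp: basis_carrier)
  then show "\<ominus>\<^bsub>A\<^esub> f \<in> {f. finite (supp f) \<and> supp f \<subseteq> {x \<in> B. P x}}" using f by (simp add: a_inv_A)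
qed (auto simp: basis_carrier)

theorem superalgebra_A: "superalgebra A"
proof -
  have "superalgebra_axioms A"
  proof (rule superalgebra_axioms.intro)
    show "submodule (even_part A) complex_ring A" "submodule (odd_part A) complex_ring A"
      using submodule_basis[of "\<lambda>x. even (par x)"] submodule_basis[of "\<lambda>x. odd (par x)"]
      by (simp_all add: basis_superalgebra_def)
  next
    fix f assume f: "f \<in> carrier A"
    let ?e = "\<lambda>x. if even (par x) then f x else 0" and ?o = "\<lambda>x. if odd (par x) then f x else 0"
    show "\<exists>!q. q \<in> even_part A \<times> odd_part A \<and> f = fst q \<oplus>\<^bsub>A\<^esub> snd q"
    proof (rule ex1I[of _ "(?e, ?o)"])
      have "supp ?e \<subseteq> supp f" "supp ?o \<subseteq> supp f" by auto
      moreover have "finite (supp f)" using f by (simp add: basis_carrier)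
      ultimately have "finite (supp ?e)" "finite (supp ?o)" by (blast intro: finite_subset)+
      then show "(?e, ?o) \<in> even_part A \<times> odd_part A \<and> f = fst (?e, ?o) \<oplus>\<^bsub>A\<^esub> snd (?e, ?o)"
        using f by (auto simp: basis_even basis_odd basis_carrier)
    next
      fix q assume q: "q \<in> even_part A \<times> odd_part A \<and> f = fst q \<oplus>\<^bsub>A\<^esub> snd q"
      then have "fst q x = 0" if "odd (par x)" for x using that by (auto simp: basis_even)
      moreover have "snd q x = 0" if "even (par x)" for x using that q by (auto simp: basis_odd)
      moreover have "f x = fst q x + snd q x" for x using q by simp
      ultimately show "q = (?e, ?o)" by (auto simp: prod_eq_iff fun_eq_iff)
    qed
  next
    fix f g assume "f \<in> even_part A" "g \<in> even_part A"
    then show "f \<otimes>\<^bsub>A\<^esub> g \<in> even_part A" using graded_mult[of f g True True] by (simp add: basis_even)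
  next
    fix f g assume "f \<in> even_part A" "g \<in> odd_part A"
    then show "f \<otimes>\<^bsub>A\<^esub> g \<in> odd_part A" using graded_mult[of f g True False] by (simp add: basis_even basis_odd)
  next
    fix f g assume "f \<in> odd_part A" "g \<in> even_part A"
    then show "f \<otimes>\<^bsub>A\<^esub> g \<in> odd_part A" using graded_mult[of f g False True] by (simp add: basis_even basis_odd)
  next
    fix f g assume "f \<in> odd_part A" "g \<in> odd_part A"
    then show "f \<otimes>\<^bsub>A\<^esub> g \<in> even_part A" using graded_mult[of f g False False] by (simp add: basis_even basis_odd)
  qed (use smult_mult in auto)
  then show ?thesis using module_A ring_A by (simp add: superalgebra_def)
qed

lemma basis_vec_closed: "x \<in> B \<Longrightarrow> basis_vec x \<in> carrier A"
  by (simp add: basis_carrier)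

lemma carrier_induct [consumes 1, case_names zero add]:
  assumes "f \<in> carrier A"
    and "P (\<lambda>_. 0)"
    and "\<And>a x g. x \<in> B \<Longrightarrow> g \<in> carrier A \<Longrightarrow> P g \<Longrightarrow> P ((a \<odot>\<^bsub>A\<^esub> basis_vec x) \<oplus>\<^bsub>A\<^esub> g)"
  shows "P f"
proof -
  have "finite U \<Longrightarrow> U \<subseteq> B \<Longrightarrow> supp f \<subseteq> U \<Longrightarrow> P f" for U f
  proof (induction U arbitrary: f rule: finite_induct)
    case empty
    then have "f = (\<lambda>_. 0)" by auto
    then show ?case using assms(2) by simp
  next
    case (insert x U)
    let ?g = "f(x := 0)"
    have s: "supp ?g \<subseteq> U" using insert.prems by auto
    then have "P ?g" using insert by auto
    moreover have "?g \<in> carrier A" using s insert finite_subset[OF s insert(1)] unfolding basis_carrier by blast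
    ultimately have "P ((f x \<odot>\<^bsub>A\<^esub> basis_vec x) \<oplus>\<^bsub>A\<^esub> ?g)" using insert.prems by (intro assms(3)) auto
    moreover have "(f x \<odot>\<^bsub>A\<^esub> basis_vec x) \<oplus>\<^bsub>A\<^esub> ?g = f" by (auto simp: basis_vec_def)
    ultimately show ?case by simp
  qed
  then show ?thesis using assms(1) by (auto simp: basis_carrier)
qed

end

section \<open>Quotients by homogeneous ideals\<close>

context superalgebra
begin

lemma even_closed: "x \<in> even_part A \<Longrightarrow> x \<in> carrier A"
  and odd_closed: "x \<in> odd_part A \<Longrightarrow> x \<in> carrier A"
  using submoduleE(1)[OF even_submodule] submoduleE(1)[OF odd_submodule] by auto

lemma decompose:
  assumes "x \<in> carrier A"
  obtains e f where "e \<in> even_part A" "f \<in> odd_part A" "x = e \<oplus> f"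
proof -
  obtain p where "p \<in> even_part A \<times> odd_part A" "x = fst p \<oplus> snd p" using direct_sum[OF assms] by blast
  then show thesis by (intro that[of "fst p" "snd p"]) (auto simp: mem_Times_iff)
qed

lemma decompose_unique:
  assumes "e \<in> even_part A" "f \<in> odd_part A" "e' \<in> even_part A" "f' \<in> odd_part A" "e \<oplus> f = e' \<oplus> f'"
  shows "e = e' \<and> f = f'"
proof -
  have "e \<oplus> f \<in> carrier A" using assms even_closed odd_closed by auto
  from direct_sum[OF this] have "(e, f) = (e', f')"
    by (rule ex1E) (metis assms fst_conv mem_Sigma_iff snd_conv)
  then show ?thesis by simp
qed

text \<open>This is why ring ideals are closed under scalars.\<close>

lemma smult_eq_mult: "x \<in> carrier A \<Longrightarrow> a \<odot> x = (a \<odot> \<one>) \<otimes> x"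
  using smult_mult_left[of \<one> x a] by simp

definition homogeneous :: "'a set \<Rightarrow> bool" where
  "homogeneous I \<longleftrightarrow> (\<forall>e \<in> even_part A. \<forall>f \<in> odd_part A. e \<oplus> f \<in> I \<longrightarrow> e \<in> I \<and> f \<in> I)"

text \<open>The elements of the ideal whose components lie in it form an ideal containing the generators.\<close>

lemma homogeneous_genideal:
  assumes "H \<subseteq> even_part A \<union> odd_part A"
  shows "homogeneous (Idl H)"
proof -
  have HA: "H \<subseteq> carrier A" using assms even_closed odd_closed by auto
  interpret I: ideal "Idl H" A by (rule genideal_ideal[OF HA])
  let ?e = "even_part A" and ?o = "odd_part A"
  let ?J = "{x. \<exists>e \<in> ?e \<inter> Idl H. \<exists>f \<in> ?o \<inter> Idl H. x = e \<oplus> f}"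
  note E = submoduleE[OF even_submodule] and O = submoduleE[OF odd_submodule]
  have zero: "\<zero> \<in> ?e" "\<zero> \<in> ?o"
    using submodule.axioms(1)[OF even_submodule] submodule.axioms(1)[OF odd_submodule] subgroup.one_closed by force+
  note c = even_closed odd_closed
  have "ideal ?J A"
  proof (rule idealI[OF ring_axioms])
    show "subgroup ?J (add_monoid A)"
    proof (rule add.subgroupI)
      show "?J \<subseteq> carrier A" using c by auto
      have "\<zero> \<oplus> \<zero> \<in> ?J" using zero I.zero_closed by blast
      then show "?J \<noteq> {}" by blast
    next
      fix x assume "x \<in> ?J"
      then obtain e f where ef: "e \<in> ?e" "e \<in> Idl H" "f \<in> ?o" "f \<in> Idl H" "x = e \<oplus> f" by auto
      then have "\<ominus> x = \<ominus> e \<oplus> \<ominus> f" using c by (simp add: minus_add a_comm)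
      moreover have "\<ominus> e \<in> ?e" "\<ominus> f \<in> ?o" "\<ominus> e \<in> Idl H" "\<ominus> f \<in> Idl H" using ef E(3) O(3) by auto
      ultimately show "\<ominus> x \<in> ?J" by blast
    next
      fix x y assume "x \<in> ?J" "y \<in> ?J"
      then obtain e f e' f' where ef: "e \<in> ?e" "e \<in> Idl H" "f \<in> ?o" "f \<in> Idl H" "x = e \<oplus> f"
        "e' \<in> ?e" "e' \<in> Idl H" "f' \<in> ?o" "f' \<in> Idl H" "y = e' \<oplus> f'" by auto
      then have "x \<oplus> y = (e \<oplus> e') \<oplus> (f \<oplus> f')" using c by (simp add: a_ac)
      moreover have "e \<oplus> e' \<in> ?e" "f \<oplus> f' \<in> ?o" "e \<oplus> e' \<in> Idl H" "f \<oplus> f' \<in> Idl H" using ef E(5) O(5) by auto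
      ultimately show "x \<oplus> y \<in> ?J" by blast
    qed
  next
    fix a x assume "a \<in> ?J" "x \<in> carrier A"
    then obtain e f where ef: "e \<in> ?e" "e \<in> Idl H" "f \<in> ?o" "f \<in> Idl H" "a = e \<oplus> f" by auto
    obtain g h where gh: "g \<in> ?e" "h \<in> ?o" "x = g \<oplus> h" using decompose[OF \<open>x \<in> carrier A\<close>] by blast
    note ce = c(1)[OF ef(1)] c(2)[OF ef(3)] c(1)[OF gh(1)] c(2)[OF gh(2)]
    have "x \<otimes> a = (g \<otimes> e \<oplus> h \<otimes> f) \<oplus> (g \<otimes> f \<oplus> h \<otimes> e)" using ef(5) gh(3) ce by (simp add: l_distr r_distr a_ac)
    moreover have "g \<otimes> e \<oplus> h \<otimes> f \<in> ?e" "g \<otimes> f \<oplus> h \<otimes> e \<in> ?o"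
      using ef gh E(5) O(5) even_even odd_odd even_odd odd_even by auto
    moreover have "g \<otimes> e \<oplus> h \<otimes> f \<in> Idl H" "g \<otimes> f \<oplus> h \<otimes> e \<in> Idl H"
      using ef ce I.I_l_closed by auto
    ultimately show "x \<otimes> a \<in> ?J" by blast
    have "a \<otimes> x = (e \<otimes> g \<oplus> f \<otimes> h) \<oplus> (e \<otimes> h \<oplus> f \<otimes> g)" using ef(5) gh(3) ce by (simp add: l_distr r_distr a_ac)
    moreover have "e \<otimes> g \<oplus> f \<otimes> h \<in> ?e" "e \<otimes> h \<oplus> f \<otimes> g \<in> ?o"
      using ef gh E(5) O(5) even_even odd_odd even_odd odd_even by auto
    moreover have "e \<otimes> g \<oplus> f \<otimes> h \<in> Idl H" "e \<otimes> h \<oplus> f \<otimes> g \<in> Idl H"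
      using ef ce I.I_r_closed by auto
    ultimately show "a \<otimes> x \<in> ?J" by blast
  qed
  moreover have "H \<subseteq> ?J"
  proof
    fix x assume x: "x \<in> H"
    then have xI: "x \<in> Idl H" "x \<in> carrier A" using genideal_self[OF HA] HA by auto
    show "x \<in> ?J"
    proof (cases "x \<in> ?e")
      case True
      then show ?thesis using xI zero I.zero_closed r_zero[of x] by (intro CollectI bexI[of _ x] bexI[of _ \<zero>]) auto
    next
      case False
      then have "x \<in> ?o" using assms x by auto
      then show ?thesis using xI zero I.zero_closed l_zero[of x] by (intro CollectI bexI[of _ x] bexI[of _ \<zero>]) auto
    qed
  qed
  ultimately have J: "Idl H \<subseteq> ?J" by (rule genideal_minimal)
  show ?thesis unfolding homogeneous_def
  proof (intro ballI impI)
    fix e f assume ef: "e \<in> ?e" "f \<in> ?o" "e \<oplus> f \<in> Idl H"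
    then obtain e' f' where ef': "e' \<in> ?e" "e' \<in> Idl H" "f' \<in> ?o" "f' \<in> Idl H" "e \<oplus> f = e' \<oplus> f'" using J by auto
    then show "e \<in> Idl H \<and> f \<in> Idl H" using decompose_unique[OF ef(1,2) ef'(1,3,5)] by simp
  qed
qed

end

locale graded_ideal = superalgebra + ideal I A for I +
  assumes homogeneous: "homogeneous I"
begin

abbreviation "Q \<equiv> quotient_superalgebra A I"
abbreviation "cls x \<equiv> I +> x"

lemma Q_simps [simp]:
  "carrier Q = carrier (A Quot I)" "x \<otimes>\<^bsub>Q\<^esub> y = x \<otimes>\<^bsub>A Quot I\<^esub> y" "x \<oplus>\<^bsub>Q\<^esub> y = x \<oplus>\<^bsub>A Quot I\<^esub> y"
  "\<one>\<^bsub>Q\<^esub> = \<one>\<^bsub>A Quot I\<^esub>" "\<zero>\<^bsub>Q\<^esub> = \<zero>\<^bsub>A Quot I\<^esub>"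
  "even_part Q = cls ` even_part A" "odd_part Q = cls ` odd_part A"
  by (simp_all add: quotient_superalgebra_def)

lemma quot_carrier: "carrier (A Quot I) = cls ` carrier A"
  by (auto simp: FactRing_def A_RCOSETS_def')

lemma cls_closed: "x \<in> carrier A \<Longrightarrow> cls x \<in> carrier (A Quot I)"
  by (simp add: quot_carrier)

lemma cls_hom: "cls \<in> ring_hom A (A Quot I)"
  by (rule rcos_ring_hom)

lemma cls_mult: "x \<in> carrier A \<Longrightarrow> y \<in> carrier A \<Longrightarrow> cls (x \<otimes> y) = cls x \<otimes>\<^bsub>A Quot I\<^esub> cls y"
  and cls_add: "x \<in> carrier A \<Longrightarrow> y \<in> carrier A \<Longrightarrow> cls (x \<oplus> y) = cls x \<oplus>\<^bsub>A Quot I\<^esub> cls y"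
  and cls_one: "cls \<one> = \<one>\<^bsub>A Quot I\<^esub>"
  using ring_hom_mult[OF cls_hom] ring_hom_add[OF cls_hom] ring_hom_one[OF cls_hom] by auto

lemma cls_eq_iff:
  assumes "x \<in> carrier A" "y \<in> carrier A" shows "cls x = cls y \<longleftrightarrow> x \<ominus> y \<in> I"
  using quotient_eq_iff_same_a_r_cos[OF ideal_axioms assms] by simp

lemma cls_smult:
  assumes "x \<in> carrier A" shows "a \<odot>\<^bsub>Q\<^esub> cls x = cls (a \<odot> x)"
proof -
  have "cls (a \<odot> y) = cls (a \<odot> x)" if y: "y \<in> cls x" for y
  proof -
    have yA: "y \<in> carrier A" using y assms a_r_coset_subset_G[OF a_subset] by blast
    have one: "a \<odot> \<one> \<in> carrier A" "a \<odot> y \<in> carrier A" "a \<odot> x \<in> carrier A"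
      using smult_closed[of a] yA assms by (simp_all add: ring_of_type_algebra_def)
    have "y \<ominus> x \<in> I" using y yA assms cls_eq_iff[OF yA assms] a_repr_independence'[OF y assms] by simp
    then have "(a \<odot> \<one>) \<otimes> (y \<ominus> x) \<in> I" using one(1) by (rule I_l_closed)
    moreover have "a \<odot> y \<ominus> a \<odot> x = (a \<odot> \<one>) \<otimes> (y \<ominus> x)"
    proof -
      have "a \<odot> y \<ominus> a \<odot> x = (a \<odot> \<one>) \<otimes> y \<ominus> (a \<odot> \<one>) \<otimes> x"
        by (rule arg_cong2[where f = "\<lambda>u v. u \<ominus> v", OF smult_eq_mult[OF yA] smult_eq_mult[OF assms]])
      also have "\<dots> = (a \<odot> \<one>) \<otimes> (y \<ominus> x)"
        using one(1) yA assms by (simp add: minus_eq r_distr r_minus)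
      finally show ?thesis .
    qed
    ultimately show ?thesis using cls_eq_iff[OF one(2,3)] by simp
  qed
  then have "(\<Union>y \<in> cls x. cls (a \<odot> y)) = (\<Union>y \<in> cls x. cls (a \<odot> x))" by (intro SUP_cong refl)
  also have "\<dots> = cls (a \<odot> x)" using a_rcos_self[OF assms] by (intro UN_constant_eq) blast+
  finally show ?thesis by (simp add: quotient_superalgebra_def)
qed

sublocale quot: ring "A Quot I"
  by (rule quotient_is_ring)

lemma ring_Q: "ring Q"
proof (rule ringI)
  show "abelian_group Q"
  proof (rule abelian_groupI)
    fix x assume "x \<in> carrier Q"
    then show "\<exists>y \<in> carrier Q. y \<oplus>\<^bsub>Q\<^esub> x = \<zero>\<^bsub>Q\<^esub>"
      using quot.l_neg[of x] quot.a_inv_closed[of x] by (metis Q_simps(1,3,5))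
  qed (simp_all add: quot.a_ac)
  show "monoid Q" by (rule monoidI) (simp_all add: quot.m_assoc)
qed (simp_all add: quot.l_distr quot.r_distr)

lemma a_inv_Q:
  assumes "x \<in> carrier A" shows "\<ominus>\<^bsub>Q\<^esub> cls x = cls (\<ominus> x)"
proof -
  have "cls (\<ominus> x) \<oplus>\<^bsub>Q\<^esub> cls x = \<zero>\<^bsub>Q\<^esub>"
  proof -
    have "cls (\<ominus> x) \<oplus>\<^bsub>Q\<^esub> cls x = cls (\<ominus> x \<oplus> x)" using assms by (simp add: cls_add)
    also have "\<dots> = cls \<zero>" using assms by (simp add: l_neg)
    also have "\<dots> = \<zero>\<^bsub>Q\<^esub>" using ring_hom_zero[OF cls_hom ring_axioms quot.ring_axioms] by simp
    finally show ?thesis .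
  qed
  then show ?thesis using abelian_group.minus_equality[OF ring.is_abelian_group[OF ring_Q], of "cls (\<ominus> x)" "cls x"]
      assms cls_closed by simp
qed

lemma module_Q: "module complex_ring Q"
proof (rule moduleI)
  show "cring complex_ring" by (rule R.is_cring)
  show "abelian_group Q" using ring_Q by (rule ring.is_abelian_group)
next
  fix a x assume "a \<in> carrier complex_ring" "x \<in> carrier Q"
  then show "a \<odot>\<^bsub>Q\<^esub> x \<in> carrier Q" by (auto simp: quot_carrier cls_smult)
next
  fix a b x assume "a \<in> carrier complex_ring" "b \<in> carrier complex_ring" "x \<in> carrier Q"
  then obtain y where "y \<in> carrier A" "x = cls y" by (auto simp: quot_carrier)
  then show "(a \<oplus>\<^bsub>complex_ring\<^esub> b) \<odot>\<^bsub>Q\<^esub> x = a \<odot>\<^bsub>Q\<^esub> x \<oplus>\<^bsub>Q\<^esub> b \<odot>\<^bsub>Q\<^esub> x"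
    "(a \<otimes>\<^bsub>complex_ring\<^esub> b) \<odot>\<^bsub>Q\<^esub> x = a \<odot>\<^bsub>Q\<^esub> (b \<odot>\<^bsub>Q\<^esub> x)"
    using \<open>a \<in> _\<close> \<open>b \<in> _\<close> by (simp_all add: cls_smult smult_l_distr smult_assoc1 cls_add)
next
  fix a x y assume "a \<in> carrier complex_ring" "x \<in> carrier Q" "y \<in> carrier Q"
  then obtain x' y' where xy: "x' \<in> carrier A" "x = cls x'" "y' \<in> carrier A" "y = cls y'" by (auto simp: quot_carrier)
  then have "x \<oplus>\<^bsub>Q\<^esub> y = cls (x' \<oplus> y')" by (simp add: cls_add)
  then show "a \<odot>\<^bsub>Q\<^esub> (x \<oplus>\<^bsub>Q\<^esub> y) = a \<odot>\<^bsub>Q\<^esub> x \<oplus>\<^bsub>Q\<^esub> a \<odot>\<^bsub>Q\<^esub> y"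
    using \<open>a \<in> _\<close> xy by (simp add: cls_smult smult_r_distr cls_add[of "a \<odot> x'" "a \<odot> y'"])
next
  fix x assume "x \<in> carrier Q"
  then show "\<one>\<^bsub>complex_ring\<^esub> \<odot>\<^bsub>Q\<^esub> x = x" by (auto simp: quot_carrier cls_smult)
qed

lemma submodule_Q:
  assumes "submodule M complex_ring A" shows "submodule (cls ` M) complex_ring Q"
proof (rule module.submoduleI[OF module_Q])
  note M = submoduleE[OF assms]
  have MA: "x \<in> M \<Longrightarrow> x \<in> carrier A" for x using M(1) by auto
  show "cls ` M \<subseteq> carrier Q" using MA by (auto simp: cls_closed)
  have "\<zero> \<in> M" using submodule.axioms(1)[OF assms] subgroup.one_closed by force
  then show "\<zero>\<^bsub>Q\<^esub> \<in> cls ` M" using ring_hom_zero[OF cls_hom ring_axioms quot.ring_axioms] by force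
  fix x assume "x \<in> cls ` M"
  then obtain x' where x': "x' \<in> M" "x = cls x'" by auto
  show "\<ominus>\<^bsub>Q\<^esub> x \<in> cls ` M" using x' a_inv_Q[OF MA[OF x'(1)]] M(3) by auto
  show "a \<odot>\<^bsub>Q\<^esub> x \<in> cls ` M" if "a \<in> carrier complex_ring" for a
    using that x' M(4)[of a x'] cls_smult[OF MA[OF x'(1)]] by auto
  fix y assume "y \<in> cls ` M"
  then obtain y' where y': "y' \<in> M" "y = cls y'" by auto
  show "x \<oplus>\<^bsub>Q\<^esub> y \<in> cls ` M" using x' y' M(5)[of x' y'] cls_add[OF MA[OF x'(1)] MA[OF y'(1)]] by auto
qed

theorem superalgebra_Q: "superalgebra Q"
proof -
  note c = even_closed odd_closed
  have "superalgebra_axioms Q"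
  proof (rule superalgebra_axioms.intro)
    fix x y a assume "x \<in> carrier Q" "y \<in> carrier Q"
    then obtain x' y' where xy: "x' \<in> carrier A" "x = cls x'" "y' \<in> carrier A" "y = cls y'" by (auto simp: quot_carrier)
    have a: "a \<odot> x' \<in> carrier A" "a \<odot> y' \<in> carrier A" using xy by (auto simp: ring_of_type_algebra_def)
    show "(a \<odot>\<^bsub>Q\<^esub> x) \<otimes>\<^bsub>Q\<^esub> y = a \<odot>\<^bsub>Q\<^esub> (x \<otimes>\<^bsub>Q\<^esub> y)" "x \<otimes>\<^bsub>Q\<^esub> (a \<odot>\<^bsub>Q\<^esub> y) = a \<odot>\<^bsub>Q\<^esub> (x \<otimes>\<^bsub>Q\<^esub> y)"
      using xy a by (simp_all add: cls_smult smult_mult_left smult_mult_right flip: cls_mult)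
  next
    show "submodule (even_part Q) complex_ring Q" "submodule (odd_part Q) complex_ring Q"
      using submodule_Q[OF even_submodule] submodule_Q[OF odd_submodule] by simp_all
  next
    fix x assume "x \<in> carrier Q"
    then obtain x' where x': "x' \<in> carrier A" "x = cls x'" by (auto simp: quot_carrier)
    obtain e f where ef: "e \<in> even_part A" "f \<in> odd_part A" "x' = e \<oplus> f" using decompose[OF x'(1)] by blast
    show "\<exists>!p. p \<in> even_part Q \<times> odd_part Q \<and> x = fst p \<oplus>\<^bsub>Q\<^esub> snd p"
    proof (rule ex1I[of _ "(cls e, cls f)"])
      show "(cls e, cls f) \<in> even_part Q \<times> odd_part Q \<and> x = fst (cls e, cls f) \<oplus>\<^bsub>Q\<^esub> snd (cls e, cls f)"
        using ef x' c by (auto simp: cls_add)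
    next
      fix p assume p: "p \<in> even_part Q \<times> odd_part Q \<and> x = fst p \<oplus>\<^bsub>Q\<^esub> snd p"
      then obtain e' f' where ef': "e' \<in> even_part A" "f' \<in> odd_part A" "p = (cls e', cls f')" by auto
      have cc: "e \<in> carrier A" "f \<in> carrier A" "e' \<in> carrier A" "f' \<in> carrier A" using ef ef' c by auto
      have "cls (e \<oplus> f) = cls (e' \<oplus> f')" using p x' ef ef' cc by (simp add: cls_add)
      then have "(e \<oplus> f) \<ominus> (e' \<oplus> f') \<in> I" using cls_eq_iff cc by simp
      moreover have "(e \<oplus> f) \<ominus> (e' \<oplus> f') = (e \<ominus> e') \<oplus> (f \<ominus> f')" using cc by (simp add: minus_eq minus_add a_ac)
      moreover have "e \<ominus> e' \<in> even_part A" "f \<ominus> f' \<in> odd_part A"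
        using ef ef' submoduleE(3,5)[OF even_submodule] submoduleE(3,5)[OF odd_submodule] by (auto simp: minus_eq)
      ultimately have "e \<ominus> e' \<in> I" "f \<ominus> f' \<in> I" using homogeneous unfolding homogeneous_def by auto
      then have "cls e = cls e'" "cls f = cls f'" using cls_eq_iff cc by blast+
      then show "p = (cls e, cls f)" using ef'(3) by simp
    qed
  next
    fix x y assume "x \<in> even_part Q" "y \<in> even_part Q"
    then show "x \<otimes>\<^bsub>Q\<^esub> y \<in> even_part Q" using even_even c by (auto simp flip: cls_mult)
  next
    fix x y assume "x \<in> even_part Q" "y \<in> odd_part Q"
    then show "x \<otimes>\<^bsub>Q\<^esub> y \<in> odd_part Q" using even_odd c by (auto simp flip: cls_mult)
  next
    fix x y assume "x \<in> odd_part Q" "y \<in> even_part Q"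
    then show "x \<otimes>\<^bsub>Q\<^esub> y \<in> odd_part Q" using odd_even c by (auto simp flip: cls_mult)
  next
    fix x y assume "x \<in> odd_part Q" "y \<in> odd_part Q"
    then show "x \<otimes>\<^bsub>Q\<^esub> y \<in> even_part Q" using odd_odd c by (auto simp flip: cls_mult)
  qed
  then show ?thesis using module_Q ring_Q by (simp add: superalgebra_def)
qed

end

text \<open>The composite of \<open>\<phi>\<close> with the quotient map is surjective with kernel \<open>I\<close>. The induced isomorphism
  of rings sends the class of \<open>x\<close> to the class of \<open>\<phi> x\<close>, so it respects scalars and parity.\<close>

theorem quotient_superalgebras_isomorphic:
  assumes I: "graded_ideal F I" and J: "graded_ideal A J"
    and hom: "\<phi> \<in> ring_hom F A" and surj: "\<phi> ` carrier F = carrier A"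
    and smult: "\<And>a x. x \<in> carrier F \<Longrightarrow> \<phi> (a \<odot>\<^bsub>F\<^esub> x) = a \<odot>\<^bsub>A\<^esub> \<phi> x"
    and even: "\<phi> ` even_part F = even_part A" and odd: "\<phi> ` odd_part F = odd_part A"
    and kernel: "\<And>x. x \<in> carrier F \<Longrightarrow> \<phi> x \<in> J \<longleftrightarrow> x \<in> I"
  shows "superalgebra_isomorphic (quotient_superalgebra F I) (quotient_superalgebra A J)"
proof -
  interpret I: graded_ideal F I by (rule I)
  interpret J: graded_ideal A J by (rule J)
  let ?h = "J.cls \<circ> \<phi>"
  have h: "?h \<in> ring_hom F (A Quot J)" by (rule ring_hom_trans[OF hom J.cls_hom])
  interpret h: ring_hom_ring F "A Quot J" ?h
    by (rule ring_hom_ringI2[OF I.ring_axioms J.quot.ring_axioms h])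
  interpret p: ring_hom_ring F A \<phi>
    by (rule ring_hom_ringI2[OF I.ring_axioms J.ring_axioms hom])
  have hs: "?h ` carrier F = carrier (A Quot J)" using surj by (simp add: J.quot_carrier flip: image_image)
  have "a_kernel F (A Quot J) ?h = I"
  proof -
    have kz: "?h x = \<zero>\<^bsub>A Quot J\<^esub> \<longleftrightarrow> x \<in> I" if "x \<in> carrier F" for x
    proof -
      have px: "\<phi> x \<in> carrier A" using that surj by auto
      have "\<zero>\<^bsub>A Quot J\<^esub> = J.cls \<zero>\<^bsub>A\<^esub>"
        using ring_hom_zero[OF J.cls_hom J.ring_axioms J.quot.ring_axioms] by simp
      then have "?h x = \<zero>\<^bsub>A Quot J\<^esub> \<longleftrightarrow> \<phi> x \<ominus>\<^bsub>A\<^esub> \<zero>\<^bsub>A\<^esub> \<in> J" using J.cls_eq_iff[OF px] by simp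
      also have "\<phi> x \<ominus>\<^bsub>A\<^esub> \<zero>\<^bsub>A\<^esub> = \<phi> x" using px by (simp add: J.minus_eq)
      finally show ?thesis using kernel[OF that] by simp
    qed
    show ?thesis unfolding a_kernel_def' using kz I.a_subset by blast
  qed
  then have iso: "(\<lambda>Y. the_elem (?h ` Y)) \<in> ring_iso (F Quot I) (A Quot J)"
    using h.FactRing_iso_set[OF hs] by simp
  let ?k = "\<lambda>Y. the_elem (?h ` Y)"
  have k: "?k (I.cls x) = J.cls (\<phi> x)" if x: "x \<in> carrier F" for x
  proof -
    have "?h y = ?h x" if y: "y \<in> I.cls x" for y
    proof -
      have yF: "y \<in> carrier F" using y x I.a_r_coset_subset_G[OF I.a_subset] by blast
      have d: "y \<ominus>\<^bsub>F\<^esub> x \<in> I" using yF x I.cls_eq_iff[OF yF x] I.a_repr_independence'[OF y x] by simp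
      have c: "\<phi> y \<in> carrier A" "\<phi> x \<in> carrier A" using surj x yF by auto
      have "\<phi> (y \<ominus>\<^bsub>F\<^esub> x) = \<phi> y \<ominus>\<^bsub>A\<^esub> \<phi> x"
        unfolding a_minus_def p.hom_add[OF yF I.add.inv_closed[OF x]] p.hom_a_inv[OF x] ..
      then have "\<phi> y \<ominus>\<^bsub>A\<^esub> \<phi> x \<in> J" using d kernel[of "y \<ominus>\<^bsub>F\<^esub> x"] yF x by simp
      then show ?thesis using J.cls_eq_iff[OF c] by simp
    qed
    then have "?h ` I.cls x = (\<lambda>_. ?h x) ` I.cls x" by (intro image_cong refl)
    then have "?h ` I.cls x = {?h x}" by (simp only: image_constant[OF I.a_rcos_self[OF x]])
    then show ?thesis by (simp only: the_elem_eq comp_def)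
  qed
  have "?k \<in> superalgebra_iso (quotient_superalgebra F I) (quotient_superalgebra A J)"
    unfolding superalgebra_iso_def
  proof (intro CollectI conjI allI ballI)
    show "?k \<in> ring_iso (quotient_superalgebra F I) (quotient_superalgebra A J)"
      using iso by (simp add: ring_iso_def ring_hom_def)
    show "?k (a \<odot>\<^bsub>I.Q\<^esub> Y) = a \<odot>\<^bsub>J.Q\<^esub> ?k Y" if "Y \<in> carrier I.Q" for a Y
    proof -
      obtain x where x: "x \<in> carrier F" "Y = I.cls x" using \<open>Y \<in> carrier I.Q\<close> by (auto simp: I.quot_carrier)
      have px: "\<phi> x \<in> carrier A" using surj x by auto
      have ax: "a \<odot>\<^bsub>F\<^esub> x \<in> carrier F"
        using I.smult_closed[of a x] x(1) by (simp add: ring_of_type_algebra_def)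
      show ?thesis unfolding x(2) I.cls_smult[OF x(1)] k[OF x(1)] k[OF ax] J.cls_smult[OF px] smult[OF x(1)] ..
    qed
    have im: "?k ` I.cls ` M = J.cls ` \<phi> ` M" if "M \<subseteq> carrier F" for M
      unfolding image_image using that k by (intro image_cong refl) blast
    have "even_part F \<subseteq> carrier F" "odd_part F \<subseteq> carrier F" using I.even_closed I.odd_closed by blast+
    then show "?k ` even_part I.Q = even_part J.Q" "?k ` odd_part I.Q = odd_part J.Q"
      unfolding I.Q_simps J.Q_simps by (simp_all only: im even odd)
  qed
  then show ?thesis unfolding superalgebra_isomorphic_def using I.superalgebra_Q J.superalgebra_Q by blast
qed

section \<open>Linear extension and the span of diagrams of words\<close>

text \<open>The linear map that sends a basis element \<open>x\<close> to the basis element \<open>m x\<close>, or to zero if \<open>m x\<close> is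
  \<open>None\<close>. The sum is over a finite set for finitely supported \<open>f\<close>.\<close>

definition extend_linearly :: "('a \<Rightarrow> 'b option) \<Rightarrow> ('a \<Rightarrow> complex) \<Rightarrow> 'b \<Rightarrow> complex" where
  "extend_linearly m f z = (\<Sum>x | f x \<noteq> 0 \<and> m x = Some z. f x)"

lemma extend_linearly_expand:
  assumes "finite U" "supp f \<subseteq> U"
  shows "extend_linearly m f z = (\<Sum>x\<in>U. if m x = Some z then f x else 0)"
  unfolding extend_linearly_def
  by (rule sum.mono_neutral_cong_left) (use assms in \<open>auto split: if_splits\<close>)

lemma extend_linearly_zero [simp]: "extend_linearly m (\<lambda>_. 0) = (\<lambda>_. 0)"
  by (auto simp: extend_linearly_def)

lemma extend_linearly_add:
  assumes "finite (supp f)" "finite (supp g)"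
  shows "extend_linearly m (\<lambda>x. f x + g x) = (\<lambda>z. extend_linearly m f z + extend_linearly m g z)"
proof
  fix z
  have U: "finite (supp f \<union> supp g)" using assms by simp
  have s: "supp f \<subseteq> supp f \<union> supp g" "supp g \<subseteq> supp f \<union> supp g" "supp (\<lambda>x. f x + g x) \<subseteq> supp f \<union> supp g" by auto
  show "extend_linearly m (\<lambda>x. f x + g x) z = extend_linearly m f z + extend_linearly m g z"
    unfolding extend_linearly_expand[OF U s(1)] extend_linearly_expand[OF U s(2)] extend_linearly_expand[OF U s(3)]
    by (simp add: sum.distrib[symmetric] if_distrib cong: if_cong)
qed

lemma extend_linearly_smult:
  assumes "finite (supp f)"
  shows "extend_linearly m (\<lambda>x. a * f x) = (\<lambda>z. a * extend_linearly m f z)"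
proof
  fix z
  have s: "supp (\<lambda>x. a * f x) \<subseteq> supp f" by auto
  show "extend_linearly m (\<lambda>x. a * f x) z = a * extend_linearly m f z"
    unfolding extend_linearly_expand[OF assms s] extend_linearly_expand[OF assms order_refl]
    by (simp add: sum_distrib_left if_distrib cong: if_cong)
qed

lemma extend_linearly_basis_vec:
  "extend_linearly m (basis_vec x) = (case m x of None \<Rightarrow> (\<lambda>_. 0) | Some z \<Rightarrow> basis_vec z)"
proof
  fix z
  show "extend_linearly m (basis_vec x) z = (case m x of None \<Rightarrow> (\<lambda>_. 0) | Some z \<Rightarrow> basis_vec z) z"
    using extend_linearly_expand[of "{x}" "basis_vec x" m z]
    by (auto simp: basis_vec_def split: option.splits)
qed

lemma extend_linearly_supp:
  assumes "finite (supp f)" "supp f \<subseteq> B" "\<And>x z. x \<in> B \<Longrightarrow> m x = Some z \<Longrightarrow> z \<in> B'"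
  shows "finite (supp (extend_linearly m f)) \<and> supp (extend_linearly m f) \<subseteq> B'"
proof -
  have "supp (extend_linearly m f) \<subseteq> (\<Union>x \<in> supp f. set_option (m x))"
  proof
    fix z assume "z \<in> supp (extend_linearly m f)"
    then have "(\<Sum>x | f x \<noteq> 0 \<and> m x = Some z. f x) \<noteq> 0" by (simp add: extend_linearly_def)
    then obtain x where "x \<in> {x. f x \<noteq> 0 \<and> m x = Some z}" by (meson sum.neutral)
    then show "z \<in> (\<Union>x \<in> supp f. set_option (m x))" by force
  qed
  moreover have "(\<Union>x \<in> supp f. set_option (m x)) \<subseteq> B'" using assms(2,3) by auto
  moreover have "finite (\<Union>x \<in> supp f. set_option (m x))" using assms(1) by auto
  ultimately show ?thesis using finite_subset by blast
qed

text \<open>Both sides are bilinear, so that it suffices to compare them on basis elements.\<close>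

lemma extend_linearly_mult:
  assumes "basis_product B p u par" "basis_product B' p' u' par'"
    and m: "\<And>x z. x \<in> B \<Longrightarrow> m x = Some z \<Longrightarrow> z \<in> B'"
    and mp: "\<And>x y. x \<in> B \<Longrightarrow> y \<in> B \<Longrightarrow> Option.bind (p x y) m = Option.bind (m x) (\<lambda>a. Option.bind (m y) (p' a))"
    and f: "f \<in> carrier (basis_superalgebra B p u par)" and g: "g \<in> carrier (basis_superalgebra B p u par)"
  shows "extend_linearly m (f \<otimes>\<^bsub>basis_superalgebra B p u par\<^esub> g) =
    extend_linearly m f \<otimes>\<^bsub>basis_superalgebra B' p' u' par'\<^esub> extend_linearly m g"
proof -
  interpret X: basis_product B p u par by fact
  interpret Y: basis_product B' p' u' par' by fact
  interpret XS: superalgebra X.A by (rule X.superalgebra_A)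
  interpret YS: superalgebra Y.A by (rule Y.superalgebra_A)
  let ?l = "extend_linearly m"
  have cl: "?l f \<in> carrier Y.A" if "f \<in> carrier X.A" for f
    using extend_linearly_supp[of f B m B'] that m by (simp add: basis_carrier)
  have add_hom: "?l (f \<oplus>\<^bsub>X.A\<^esub> g) = ?l f \<oplus>\<^bsub>Y.A\<^esub> ?l g" if "f \<in> carrier X.A" "g \<in> carrier X.A" for f g
    using that extend_linearly_add[of f g m] by (simp add: basis_carrier)
  have smult: "?l (a \<odot>\<^bsub>X.A\<^esub> f) = a \<odot>\<^bsub>Y.A\<^esub> ?l f" if "f \<in> carrier X.A" for a f
    using that extend_linearly_smult[of f m a] by (simp add: basis_carrier)
  have sc: "a \<odot>\<^bsub>X.A\<^esub> f \<in> carrier X.A" if "f \<in> carrier X.A" for a f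
    using XS.smult_closed[of a f] that by (simp add: ring_of_type_algebra_def del: basis_smult)
  have sc': "a \<odot>\<^bsub>Y.A\<^esub> f \<in> carrier Y.A" if "f \<in> carrier Y.A" for a f
    using YS.smult_closed[of a f] that by (simp add: ring_of_type_algebra_def del: basis_smult)
  have base: "?l (basis_vec x \<otimes>\<^bsub>X.A\<^esub> basis_vec y) = ?l (basis_vec x) \<otimes>\<^bsub>Y.A\<^esub> ?l (basis_vec y)"
    if "x \<in> B" "y \<in> B" for x y
  proof -
    have z: "(\<lambda>_. 0) \<otimes>\<^bsub>Y.A\<^esub> h = (\<lambda>_. 0)" "h \<otimes>\<^bsub>Y.A\<^esub> (\<lambda>_. 0) = (\<lambda>_. 0)" if "h \<in> carrier Y.A" for h
      using YS.l_null[OF that] YS.r_null[OF that] by simp_all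
    have v: "basis_vec a \<in> carrier Y.A" "basis_vec b \<in> carrier Y.A" if "m x = Some a" "m y = Some b" for a b
      using m[OF \<open>x \<in> B\<close> that(1)] m[OF \<open>y \<in> B\<close> that(2)] Y.basis_vec_closed by auto
    have z0: "(\<lambda>_. 0) \<in> carrier Y.A" using YS.zero_closed by simp
    have vx: "basis_vec a \<in> carrier Y.A" if "m x = Some a" for a using m[OF \<open>x \<in> B\<close> that] Y.basis_vec_closed by auto
    have vy: "basis_vec a \<in> carrier Y.A" if "m y = Some a" for a using m[OF \<open>y \<in> B\<close> that] Y.basis_vec_closed by auto
    show ?thesis
      using mp[OF that] z z0 vx vy
      by (cases "p x y"; cases "m x"; cases "m y")
        (simp_all add: basis_vec_mult extend_linearly_basis_vec split: option.splits)
  qed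
  have one: "?l (basis_vec x \<otimes>\<^bsub>X.A\<^esub> g) = ?l (basis_vec x) \<otimes>\<^bsub>Y.A\<^esub> ?l g" if x: "x \<in> B" and g: "g \<in> carrier X.A" for x g
    using g
  proof (induction rule: X.carrier_induct)
    case zero
    have "basis_vec x \<otimes>\<^bsub>X.A\<^esub> (\<lambda>_. 0) = (\<lambda>_. 0)" using XS.r_null[OF X.basis_vec_closed[OF x]] by simp
    moreover have "?l (basis_vec x) \<otimes>\<^bsub>Y.A\<^esub> (\<lambda>_. 0) = (\<lambda>_. 0)" using YS.r_null[OF cl[OF X.basis_vec_closed[OF x]]] by simp
    ultimately show ?case by simp
  next
    case (add a y g)
    note c = X.basis_vec_closed[OF x] X.basis_vec_closed[OF add(1)] add(2)
    have c2: "a \<odot>\<^bsub>X.A\<^esub> basis_vec y \<in> carrier X.A" by (rule sc[OF c(2)])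
    have "?l (basis_vec x \<otimes>\<^bsub>X.A\<^esub> ((a \<odot>\<^bsub>X.A\<^esub> basis_vec y) \<oplus>\<^bsub>X.A\<^esub> g)) =
      ?l ((a \<odot>\<^bsub>X.A\<^esub> (basis_vec x \<otimes>\<^bsub>X.A\<^esub> basis_vec y)) \<oplus>\<^bsub>X.A\<^esub> (basis_vec x \<otimes>\<^bsub>X.A\<^esub> g))"
      by (simp only: XS.r_distr[OF c2 c(3) c(1)] XS.smult_mult_right[OF c(1,2)])
    also have "\<dots> = (a \<odot>\<^bsub>Y.A\<^esub> ?l (basis_vec x \<otimes>\<^bsub>X.A\<^esub> basis_vec y)) \<oplus>\<^bsub>Y.A\<^esub> ?l (basis_vec x \<otimes>\<^bsub>X.A\<^esub> g)"
      using XS.m_closed[OF c(1,2)] XS.m_closed[OF c(1,3)] sc[OF XS.m_closed[OF c(1,2)]]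
      by (simp only: add(3) add_hom smult)
    also have "\<dots> = ?l (basis_vec x) \<otimes>\<^bsub>Y.A\<^esub> ((a \<odot>\<^bsub>Y.A\<^esub> ?l (basis_vec y)) \<oplus>\<^bsub>Y.A\<^esub> ?l g)"
      unfolding base[OF x add(1)] add(3)
      by (simp only: YS.r_distr[OF sc'[OF cl[OF c(2)]] cl[OF c(3)] cl[OF c(1)]] YS.smult_mult_right[OF cl[OF c(1)] cl[OF c(2)]])
    also have "\<dots> = ?l (basis_vec x) \<otimes>\<^bsub>Y.A\<^esub> ?l ((a \<odot>\<^bsub>X.A\<^esub> basis_vec y) \<oplus>\<^bsub>X.A\<^esub> g)"
      by (simp only: add_hom[OF c2 c(3)] smult[OF c(2)])
    finally show ?case .
  qed
  show ?thesis using f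
  proof (induction rule: X.carrier_induct)
    case zero
    have "(\<lambda>_. 0) \<otimes>\<^bsub>X.A\<^esub> g = (\<lambda>_. 0)" using XS.l_null[OF g] by simp
    moreover have "(\<lambda>_. 0) \<otimes>\<^bsub>Y.A\<^esub> ?l g = (\<lambda>_. 0)" using YS.l_null[OF cl[OF g]] by simp
    ultimately show ?case by simp
  next
    case (add a x f)
    note c = X.basis_vec_closed[OF add(1)] add(2) g
    have c2: "a \<odot>\<^bsub>X.A\<^esub> basis_vec x \<in> carrier X.A" by (rule sc[OF c(1)])
    have "?l (((a \<odot>\<^bsub>X.A\<^esub> basis_vec x) \<oplus>\<^bsub>X.A\<^esub> f) \<otimes>\<^bsub>X.A\<^esub> g) =
      ?l ((a \<odot>\<^bsub>X.A\<^esub> (basis_vec x \<otimes>\<^bsub>X.A\<^esub> g)) \<oplus>\<^bsub>X.A\<^esub> (f \<otimes>\<^bsub>X.A\<^esub> g))"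
      by (simp only: XS.l_distr[OF c2 c(2,3)] XS.smult_mult_left[OF c(1,3)])
    also have "\<dots> = (a \<odot>\<^bsub>Y.A\<^esub> ?l (basis_vec x \<otimes>\<^bsub>X.A\<^esub> g)) \<oplus>\<^bsub>Y.A\<^esub> ?l (f \<otimes>\<^bsub>X.A\<^esub> g)"
      using XS.m_closed[OF c(1,3)] XS.m_closed[OF c(2,3)] sc[OF XS.m_closed[OF c(1,3)]]
      by (simp only: add(3) add_hom smult)
    also have "\<dots> = ((a \<odot>\<^bsub>Y.A\<^esub> ?l (basis_vec x)) \<oplus>\<^bsub>Y.A\<^esub> ?l f) \<otimes>\<^bsub>Y.A\<^esub> ?l g"
      unfolding one[OF add(1) g] add(3)
      by (simp only: YS.l_distr[OF sc'[OF cl[OF c(1)]] cl[OF c(2)] cl[OF c(3)]] YS.smult_mult_left[OF cl[OF c(1)] cl[OF c(3)]])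
    also have "\<dots> = ?l ((a \<odot>\<^bsub>X.A\<^esub> basis_vec x) \<oplus>\<^bsub>X.A\<^esub> f) \<otimes>\<^bsub>Y.A\<^esub> ?l g"
      by (simp only: add_hom[OF c2 c(2)] smult[OF c(1)])
    finally show ?case .
  qed
qed

definition reachable_diagrams :: "nat \<Rightarrow> nat \<Rightarrow> diagram set" where
  "reachable_diagrams r s = {d. \<exists>w. set w \<subseteq> generators r s \<and> word_diagram r s w = Some d}"

text \<open>Products of diagrams of words are diagrams of concatenated words. In particular the associativity of
  diagram multiplication is inherited from that of concatenation.\<close>

lemma reachable_product:
  "basis_product (reachable_diagrams r s) diagram_mult (id_diagram r s) (\<lambda>d. card (bead_numbers d))"
proof
  fix x y z assume "x \<in> reachable_diagrams r s" "y \<in> reachable_diagrams r s"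
  then obtain v w where vw: "set v \<subseteq> generators r s" "set w \<subseteq> generators r s"
    "word_diagram r s v = Some x" "word_diagram r s w = Some y" by (auto simp: reachable_diagrams_def)
  have xy: "diagram_mult x y = word_diagram r s (v @ w)" using word_diagram_append[OF vw(1,2)] vw(3,4) by simp
  then show "z \<in> reachable_diagrams r s" if "diagram_mult x y = Some z"
    using that vw unfolding reachable_diagrams_def by (intro CollectI exI[of _ "v @ w"]) auto
  show "card (bead_numbers z) = card (bead_numbers x) + card (bead_numbers y)" if "diagram_mult x y = Some z"
    using that vw xy word_diagram_bead_diagram(2)[of v r s x] word_diagram_bead_diagram(2)[of w r s y]
      word_diagram_bead_diagram(2)[of "v @ w" r s z] by simp
  assume "z \<in> reachable_diagrams r s"
  then obtain u where u: "set u \<subseteq> generators r s" "word_diagram r s u = Some z" by (auto simp: reachable_diagrams_def)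
  have "diagram_mult y z = word_diagram r s (w @ u)" using word_diagram_append[OF vw(2) u(1)] vw(4) u(2) by simp
  then have "Option.bind (diagram_mult y z) (diagram_mult x) = word_diagram r s (v @ (w @ u))"
    using word_diagram_append[of v r s "w @ u"] vw u by simp
  moreover have "Option.bind (diagram_mult x y) (\<lambda>t. diagram_mult t z) = word_diagram r s ((v @ w) @ u)"
    using word_diagram_append[of "v @ w" r s u] vw u xy by simp
  ultimately show "Option.bind (diagram_mult x y) (\<lambda>t. diagram_mult t z) = Option.bind (diagram_mult y z) (diagram_mult x)"
    by simp
next
  fix x assume "x \<in> reachable_diagrams r s"
  then obtain v where v: "set v \<subseteq> generators r s" "word_diagram r s v = Some x" by (auto simp: reachable_diagrams_def)
  have "Some x = diagram_mult (id_diagram r s) x"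
    using word_diagram_append[of "[]" r s v] v by (simp add: word_diagram_Nil)
  then show "diagram_mult (id_diagram r s) x = Some x" ..
  have "Some x = diagram_mult x (id_diagram r s)"
    using word_diagram_append[of v r s "[]"] v by (simp add: word_diagram_Nil)
  then show "diagram_mult x (id_diagram r s) = Some x" ..
next
  show "id_diagram r s \<in> reachable_diagrams r s"
    unfolding reachable_diagrams_def using word_diagram_Nil by (intro CollectI exI[of _ "[]"]) auto
  show "card (bead_numbers (id_diagram r s)) = 0"
    using word_diagram_bead_diagram(2)[of "[]" r s "id_diagram r s"] by (simp add: word_diagram_Nil)
qed

lemma reachable_bead_diagrams: "reachable_diagrams r s \<subseteq> bead_diagrams r s"
  by (auto simp: reachable_diagrams_def intro: word_diagram_bead_diagram)

lemma generator_diagrams: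
  "BD_generators r s = (\<lambda>g. the (word_diagram r s [g])) ` generators r s"
  "g \<in> generators r s \<Longrightarrow> word_diagram r s [g] \<noteq> None"
proof -
  show "g \<in> generators r s \<Longrightarrow> word_diagram r s [g] \<noteq> None"
    by (auto simp: generators_def word_diagram_generator split: if_splits)
  have "(\<lambda>i. the (word_diagram r s [S i])) ` s_indices r s = s_diagram r s ` s_indices r s"
    "(\<lambda>k. the (word_diagram r s [C k])) ` {1..r+s} = c_diagram r s ` {1..r+s}"
    by (intro image_cong refl; simp add: word_diagram_generator)+
  moreover have "1 \<le> r \<Longrightarrow> 1 \<le> s \<Longrightarrow> the (word_diagram r s [E]) = e_diagram r s" by (simp add: word_diagram_generator)
  ultimately show "BD_generators r s = (\<lambda>g. the (word_diagram r s [g])) ` generators r s"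
    unfolding BD_generators_def generators_def image_Un image_image by auto
qed

text \<open>Every product of generator diagrams is the diagram of a word, and conversely the diagram of a
  word is the product of the diagrams of its letters.\<close>

theorem BD'_eq:
  "BD' r s = basis_superalgebra (reachable_diagrams r s) diagram_mult (id_diagram r s) (\<lambda>d. card (bead_numbers d))"
proof -
  let ?D = "reachable_diagrams r s" and ?T = "BD_tilde r s"
  interpret D: basis_product ?D diagram_mult "id_diagram r s" "\<lambda>d. card (bead_numbers d)"
    by (rule reachable_product)
  interpret DS: superalgebra D.A by (rule D.superalgebra_A)
  let ?H = "subalgebra_generated ?T (basis_vec ` BD_generators r s)"
  have ops: "f \<otimes>\<^bsub>?T\<^esub> g = f \<otimes>\<^bsub>D.A\<^esub> g" "f \<oplus>\<^bsub>?T\<^esub> g = f \<oplus>\<^bsub>D.A\<^esub> g" "a \<odot>\<^bsub>?T\<^esub> f = a \<odot>\<^bsub>D.A\<^esub> f"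
    "\<one>\<^bsub>?T\<^esub> = \<one>\<^bsub>D.A\<^esub>" "\<zero>\<^bsub>?T\<^esub> = \<zero>\<^bsub>D.A\<^esub>" for f g a
    by (simp_all add: BD_tilde_def basis_superalgebra_def)
  have gen: "the (word_diagram r s [g]) \<in> ?D" if "g \<in> generators r s" for g
    using generator_diagrams(2)[OF that] that by (auto simp: reachable_diagrams_def intro!: exI[of _ "[g]"])
  have "?H = carrier D.A"
  proof
    show "?H \<subseteq> carrier D.A"
    proof
      fix x assume "x \<in> ?H"
      then show "x \<in> carrier D.A"
      proof (induction rule: subalgebra_generated.induct)
        case (incl x)
        then show ?case using gen D.basis_vec_closed by (auto simp: generator_diagrams(1))
      next
        case (smult x a)
        then show ?case using DS.smult_closed[of a x] unfolding ops by (simp add: ring_of_type_algebra_def del: basis_smult)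
      qed (auto simp: ops simp del: basis_add basis_one basis_zero)
    qed
    have vec: "basis_vec d \<in> ?H" if "set w \<subseteq> generators r s" "word_diagram r s w = Some d" for w d
      using that
    proof (induction w arbitrary: d)
      case Nil
      then have "basis_vec d = \<one>\<^bsub>?T\<^esub>" by (simp add: ops word_diagram_Nil)
      then show ?case by (metis subalgebra_generated.one)
    next
      case (Cons g w)
      obtain e f where ef: "word_diagram r s [g] = Some e" "word_diagram r s w = Some f" "diagram_mult e f = Some d"
        using word_diagram_append[of "[g]" r s w] Cons.prems by (auto split: bind_splits)
      have "e \<in> BD_generators r s" using Cons.prems ef(1) by (force simp: generator_diagrams(1))
      then have "basis_vec e \<in> ?H" by (auto intro: subalgebra_generated.incl)
      moreover have "basis_vec f \<in> ?H" using Cons ef(2) by auto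
      ultimately have "basis_vec e \<otimes>\<^bsub>?T\<^esub> basis_vec f \<in> ?H" by (rule subalgebra_generated.mult)
      then show ?case unfolding ops by (simp add: basis_vec_mult ef(3))
    qed
    show "carrier D.A \<subseteq> ?H"
    proof
      fix x assume "x \<in> carrier D.A"
      then show "x \<in> ?H"
      proof (induction rule: D.carrier_induct)
        case zero
        then show ?case using subalgebra_generated.zero[of ?T] by (simp add: ops)
      next
        case (add a x g)
        then have "basis_vec x \<in> ?H" using vec by (auto simp: reachable_diagrams_def)
        then show ?case using add by (auto simp: simp del: basis_add basis_smult simp flip: ops intro: subalgebra_generated.intros)
      qed
    qed
  qed
  moreover have "even_part ?T \<inter> carrier D.A = even_part D.A" "odd_part ?T \<inter> carrier D.A = odd_part D.A"
    using reachable_bead_diagrams[of r s] unfolding BD_tilde_def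
    by (simp_all add: set_eq_iff basis_even basis_odd basis_carrier) blast+
  ultimately show ?thesis
    unfolding BD'_def restrict_superalgebra_def
    by (simp add: BD_tilde_def) (simp add: basis_superalgebra_def)
qed

section \<open>Comparison of the two quotients\<close>

text \<open>The image of an ideal under a surjective homomorphism is an ideal, and the preimage of an
  ideal is an ideal. An ideal containing the kernel is the preimage of its image.\<close>

lemma (in ring_hom_ring) genideal_correspondence:
  assumes surj: "h ` carrier R = carrier S" and U: "U \<subseteq> carrier R" and V: "V \<subseteq> carrier S"
    and UV: "h ` U \<subseteq> Idl\<^bsub>S\<^esub> V" and VU: "V \<subseteq> h ` (Idl\<^bsub>R\<^esub> U)"
    and ker: "\<And>x. x \<in> carrier R \<Longrightarrow> h x = \<zero>\<^bsub>S\<^esub> \<Longrightarrow> x \<in> Idl\<^bsub>R\<^esub> U"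
    and x: "x \<in> carrier R"
  shows "h x \<in> Idl\<^bsub>S\<^esub> V \<longleftrightarrow> x \<in> Idl\<^bsub>R\<^esub> U"
proof
  let ?I = "Idl\<^bsub>R\<^esub> U"
  interpret I: ideal ?I R by (rule R.genideal_ideal[OF U])
  note IR = I.Icarr
  have "ideal (h ` ?I) S"
  proof (rule idealI[OF S.ring_axioms])
    show "subgroup (h ` ?I) (add_monoid S)"
    proof (rule S.add.subgroupI)
      show "h ` ?I \<subseteq> carrier S" using IR by auto
      have "h \<zero>\<^bsub>R\<^esub> \<in> h ` ?I" by (rule imageI[OF additive_subgroup.zero_closed[OF I.additive_subgroup_axioms]])
      then show "h ` ?I \<noteq> {}" by blast
      fix a assume "a \<in> h ` ?I"
      then obtain y where y: "y \<in> ?I" "a = h y" by auto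
      then have "\<ominus>\<^bsub>S\<^esub> a = h (\<ominus>\<^bsub>R\<^esub> y)" using IR by simp
      then show "\<ominus>\<^bsub>S\<^esub> a \<in> h ` ?I"
        by (rule image_eqI) (rule additive_subgroup.a_inv_closed[OF I.additive_subgroup_axioms y(1)])
      fix b assume "b \<in> h ` ?I"
      then obtain z where z: "z \<in> ?I" "b = h z" by auto
      then have "a \<oplus>\<^bsub>S\<^esub> b = h (y \<oplus>\<^bsub>R\<^esub> z)" using IR y by simp
      then show "a \<oplus>\<^bsub>S\<^esub> b \<in> h ` ?I"
        by (rule image_eqI) (rule additive_subgroup.a_closed[OF I.additive_subgroup_axioms y(1) z(1)])
    qed
    fix a b assume "a \<in> h ` ?I" "b \<in> carrier S"
    then obtain y z where yz: "y \<in> ?I" "a = h y" "z \<in> carrier R" "b = h z"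
      unfolding surj[symmetric] by (elim imageE)
    have "b \<otimes>\<^bsub>S\<^esub> a = h (z \<otimes>\<^bsub>R\<^esub> y)" "a \<otimes>\<^bsub>S\<^esub> b = h (y \<otimes>\<^bsub>R\<^esub> z)" using yz IR by simp_all
    then show "b \<otimes>\<^bsub>S\<^esub> a \<in> h ` ?I" "a \<otimes>\<^bsub>S\<^esub> b \<in> h ` ?I"
      using I.I_l_closed[OF yz(1,3)] I.I_r_closed[OF yz(1,3)] by blast+
  qed
  then have sub: "Idl\<^bsub>S\<^esub> V \<subseteq> h ` ?I" using VU by (rule S.genideal_minimal)
  assume "h x \<in> Idl\<^bsub>S\<^esub> V"
  then obtain y where y: "y \<in> ?I" "h x = h y" using sub by auto
  have yR: "y \<in> carrier R" by (rule IR[OF y(1)])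
  have "h (x \<ominus>\<^bsub>R\<^esub> y) = \<zero>\<^bsub>S\<^esub>" using x yR y(2) S.r_neg[of "h y"] by (simp add: a_minus_def)
  then have "x \<ominus>\<^bsub>R\<^esub> y \<in> ?I" using x yR by (intro ker) auto
  then have "(x \<ominus>\<^bsub>R\<^esub> y) \<oplus>\<^bsub>R\<^esub> y \<in> ?I" using y(1) by (rule additive_subgroup.a_closed[OF I.additive_subgroup_axioms])
  then show "x \<in> ?I" using x yR by (simp add: a_minus_def R.a_assoc R.l_neg)
next
  assume "x \<in> Idl\<^bsub>R\<^esub> U"
  moreover have "Idl\<^bsub>R\<^esub> U \<subseteq> {x \<in> carrier R. h x \<in> Idl\<^bsub>S\<^esub> V}"
    using U UV by (intro R.genideal_minimal ideal_vimage S.genideal_ideal V) auto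
  ultimately show "h x \<in> Idl\<^bsub>S\<^esub> V" by auto
qed

lemma words_product: "basis_product (lists G) (\<lambda>v w. Some (v @ w)) [] (\<lambda>w. length (filter P w))"
  by unfold_locales auto

context fixes r s :: nat
begin

abbreviation "gens \<equiv> generators r s"
abbreviation "F \<equiv> free_superalgebra r s"
abbreviation "D \<equiv> BD' r s"

interpretation words: basis_product "lists gens" "\<lambda>v w. Some (v @ w)" "[]" "\<lambda>w. length (filter is_C w)"
  rewrites "basis_superalgebra (lists gens) (\<lambda>v w. Some (v @ w)) [] (\<lambda>w. length (filter is_C w)) = F"
  by (rule words_product) (simp add: free_superalgebra_def)

interpretation diagrams: basis_product "reachable_diagrams r s" diagram_mult "id_diagram r s" "\<lambda>d. card (bead_numbers d)"
  rewrites "basis_superalgebra (reachable_diagrams r s) diagram_mult (id_diagram r s) (\<lambda>d. card (bead_numbers d)) = D"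
  by (rule reachable_product) (rule BD'_eq[symmetric])

lemma free_carrier: "f \<in> carrier F \<longleftrightarrow> finite (supp f) \<and> supp f \<subseteq> lists gens"
  and free_even: "f \<in> even_part F \<longleftrightarrow> finite (supp f) \<and> supp f \<subseteq> {w \<in> lists gens. even (count_C w)}"
  and free_odd: "f \<in> odd_part F \<longleftrightarrow> finite (supp f) \<and> supp f \<subseteq> {w \<in> lists gens. odd (count_C w)}"
  and free_ops [simp]: "\<zero>\<^bsub>F\<^esub> = (\<lambda>_. 0)" "\<one>\<^bsub>F\<^esub> = basis_vec []" "f \<oplus>\<^bsub>F\<^esub> g = (\<lambda>x. f x + g x)"
    "a \<odot>\<^bsub>F\<^esub> f = (\<lambda>x. a * f x)" "basis_vec v \<otimes>\<^bsub>F\<^esub> basis_vec w = basis_vec (v @ w)"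
  unfolding free_superalgebra_def
  by (simp_all add: basis_carrier basis_even basis_odd basis_vec_mult count_C_def)

lemma free_minus: "f \<in> carrier F \<Longrightarrow> g \<in> carrier F \<Longrightarrow> f \<ominus>\<^bsub>F\<^esub> g = (\<lambda>w. f w - g w)"
  by (simp add: a_minus_def words.a_inv_A)

lemma diagrams_carrier: "f \<in> carrier D \<longleftrightarrow> finite (supp f) \<and> supp f \<subseteq> reachable_diagrams r s"
  and diagrams_even: "f \<in> even_part D \<longleftrightarrow> finite (supp f) \<and> supp f \<subseteq> {d \<in> reachable_diagrams r s. even (card (bead_numbers d))}"
  and diagrams_odd: "f \<in> odd_part D \<longleftrightarrow> finite (supp f) \<and> supp f \<subseteq> {d \<in> reachable_diagrams r s. odd (card (bead_numbers d))}"
  and diagrams_ops [simp]: "\<zero>\<^bsub>D\<^esub> = (\<lambda>_. 0)" "\<one>\<^bsub>D\<^esub> = basis_vec (id_diagram r s)" "f \<oplus>\<^bsub>D\<^esub> g = (\<lambda>x. f x + g x)"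
    "a \<odot>\<^bsub>D\<^esub> f = (\<lambda>x. a * f x)"
    "basis_vec d \<otimes>\<^bsub>D\<^esub> basis_vec e = (case diagram_mult d e of None \<Rightarrow> (\<lambda>_. 0) | Some z \<Rightarrow> basis_vec z)"
  unfolding BD'_eq
  by (simp_all add: basis_carrier basis_even basis_odd basis_vec_mult)

text \<open>The homomorphism from the free superalgebra that sends a word to its diagram, or to zero.\<close>

abbreviation "draw \<equiv> extend_linearly (word_diagram r s)"

lemma draw_reachable: "w \<in> lists gens \<Longrightarrow> word_diagram r s w = Some d \<Longrightarrow> d \<in> reachable_diagrams r s"
  by (auto simp: reachable_diagrams_def lists_eq_set)

lemma draw_closed: "f \<in> carrier F \<Longrightarrow> draw f \<in> carrier D"
  unfolding free_carrier diagrams_carrier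
  using extend_linearly_supp[of f "lists gens" "word_diagram r s" "reachable_diagrams r s"] draw_reachable by blast

lemma draw_ring_hom: "draw \<in> ring_hom F D"
proof (rule ring_hom_memI)
  fix f g assume fg: "f \<in> carrier F" "g \<in> carrier F"
  have "Option.bind (Some (v @ w)) (word_diagram r s) = Option.bind (word_diagram r s v) (\<lambda>d. Option.bind (word_diagram r s w) (diagram_mult d))"
    if "v \<in> lists gens" "w \<in> lists gens" for v w
    using word_diagram_append[of v r s w] that by (simp add: lists_eq_set)
  then show "draw (f \<otimes>\<^bsub>F\<^esub> g) = draw f \<otimes>\<^bsub>D\<^esub> draw g"
    using extend_linearly_mult[OF words_product[of gens is_C] reachable_product[of r s] draw_reachable _
        fg[unfolded free_superalgebra_def]]
    by (simp only: free_superalgebra_def BD'_eq)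
  show "draw (f \<oplus>\<^bsub>F\<^esub> g) = draw f \<oplus>\<^bsub>D\<^esub> draw g"
    using extend_linearly_add[of f g] fg by (simp add: free_carrier)
next
  show "draw \<one>\<^bsub>F\<^esub> = \<one>\<^bsub>D\<^esub>" by (simp add: extend_linearly_basis_vec word_diagram_Nil)
qed (rule draw_closed)

lemma draw_smult: "f \<in> carrier F \<Longrightarrow> draw (a \<odot>\<^bsub>F\<^esub> f) = a \<odot>\<^bsub>D\<^esub> draw f"
  using extend_linearly_smult[of f] by (simp add: free_carrier)

text \<open>A choice of words for diagrams splits \<open>draw\<close>.\<close>

definition "word_of d = (SOME w. set w \<subseteq> gens \<and> word_diagram r s w = Some d)"

abbreviation "spell \<equiv> extend_linearly (\<lambda>d. Some (word_of d))"

lemma word_of: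
  assumes "d \<in> reachable_diagrams r s"
  shows "word_of d \<in> lists gens" "word_diagram r s (word_of d) = Some d" "count_C (word_of d) = card (bead_numbers d)"
proof -
  have "set (word_of d) \<subseteq> gens \<and> word_diagram r s (word_of d) = Some d"
    unfolding word_of_def by (rule someI_ex) (use assms in \<open>simp add: reachable_diagrams_def\<close>)
  then show "word_of d \<in> lists gens" "word_diagram r s (word_of d) = Some d" "count_C (word_of d) = card (bead_numbers d)"
    using word_diagram_bead_diagram(2)[of "word_of d" r s d] by (auto simp: lists_eq_set)
qed

lemma spell_closed: "f \<in> carrier D \<Longrightarrow> spell f \<in> carrier F"
  unfolding free_carrier diagrams_carrier
  using extend_linearly_supp[of f "reachable_diagrams r s" "\<lambda>d. Some (word_of d)" "lists gens"] word_of(1) by blast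

lemma draw_spell:
  assumes "f \<in> carrier D" shows "draw (spell f) = f"
  using assms
proof (induction rule: diagrams.carrier_induct)
  case zero
  then show ?case by simp
next
  case (add a d g)
  have v: "basis_vec d \<in> carrier D" by (rule diagrams.basis_vec_closed[OF add(1)])
  let ?m = "\<lambda>d. Some (word_of d)"
  have "draw (spell (basis_vec d)) = basis_vec d"
    using word_of(2)[OF add(1)] by (simp add: extend_linearly_basis_vec)
  moreover have "spell ((a \<odot>\<^bsub>D\<^esub> basis_vec d) \<oplus>\<^bsub>D\<^esub> g) = (a \<odot>\<^bsub>F\<^esub> spell (basis_vec d)) \<oplus>\<^bsub>F\<^esub> spell g"
    using add(2) finite_supp_smult[of "basis_vec d" a]
      extend_linearly_add[of "\<lambda>x. a * basis_vec d x" g ?m] extend_linearly_smult[of "basis_vec d" ?m a]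
    by (simp add: diagrams_carrier)
  moreover have "a \<odot>\<^bsub>F\<^esub> spell (basis_vec d) \<in> carrier F"
    using spell_closed[OF v] finite_supp_smult[of "spell (basis_vec d)" a] by (auto simp: free_carrier)
  ultimately show ?case
    using ring_hom_add[OF draw_ring_hom, of "a \<odot>\<^bsub>F\<^esub> spell (basis_vec d)" "spell g"] draw_smult[OF spell_closed[OF v], of a]
      spell_closed[OF add(2)] add(3) by simp
qed

lemma draw_surj:
  "draw ` carrier F = carrier D" "draw ` even_part F = even_part D" "draw ` odd_part F = odd_part D"
proof -
  show "draw ` carrier F = carrier D"
  proof
    show "draw ` carrier F \<subseteq> carrier D" using draw_closed by blast
    show "carrier D \<subseteq> draw ` carrier F"
    proof
      fix f assume "f \<in> carrier D"
      then show "f \<in> draw ` carrier F" by (intro image_eqI[where x = "spell f"] spell_closed draw_spell[symmetric])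
    qed
  qed
  let ?B = "\<lambda>b. {w \<in> lists gens. even (count_C w) = b}"
  let ?B' = "\<lambda>b. {d \<in> reachable_diagrams r s. even (card (bead_numbers d)) = b}"
  have *: "draw ` {f. finite (supp f) \<and> supp f \<subseteq> ?B b} = {f. finite (supp f) \<and> supp f \<subseteq> ?B' b}" for b
  proof
    have "d \<in> ?B' b" if "w \<in> ?B b" "word_diagram r s w = Some d" for w d
      using that draw_reachable[of w d] word_diagram_bead_diagram(2)[of w r s d] by (simp add: lists_eq_set)
    then show "draw ` {f. finite (supp f) \<and> supp f \<subseteq> ?B b} \<subseteq> {f. finite (supp f) \<and> supp f \<subseteq> ?B' b}"
      using extend_linearly_supp[of _ "?B b" "word_diagram r s" "?B' b"] by blast
    show "{f. finite (supp f) \<and> supp f \<subseteq> ?B' b} \<subseteq> draw ` {f. finite (supp f) \<and> supp f \<subseteq> ?B b}"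
    proof
      fix f assume f: "f \<in> {f. finite (supp f) \<and> supp f \<subseteq> ?B' b}"
      have "\<And>d w. d \<in> ?B' b \<Longrightarrow> Some (word_of d) = Some w \<Longrightarrow> w \<in> ?B b" using word_of by auto
      then have "spell f \<in> {f. finite (supp f) \<and> supp f \<subseteq> ?B b}"
        using f extend_linearly_supp[of f "?B' b" "\<lambda>d. Some (word_of d)" "?B b"] by blast
      moreover have "f \<in> carrier D" using f by (auto simp: diagrams_carrier)
      ultimately show "f \<in> draw ` {f. finite (supp f) \<and> supp f \<subseteq> ?B b}"
        by (intro image_eqI[where x = "spell f"] draw_spell[symmetric])
    qed
  qed
  have "even_part F = {f. finite (supp f) \<and> supp f \<subseteq> ?B True}" "odd_part F = {f. finite (supp f) \<and> supp f \<subseteq> ?B False}"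
    "even_part D = {f. finite (supp f) \<and> supp f \<subseteq> ?B' True}" "odd_part D = {f. finite (supp f) \<and> supp f \<subseteq> ?B' False}"
    by (simp_all add: set_eq_iff free_even free_odd diagrams_even diagrams_odd)
  then show "draw ` even_part F = even_part D" "draw ` odd_part F = odd_part D" using *[of True] *[of False] by simp_all
qed

interpretation F: superalgebra F by (rule words.superalgebra_A)
interpretation D: superalgebra D by (rule diagrams.superalgebra_A)
interpretation draw: ring_hom_ring F D draw
  by (rule ring_hom_ringI2[OF F.ring_axioms D.ring_axioms draw_ring_hom])

abbreviation "relators \<equiv> {x \<ominus>\<^bsub>F\<^esub> y | x y. (x, y) \<in> BC_relations r s}"

lemma generator_index [simp]:
  "S i \<in> gens \<longleftrightarrow> i \<in> s_indices r s" "E \<in> gens \<longleftrightarrow> 1 \<le> r \<and> 1 \<le> s" "C k \<in> gens \<longleftrightarrow> k \<in> {1..r + s}"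
  by (auto simp: generators_def)

lemma neighbour_index: "2 \<le> r \<Longrightarrow> r - Suc 0 \<in> s_indices r s" "2 \<le> s \<Longrightarrow> Suc r \<in> s_indices r s"
  by (auto simp: s_indices_def)

lemma strand_index: "i \<in> s_indices r s \<Longrightarrow> Suc 0 \<le> i" "i \<in> s_indices r s \<Longrightarrow> i < r + s"
    "i \<in> s_indices r s \<Longrightarrow> i \<le> r + s"
  by (auto simp: s_indices_def)

lemma relation_parity:
  assumes "(x, y) \<in> BC_relations r s"
  shows "x \<in> even_part F \<and> y \<in> even_part F \<or> x \<in> odd_part F \<and> y \<in> odd_part F"
  using assms by cases (auto simp: free_even free_odd s_indices_def)

lemma relation_closed: "(x, y) \<in> BC_relations r s \<Longrightarrow> x \<in> carrier F \<and> y \<in> carrier F"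
  using relation_parity F.even_closed F.odd_closed by blast

lemma relators_parity: "relators \<subseteq> even_part F \<union> odd_part F"
proof
  fix z assume "z \<in> relators"
  then obtain x y where xy: "(x, y) \<in> BC_relations r s" "z = x \<ominus>\<^bsub>F\<^esub> y" by blast
  have z: "z = (\<lambda>w. x w - y w)" using xy relation_closed[OF xy(1)] free_minus by simp
  have "supp z \<subseteq> supp x \<union> supp y" unfolding z by auto
  then show "z \<in> even_part F \<union> odd_part F"
    using relation_parity[OF xy(1)] finite_subset[of "supp z" "supp x \<union> supp y"] unfolding free_even free_odd Un_iff by blast
qed

lemma relators_closed: "relators \<subseteq> carrier F"
  using relators_parity F.even_closed F.odd_closed by blast

lemma relator_in_ideal: "(x, y) \<in> BC_relations r s \<Longrightarrow> x \<ominus>\<^bsub>F\<^esub> y \<in> Idl\<^bsub>F\<^esub> relators"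
  using F.genideal_self[OF relators_closed] by blast

interpretation I: graded_ideal F "Idl\<^bsub>F\<^esub> relators"
  by (intro graded_ideal.intro graded_ideal_axioms.intro F.superalgebra_axioms
      F.genideal_ideal F.homogeneous_genideal relators_closed relators_parity)

lemma vec_closed: "w \<in> lists gens \<Longrightarrow> basis_vec w \<in> carrier F"
  by (rule words.basis_vec_closed)

lemma cls_relation: "(x, y) \<in> BC_relations r s \<Longrightarrow> I.cls x = I.cls y"
  using relator_in_ideal relation_closed I.cls_eq_iff by blast

lemma cls_vec_mult:
  "v \<in> lists gens \<Longrightarrow> w \<in> lists gens \<Longrightarrow>
    I.cls (basis_vec v) \<otimes>\<^bsub>F Quot Idl\<^bsub>F\<^esub> relators\<^esub> I.cls (basis_vec w) = I.cls (basis_vec (v @ w))"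
  using I.cls_mult[OF vec_closed vec_closed, of v w] by simp

lemma cls_minus:
  assumes "f \<in> carrier F" shows "I.cls (\<lambda>w. - f w) = \<ominus>\<^bsub>F Quot Idl\<^bsub>F\<^esub> relators\<^esub> I.cls f"
proof -
  interpret h: ring_hom_ring F "F Quot Idl\<^bsub>F\<^esub> relators" "I.cls"
    by (rule ring_hom_ringI2[OF F.ring_axioms I.quot.ring_axioms I.cls_hom])
  show ?thesis using h.hom_a_inv[OF assms] by (simp only: words.a_inv_A[OF assms])
qed

lemma cls_zero: "I.cls (\<lambda>_. 0) = \<zero>\<^bsub>F Quot Idl\<^bsub>F\<^esub> relators\<^esub>"
  using ring_hom_zero[OF I.cls_hom F.ring_axioms I.quot.ring_axioms] by simp

lemma cls_one: "\<one>\<^bsub>F Quot Idl\<^bsub>F\<^esub> relators\<^esub> = I.cls (basis_vec [])"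
  using ring_hom_one[OF I.cls_hom] by simp

interpretation R: brauer_clifford_ring "F Quot Idl\<^bsub>F\<^esub> relators" r s
  "\<lambda>i. I.cls (basis_vec [S i])" "I.cls (basis_vec [E])" "\<lambda>k. I.cls (basis_vec [C k])"
proof (intro brauer_clifford_ring.intro brauer_clifford_ring_axioms.intro, goal_cases)
  note m = cls_vec_mult cls_zero[symmetric] cls_one cls_minus[symmetric] vec_closed
  {
    case 1 show ?case by (rule I.quot.ring_axioms)
  next
    case (2 i) then show ?case by (intro I.cls_closed vec_closed) simp
  next
    case 3 then show ?case by (intro I.cls_closed vec_closed) simp
  next
    case (4 k) then show ?case by (intro I.cls_closed vec_closed) simp
  next
    case (5 i) then show ?case using cls_relation[OF BC_relations.s_square[of i]] by (simp add: m)
  next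
    case (6 i) then show ?case using cls_relation[OF BC_relations.s_braid[of i]] by (simp add: m)
  next
    case (7 i j) then show ?case using cls_relation[OF BC_relations.s_commute[of i _ _ j]] by (simp add: m)
  next
    case 8 then show ?case using cls_relation[OF BC_relations.e_square] by (simp add: m)
  next
    case (9 j) then show ?case using cls_relation[OF BC_relations.e_s_commute[of _ _ j]] by (simp add: m)
  next
    case 10 then show ?case using cls_relation[OF BC_relations.e_s_e_left, symmetric] by (simp add: m neighbour_index)
  next
    case 11 then show ?case using cls_relation[OF BC_relations.e_s_e_right, symmetric] by (simp add: m neighbour_index)
  next
    case 12 then show ?case using cls_relation[OF BC_relations.s_s_e] by (simp add: m neighbour_index)
  next
    case (13 k) then show ?case
      using cls_relation[OF BC_relations.c_square_left[of k]] cls_relation[OF BC_relations.c_square_right[of k]]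
      by (simp add: m)
  next
    case (14 i j) then show ?case using cls_relation[OF BC_relations.c_anticommute[of i _ _ j]] by (simp add: m)
  next
    case (15 i) then show ?case using cls_relation[OF BC_relations.s_c_s[of i]] by (simp add: m strand_index)
  next
    case (16 i j) then show ?case using cls_relation[OF BC_relations.s_c_commute[of i _ _ j]] by (simp add: m)
  next
    case 17 then show ?case using cls_relation[OF BC_relations.c_e] by (simp add: m)
  next
    case 18 then show ?case using cls_relation[OF BC_relations.e_c] by (simp add: m)
  next
    case 19 then show ?case using cls_relation[OF BC_relations.e_c_e] by (simp add: m)
  next
    case (20 j) then show ?case using cls_relation[OF BC_relations.e_c_commute[of _ _ j]] by (simp add: m)
  }
qed

lemma val_eq_cls: "w \<in> lists gens \<Longrightarrow> R.val w = I.cls (basis_vec w)"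
proof (induction w)
  case Nil
  show ?case by (simp add: cls_one)
next
  case (Cons g w)
  then have "R.letter_value g = I.cls (basis_vec [g])" by (cases g) simp_all
  then show ?case using Cons cls_vec_mult[of "[g]" w] by simp
qed

text \<open>The theorems \<open>val_cong\<close> and \<open>val_zero\<close> for the quotient by the relations.\<close>

lemma cls_spell_draw_vec:
  assumes w: "w \<in> lists gens" shows "I.cls (spell (draw (basis_vec w))) = I.cls (basis_vec w)"
proof (cases "word_diagram r s w")
  case None
  then show ?thesis using R.val_zero[of w] w val_eq_cls[OF w]
    by (simp add: extend_linearly_basis_vec cls_zero lists_eq_set)
next
  case (Some d)
  then have d: "d \<in> reachable_diagrams r s" using draw_reachable[OF w] by simp
  have "R.val (word_of d) = R.val w"
    using R.val_cong[of "word_of d" w d] w word_of[OF d] Some by (simp add: lists_eq_set)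
  then show ?thesis
    using Some val_eq_cls[OF w] val_eq_cls[OF word_of(1)[OF d]] by (simp add: extend_linearly_basis_vec)
qed

text \<open>Both sides are linear in \<open>f\<close>.\<close>

lemma cls_spell_draw:
  assumes "f \<in> carrier F" shows "I.cls (spell (draw f)) = I.cls f"
  using assms
proof (induction rule: words.carrier_induct)
  case zero
  then show ?case by simp
next
  case (add a w g)
  have v: "basis_vec w \<in> carrier F" by (rule vec_closed[OF add(1)])
  have sm: "a \<odot>\<^bsub>F\<^esub> f \<in> carrier F" "a \<odot>\<^bsub>D\<^esub> f' \<in> carrier D" if "f \<in> carrier F" "f' \<in> carrier D" for f f'
    using F.smult_closed[of a f] D.smult_closed[of a f'] that
    by (simp_all del: free_ops diagrams_ops)
  have spell_hom: "spell ((a \<odot>\<^bsub>D\<^esub> f) \<oplus>\<^bsub>D\<^esub> h) = (a \<odot>\<^bsub>F\<^esub> spell f) \<oplus>\<^bsub>F\<^esub> spell h"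
    if "f \<in> carrier D" "h \<in> carrier D" for f h
    using that sm(2)[OF vec_closed that(1)] extend_linearly_add[of "\<lambda>x. a * f x" h "\<lambda>d. Some (word_of d)"]
      extend_linearly_smult[of f "\<lambda>d. Some (word_of d)" a]
    by (simp add: diagrams_carrier finite_supp_smult)
  have dv: "draw (basis_vec w) \<in> carrier D" "draw g \<in> carrier D" using v add(2) draw_closed by auto
  have lin: "I.cls ((a \<odot>\<^bsub>F\<^esub> f) \<oplus>\<^bsub>F\<^esub> h) = (a \<odot>\<^bsub>I.Q\<^esub> I.cls f) \<oplus>\<^bsub>I.Q\<^esub> I.cls h"
    if "f \<in> carrier F" "h \<in> carrier F" for f h
    using I.cls_add[OF sm(1)[OF that(1) dv(1)] that(2)] I.cls_smult[OF that(1), of a] by (simp del: free_ops)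
  have "draw ((a \<odot>\<^bsub>F\<^esub> basis_vec w) \<oplus>\<^bsub>F\<^esub> g) = (a \<odot>\<^bsub>D\<^esub> draw (basis_vec w)) \<oplus>\<^bsub>D\<^esub> draw g"
    unfolding ring_hom_add[OF draw_ring_hom sm(1)[OF v dv(1)] add(2)] draw_smult[OF v] ..
  then have "I.cls (spell (draw ((a \<odot>\<^bsub>F\<^esub> basis_vec w) \<oplus>\<^bsub>F\<^esub> g))) =
    (a \<odot>\<^bsub>I.Q\<^esub> I.cls (spell (draw (basis_vec w)))) \<oplus>\<^bsub>I.Q\<^esub> I.cls (spell (draw g))"
    by (simp only: spell_hom[OF dv] lin[OF spell_closed[OF dv(1)] spell_closed[OF dv(2)]])
  then show ?case by (simp only: cls_spell_draw_vec[OF add(1)] add(3) lin[OF v add(2)])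
qed

lemma draw_kernel:
  assumes x: "x \<in> carrier F" and "draw x = \<zero>\<^bsub>D\<^esub>" shows "x \<in> Idl\<^bsub>F\<^esub> relators"
proof -
  have z: "(\<lambda>_. 0) \<in> carrier F" by (simp add: free_carrier)
  have "I.cls x = I.cls (\<lambda>_. 0)" using cls_spell_draw[OF x] assms(2) by simp
  then have "x \<ominus>\<^bsub>F\<^esub> (\<lambda>_. 0) \<in> Idl\<^bsub>F\<^esub> relators" using I.cls_eq_iff[OF x z] by simp
  then show ?thesis using free_minus[OF x z] by simp
qed

text \<open>The generators of the ideal of the bead diagram algebra are the images of the Clifford
  relators.\<close>

abbreviation "clifford_elements \<equiv>
  {basis_vec (c_diagram r s k) \<otimes>\<^bsub>D\<^esub> basis_vec (c_diagram r s k) \<oplus>\<^bsub>D\<^esub> \<one>\<^bsub>D\<^esub> | k. k \<in> {1..r}} \<union>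
  {basis_vec (c_diagram r s l) \<otimes>\<^bsub>D\<^esub> basis_vec (c_diagram r s l) \<ominus>\<^bsub>D\<^esub> \<one>\<^bsub>D\<^esub> | l. l \<in> {r + 1..r + s}} \<union>
  {basis_vec (c_diagram r s i) \<otimes>\<^bsub>D\<^esub> basis_vec (c_diagram r s j) \<oplus>\<^bsub>D\<^esub>
    basis_vec (c_diagram r s j) \<otimes>\<^bsub>D\<^esub> basis_vec (c_diagram r s i) | i j.
            i \<in> {1..r + s} \<and> j \<in> {1..r + s} \<and> i \<noteq> j}"

lemma draw_beads:
  assumes "i \<in> {1..r + s}" "j \<in> {1..r + s}"
  shows "draw (basis_vec [C i, C j]) = basis_vec (c_diagram r s i) \<otimes>\<^bsub>D\<^esub> basis_vec (c_diagram r s j)"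
proof -
  have "draw (basis_vec [C i] \<otimes>\<^bsub>F\<^esub> basis_vec [C j]) = draw (basis_vec [C i]) \<otimes>\<^bsub>D\<^esub> draw (basis_vec [C j])"
    using assms by (intro ring_hom_mult[OF draw_ring_hom] vec_closed) simp_all
  then show ?thesis using assms by (simp add: extend_linearly_basis_vec word_diagram_generator del: diagrams_ops)
qed

lemma draw_relator:
  assumes "x \<in> carrier F" "y \<in> carrier F"
  shows "draw (x \<ominus>\<^bsub>F\<^esub> y) = draw x \<ominus>\<^bsub>D\<^esub> draw y"
    and "draw (x \<ominus>\<^bsub>F\<^esub> (\<lambda>w. - y w)) = draw x \<oplus>\<^bsub>D\<^esub> draw y"
proof -
  show "draw (x \<ominus>\<^bsub>F\<^esub> y) = draw x \<ominus>\<^bsub>D\<^esub> draw y"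
    unfolding a_minus_def draw.hom_add[OF assms(1) F.add.inv_closed[OF assms(2)]] draw.hom_a_inv[OF assms(2)] ..
  have "x \<ominus>\<^bsub>F\<^esub> (\<lambda>w. - y w) = x \<oplus>\<^bsub>F\<^esub> y"
    unfolding words.a_inv_A[OF assms(2), symmetric] a_minus_def F.minus_minus[OF assms(2)] ..
  then show "draw (x \<ominus>\<^bsub>F\<^esub> (\<lambda>w. - y w)) = draw x \<oplus>\<^bsub>D\<^esub> draw y" by (simp only: draw.hom_add[OF assms])
qed

lemma draw_one: "draw (basis_vec []) = \<one>\<^bsub>D\<^esub>"
  using draw.hom_one by simp

lemma clifford_elements:
  shows "i \<in> {1..r} \<Longrightarrow> draw (basis_vec [C i, C i] \<ominus>\<^bsub>F\<^esub> (\<lambda>w. - basis_vec [] w)) =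
      basis_vec (c_diagram r s i) \<otimes>\<^bsub>D\<^esub> basis_vec (c_diagram r s i) \<oplus>\<^bsub>D\<^esub> \<one>\<^bsub>D\<^esub>"
    and "i \<in> {r + 1..r + s} \<Longrightarrow> draw (basis_vec [C i, C i] \<ominus>\<^bsub>F\<^esub> basis_vec []) =
      basis_vec (c_diagram r s i) \<otimes>\<^bsub>D\<^esub> basis_vec (c_diagram r s i) \<ominus>\<^bsub>D\<^esub> \<one>\<^bsub>D\<^esub>"
    and "i \<in> {1..r + s} \<Longrightarrow> j \<in> {1..r + s} \<Longrightarrow> draw (basis_vec [C i, C j] \<ominus>\<^bsub>F\<^esub> (\<lambda>w. - basis_vec [C j, C i] w)) =
      basis_vec (c_diagram r s i) \<otimes>\<^bsub>D\<^esub> basis_vec (c_diagram r s j) \<oplus>\<^bsub>D\<^esub>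
      basis_vec (c_diagram r s j) \<otimes>\<^bsub>D\<^esub> basis_vec (c_diagram r s i)"
proof -
  have v: "basis_vec [] \<in> carrier F" "i \<in> {1..r + s} \<Longrightarrow> j \<in> {1..r + s} \<Longrightarrow> basis_vec [C i, C j] \<in> carrier F" for i j
    by (auto intro!: vec_closed)
  show "i \<in> {1..r} \<Longrightarrow> draw (basis_vec [C i, C i] \<ominus>\<^bsub>F\<^esub> (\<lambda>w. - basis_vec [] w)) =
      basis_vec (c_diagram r s i) \<otimes>\<^bsub>D\<^esub> basis_vec (c_diagram r s i) \<oplus>\<^bsub>D\<^esub> \<one>\<^bsub>D\<^esub>"
    using draw_relator(2)[OF v(2) v(1), of i i] draw_beads[of i i] draw_one by (simp del: diagrams_ops)
  show "i \<in> {r + 1..r + s} \<Longrightarrow> draw (basis_vec [C i, C i] \<ominus>\<^bsub>F\<^esub> basis_vec []) =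
      basis_vec (c_diagram r s i) \<otimes>\<^bsub>D\<^esub> basis_vec (c_diagram r s i) \<ominus>\<^bsub>D\<^esub> \<one>\<^bsub>D\<^esub>"
    using draw_relator(1)[OF v(2) v(1), of i i] draw_beads[of i i] draw_one by (simp del: diagrams_ops)
  show "i \<in> {1..r + s} \<Longrightarrow> j \<in> {1..r + s} \<Longrightarrow> draw (basis_vec [C i, C j] \<ominus>\<^bsub>F\<^esub> (\<lambda>w. - basis_vec [C j, C i] w)) =
      basis_vec (c_diagram r s i) \<otimes>\<^bsub>D\<^esub> basis_vec (c_diagram r s j) \<oplus>\<^bsub>D\<^esub>
      basis_vec (c_diagram r s j) \<otimes>\<^bsub>D\<^esub> basis_vec (c_diagram r s i)"
    using draw_relator(2)[OF v(2) v(2), of i j j i] draw_beads[of i j] draw_beads[of j i] by (simp del: diagrams_ops)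
qed

lemma clifford_elements_lift: "clifford_elements \<subseteq> draw ` relators"
proof -
  have im: "draw (x \<ominus>\<^bsub>F\<^esub> y) \<in> draw ` relators" if "(x, y) \<in> BC_relations r s" for x y
    by (rule imageI) (use that in blast)
  have "basis_vec (c_diagram r s k) \<otimes>\<^bsub>D\<^esub> basis_vec (c_diagram r s k) \<oplus>\<^bsub>D\<^esub> \<one>\<^bsub>D\<^esub> \<in> draw ` relators" if "k \<in> {1..r}" for k
    unfolding clifford_elements(1)[OF that, symmetric] by (rule im[OF BC_relations.c_square_left[OF that]])
  moreover have "basis_vec (c_diagram r s l) \<otimes>\<^bsub>D\<^esub> basis_vec (c_diagram r s l) \<ominus>\<^bsub>D\<^esub> \<one>\<^bsub>D\<^esub> \<in> draw ` relators"
    if "l \<in> {r + 1..r + s}" for l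
    unfolding clifford_elements(2)[OF that, symmetric] by (rule im[OF BC_relations.c_square_right[OF that]])
  moreover have "basis_vec (c_diagram r s i) \<otimes>\<^bsub>D\<^esub> basis_vec (c_diagram r s j) \<oplus>\<^bsub>D\<^esub>
      basis_vec (c_diagram r s j) \<otimes>\<^bsub>D\<^esub> basis_vec (c_diagram r s i) \<in> draw ` relators"
    if "i \<in> {1..r + s}" "j \<in> {1..r + s}" "i \<noteq> j" for i j
    unfolding clifford_elements(3)[OF that(1,2), symmetric] by (rule im[OF BC_relations.c_anticommute[OF that]])
  ultimately show ?thesis by blast
qed

lemma clifford_elements_parity: "clifford_elements \<subseteq> even_part D \<union> odd_part D"
proof -
  have "draw ` relators \<subseteq> draw ` even_part F \<union> draw ` odd_part F"
    unfolding image_Un[symmetric] by (rule image_mono[OF relators_parity])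
  with clifford_elements_lift show ?thesis unfolding draw_surj(2,3) by (rule order_trans)
qed

lemma clifford_elements_closed: "clifford_elements \<subseteq> carrier D"
  using clifford_elements_parity D.even_closed D.odd_closed by blast

lemma BD_ideal_eq: "BD_ideal r s = Idl\<^bsub>D\<^esub> clifford_elements"
  by (simp only: BD_ideal_def Let_def)

text \<open>All relations other than those of the Clifford generators hold for diagrams on the nose.\<close>

lemma draw_relators: "draw ` relators \<subseteq> Idl\<^bsub>D\<^esub> clifford_elements"
proof -
  have inside: "clifford_elements \<subseteq> Idl\<^bsub>D\<^esub> clifford_elements" by (rule D.genideal_self[OF clifford_elements_closed])
  interpret L: ideal "Idl\<^bsub>D\<^esub> clifford_elements" D by (rule D.genideal_ideal[OF clifford_elements_closed])
  have "draw (x \<ominus>\<^bsub>F\<^esub> y) \<in> Idl\<^bsub>D\<^esub> clifford_elements" if "(x, y) \<in> BC_relations r s" for x y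
  proof -
    have c: "x \<in> carrier F" "y \<in> carrier F" using relation_closed[OF that] by auto
    have eq: ?thesis if "draw x = draw y"
      using that draw_relator(1)[OF c] L.zero_closed D.r_neg[OF draw_closed[OF c(2)]] by (simp add: a_minus_def)
    have word: ?thesis if "x = basis_vec v" "y = basis_vec w" "word_diagram r s v = word_diagram r s w" for v w
      using that by (intro eq) (simp add: extend_linearly_basis_vec)
    have zero: ?thesis if "x = basis_vec v" "y = (\<lambda>_. 0)" "word_diagram r s v = None" for v
      using that by (intro eq) (simp add: extend_linearly_basis_vec)
    show ?thesis using that
    proof cases
      case (s_square i) then show ?thesis by (intro word[OF _ _ word_diagram_symmetric_relations(1)])
    next
      case (s_braid i) then show ?thesis by (intro word[OF _ _ word_diagram_symmetric_relations(2)])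
    next
      case (s_commute i j) then show ?thesis by (intro word[OF _ _ word_diagram_symmetric_relations(3)]) auto
    next
      case e_square then show ?thesis by (intro zero[OF _ _ word_diagram_cap_relations(1)])
    next
      case (e_s_commute j) then show ?thesis by (intro word[OF _ _ word_diagram_cap_swap_relations(1)])
    next
      case e_s_e_left then show ?thesis by (intro word[OF _ _ word_diagram_cap_swap_relations(2)[symmetric]])
    next
      case e_s_e_right then show ?thesis by (intro word[OF _ _ word_diagram_cap_swap_relations(3)[symmetric]])
    next
      case s_s_e then show ?thesis by (intro word[OF _ _ word_diagram_cap_swap_relations(4)])
    next
      case (c_square_left i)
      show ?thesis unfolding c_square_left(1,2) clifford_elements(1)[OF c_square_left(3)]
        by (rule subsetD[OF inside]) (use c_square_left in blast)
    next
      case (c_square_right i)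
      show ?thesis unfolding c_square_right(1,2) clifford_elements(2)[OF c_square_right(3)]
        by (rule subsetD[OF inside]) (use c_square_right in blast)
    next
      case (c_anticommute i j)
      show ?thesis unfolding c_anticommute(1,2) clifford_elements(3)[OF c_anticommute(3,4)]
        by (rule subsetD[OF inside]) (use c_anticommute in blast)
    next
      case (s_c_s i) then show ?thesis by (intro word[OF _ _ word_diagram_bead_relations(1)])
    next
      case (s_c_commute i j) then show ?thesis by (intro word[OF _ _ word_diagram_bead_relations(2)])
    next
      case c_e then show ?thesis by (intro word[OF _ _ word_diagram_cap_relations(3)])
    next
      case e_c then show ?thesis by (intro word[OF _ _ word_diagram_cap_relations(4)])
    next
      case e_c_e then show ?thesis by (intro zero[OF _ _ word_diagram_cap_relations(2)])
    next
      case (e_c_commute j) then show ?thesis by (intro word[OF _ _ word_diagram_cap_relations(5)])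
    qed
  qed
  then show ?thesis by blast
qed

lemma BC_isomorphic_BD: "superalgebra_isomorphic (BC r s) (BD r s)"
  unfolding BC_def BD_def BD_ideal_eq Let_def
proof (rule quotient_superalgebras_isomorphic[OF I.graded_ideal_axioms _ draw_ring_hom draw_surj(1) _ draw_surj(2,3)])
  show "graded_ideal D (Idl\<^bsub>D\<^esub> clifford_elements)"
    by (intro graded_ideal.intro graded_ideal_axioms.intro D.superalgebra_axioms
      D.genideal_ideal D.homogeneous_genideal clifford_elements_closed clifford_elements_parity)
  show "draw (a \<odot>\<^bsub>F\<^esub> x) = a \<odot>\<^bsub>D\<^esub> draw x" if "x \<in> carrier F" for a x by (rule draw_smult[OF that])
  show "draw x \<in> Idl\<^bsub>D\<^esub> clifford_elements \<longleftrightarrow> x \<in> Idl\<^bsub>F\<^esub> relators" if "x \<in> carrier F" for x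
    by (rule draw.genideal_correspondence[OF draw_surj(1) relators_closed clifford_elements_closed
        draw_relators order_trans[OF clifford_elements_lift image_mono[OF F.genideal_self[OF relators_closed]]]
        draw_kernel that])
qed

end

theorem theorem2p9:
  fixes r s :: nat
  shows "superalgebra_isomorphic (BC r s) (BD r s)"
  by (rule BC_isomorphic_BD)

end
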